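(* Let $Q:=(-1,1)^{n}$, let $0<\alpha<\infty$, $1<q<\infty$ be numbers such that $q>1+\alpha$, let $s\in[0,1]$, and let $\mathtt{L}$ satisfy the nearly linear growth assumptions (stated in the context) with $\mu\ge1$. For a coefficient $a\ge 0$ set $$\mathcal{H}(w;Q):=\int_{Q}\mathtt{L}(Dw)+a(x)(s^{2}+|Dw|^{2})^{\frac q2}\,dx,\qquad \mathcal{G}(w;Q):=\int_{Q}|Dw|\,\mathtt{g}(|Dw|)+a(x)|Dw|^{q}\,dx .$$ There exist a coefficient $0\le a\in C^{\alpha}(\bar Q)$ and functions $\bar u_{0}\in W^{1,1}_{0}(Q)\cap L^{\infty}(\bar Q)$ with $\mathcal{G}(\bar u_{0};Q)<\infty$, and $\tilde u_{0}\in C^{\infty}(\bar Q)$, such that the following holds. \begin{itemize} \item The Lavrentiev phenomenon occurs: $$\inf_{w\in\tilde u_{0}+C^{\infty}_{c}(Q)}\mathcal{H}(w;Q)>\inf_{w\in\tilde u_{0}+W^{1,1}_{0}(Q)}\mathcal{H}(w;Q).$$ \item There is no sequence $\{u_{i}\}_{i\in\mathbb{N}}\subset C^{\infty}_{c}(Q)$ such that $\mathcal{G}(u_{i}-\bar u_{0};Q)\to0$, i.e. smooth maps are not dense in $W^{1,1}_{0}(Q)\cap\{w\colon\mathcal{G}(w;Q)<\infty\}$ with respect to modular convergence. \end{itemize}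
   Context: $n\ge2$; functions are scalar valued. $C^{\alpha}(\bar Q)$ is the H\"older class of order $\alpha$, i.e. $C^{k,\beta}(\bar Q)$ with $k\in\mathbb{N}\cup\{0\}$, $\beta\in(0,1]$, $k+\beta=\alpha$. Nearly linear growth assumptions: $\mathtt{L}\colon\mathbb{R}^n\to\mathbb{R}$, $\mathtt{L}\in C^{2}_{\mathrm{loc}}(\mathbb{R}^{n}\setminus\{0\})\cap C^{1}_{\mathrm{loc}}(\mathbb{R}^{n})$, and there are $\Lambda\ge1$, $\mu\ge1$ such that for all $z\in\mathbb{R}^{n}\setminus\{0\}$, $\xi\in\mathbb{R}^{n}$: $$\tfrac1\Lambda|z|\mathtt{g}(|z|)-\Lambda\le\mathtt{L}(z)\le\Lambda|z|\mathtt{g}(|z|)+\Lambda,$$ $$\frac{|\xi|^{2}}{\Lambda(1+|z|^{2})^{\mu/2}}\le\langle\partial^{2}\mathtt{L}(z)\xi,\xi\rangle,\qquad |\partial^{2}\mathtt{L}(z)|\le\frac{\Lambda(\mathtt{g}(|z|)+1)}{(1+|z|^{2})^{1/2}}.$$ Here $0\le\mathtt{g}\in C[0,\infty)$ is nondecreasing, unbounded and concave, $t\mapsto t\mathtt{g}(t)$ is convex, and for every $\varepsilon>0$ there is $c(\mathtt{g},\varepsilon)$ with $\mathtt{g}(t)\le c(\mathtt{g},\varepsilon)(1+t^{\varepsilon})$ for all $t\ge0$. *)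

theory Defs
  imports "HOL-Analysis.Analysis"
begin

section \<open>Classical function spaces on open sets\<close>

definition partial :: "'n \<Rightarrow> (real^'n::finite \<Rightarrow> real) \<Rightarrow> real^'n \<Rightarrow> real" where
  "partial i f x = frechet_derivative f (at x) (axis i 1)"

text \<open>A list of directions plays the role of a multi-index; the last direction is applied first.\<close>

definition partials :: "'n list \<Rightarrow> (real^'n::finite \<Rightarrow> real) \<Rightarrow> real^'n \<Rightarrow> real" where
  "partials is f = foldr partial is f"

definition grad :: "(real^'n::finite \<Rightarrow> real) \<Rightarrow> real^'n \<Rightarrow> real^'n" where
  "grad f x = (\<chi> i. partial i f x)"

definition hessian :: "(real^'n::finite \<Rightarrow> real) \<Rightarrow> real^'n \<Rightarrow> real^'n^'n" where
  "hessian f x = (\<chi> i j. partials [i, j] f x)"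

text \<open>The notions \<open>C_on\<close> and \<open>C_closure\<close> are meant for open \<open>\<Omega>\<close>: they stand for
  \<open>C\<^sup>k(\<Omega>)\<close> (which is also \<open>C\<^sup>k\<^sub>l\<^sub>o\<^sub>c(\<Omega>)\<close>) and \<open>C\<^sup>k\<close> of the closure of \<open>\<Omega>\<close>, i.e. all
  derivatives up to order \<open>k\<close> extend continuously to the closure.\<close>

definition C_on :: "nat \<Rightarrow> (real^'n::finite) set \<Rightarrow> (real^'n \<Rightarrow> real) set" where
  "C_on k \<Omega> = {f. (\<forall>is. length is \<le> k \<longrightarrow> continuous_on \<Omega> (partials is f))
                \<and> (\<forall>is. length is < k \<longrightarrow> partials is f differentiable_on \<Omega>)}"

definition C_closure :: "nat \<Rightarrow> (real^'n::finite) set \<Rightarrow> (real^'n \<Rightarrow> real) set" where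
  "C_closure k \<Omega> = {f \<in> C_on k \<Omega>. continuous_on (closure \<Omega>) f
      \<and> (\<forall>is. length is \<le> k \<longrightarrow>
            (\<exists>F. continuous_on (closure \<Omega>) F \<and> (\<forall>x\<in>\<Omega>. F x = partials is f x)))}"

definition smooth_closure :: "(real^'n::finite) set \<Rightarrow> (real^'n \<Rightarrow> real) set" where
  "smooth_closure \<Omega> = (\<Inter>k. C_closure k \<Omega>)"

definition holder_closure :: "nat \<Rightarrow> real \<Rightarrow> (real^'n::finite) set \<Rightarrow> (real^'n \<Rightarrow> real) set" where
  "holder_closure k \<beta> \<Omega> = {f \<in> C_closure k \<Omega>. \<forall>is. length is = k \<longrightarrow>
      (\<exists>C. \<forall>x\<in>\<Omega>. \<forall>y\<in>\<Omega>. \<bar>partials is f x - partials is f y\<bar> \<le> C * dist x y powr \<beta>)}"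

text \<open>For integer \<open>\<alpha>\<close> the decomposition has \<open>k = \<alpha> - 1\<close> and \<open>\<beta> = 1\<close>.\<close>

definition holder_class :: "real \<Rightarrow> (real^'n::finite) set \<Rightarrow> (real^'n \<Rightarrow> real) set" where
  "holder_class \<alpha> \<Omega> =
     {f. \<exists>k \<beta>. 0 < \<beta> \<and> \<beta> \<le> 1 \<and> real k + \<beta> = \<alpha> \<and> f \<in> holder_closure k \<beta> \<Omega>}"

text \<open>Test functions are extended by zero to the whole space.\<close>

definition test_functions :: "(real^'n::finite) set \<Rightarrow> (real^'n \<Rightarrow> real) set" where
  "test_functions \<Omega> = {\<phi>. (\<forall>k. \<phi> \<in> C_on k UNIV)
      \<and> (\<exists>K. compact K \<and> K \<subseteq> \<Omega> \<and> (\<forall>x. x \<notin> K \<longrightarrow> \<phi> x = 0))}"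

section \<open>Sobolev and Lebesgue spaces\<close>

definition locally_integrable :: "(real^'n::finite) set \<Rightarrow> (real^'n \<Rightarrow> 'b::euclidean_space) \<Rightarrow> bool" where
  "locally_integrable \<Omega> f \<longleftrightarrow> (\<forall>K. compact K \<and> K \<subseteq> \<Omega> \<longrightarrow> integrable (lebesgue_on K) f)"

definition is_weak_gradient :: "(real^'n::finite) set \<Rightarrow> (real^'n \<Rightarrow> real) \<Rightarrow> (real^'n \<Rightarrow> real^'n) \<Rightarrow> bool" where
  "is_weak_gradient \<Omega> u V \<longleftrightarrow> locally_integrable \<Omega> u \<and> locally_integrable \<Omega> V
     \<and> (\<forall>\<phi>\<in>test_functions \<Omega>. \<forall>i.
          (LINT x|lebesgue_on \<Omega>. u x * partial i \<phi> x) = - (LINT x|lebesgue_on \<Omega>. V x $ i * \<phi> x))"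

text \<open>A representative: for open \<open>\<Omega>\<close> the weak gradient is unique almost everywhere in \<open>\<Omega>\<close>.\<close>

definition weak_grad :: "(real^'n::finite) set \<Rightarrow> (real^'n \<Rightarrow> real) \<Rightarrow> real^'n \<Rightarrow> real^'n" where
  "weak_grad \<Omega> u = (SOME V. is_weak_gradient \<Omega> u V)"

definition W11 :: "(real^'n::finite) set \<Rightarrow> (real^'n \<Rightarrow> real) set" where
  "W11 \<Omega> = {u. integrable (lebesgue_on \<Omega>) u
      \<and> (\<exists>V. is_weak_gradient \<Omega> u V \<and> integrable (lebesgue_on \<Omega>) V)}"

definition W11_0 :: "(real^'n::finite) set \<Rightarrow> (real^'n \<Rightarrow> real) set" where
  "W11_0 \<Omega> = {u \<in> W11 \<Omega>. \<exists>\<phi>. (\<forall>j. \<phi> j \<in> test_functions \<Omega>)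
      \<and> (\<lambda>j::nat. LINT x|lebesgue_on \<Omega>. \<bar>\<phi> j x - u x\<bar>) \<longlonglongrightarrow> 0
      \<and> (\<lambda>j. LINT x|lebesgue_on \<Omega>. norm (grad (\<phi> j) x - weak_grad \<Omega> u x)) \<longlonglongrightarrow> 0}"

definition L_infinity :: "(real^'n::finite) set \<Rightarrow> (real^'n \<Rightarrow> real) set" where
  "L_infinity A = {u \<in> borel_measurable (lebesgue_on A). \<exists>C. AE x in lebesgue_on A. \<bar>u x\<bar> \<le> C}"

section \<open>Integrands and functionals\<close>

definition growth_function :: "(real \<Rightarrow> real) \<Rightarrow> bool" where
  "growth_function g \<longleftrightarrow>
     (\<forall>t\<ge>0. 0 \<le> g t) \<and> continuous_on {0..} g \<and> mono_on {0..} g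
     \<and> \<not> bounded (g ` {0..}) \<and> concave_on {0..} g \<and> convex_on {0..} (\<lambda>t. t * g t)
     \<and> (\<forall>\<epsilon>>0. \<exists>c. \<forall>t\<ge>0. g t \<le> c * (1 + t powr \<epsilon>))"

text \<open>The norm of the Hessian is the Euclidean (Frobenius) norm of the matrix.\<close>

definition nearly_linear_growth ::
    "(real \<Rightarrow> real) \<Rightarrow> real \<Rightarrow> real \<Rightarrow> (real^'n::finite \<Rightarrow> real) \<Rightarrow> bool" where
  "nearly_linear_growth g \<Lambda> \<mu> L \<longleftrightarrow>
     growth_function g \<and> \<Lambda> \<ge> 1 \<and> \<mu> \<ge> 1
     \<and> L \<in> C_on 2 (UNIV - {0}) \<and> L \<in> C_on 1 UNIV
     \<and> (\<forall>z. z \<noteq> 0 \<longrightarrow>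
          1 / \<Lambda> * norm z * g (norm z) - \<Lambda> \<le> L z
          \<and> L z \<le> \<Lambda> * norm z * g (norm z) + \<Lambda>
          \<and> (\<forall>\<xi>. (norm \<xi>)\<^sup>2 / (\<Lambda> * (1 + (norm z)\<^sup>2) powr (\<mu> / 2)) \<le> (hessian L z *v \<xi>) \<bullet> \<xi>)
          \<and> norm (hessian L z) \<le> \<Lambda> * (g (norm z) + 1) / (1 + (norm z)\<^sup>2) powr (1 / 2))"

text \<open>Integral with values in the extended reals. The integrands of \<open>energy\<close> below are bounded
  from below and integrated over a bounded set, so that only the first term can be infinite.\<close>

definition ext_integral :: "'a measure \<Rightarrow> ('a \<Rightarrow> real) \<Rightarrow> ereal" where
  "ext_integral M f =
     enn2ereal (\<integral>\<^sup>+ x. ennreal (f x) \<partial>M) - enn2ereal (\<integral>\<^sup>+ x. ennreal (- f x) \<partial>M)"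

definition energy ::
    "(real^'n::finite \<Rightarrow> real) \<Rightarrow> (real^'n \<Rightarrow> real) \<Rightarrow> real \<Rightarrow> real \<Rightarrow> (real^'n \<Rightarrow> real) \<Rightarrow> (real^'n) set \<Rightarrow> ereal"
  where
  "energy L a s q w \<Omega> = ext_integral (lebesgue_on \<Omega>)
     (\<lambda>x. L (weak_grad \<Omega> w x) + a x * (s\<^sup>2 + (norm (weak_grad \<Omega> w x))\<^sup>2) powr (q / 2))"

definition modular ::
    "(real \<Rightarrow> real) \<Rightarrow> (real^'n::finite \<Rightarrow> real) \<Rightarrow> real \<Rightarrow> (real^'n \<Rightarrow> real) \<Rightarrow> (real^'n) set \<Rightarrow> ennreal"
  where
  "modular g a q w \<Omega> = (\<integral>\<^sup>+ x. ennreal (norm (weak_grad \<Omega> w x) * g (norm (weak_grad \<Omega> w x))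
     + a x * norm (weak_grad \<Omega> w x) powr q) \<partial>(lebesgue_on \<Omega>))"

definition cube :: "(real^'n::finite) set" where
  "cube = {x. \<forall>i. -1 < x $ i \<and> x $ i < 1}"

end

theory Submission
  imports Defs
begin

text \<open>The dimension-free threshold \<open>q > 1 + \<alpha>\<close> comes from a contact set of dimension close to
\<open>n - 1\<close> on the hyperplane \<open>x\<^sub>j = 0\<close>.

Fix two coordinates \<open>i\<close> and \<open>j\<close>. A function \<open>H \<ge> 0\<close> that does not depend on \<open>x\<^sub>j\<close> (\<open>H\<close>, built from
\<open>width\<close>) describes a layer \<open>\<bar>x\<^sub>j\<bar> < H\<close> around the hyperplane. The layer has thickness zero exactly above a
product of a Cantor set in the direction \<open>i\<close> with a cube in the remaining directions. The coefficient
\<open>a = (\<bar>x\<^sub>j\<bar> - H)\<^sub>+\<^sup>\<alpha>\<close> (\<open>coef\<close>) vanishes in the layer. The competitor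
\<open>U = step (x\<^sub>j / H)\<close> climbs from 0 to 1 inside the layer, so \<open>a \<bar>DU\<bar>\<^sup>q = 0\<close>, and what remains of its energy
is controlled by \<open>\<integral> H powr - \<epsilon>\<close> with a small \<open>\<epsilon>\<close>, since \<open>g\<close> grows more slowly than every power. This
integral is finite (\<open>inv_pow_integral\<close>) because the Cantor set has dimension less than one and \<open>H\<close> degenerates
only polynomially.

A smooth function \<open>w\<close> with the same boundary values has to climb as well, but it is continuous at the contact
points, so the climb must happen in the double cones with vertices there. In these cones
\<open>a \<ge> (\<bar>x\<^sub>j\<bar> / 2)\<^sup>\<alpha>\<close>. This is made quantitative by duality: \<open>flow1\<close> and \<open>flow2\<close> are the components of a
divergence-free field that runs through such a double cone, regularised near the vertex. The flux of \<open>Dw\<close> along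
it depends only on the boundary values. Averaged over the contact points of generation \<open>k\<close>, the field
has size at most \<open>C \<bar>x\<^sub>j\<bar> powr (D - 1)\<close>, where \<open>D < 1\<close> is a lower bound for the dimension of the Cantor set
(\<open>contact_count\<close>, \<open>avg_flow_bound\<close>). Balancing this against \<open>a \<bar>Dw\<bar>\<^sup>q\<close> leaves the weight
\<open>\<bar>x\<^sub>j\<bar> powr - ((\<alpha> + 1 - D) / (q - 1))\<close>, which is integrable as soon as \<open>\<alpha> + 1 - D < q - 1\<close>; for \<open>q > 1 + \<alpha>\<close>
this holds once \<open>D\<close> is close enough to one. Since \<open>w\<close> has a bounded gradient, the regularised vertices contribute
nothing in the limit \<open>k \<rightarrow> \<infinity>\<close>. The outcome is \<open>smooth_energy_lower_bound\<close>: \<open>\<integral> a \<bar>Dw\<bar>\<^sup>q \<ge> c > 0\<close> for all \<open>w = v + \<phi>\<close>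
with a test function \<open>\<phi>\<close>, where \<open>v = step (2 x\<^sub>j)\<close>.

Both claims follow. With boundary values \<open>T v\<close> the smooth energies are at least \<open>c T\<^sup>q - C\<close>, while \<open>T U\<close> has energy
at most \<open>A T powr (1 + e)\<close> with \<open>1 + e < q\<close>; a large \<open>T\<close> produces the gap. For the failure of density take
\<open>u\<^sub>0 = U - v\<close>: wherever \<open>a > 0\<close> the gradient of \<open>U\<close> vanishes, so there \<open>D(u\<^sub>i - u\<^sub>0) = D(v + u\<^sub>i)\<close> and the modular
of \<open>u\<^sub>i - u\<^sub>0\<close> stays above \<open>c\<close>.

The Cantor set is the zero set of a lacunary series \<open>h(x) = \<Sum>\<^sub>k N\<^sup>-\<^sup>M\<^sup>k gap (N\<^sup>k x)\<close> with a periodic bump \<open>gap\<close>. The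
relation \<open>h(x) = gap(x) + N\<^sup>-\<^sup>M h(N x)\<close> gives the integrability of negative powers; the exponent \<open>M\<close> controls the
smoothness of \<open>h\<close> and hence of \<open>a\<close>; and the truncated series give smooth functions \<open>H\<^sub>m > 0\<close>, so that
\<open>step (x\<^sub>j / H\<^sub>m) - v\<close> are test functions that converge to \<open>U - v\<close> in \<open>W\<^sup>1\<^sup>,\<^sup>1\<close>.\<close>

section \<open>Smooth functions of one variable\<close>

primrec Ck :: "nat \<Rightarrow> (real \<Rightarrow> real) \<Rightarrow> bool" where
  Ck_0: "Ck 0 f = continuous_on UNIV f"
| Ck_Suc: "Ck (Suc k) f = ((\<forall>x. (f has_real_derivative deriv f x) (at x)) \<and> Ck k (deriv f))"

declare Ck.simps [simp del]

text \<open>Derivatives are stored through \<open>deriv\<close>; this rule is how an explicit derivative enters.\<close>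

lemma Ck_SucI:
  assumes "\<And>x. (f has_real_derivative f' x) (at x)" "Ck k f'"
  shows "Ck (Suc k) f"
proof -
  have "deriv f = f'" using DERIV_imp_deriv[OF assms(1)] by (intro ext)
  with assms show ?thesis by (simp add: Ck_Suc)
qed

lemma Ck_has_deriv: "Ck (Suc k) f \<Longrightarrow> (f has_real_derivative deriv f x) (at x)"
  by (simp add: Ck_Suc)

lemma Ck_deriv: "Ck (Suc k) f \<Longrightarrow> Ck k (deriv f)"
  by (simp add: Ck_Suc)

lemma Ck_continuous: "Ck k f \<Longrightarrow> continuous_on UNIV f"
proof (cases k)
  case (Suc k')
  assume "Ck k f"
  then have "isCont f x" for x unfolding Suc by (rule DERIV_isCont[OF Ck_has_deriv])
  then show ?thesis by (simp add: continuous_at_imp_continuous_on)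
qed (simp add: Ck_0)

lemma Ck_SucD: "Ck (Suc k) f \<Longrightarrow> Ck k f"
proof (induction k arbitrary: f)
  case 0 then show ?case using Ck_continuous Ck_0 by blast
next
  case (Suc k)
  then show ?case by (simp add: Ck_Suc[of _ f])
qed

lemma Ck_const: "Ck k (\<lambda>x. c)"
proof (induction k arbitrary: c)
  case 0 then show ?case by (simp add: Ck_0)
next
  case (Suc k) show ?case by (rule Ck_SucI[of _ "\<lambda>x. 0"]) (use Suc in auto)
qed

lemma Ck_id: "Ck k (\<lambda>x. x)"
proof (cases k)
  case 0 then show ?thesis by (simp add: Ck_0)
next
  case (Suc k) show ?thesis unfolding Suc by (rule Ck_SucI[of _ "\<lambda>x. 1"]) (auto simp: Ck_const)
qed

lemma Ck_add: "Ck k f \<Longrightarrow> Ck k g \<Longrightarrow> Ck k (\<lambda>x. f x + g x)"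
proof (induction k arbitrary: f g)
  case 0 then show ?case by (auto simp: Ck_0 intro!: continuous_intros)
next
  case (Suc k)
  let ?f' = "deriv f" and ?g' = "deriv g"
  note d = Suc.prems[THEN Ck_has_deriv] Suc.prems[THEN Ck_deriv] Suc.prems[THEN Ck_SucD]
  have "Ck k (\<lambda>x. ?f' x + ?g' x)" by (rule Suc.IH[OF d(3,4)])
  with d show ?case by (intro Ck_SucI[of _ "\<lambda>x. ?f' x + ?g' x"]) (auto intro!: derivative_eq_intros)
qed

lemma Ck_mult: "Ck k f \<Longrightarrow> Ck k g \<Longrightarrow> Ck k (\<lambda>x. f x * g x)"
proof (induction k arbitrary: f g)
  case 0 then show ?case unfolding Ck_0 by (intro continuous_on_mult)
next
  case (Suc k)
  let ?f' = "deriv f" and ?g' = "deriv g"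
  note d = Suc.prems[THEN Ck_has_deriv] Suc.prems[THEN Ck_deriv] Suc.prems[THEN Ck_SucD]
  have "Ck k (\<lambda>x. ?f' x * g x + ?g' x * f x)"
    by (rule Ck_add[OF Suc.IH[OF d(3) d(6)] Suc.IH[OF d(4) d(5)]])
  then show ?case
    by (rule Ck_SucI[rotated]) (rule DERIV_mult[OF d(1,2)])
qed

lemma Ck_cmult: "Ck k f \<Longrightarrow> Ck k (\<lambda>x. c * f x)"
  by (intro Ck_mult Ck_const)

lemma Ck_diff: "Ck k f \<Longrightarrow> Ck k g \<Longrightarrow> Ck k (\<lambda>x. f x - g x)"
  using Ck_add[of k f "\<lambda>x. (-1) * g x"] Ck_cmult[of k g "-1"] by simp

lemma Ck_compose: "Ck k f \<Longrightarrow> Ck k g \<Longrightarrow> Ck k (\<lambda>x. f (g x))"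
proof (induction k arbitrary: f g)
  case 0 then show ?case unfolding Ck_0 by (rule continuous_on_compose2) auto
next
  case (Suc k)
  let ?f' = "deriv f" and ?g' = "deriv g"
  note d = Suc.prems[THEN Ck_has_deriv] Suc.prems[THEN Ck_deriv] Suc.prems[THEN Ck_SucD]
  have "Ck k (\<lambda>x. ?f' (g x) * ?g' x)"
    by (rule Ck_mult[OF Suc.IH[OF d(3) d(6)] d(4)])
  then show ?case
    by (rule Ck_SucI[rotated]) (rule DERIV_chain2[OF d(1,2)])
qed

lemma Ck_inverse: "Ck k f \<Longrightarrow> (\<And>x. f x \<noteq> 0) \<Longrightarrow> Ck k (\<lambda>x. inverse (f x))"
proof (induction k arbitrary: f)
  case 0 then show ?case unfolding Ck_0 by (intro continuous_on_inverse) auto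
next
  case (Suc k)
  let ?f' = "deriv f"
  note d = Suc.prems(1)[THEN Ck_has_deriv] Suc.prems(1)[THEN Ck_deriv] Suc.prems(1)[THEN Ck_SucD]
  have "Ck k (\<lambda>x. (-1) * (inverse (f x) * (?f' x * inverse (f x))))"
    by (rule Ck_mult[OF Ck_const Ck_mult[OF Suc.IH[OF d(3)] Ck_mult[OF d(2) Suc.IH[OF d(3)]]]])
      (use Suc.prems(2) in auto)
  with d Suc.prems show ?case
    by (intro Ck_SucI[of _ "\<lambda>x. (-1) * (inverse (f x) * (?f' x * inverse (f x)))"])
       (auto intro!: derivative_eq_intros)
qed

lemma Ck_sum: "finite A \<Longrightarrow> (\<And>a. a \<in> A \<Longrightarrow> Ck k (f a)) \<Longrightarrow> Ck k (\<lambda>x. \<Sum>a\<in>A. f a x)"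
  by (induction A rule: finite_induct) (auto intro!: Ck_const Ck_add)

lemma Ck_cos: "Ck k cos" and Ck_sin: "Ck k sin"
proof (induction k)
  case 0
  { case 1 show ?case by (auto simp: Ck_0 intro!: continuous_intros) }
  { case 2 show ?case by (auto simp: Ck_0 intro!: continuous_intros) }
next
  case (Suc k)
  { case 1
    have "Ck k (\<lambda>x. (-1) * sin x)" by (intro Ck_cmult Suc)
    then show ?case by (intro Ck_SucI[of cos "\<lambda>x. (-1) * sin x"]) (auto intro!: derivative_eq_intros) }
  { case 2 show ?case by (rule Ck_SucI[of _ cos])
        (use Suc in \<open>auto intro!: derivative_eq_intros\<close>) }
qed

text \<open>The functions \<open>exp (- 1 / x) / x\<^sup>m\<close> are closed under differentiation up to linear combinations, which makes
all of them smooth across \<open>0\<close> at once.\<close>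

definition flat :: "nat \<Rightarrow> real \<Rightarrow> real" where
  "flat m x = (if x > 0 then exp (- 1 / x) / x ^ m else 0)"

lemma flat_nonneg: "0 \<le> flat m x" by (simp add: flat_def)

text \<open>Comparison of the exponential series at \<open>1 / x\<close> with its term of order \<open>m + 2\<close>. The square on the right makes
the difference quotient at \<open>0\<close> tend to \<open>0\<close>.\<close>

lemma flat_bound: "flat m x \<le> fact (m + 2) * x\<^sup>2"
proof (cases "x > 0")
  case True
  have "(1 / x) ^ (m + 2) / fact (m + 2) \<le> exp (1 / x)"
  proof -
    have s: "summable (\<lambda>n. (1 / x) ^ n /\<^sub>R fact n)" by (rule summable_exp_generic)
    have "(\<Sum>n\<in>{m+2}. (1 / x) ^ n /\<^sub>R fact n) \<le> (\<Sum>n. (1 / x) ^ n /\<^sub>R fact n)"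
      by (rule sum_le_suminf[OF s]) (use True in auto)
    then show ?thesis by (simp add: exp_def field_simps scaleR_conv_of_real)
  qed
  then have "exp (- 1 / x) \<le> fact (m + 2) * x ^ (m + 2)"
  proof -
    assume "(1 / x) ^ (m + 2) / fact (m + 2) \<le> exp (1 / x)"
    then have "1 \<le> fact (m + 2) * x ^ (m + 2) * exp (1 / x)"
      using True by (simp add: power_divide divide_le_eq mult_ac del: power_Suc fact_Suc power_add)
    then show ?thesis using True by (simp add: exp_minus field_simps del: power_Suc fact_Suc power_add add_2_eq_Suc add_2_eq_Suc')
  qed
  then have "exp (- 1 / x) / x ^ m \<le> fact (m + 2) * x\<^sup>2"
    using True by (simp add: divide_le_eq power_add mult_ac del: fact_Suc add_2_eq_Suc add_2_eq_Suc')
  then show ?thesis using True by (simp add: flat_def)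
qed (simp add: flat_def)

lemma flat_has_deriv: "(flat m has_real_derivative (flat (m + 2) x - m * flat (m + 1) x)) (at x)"
proof -
  consider "x > 0" | "x < 0" | "x = 0" by linarith
  then show ?thesis
  proof cases
    case 1
    have "((\<lambda>x. exp (- 1 / x) / x ^ m) has_real_derivative (flat (m + 2) x - m * flat (m + 1) x)) (at x)"
    proof (cases m)
      case 0
      with 1 show ?thesis by (auto intro!: derivative_eq_intros simp: flat_def power2_eq_square)
    next
      case (Suc p)
      have pw: "((\<lambda>x. x ^ m) has_real_derivative real m * x ^ p) (at x)"
        using DERIV_pow[of m x UNIV] by (simp add: Suc)
      have "((\<lambda>x. exp (- 1 / x) / x ^ m) has_real_derivative
         ((exp (- 1 / x) * (1 / x\<^sup>2)) * x ^ m - exp (- 1 / x) * (real m * x ^ p)) / (x ^ m * x ^ m)) (at x)"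
        using 1 by (intro DERIV_divide pw)
           (auto intro!: derivative_eq_intros simp: Suc power2_eq_square)
      also have "((exp (- 1 / x) * (1 / x\<^sup>2)) * x ^ m - exp (- 1 / x) * (real m * x ^ p)) / (x ^ m * x ^ m)
          = flat (m + 2) x - m * flat (m + 1) x"
        using 1 by (simp add: flat_def Suc field_simps power2_eq_square)
      finally show ?thesis .
    qed
    then show ?thesis
      by (rule has_field_derivative_transform_within_open[of _ _ _ "{0<..}"]) (use 1 in \<open>auto simp: flat_def\<close>)
  next
    case 2
    have "((\<lambda>x. 0) has_real_derivative (flat (m + 2) x - m * flat (m + 1) x)) (at x)"
      using 2 by (simp add: flat_def)
    then show ?thesis
      by (rule has_field_derivative_transform_within_open[of _ _ _ "{..<0}"]) (use 2 in \<open>auto simp: flat_def\<close>)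
  next
    case 3
    have "(\<lambda>y. flat m y / y) \<midarrow>0\<rightarrow> 0"
    proof (rule Lim_null_comparison)
      show "\<forall>\<^sub>F y in at 0. norm (flat m y / y) \<le> fact (m + 2) * \<bar>y\<bar>"
      proof (rule always_eventually, intro allI)
        fix y :: real
        show "norm (flat m y / y) \<le> fact (m + 2) * \<bar>y\<bar>"
        proof (cases "y > 0")
          case True then show ?thesis
            using flat_bound[of m y] flat_nonneg[of m y]
            by (simp add: pos_divide_le_eq power2_eq_square mult_ac)
        next
          case False
          then have "norm (flat m y / y) = 0" by (simp add: flat_def)
          also have "0 \<le> fact (m + 2) * \<bar>y\<bar>" by (intro mult_nonneg_nonneg) auto
          finally show ?thesis .
        qed
      qed
      show "(\<lambda>y::real. fact (m + 2) * \<bar>y\<bar>) \<midarrow>0\<rightarrow> 0"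
        by (auto intro!: tendsto_eq_intros)
    qed
    then show ?thesis using 3 by (simp add: has_field_derivative_iff flat_def)
  qed
qed

lemma Ck_flat: "Ck k (flat m)"
proof (induction k arbitrary: m)
  case 0
  show ?case unfolding Ck_0
    by (simp add: continuous_at_imp_continuous_on DERIV_isCont[OF flat_has_deriv])
next
  case (Suc k)
  have "Ck k (\<lambda>x. flat (m + 2) x - m * flat (m + 1) x)"
    by (intro Ck_diff Ck_cmult Suc)
  then show ?case by (intro Ck_SucI[OF flat_has_deriv])
qed

definition ramp :: "real \<Rightarrow> real" where "ramp = flat 0"

lemma ramp_eq: "ramp x = (if x > 0 then exp (- 1 / x) else 0)" by (simp add: ramp_def flat_def)
lemma Ck_ramp: "Ck k ramp" by (simp add: ramp_def Ck_flat)
lemma ramp_nonneg: "0 \<le> ramp x" by (simp add: ramp_eq)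
lemma ramp_le_1: "ramp x \<le> 1" by (simp add: ramp_eq)
lemma ramp_pos: "0 < x \<Longrightarrow> 0 < ramp x" by (simp add: ramp_eq)
lemma ramp_zero: "x \<le> 0 \<Longrightarrow> ramp x = 0" by (simp add: ramp_eq)
lemma ramp_mono: "x \<le> y \<Longrightarrow> ramp x \<le> ramp y"
  by (auto simp: ramp_eq divide_simps)
lemma ramp_deriv: "(ramp has_real_derivative flat 2 x) (at x)"
  using flat_has_deriv[of 0 x] by (simp add: ramp_def numeral_2_eq_2)

text \<open>A smooth transition from \<open>0\<close> (for \<open>x \<le> -1\<close>) to \<open>1\<close> (for \<open>x \<ge> 1\<close>).\<close>

definition step :: "real \<Rightarrow> real" where
  "step x = ramp (1 + x) * inverse (ramp (1 + x) + ramp (1 - x))"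

lemma step_denom: "ramp (1 + x) + ramp (1 - x) > 0"
  using ramp_pos[of "1 + x"] ramp_pos[of "1 - x"] ramp_nonneg[of "1 + x"] ramp_nonneg[of "1 - x"]
  by (smt (verit))

lemma Ck_step: "Ck k step"
proof -
  have 1: "Ck k (\<lambda>x. ramp (1 + x))" by (intro Ck_compose[OF Ck_ramp] Ck_add Ck_const Ck_id)
  have 2: "Ck k (\<lambda>x. ramp (1 - x))" by (intro Ck_compose[OF Ck_ramp] Ck_diff Ck_const Ck_id)
  have "Ck k (\<lambda>x. ramp (1 + x) * inverse (ramp (1 + x) + ramp (1 - x)))"
    by (intro Ck_mult Ck_inverse Ck_add 1 2) (metis step_denom less_irrefl)
  then show ?thesis unfolding step_def .
qed

lemma step_low: "x \<le> -1 \<Longrightarrow> step x = 0" by (simp add: step_def ramp_zero)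
lemma step_high: "1 \<le> x \<Longrightarrow> step x = 1"
  using step_denom[of x] by (simp add: step_def ramp_zero)
lemma step_nonneg: "0 \<le> step x" 
  using step_denom[of x] by (simp add: step_def ramp_nonneg)
lemma step_le_1: "step x \<le> 1"
  using step_denom[of x] ramp_nonneg[of "1 - x"] by (simp add: step_def field_simps)

definition dstep :: "real \<Rightarrow> real" where "dstep = deriv step"

lemma step_deriv: "(step has_real_derivative dstep x) (at x)"
  unfolding dstep_def using Ck_has_deriv[OF Ck_step] .
lemma Ck_dstep: "Ck k dstep" unfolding dstep_def by (rule Ck_deriv[OF Ck_step])

lemma dstep_eq: "dstep x = (flat 2 (1 + x) * ramp (1 - x) + ramp (1 + x) * flat 2 (1 - x))
    / (ramp (1 + x) + ramp (1 - x))\<^sup>2"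
proof -
  have a: "((\<lambda>x. ramp (1 + x)) has_real_derivative flat 2 (1 + x)) (at x)"
    by (rule DERIV_cong[OF DERIV_chain2[OF ramp_deriv, of _ 1]]) (auto intro!: derivative_eq_intros)
  have b: "((\<lambda>x. ramp (1 - x)) has_real_derivative - flat 2 (1 - x)) (at x)"
    by (rule DERIV_cong[OF DERIV_chain2[OF ramp_deriv, of _ "-1"]]) (auto intro!: derivative_eq_intros)
  have "((\<lambda>x. ramp (1 + x) / (ramp (1 + x) + ramp (1 - x))) has_real_derivative 
     (flat 2 (1 + x) * ramp (1 - x) + ramp (1 + x) * flat 2 (1 - x))
    / (ramp (1 + x) + ramp (1 - x))\<^sup>2) (at x)"
    using step_denom[of x]
    by (intro DERIV_cong[OF DERIV_divide[OF a DERIV_add[OF a b]]]) (auto simp: algebra_simps power2_eq_square)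
  then show ?thesis
    unfolding dstep_def by (intro DERIV_imp_deriv) (simp add: step_def[abs_def] divide_inverse)
qed

lemma dstep_nonneg: "0 \<le> dstep x"
  unfolding dstep_eq by (intro divide_nonneg_nonneg add_nonneg_nonneg mult_nonneg_nonneg flat_nonneg ramp_nonneg) auto
lemma dstep_zero: "1 \<le> \<bar>x\<bar> \<Longrightarrow> dstep x = 0"
  by (cases "x > 0") (auto simp: dstep_eq ramp_zero flat_def)
lemma dstep_pos: "0 < dstep 0"
  by (auto simp: dstep_eq ramp_eq flat_def)
lemma dstep_bounded: "\<exists>B>0. \<forall>x. dstep x \<le> B"
proof -
  have "compact (dstep ` {-1..1})"
    by (intro compact_continuous_image continuous_on_subset[OF Ck_continuous[OF Ck_dstep[of 0]]]) auto
  then obtain B where B: "\<forall>x\<in>dstep ` {-1..1}. norm x \<le> B" using compact_imp_bounded bounded_iff by metis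
  have "dstep x \<le> max B 1" for x
  proof (cases "x \<in> {-1..1}")
    case True
    then have "\<bar>dstep x\<bar> \<le> B" using B by auto
    then show ?thesis by linarith
  qed (use dstep_zero[of x] in auto)
  then show ?thesis by (intro exI[of _ "max B 1"]) auto
qed

section \<open>Partial derivatives and functions of class \<open>C\<^sup>k\<close>\<close>

lemma partials_Nil [simp]: "partials [] f = f" by (simp add: partials_def)
lemma partials_snoc [simp]: "partials (is @ [i]) f = partials is (partial i f)" by (simp add: partials_def)

lemma partial_eqI: "(f has_derivative f') (at x) \<Longrightarrow> partial i f x = f' (axis i 1)"
  unfolding partial_def using frechet_derivative_at by metis

lemma partial_const [simp]: "partial i (\<lambda>x. c) x = 0"
  by (rule partial_eqI[OF has_derivative_const])

lemma partial_coord: "partial i (\<lambda>x. x $ j) x = (if i = j then 1 else 0)"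
  by (subst partial_eqI[OF bounded_linear.has_derivative[OF bounded_linear_vec_nth has_derivative_ident]])
     (auto simp: axis_def)

lemma partial_add:
  assumes "f differentiable at x" "g differentiable at x"
  shows "partial i (\<lambda>x. f x + g x) x = partial i f x + partial i g x"
  unfolding partial_eqI[OF has_derivative_add[OF assms[unfolded frechet_derivative_works]]]
  by (simp add: partial_def)

lemma partial_diff:
  assumes "f differentiable at x" "g differentiable at x"
  shows "partial i (\<lambda>x. f x - g x) x = partial i f x - partial i g x"
  unfolding partial_eqI[OF has_derivative_diff[OF assms[unfolded frechet_derivative_works]]]
  by (simp add: partial_def)

lemma partial_mult:
  fixes f g :: "real^'n \<Rightarrow> real"
  assumes "f differentiable at x" "g differentiable at x"
  shows "partial i (\<lambda>x. f x * g x) x = f x * partial i g x + partial i f x * g x"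
  unfolding partial_eqI[OF has_derivative_mult[OF assms[unfolded frechet_derivative_works]]]
  by (simp add: partial_def)

lemma has_derivative_compose_real:
  fixes f :: "real^'n \<Rightarrow> real"
  assumes "f differentiable at x" "(\<psi> has_real_derivative d) (at (f x))"
  shows "((\<lambda>x. \<psi> (f x)) has_derivative (\<lambda>v. frechet_derivative f (at x) v * d)) (at x)"
proof -
  have "(*) d = (\<lambda>h. h * d)" by (rule ext) (rule mult.commute)
  with assms(2) have "(\<psi> has_derivative (\<lambda>h. h * d)) (at (f x))"
    unfolding has_field_derivative_def by simp
  from has_derivative_compose[OF assms(1)[unfolded frechet_derivative_works] this] show ?thesis .
qed

text \<open>The outer function is differentiated at one point only, so the rule also serves functions such as \<open>inverse\<close>.\<close>

lemma partial_compose: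
  fixes f :: "real^'n \<Rightarrow> real"
  assumes "f differentiable at x" "(\<psi> has_real_derivative d) (at (f x))"
  shows "partial i (\<lambda>x. \<psi> (f x)) x = d * partial i f x"
  unfolding partial_eqI[OF has_derivative_compose_real[OF assms]] by (simp add: partial_def)

lemma C_on_0: "f \<in> C_on 0 UNIV \<longleftrightarrow> continuous_on UNIV f"
  by (auto simp: C_on_def)

text \<open>On the whole space the classes \<open>C\<^sup>k\<close> can be treated recursively, because the last entry of a list of directions is
the derivative that is taken first.\<close>

lemma C_on_Suc: "f \<in> C_on (Suc k) UNIV \<longleftrightarrow> (\<forall>x. f differentiable at x) \<and> (\<forall>i. partial i f \<in> C_on k UNIV)"
proof safe
  assume f: "f \<in> C_on (Suc k) UNIV"
  have "\<forall>is. length is < Suc k \<longrightarrow> partials is f differentiable_on UNIV" using f unfolding C_on_def by blast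
  from this[rule_format, of "[]"] have "partials [] f differentiable_on UNIV" by simp
  then show "f differentiable at x" for x by (simp add: differentiable_on_def)
  show "partial i f \<in> C_on k UNIV" for i
    unfolding C_on_def
  proof (intro CollectI conjI allI impI)
    fix "is" :: "'a list" assume "length is \<le> k"
    then have "continuous_on UNIV (partials (is @ [i]) f)"
      using f unfolding C_on_def by (auto simp del: partials_snoc)
    then show "continuous_on UNIV (partials is (partial i f))" by simp
  next
    fix "is" :: "'a list" assume "length is < k"
    then have "partials (is @ [i]) f differentiable_on UNIV"
      using f unfolding C_on_def by (auto simp del: partials_snoc)
    then show "partials is (partial i f) differentiable_on UNIV" by simp
  qed
next
  assume d: "\<forall>x. f differentiable at x" and p: "\<forall>i. partial i f \<in> C_on k UNIV"
  have don: "f differentiable_on UNIV" using d by (auto simp: differentiable_on_def)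
  show "f \<in> C_on (Suc k) UNIV"
    unfolding C_on_def
  proof (intro CollectI conjI allI impI)
    fix "is" :: "'a list" assume l: "length is \<le> Suc k"
    show "continuous_on UNIV (partials is f)"
    proof (cases "is" rule: rev_cases)
      case Nil then show ?thesis using don by (simp add: differentiable_imp_continuous_on)
    next
      case (snoc is' i) then show ?thesis using p l by (auto simp: C_on_def)
    qed
  next
    fix "is" :: "'a list" assume l: "length is < Suc k"
    show "partials is f differentiable_on UNIV"
    proof (cases "is" rule: rev_cases)
      case Nil then show ?thesis using don by simp
    next
      case (snoc is' i) then show ?thesis using p l by (auto simp: C_on_def)
    qed
  qed
qed

lemma C_on_diffble: "f \<in> C_on (Suc k) UNIV \<Longrightarrow> f differentiable at x"
  by (simp add: C_on_Suc)

lemma C_on_partial: "f \<in> C_on (Suc k) UNIV \<Longrightarrow> partial i f \<in> C_on k UNIV"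
  by (simp add: C_on_Suc)

lemma C_on_mono: "f \<in> C_on k \<Omega> \<Longrightarrow> j \<le> k \<Longrightarrow> f \<in> C_on j \<Omega>"
  by (auto simp: C_on_def)

lemma C_on_SucD: "f \<in> C_on (Suc k) \<Omega> \<Longrightarrow> f \<in> C_on k \<Omega>"
  by (rule C_on_mono) auto

lemma C_on_continuous: "f \<in> C_on k UNIV \<Longrightarrow> continuous_on UNIV f"
  using C_on_mono[of f k UNIV 0] by (simp add: C_on_0)

lemma C_on_const: "(\<lambda>x. c) \<in> C_on k UNIV"
proof (induction k arbitrary: c)
  case 0 then show ?case by (simp add: C_on_0)
next
  case (Suc k)
  have "partial i (\<lambda>x. c) = (\<lambda>x. 0)" for i :: 'a by (rule ext) simp
  then show ?case using Suc by (simp add: C_on_Suc)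
qed

lemma C_on_coord: "(\<lambda>x. x $ j) \<in> C_on k UNIV"
proof (cases k)
  case 0 then show ?thesis by (simp add: C_on_0 continuous_on_component)
next
  case (Suc k)
  have "partial i (\<lambda>x. x $ j) = (\<lambda>x. if i = j then 1 else 0)" for i by (rule ext) (rule partial_coord)
  moreover have "(\<lambda>x::real^'a. x $ j) differentiable at x" for x
    by (rule bounded_linear_imp_differentiable[OF bounded_linear_vec_nth])
  ultimately show ?thesis unfolding Suc C_on_Suc by (simp add: C_on_const)
qed

lemma C_on_add: "f \<in> C_on k UNIV \<Longrightarrow> g \<in> C_on k UNIV \<Longrightarrow> (\<lambda>x. f x + g x) \<in> C_on k UNIV"
proof (induction k arbitrary: f g)
  case 0 then show ?case unfolding C_on_0 by (intro continuous_on_add)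
next
  case (Suc k)
  note d = Suc.prems[THEN C_on_diffble]
  have "partial i (\<lambda>x. f x + g x) = (\<lambda>x. partial i f x + partial i g x)" for i
    by (rule ext) (rule partial_add[OF d])
  then show ?case using Suc by (simp add: C_on_Suc)
qed

lemma C_on_mult: "f \<in> C_on k UNIV \<Longrightarrow> g \<in> C_on k UNIV \<Longrightarrow> (\<lambda>x. f x * g x) \<in> C_on k UNIV"
proof (induction k arbitrary: f g)
  case 0 then show ?case unfolding C_on_0 by (intro continuous_on_mult)
next
  case (Suc k)
  note d = Suc.prems[THEN C_on_diffble]
  have "partial i (\<lambda>x. f x * g x) = (\<lambda>x. f x * partial i g x + partial i f x * g x)" for i
    by (rule ext) (rule partial_mult[OF d])
  moreover have "(\<lambda>x. f x * partial i g x + partial i f x * g x) \<in> C_on k UNIV" for i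
    by (rule C_on_add[OF Suc.IH[OF C_on_SucD[OF Suc.prems(1)] C_on_partial[OF Suc.prems(2)]]
         Suc.IH[OF C_on_partial[OF Suc.prems(1)] C_on_SucD[OF Suc.prems(2)]]])
  moreover have "(\<lambda>x. f x * g x) differentiable at x" for x by (rule differentiable_mult[OF d])
  ultimately show ?case by (simp add: C_on_Suc)
qed

lemma C_on_cmult: "f \<in> C_on k UNIV \<Longrightarrow> (\<lambda>x. c * f x) \<in> C_on k UNIV"
  by (rule C_on_mult[OF C_on_const])

lemma C_on_diff: "f \<in> C_on k UNIV \<Longrightarrow> g \<in> C_on k UNIV \<Longrightarrow> (\<lambda>x. f x - g x) \<in> C_on k UNIV"
  using C_on_add[of f k "\<lambda>x. (-1) * g x"] C_on_cmult[of g k "-1"] by simp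

lemma C_on_prod: "finite A \<Longrightarrow> (\<And>a. a \<in> A \<Longrightarrow> f a \<in> C_on k UNIV) \<Longrightarrow> (\<lambda>x. \<Prod>a\<in>A. f a x) \<in> C_on k UNIV"
proof (induction A rule: finite_induct)
  case (insert a A) then show ?case using C_on_mult[of "f a" k "\<lambda>x. \<Prod>a\<in>A. f a x"] by simp
qed (simp add: C_on_const)

lemma C_on_compose: "Ck k \<psi> \<Longrightarrow> f \<in> C_on k UNIV \<Longrightarrow> (\<lambda>x. \<psi> (f x)) \<in> C_on k UNIV"
proof (induction k arbitrary: \<psi>)
  case 0 then show ?case unfolding C_on_0 Ck_0 by (rule continuous_on_compose2) auto
next
  case (Suc k)
  note d = C_on_diffble[OF Suc.prems(2)]
  have "partial i (\<lambda>x. \<psi> (f x)) = (\<lambda>x. deriv \<psi> (f x) * partial i f x)" for i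
    by (rule ext) (rule partial_compose[OF d Ck_has_deriv[OF Suc.prems(1)]])
  moreover have "(\<lambda>x. deriv \<psi> (f x) * partial i f x) \<in> C_on k UNIV" for i
    by (rule C_on_mult[OF Suc.IH[OF Ck_deriv[OF Suc.prems(1)] C_on_SucD[OF Suc.prems(2)]] C_on_partial[OF Suc.prems(2)]])
  moreover have "(\<lambda>x. \<psi> (f x)) differentiable at x" for x
    using has_derivative_compose_real[OF d Ck_has_deriv[OF Suc.prems(1)]] unfolding differentiable_def by blast
  ultimately show ?case by (simp add: C_on_Suc)
qed

lemma inverse_has_deriv: "y \<noteq> 0 \<Longrightarrow> (inverse has_real_derivative - (inverse y * inverse y)) (at (y::real))"
  by (auto intro!: derivative_eq_intros)

lemma C_on_inverse: "f \<in> C_on k UNIV \<Longrightarrow> (\<And>x. f x \<noteq> 0) \<Longrightarrow> (\<lambda>x. inverse (f x)) \<in> C_on k UNIV"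
proof (induction k)
  case 0 then show ?case unfolding C_on_0 by (intro continuous_on_inverse) auto
next
  case (Suc k)
  note d = C_on_diffble[OF Suc.prems(1)]
  note e = C_on_SucD[OF Suc.prems(1)]
  have I: "(\<lambda>x. inverse (f x)) \<in> C_on k UNIV" by (rule Suc.IH[OF e Suc.prems(2)])
  have "partial i (\<lambda>x. inverse (f x)) = (\<lambda>x. (-1) * ((inverse (f x) * inverse (f x)) * partial i f x))" for i
    by (rule ext) (simp add: partial_compose[OF d inverse_has_deriv[OF Suc.prems(2)]])
  moreover have "(\<lambda>x. (-1) * ((inverse (f x) * inverse (f x)) * partial i f x)) \<in> C_on k UNIV" for i
    by (rule C_on_cmult[OF C_on_mult[OF C_on_mult[OF I I] C_on_partial[OF Suc.prems(1)]]])
  moreover have "(\<lambda>x. inverse (f x)) differentiable at x" for x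
    using has_derivative_compose_real[OF d inverse_has_deriv[OF Suc.prems(2)]] unfolding differentiable_def by blast
  ultimately show ?case by (simp add: C_on_Suc)
qed

lemma C_on_compose_coord: "Ck k \<psi> \<Longrightarrow> (\<lambda>x. \<psi> (x $ j)) \<in> C_on k UNIV"
  by (rule C_on_compose[OF _ C_on_coord])

lemma C_on_partials_cont:
  "f \<in> C_on k UNIV \<Longrightarrow> length is \<le> k \<Longrightarrow> continuous_on A (partials is f)"
  by (rule continuous_on_subset[of UNIV]) (auto simp: C_on_def)

lemma C_on_subset: "f \<in> C_on k UNIV \<Longrightarrow> f \<in> C_on k \<Omega>"
  by (auto simp: C_on_def intro: continuous_on_subset differentiable_on_subset)

lemma C_on_C_closure: "f \<in> C_on k UNIV \<Longrightarrow> f \<in> C_closure k \<Omega>"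
  unfolding C_closure_def
  using C_on_subset[of f k \<Omega>] C_on_partials_cont[of f k "[]" "closure \<Omega>"]
  by (auto intro!: exI[of _ "partials _ f"] C_on_partials_cont[of f k])

section \<open>Hoelder classes\<close>

definition holder_on :: "real \<Rightarrow> 'a::metric_space set \<Rightarrow> ('a \<Rightarrow> real) \<Rightarrow> bool" where
  "holder_on \<beta> S f \<longleftrightarrow> (\<exists>C\<ge>0. \<forall>x\<in>S. \<forall>y\<in>S. \<bar>f x - f y\<bar> \<le> C * dist x y powr \<beta>)"

lemma holder_onI: "0 \<le> C \<Longrightarrow> (\<And>x y. x \<in> S \<Longrightarrow> y \<in> S \<Longrightarrow> \<bar>f x - f y\<bar> \<le> C * dist x y powr \<beta>) \<Longrightarrow> holder_on \<beta> S f"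
  unfolding holder_on_def by blast

lemma holder_on_add: assumes "holder_on \<beta> S f" "holder_on \<beta> S g" shows "holder_on \<beta> S (\<lambda>x. f x + g x)"
proof -
  from assms obtain C D where C: "0 \<le> C" "\<And>x y. x \<in> S \<Longrightarrow> y \<in> S \<Longrightarrow> \<bar>f x - f y\<bar> \<le> C * dist x y powr \<beta>"
    and D: "0 \<le> D" "\<And>x y. x \<in> S \<Longrightarrow> y \<in> S \<Longrightarrow> \<bar>g x - g y\<bar> \<le> D * dist x y powr \<beta>"
    unfolding holder_on_def by blast
  show ?thesis
  proof (rule holder_onI[of "C + D"])
    fix x y assume xy: "x \<in> S" "y \<in> S"
    have "\<bar>f x + g x - (f y + g y)\<bar> \<le> \<bar>f x - f y\<bar> + \<bar>g x - g y\<bar>" by linarith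
    also have "\<dots> \<le> C * dist x y powr \<beta> + D * dist x y powr \<beta>"
      by (intro add_mono C D xy)
    finally show "\<bar>f x + g x - (f y + g y)\<bar> \<le> (C + D) * dist x y powr \<beta>" by (simp add: distrib_right)
  qed (use C D in simp)
qed

text \<open>Unlike for sums, bounds on the factors are needed.\<close>

lemma holder_on_mult:
  assumes "holder_on \<beta> S f" "holder_on \<beta> S g" and b: "\<And>x. x \<in> S \<Longrightarrow> \<bar>f x\<bar> \<le> A" "\<And>x. x \<in> S \<Longrightarrow> \<bar>g x\<bar> \<le> B"
  shows "holder_on \<beta> S (\<lambda>x. f x * g x)"
proof (cases "S = {}")
  case False
  from assms obtain C D where C: "0 \<le> C" "\<And>x y. x \<in> S \<Longrightarrow> y \<in> S \<Longrightarrow> \<bar>f x - f y\<bar> \<le> C * dist x y powr \<beta>"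
    and D: "0 \<le> D" "\<And>x y. x \<in> S \<Longrightarrow> y \<in> S \<Longrightarrow> \<bar>g x - g y\<bar> \<le> D * dist x y powr \<beta>"
    unfolding holder_on_def by blast
  from False b have AB: "0 \<le> A" "0 \<le> B" by (meson abs_ge_zero all_not_in_conv order_trans)+
  show ?thesis
  proof (rule holder_onI[of "A * D + B * C"])
    show "0 \<le> A * D + B * C" using AB C D by simp
    fix x y assume xy: "x \<in> S" "y \<in> S"
    have "f x * g x - f y * g y = f x * (g x - g y) + (f x - f y) * g y" by (simp add: algebra_simps)
    then have "\<bar>f x * g x - f y * g y\<bar> \<le> \<bar>f x\<bar> * \<bar>g x - g y\<bar> + \<bar>g y\<bar> * \<bar>f x - f y\<bar>"
      using abs_triangle_ineq[of "f x * (g x - g y)" "(f x - f y) * g y"] by (simp add: abs_mult mult.commute)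
    also have "\<dots> \<le> A * (D * dist x y powr \<beta>) + B * (C * dist x y powr \<beta>)"
      by (intro add_mono mult_mono b C D xy AB) auto
    finally show "\<bar>f x * g x - f y * g y\<bar> \<le> (A * D + B * C) * dist x y powr \<beta>" by (simp add: algebra_simps)
  qed
qed (simp add: holder_on_def, blast)

text \<open>A recursive form of the Hoelder class: the derivatives of order \<open>k\<close> are Hoelder continuous on \<open>S\<close>, while smoothness is
required on the whole space so that no boundary behaviour has to be tracked.\<close>

primrec C_holder :: "nat \<Rightarrow> real \<Rightarrow> (real^'n::finite) set \<Rightarrow> (real^'n \<Rightarrow> real) \<Rightarrow> bool" where
  C_holder_0: "C_holder 0 \<beta> S f = (continuous_on UNIV f \<and> holder_on \<beta> S f)"
| C_holder_Suc: "C_holder (Suc k) \<beta> S f = ((\<forall>x. f differentiable at x) \<and> (\<forall>i. C_holder k \<beta> S (partial i f)))"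

lemma C_holder_C_on: "C_holder k \<beta> S f \<Longrightarrow> f \<in> C_on k UNIV"
  by (induction k arbitrary: f) (auto simp: C_on_0 C_on_Suc)

lemma C_holder_partials: "C_holder k \<beta> S f \<Longrightarrow> length is = k \<Longrightarrow> holder_on \<beta> S (partials is f)"
proof (induction k arbitrary: f "is")
  case (Suc k)
  then obtain is' i where "is = is' @ [i]" by (metis length_Suc_conv_rev)
  then show ?case using Suc by auto
qed auto

lemma C_holder_holder_closure: "C_holder k \<beta> \<Omega> f \<Longrightarrow> f \<in> holder_closure k \<beta> \<Omega>"
  unfolding holder_closure_def
  using C_on_C_closure[OF C_holder_C_on] C_holder_partials[of k \<beta> \<Omega> f] by (fastforce simp: holder_on_def)

lemma frechet_sum_partial:
  fixes f :: "real^'n \<Rightarrow> real"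
  assumes "f differentiable at x"
  shows "frechet_derivative f (at x) v = (\<Sum>i\<in>UNIV. v $ i * partial i f x)"
proof -
  interpret bounded_linear "frechet_derivative f (at x)"
    using assms frechet_derivative_works has_derivative_bounded_linear by blast
  have "v = (\<Sum>i\<in>UNIV. v $ i *\<^sub>R axis i 1)"
    by (simp add: basis_expansion[of v, unfolded scalar_mult_eq_scaleR] )
  then have "frechet_derivative f (at x) v = frechet_derivative f (at x) (\<Sum>i\<in>UNIV. v $ i *\<^sub>R axis i 1)" by simp
  then show ?thesis by (simp add: sum scaleR partial_def)
qed

lemma C1_bounded_partials:
  fixes f :: "real^'n \<Rightarrow> real"
  assumes f: "f \<in> C_on 1 UNIV" and S: "bounded S"
  shows "\<exists>B>0. \<forall>x\<in>S. \<forall>i. \<bar>partial i f x\<bar> \<le> B"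
proof -
  have "\<exists>b. \<forall>x\<in>S. \<bar>partial i f x\<bar> \<le> b" for i
  proof -
    have "continuous_on (closure S) (partial i f)"
      using C_on_partial[of f 0 i] f by (auto simp: C_on_0 intro: continuous_on_subset)
    then have "compact (partial i f ` closure S)"
      using S by (intro compact_continuous_image) (auto simp: compact_closure)
    then obtain b where "\<forall>x\<in>partial i f ` closure S. norm x \<le> b"
      using compact_imp_bounded bounded_iff by metis
    then show ?thesis using closure_subset[of S] by (intro exI[of _ b]) auto
  qed
  then obtain b where b: "\<And>i x. x \<in> S \<Longrightarrow> \<bar>partial i f x\<bar> \<le> b i" by metis
  have "\<bar>partial i f x\<bar> \<le> (\<Sum>i\<in>UNIV. \<bar>b i\<bar>) + 1" if "x \<in> S" for x i
  proof -
    have "\<bar>partial i f x\<bar> \<le> \<bar>b i\<bar>" using b[OF that, of i] by linarith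
    also have "\<dots> \<le> (\<Sum>i\<in>UNIV. \<bar>b i\<bar>)" by (rule member_le_sum) auto
    finally show ?thesis by simp
  qed
  moreover have "(\<Sum>i\<in>UNIV. \<bar>b i\<bar>) + 1 > 0" using sum_nonneg[of UNIV "\<lambda>i. \<bar>b i\<bar>"] by linarith
  ultimately show ?thesis by blast
qed

text \<open>Mean value inequality along segments in \<open>S\<close>, with the compactness of the closure of \<open>S\<close> bounding the gradient.\<close>

lemma C1_Lipschitz:
  fixes f :: "real^'n \<Rightarrow> real"
  assumes f: "f \<in> C_on 1 UNIV" and S: "bounded S" "convex S"
  shows "\<exists>B\<ge>0. \<forall>x\<in>S. \<forall>y\<in>S. \<bar>f x - f y\<bar> \<le> B * dist x y"
proof -
  obtain B where B: "B > 0" "\<And>x i. x \<in> S \<Longrightarrow> \<bar>partial i f x\<bar> \<le> B"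
    using C1_bounded_partials[OF f S(1)] by blast
  have d: "f differentiable at x" for x using f C_on_diffble[of f 0 x] by simp
  have o: "onorm (frechet_derivative f (at x)) \<le> CARD('n) * B" if "x \<in> S" for x
  proof (rule onorm_bound)
    show "0 \<le> CARD('n) * B" using B by simp
    fix v :: "real^'n"
    have "\<bar>frechet_derivative f (at x) v\<bar> \<le> (\<Sum>i\<in>UNIV. \<bar>v $ i * partial i f x\<bar>)"
      unfolding frechet_sum_partial[OF d] by (rule sum_abs)
    also have "\<dots> \<le> (\<Sum>i\<in>(UNIV::'n set). norm v * B)"
      unfolding abs_mult by (intro sum_mono mult_mono component_le_norm_cart B that) auto
    also have "\<dots> = CARD('n) * B * norm v" by simp
    finally show "norm (frechet_derivative f (at x) v) \<le> CARD('n) * B * norm v" by simp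
  qed
  have "norm (f x - f y) \<le> CARD('n) * B * norm (x - y)" if "x \<in> S" "y \<in> S" for x y
    by (rule differentiable_bound[OF S(2) _ o])
       (use that d in \<open>auto simp: frechet_derivative_works intro: has_derivative_at_withinI\<close>)
  then show ?thesis using B by (intro exI[of _ "CARD('n) * B"]) (auto simp: dist_norm)
qed

text \<open>On a bounded set \<open>dist x y \<le> C dist x y powr \<beta>\<close>.\<close>

lemma Lipschitz_imp_holder:
  assumes S: "bounded S" and \<beta>: "0 < \<beta>" "\<beta> \<le> 1" and "0 \<le> B"
    and L: "\<And>x y. x \<in> S \<Longrightarrow> y \<in> S \<Longrightarrow> \<bar>f x - f y\<bar> \<le> B * dist x y"
  shows "holder_on \<beta> S f"
proof -
  define d where "d = diameter S + 1"
  have d: "dist x y \<le> d" "d > 0" if "x \<in> S" "y \<in> S" for x y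
    using diameter_bounded_bound[OF S that] diameter_ge_0[OF S] by (auto simp: d_def)
  show ?thesis
  proof (rule holder_onI[of "B * d powr (1 - \<beta>)"])
    fix x y assume xy: "x \<in> S" "y \<in> S"
    have "dist x y = dist x y powr (1 - \<beta>) * dist x y powr \<beta>"
      by (cases "x = y") (auto simp: powr_add[symmetric])
    also have "\<dots> \<le> d powr (1 - \<beta>) * dist x y powr \<beta>"
      using d[OF xy] \<beta> by (intro mult_right_mono powr_mono2) auto
    finally have "B * dist x y \<le> B * (d powr (1 - \<beta>) * dist x y powr \<beta>)"
      using \<open>0 \<le> B\<close> by (rule mult_left_mono)
    with L[OF xy] show "\<bar>f x - f y\<bar> \<le> B * d powr (1 - \<beta>) * dist x y powr \<beta>" by (simp add: mult_ac)
  qed (use \<open>0 \<le> B\<close> in simp)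
qed

definition pos_powr :: "real \<Rightarrow> real \<Rightarrow> real" where "pos_powr p y = (max 0 y) powr p"

lemma pos_powr_has_deriv:
  assumes "p > 1" shows "(pos_powr p has_real_derivative p * pos_powr (p - 1) y) (at y)"
proof -
  consider "y > 0" | "y < 0" | "y = 0" by linarith
  then show ?thesis
  proof cases
    case 1
    have "((\<lambda>y. y powr p) has_real_derivative p * y powr (p - 1)) (at y)"
      using 1 by (rule has_real_derivative_powr)
    then have "((\<lambda>y. y powr p) has_real_derivative p * pos_powr (p - 1) y) (at y)"
      using 1 by (simp add: pos_powr_def max_def)
    then show ?thesis
      by (rule has_field_derivative_transform_within_open[of _ _ _ "{0<..}"]) (use 1 in \<open>auto simp: pos_powr_def max_def\<close>)
  next
    case 2
    have "((\<lambda>y. 0) has_real_derivative p * pos_powr (p - 1) y) (at y)"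
      using 2 by (simp add: pos_powr_def max_def)
    then show ?thesis
      by (rule has_field_derivative_transform_within_open[of _ _ _ "{..<0}"]) (use 2 in \<open>auto simp: pos_powr_def max_def\<close>)
  next
    case 3
    have "(\<lambda>z. pos_powr p z / z) \<midarrow>0\<rightarrow> 0"
    proof (rule Lim_null_comparison)
      show "\<forall>\<^sub>F z in at 0. norm (pos_powr p z / z) \<le> \<bar>z\<bar> powr (p - 1)"
      proof (intro always_eventually allI)
        fix z :: real
        show "norm (pos_powr p z / z) \<le> \<bar>z\<bar> powr (p - 1)"
        proof (cases "z > 0")
          case True
          then show ?thesis by (simp add: pos_powr_def powr_diff)
        next
          case False
          then have "pos_powr p z = 0" by (simp add: pos_powr_def)
          then show ?thesis by simp
        qed
      qed
      show "(\<lambda>z::real. \<bar>z\<bar> powr (p - 1)) \<midarrow>0\<rightarrow> 0"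
        using assms by (auto intro!: tendsto_eq_intros tendsto_powr')
    qed
    then show ?thesis using 3 by (simp add: has_field_derivative_iff pos_powr_def)
  qed
qed

context
  fixes \<beta> :: real and S :: "(real^'n::finite) set"
  assumes S: "bounded S" "convex S" and \<beta>: "0 < \<beta>" "\<beta> \<le> 1"
begin

lemma C1_holder: "f \<in> C_on 1 UNIV \<Longrightarrow> holder_on \<beta> S f"
  using C1_Lipschitz[OF _ S] Lipschitz_imp_holder[OF S(1) \<beta>] by blast

lemma C_holder_if_C: "f \<in> C_on (Suc k) UNIV \<Longrightarrow> C_holder k \<beta> S f"
proof (induction k arbitrary: f)
  case 0 then show ?case using C1_holder[of f] C_on_continuous by auto
next
  case (Suc k) then show ?case using C_on_diffble[OF Suc.prems] C_on_partial[OF Suc.prems] by simp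
qed

text \<open>Lower derivatives are differentiable with continuous derivatives, hence Lipschitz on a bounded convex set.\<close>

lemma C_holder_SucD: "C_holder (Suc k) \<beta> S f \<Longrightarrow> C_holder k \<beta> S f"
proof (induction k arbitrary: f)
  case 0
  then have "f \<in> C_on 1 UNIV" using C_holder_C_on[of "Suc 0" \<beta> S f] by simp
  then show ?case using C1_holder[of f] C_on_continuous by auto
next
  case (Suc k) then show ?case by (auto simp: C_holder_Suc)
qed

lemma C_holder_add: "C_holder k \<beta> S f \<Longrightarrow> C_holder k \<beta> S g \<Longrightarrow> C_holder k \<beta> S (\<lambda>x. f x + g x)"
proof (induction k arbitrary: f g)
  case 0 then show ?case by (auto intro: holder_on_add continuous_on_add)
next
  case (Suc k)
  have "partial i (\<lambda>x. f x + g x) = (\<lambda>x. partial i f x + partial i g x)" for i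
    by (rule ext) (rule partial_add, use Suc.prems in auto)
  then show ?case using Suc by simp
qed

lemma bounded_continuous: "continuous_on UNIV (f :: real^'n \<Rightarrow> real) \<Longrightarrow> \<exists>A. \<forall>x\<in>S. \<bar>f x\<bar> \<le> A"
proof -
  assume "continuous_on UNIV f"
  then have "compact (f ` closure S)"
    using S by (intro compact_continuous_image) (auto simp: compact_closure intro: continuous_on_subset)
  then obtain b where "\<forall>x\<in>f ` closure S. norm x \<le> b"
    using compact_imp_bounded bounded_iff by metis
  then show ?thesis using closure_subset[of S] by (intro exI[of _ b]) auto
qed

lemma C_holder_mult: "C_holder k \<beta> S f \<Longrightarrow> C_holder k \<beta> S g \<Longrightarrow> C_holder k \<beta> S (\<lambda>x. f x * g x)"
proof (induction k arbitrary: f g)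
  case 0
  obtain A B where "\<And>x. x \<in> S \<Longrightarrow> \<bar>f x\<bar> \<le> A" "\<And>x. x \<in> S \<Longrightarrow> \<bar>g x\<bar> \<le> B"
    using 0 bounded_continuous[of f] bounded_continuous[of g] by auto
  with 0 show ?case by (auto intro: holder_on_mult continuous_on_mult)
next
  case (Suc k)
  have "partial i (\<lambda>x. f x * g x) = (\<lambda>x. f x * partial i g x + partial i f x * g x)" for i
    by (rule ext) (rule partial_mult, use Suc.prems in auto)
  moreover have "C_holder k \<beta> S (\<lambda>x. f x * partial i g x + partial i f x * g x)" for i
    by (intro C_holder_add Suc.IH) (use Suc.prems C_holder_SucD in auto)
  ultimately show ?case using Suc.prems by (simp add: C_holder_Suc differentiable_mult)
qed

text \<open>With \<open>t = b / a\<close> this is \<open>t + (1 - t) \<le> t powr \<beta> + (1 - t) powr \<beta>\<close>.\<close>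

lemma powr_subadditive_diff:
  assumes "0 \<le> b" "b \<le> a"
  shows "a powr \<beta> - b powr \<beta> \<le> (a - b) powr \<beta>"
proof (cases "a = 0")
  case False
  define t where "t = b / a"
  have le: "s \<le> s powr \<beta>" if "0 \<le> s" "s \<le> 1" for s :: real
    using powr_mono'[OF \<beta>(2) that] that by simp
  from False assms have a: "a > 0" and t: "0 \<le> t" "t \<le> 1" "b = a * t" "a - b = a * (1 - t)"
    by (auto simp: t_def field_simps)
  have "a powr \<beta> * (t + (1 - t)) \<le> a powr \<beta> * (t powr \<beta> + (1 - t) powr \<beta>)"
    by (intro mult_left_mono add_mono le) (use t in auto)
  then show ?thesis unfolding t(4) unfolding t(3) using a t by (simp add: powr_mult distrib_left)
qed (use assms in simp)

lemma pos_powr_holder: "\<bar>pos_powr \<beta> y - pos_powr \<beta> z\<bar> \<le> \<bar>y - z\<bar> powr \<beta>"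
proof -
  have *: "\<bar>pos_powr \<beta> y - pos_powr \<beta> z\<bar> \<le> \<bar>y - z\<bar> powr \<beta>" if "z \<le> y" for y z
  proof -
    have "pos_powr \<beta> z \<le> pos_powr \<beta> y"
      unfolding pos_powr_def using that \<beta> by (intro powr_mono2) auto
    moreover have "pos_powr \<beta> y - pos_powr \<beta> z \<le> (max 0 y - max 0 z) powr \<beta>"
      unfolding pos_powr_def by (rule powr_subadditive_diff) (use that in auto)
    moreover have "(max 0 y - max 0 z) powr \<beta> \<le> \<bar>y - z\<bar> powr \<beta>"
      using that \<beta> by (intro powr_mono2) auto
    ultimately show ?thesis by linarith
  qed
  show ?thesis
  proof (cases "z \<le> y")
    case False
    then show ?thesis using *[of y z] by (simp add: abs_minus_commute)
  qed (rule *)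
qed

text \<open>Each derivative of the power \<open>y\<^sub>+\<^sup>k\<^sup>+\<^sup>\<beta>\<close> lowers the exponent by one, and the last one that remains, \<open>y\<^sub>+\<^sup>\<beta>\<close>, is Hoelder
continuous. One derivative more of \<open>f\<close> is assumed than appears, so that its derivatives of order \<open>k\<close> are Lipschitz.\<close>

lemma C_holder_pos_powr:
  "f \<in> C_on (Suc k) UNIV \<Longrightarrow> C_holder k \<beta> S (\<lambda>x. pos_powr (real k + \<beta>) (f x))"
proof (induction k)
  case 0
  obtain B where B: "B \<ge> 0" "\<And>x y. x \<in> S \<Longrightarrow> y \<in> S \<Longrightarrow> \<bar>f x - f y\<bar> \<le> B * dist x y"
    using C1_Lipschitz[OF _ S, of f] 0 by auto
  have "holder_on \<beta> S (\<lambda>x. pos_powr \<beta> (f x))"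
  proof (rule holder_onI[of "B powr \<beta>"])
    fix x y assume xy: "x \<in> S" "y \<in> S"
    have "\<bar>pos_powr \<beta> (f x) - pos_powr \<beta> (f y)\<bar> \<le> \<bar>f x - f y\<bar> powr \<beta>" by (rule pos_powr_holder)
    also have "\<dots> \<le> (B * dist x y) powr \<beta>" using B(2)[OF xy] \<beta> by (intro powr_mono2) auto
    also have "\<dots> = B powr \<beta> * dist x y powr \<beta>" using B(1) by (simp add: powr_mult)
    finally show "\<bar>pos_powr \<beta> (f x) - pos_powr \<beta> (f y)\<bar> \<le> B powr \<beta> * dist x y powr \<beta>" .
  qed simp
  moreover have "continuous_on UNIV (\<lambda>x. pos_powr \<beta> (f x))"
    unfolding pos_powr_def using C_on_continuous[OF 0] \<beta>
    by (intro continuous_on_powr' continuous_on_max continuous_on_const) auto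
  ultimately show ?case by simp
next
  case (Suc k)
  have d: "f differentiable at x" for x by (rule C_on_diffble[OF Suc.prems])
  have p: "(pos_powr (real (Suc k) + \<beta>) has_real_derivative (real (Suc k) + \<beta>) * pos_powr (real k + \<beta>) y) (at y)" for y
    using pos_powr_has_deriv[of "real (Suc k) + \<beta>" y] \<beta> by simp
  have "partial i (\<lambda>x. pos_powr (real (Suc k) + \<beta>) (f x))
      = (\<lambda>x. (real (Suc k) + \<beta>) * (pos_powr (real k + \<beta>) (f x) * partial i f x))" for i
    by (rule ext) (subst partial_compose[OF d p], simp)
  moreover have "C_holder k \<beta> S (\<lambda>x. (real (Suc k) + \<beta>) * (pos_powr (real k + \<beta>) (f x) * partial i f x))" for i
    by (rule C_holder_mult[OF C_holder_if_C[OF C_on_const] C_holder_mult[OF Suc.IH[OF C_on_SucD[OF Suc.prems]]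
          C_holder_if_C[OF C_on_partial[OF Suc.prems]]]])
  moreover have "(\<lambda>x. pos_powr (real (Suc k) + \<beta>) (f x)) differentiable at x" for x
    using has_derivative_compose_real[OF d p] unfolding differentiable_def by blast
  ultimately show ?case by (simp add: C_holder_Suc)
qed

end

section \<open>Integration over the cube\<close>

lemma continuous_borel: "continuous_on UNIV f \<Longrightarrow> f \<in> borel_measurable borel"
  by (rule borel_measurable_continuous_onI)

lemma cube_box: "cube = box (\<chi> i. -1) (\<chi> i. (1::real))"
  by (auto simp: cube_def mem_box_cart)

lemma open_cube: "open (cube :: (real^'n::finite) set)"
  unfolding cube_box by (rule open_box)

lemma cube_sets [measurable, simp]: "(cube :: (real^'n::finite) set) \<in> sets borel"
  using open_cube by (rule borel_open)

lemma bounded_cube: "bounded (cube :: (real^'n::finite) set)"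
  unfolding cube_box by (rule bounded_box)

lemma convex_cube: "convex (cube :: (real^'n::finite) set)"
  unfolding cube_box by (rule convex_box)

lemma emeasure_cube_finite: "emeasure lborel (cube :: (real^'n::finite) set) < \<infinity>"
  unfolding cube_box by (rule emeasure_lborel_box_finite)

lemma nn_integral_lebesgue_on:
  assumes "\<Omega> \<in> sets borel" "f \<in> borel_measurable borel"
  shows "(\<integral>\<^sup>+x. f x \<partial>lebesgue_on \<Omega>) = (\<integral>\<^sup>+x\<in>\<Omega>. f x \<partial>lborel)"
proof -
  have "\<Omega> \<inter> space lebesgue \<in> sets lebesgue" using assms(1) by auto
  from nn_integral_restrict_space[OF this]
  have "(\<integral>\<^sup>+x. f x \<partial>lebesgue_on \<Omega>) = (\<integral>\<^sup>+x. f x * indicator \<Omega> x \<partial>lebesgue)" by simp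
  also have "\<dots> = (\<integral>\<^sup>+x\<in>\<Omega>. f x \<partial>lborel)"
    by (rule nn_integral_completion)
  finally show ?thesis .
qed

lemma integral_lebesgue_on:
  fixes f :: "'a::euclidean_space \<Rightarrow> real"
  assumes "\<Omega> \<in> sets borel" "f \<in> borel_measurable borel"
  shows "(LINT x|lebesgue_on \<Omega>. f x) = (LINT x|lborel. indicator \<Omega> x * f x)"
proof -
  have "\<Omega> \<inter> space lebesgue \<in> sets lebesgue" using assms(1) by auto
  from integral_restrict_space[OF this, of f]
  have "(LINT x|lebesgue_on \<Omega>. f x) = (LINT x|lebesgue. indicator \<Omega> x * f x)"
    unfolding real_scaleR_def .
  also have "\<dots> = (LINT x|lborel. indicator \<Omega> x * f x)"
    by (rule integral_completion) (use assms in measurable)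
  finally show ?thesis .
qed

lemma AE_lebesgue_on_iff:
  assumes "\<Omega> \<in> sets borel"
  shows "(AE x in lebesgue_on \<Omega>. P x) \<longleftrightarrow> (AE x in lborel. x \<in> \<Omega> \<longrightarrow> P x)"
  using assms by (simp add: AE_restrict_space_iff AE_completion_iff)

section \<open>Integration by parts\<close>

lemma partial_zero_outside:
  assumes "closed K" "\<And>x. x \<notin> K \<Longrightarrow> f x = 0" "x \<notin> K"
  shows "partial i f x = 0"
proof -
  have "((\<lambda>x. 0) has_derivative (\<lambda>x. 0)) (at x)" by simp
  then have "(f has_derivative (\<lambda>x. 0)) (at x)"
    by (rule has_derivative_transform_within_open[of _ _ _ _ "- K"]) (use assms in auto)
  from partial_eqI[OF this] show ?thesis .
qed

lemma integrable_continuous_compact: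
  fixes f :: "'a::euclidean_space \<Rightarrow> real"
  assumes "continuous_on UNIV f" "compact K" "\<And>x. x \<notin> K \<Longrightarrow> f x = 0"
  shows "integrable lborel f"
proof -
  have "integrable lborel (\<lambda>x. indicator K x *\<^sub>R f x)"
    using assms by (intro borel_integrable_compact) (auto intro: continuous_on_subset)
  moreover have "(\<lambda>x. indicator K x *\<^sub>R f x) = f"
    by (rule ext) (auto simp: assms(3) split: split_indicator)
  ultimately show ?thesis by simp
qed

lemma lborel_integral_shift:
  fixes f :: "'a::euclidean_space \<Rightarrow> real"
  assumes "f \<in> borel_measurable borel"
  shows "(LINT x|lborel. f (x + c)) = (LINT x|lborel. f x)"
proof -
  have "(LINT x|lborel. f x) = (LINT x|distr lborel borel ((+) c). f x)" by (simp add: lborel_distr_plus)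
  also have "\<dots> = (LINT x|lborel. f (c + x))" using assms by (intro integral_distr) auto
  finally show ?thesis by (simp add: add.commute)
qed

lemma lborel_integrable_shift:
  fixes f :: "'a::euclidean_space \<Rightarrow> real"
  assumes "integrable lborel f"
  shows "integrable lborel (\<lambda>x. f (x + c))"
proof -
  have [measurable]: "f \<in> borel_measurable borel" using borel_measurable_integrable[OF assms] by simp
  have "integrable (distr lborel borel ((+) c)) f" using assms by (simp add: lborel_distr_plus)
  then have "integrable lborel (\<lambda>x. f (c + x))" by (subst (asm) integrable_distr_eq) auto
  then show ?thesis by (simp add: add.commute)
qed

lemma lborel_nn_integral_shift:
  fixes f :: "'a::euclidean_space \<Rightarrow> ennreal"
  assumes "f \<in> borel_measurable borel"
  shows "(\<integral>\<^sup>+x. f (x + c) \<partial>lborel) = (\<integral>\<^sup>+x. f x \<partial>lborel)"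
proof -
  have "(\<integral>\<^sup>+x. f x \<partial>lborel) = (\<integral>\<^sup>+x. f x \<partial>distr lborel borel ((+) c))" by (simp add: lborel_distr_plus)
  also have "\<dots> = (\<integral>\<^sup>+x. f (c + x) \<partial>lborel)" using assms by (intro nn_integral_distr) auto
  finally show ?thesis by (simp add: add.commute)
qed

text \<open>Translation invariance kills the integral of each difference quotient; dominated convergence, with the Lipschitz constant as
bound, passes to the derivative.\<close>

lemma integral_partial_eq_0:
  fixes f :: "real^'n::finite \<Rightarrow> real"
  assumes f: "f \<in> C_on 1 UNIV" and K: "compact K" "\<And>x. x \<notin> K \<Longrightarrow> f x = 0"
  shows "(LINT x|lborel. partial i f x) = 0"
proof -
  define e :: "real^'n" where "e = axis i 1"
  have ne: "norm e = 1" by (simp add: e_def)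
  have fc: "continuous_on UNIV f" by (rule C_on_continuous[OF f])
  have fb [measurable]: "f \<in> borel_measurable borel" by (rule continuous_borel[OF fc])
  have pc: "continuous_on UNIV (partial i f)"
    using C_on_partial[of f 0 i] f by (simp add: C_on_0)
  have pb [measurable]: "partial i f \<in> borel_measurable borel" by (rule continuous_borel[OF pc])
  have fi: "integrable lborel f" by (rule integrable_continuous_compact[OF fc K])
  obtain R where R: "\<And>x. x \<in> K \<Longrightarrow> norm x \<le> R" using compact_imp_bounded[OF K(1)] bounded_iff by blast
  define S where "S = cball (0::real^'n) (R + 2)"
  obtain B where B: "B \<ge> 0" "\<And>x y. x \<in> S \<Longrightarrow> y \<in> S \<Longrightarrow> \<bar>f x - f y\<bar> \<le> B * dist x y"
    using C1_Lipschitz[OF f, of S] by (auto simp: S_def)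
  define q where "q m x = real (Suc m) * (f (x + (1 / real (Suc m)) *\<^sub>R e) - f x)" for m x
  have qb [measurable]: "q m \<in> borel_measurable borel" for m unfolding q_def[abs_def] by measurable
  have "(LINT x|lborel. q m x) = 0" for m
  proof -
    have "integrable lborel (\<lambda>x. f (x + (1 / real (Suc m)) *\<^sub>R e))"
      by (rule lborel_integrable_shift[OF fi])
    then show ?thesis unfolding q_def using fi lborel_integral_shift[OF fb] by simp
  qed
  moreover have "(\<lambda>m. LINT x|lborel. q m x) \<longlonglongrightarrow> (LINT x|lborel. partial i f x)"
  proof (rule integral_dominated_convergence[where w = "\<lambda>x. indicator S x *\<^sub>R B"])
    show "integrable lborel (\<lambda>x. indicat_real S x *\<^sub>R B)"
      unfolding S_def by (intro borel_integrable_compact) auto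
    show "AE x in lborel. norm (q m x) \<le> indicat_real S x *\<^sub>R B" for m
    proof (intro always_eventually allI)
      fix x
      let ?y = "x + (1 / real (Suc m)) *\<^sub>R e"
      have yn: "norm ?y \<le> norm x + 1" "norm x \<le> norm ?y + 1"
      proof -
        have n: "norm ((1 / real (Suc m)) *\<^sub>R e) \<le> 1" by (simp add: ne)
        then show "norm ?y \<le> norm x + 1" using norm_triangle_ineq[of x "(1 / real (Suc m)) *\<^sub>R e"] by linarith
        have "norm (?y - (1 / real (Suc m)) *\<^sub>R e) \<le> norm ?y + norm ((1 / real (Suc m)) *\<^sub>R e)"
          by (rule norm_triangle_ineq4)
        moreover have "?y - (1 / real (Suc m)) *\<^sub>R e = x" by simp
        ultimately have "norm x \<le> norm ?y + norm ((1 / real (Suc m)) *\<^sub>R e)" by (simp only:)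
        with n show "norm x \<le> norm ?y + 1" by linarith
      qed
      show "norm (q m x) \<le> indicat_real S x *\<^sub>R B"
      proof (cases "f ?y = 0 \<and> f x = 0")
        case True then show ?thesis using B by (simp add: q_def)
      next
        case False
        then have "norm x \<le> R \<or> norm ?y \<le> R" using K(2) R by blast
        then have xy: "x \<in> S" "?y \<in> S" using yn by (auto simp: S_def)
        have "\<bar>f ?y - f x\<bar> \<le> B * (1 / real (Suc m))" using B(2)[OF xy(2,1)] by (simp add: dist_norm ne)
        then have "real (Suc m) * \<bar>f ?y - f x\<bar> \<le> B" by (simp add: field_simps)
        then show ?thesis using xy by (simp add: q_def abs_mult)
      qed
    qed
    show "AE x in lborel. (\<lambda>m. q m x) \<longlonglongrightarrow> partial i f x"
    proof (intro always_eventually allI)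
      fix x
      have d: "(f has_derivative frechet_derivative f (at x)) (at x)"
        using C_on_diffble[of f 0 x] f frechet_derivative_works by auto
      have "((\<lambda>t. f (x + t *\<^sub>R e)) has_real_derivative partial i f x) (at 0)"
      proof -
        have "((\<lambda>t::real. x + t *\<^sub>R e) has_derivative (\<lambda>t. t *\<^sub>R e)) (at 0)"
          by (auto intro!: derivative_eq_intros)
        from has_derivative_compose[OF this, of f "frechet_derivative f (at x)"] d
        have "((\<lambda>t. f (x + t *\<^sub>R e)) has_derivative (\<lambda>t. frechet_derivative f (at x) (t *\<^sub>R e))) (at 0)" by simp
        moreover have "frechet_derivative f (at x) (t *\<^sub>R e) = partial i f x * t" for t
          using linear_scale[OF has_derivative_linear[OF d], of t e] by (simp add: partial_def e_def)
        ultimately show ?thesis by (simp add: has_field_derivative_def)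
      qed
      then have L: "((\<lambda>h. (f (x + h *\<^sub>R e) - f x) / h) \<longlongrightarrow> partial i f x) (at 0)"
        by (simp add: has_field_derivative_iff)
      have "filterlim (\<lambda>m. 1 / real (Suc m)) (at 0) sequentially"
        unfolding filterlim_at using LIMSEQ_inverse_real_of_nat by (auto simp: inverse_eq_divide)
      from filterlim_compose[OF L this] show "(\<lambda>m. q m x) \<longlonglongrightarrow> partial i f x"
        by (simp add: q_def field_simps)
    qed
  qed measurable
  ultimately have "(\<lambda>m::nat. 0) \<longlonglongrightarrow> (LINT x|lborel. partial i f x)" by simp
  then show ?thesis by (simp add: LIMSEQ_const_iff)
qed

lemma test_C: "\<phi> \<in> test_functions \<Omega> \<Longrightarrow> \<phi> \<in> C_on k UNIV"
  by (simp add: test_functions_def)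

lemma test_support:
  assumes "\<phi> \<in> test_functions \<Omega>"
  obtains K where "compact K" "K \<subseteq> \<Omega>" "\<And>x. x \<notin> K \<Longrightarrow> \<phi> x = 0" "\<And>x i. x \<notin> K \<Longrightarrow> partial i \<phi> x = 0"
proof -
  from assms obtain K where K: "compact K" "K \<subseteq> \<Omega>" "\<And>x. x \<notin> K \<Longrightarrow> \<phi> x = 0"
    by (auto simp: test_functions_def)
  show ?thesis by (rule that[of K]) (use K partial_zero_outside[OF compact_imp_closed[OF K(1)] K(3)] in auto)
qed

lemma integration_by_parts:
  fixes w :: "real^'n::finite \<Rightarrow> real"
  assumes w: "w \<in> C_on 1 UNIV" and z: "\<zeta> \<in> test_functions cube"
  shows "(LINT x|lebesgue_on cube. w x * partial i \<zeta> x) = - (LINT x|lebesgue_on cube. partial i w x * \<zeta> x)"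
proof -
  obtain K where K: "compact K" "K \<subseteq> cube" "\<And>x. x \<notin> K \<Longrightarrow> \<zeta> x = 0" "\<And>x i. x \<notin> K \<Longrightarrow> partial i \<zeta> x = 0"
    using test_support[OF z] by metis
  have z1: "\<zeta> \<in> C_on 1 UNIV" by (rule test_C[OF z])
  have c: "continuous_on UNIV w" "continuous_on UNIV \<zeta>" "continuous_on UNIV (partial i w)" "continuous_on UNIV (partial i \<zeta>)"
    using C_on_continuous[OF w] C_on_continuous[OF z1] C_on_partial[of w 0 i] C_on_partial[of \<zeta> 0 i] w z1
    by (auto simp: C_on_0)
  have c1: "continuous_on UNIV (\<lambda>x. w x * partial i \<zeta> x)" "continuous_on UNIV (\<lambda>x. partial i w x * \<zeta> x)"
    by (rule continuous_on_mult[OF c(1,4)], rule continuous_on_mult[OF c(3,2)])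
  have i: "integrable lborel (\<lambda>x. w x * partial i \<zeta> x)" "integrable lborel (\<lambda>x. partial i w x * \<zeta> x)"
    by (rule integrable_continuous_compact[OF c1(1) K(1)], use K in simp,
        rule integrable_continuous_compact[OF c1(2) K(1)], use K in simp)
  have p: "partial i (\<lambda>x. w x * \<zeta> x) x = w x * partial i \<zeta> x + partial i w x * \<zeta> x" for x
    by (rule partial_mult) (use w z1 C_on_diffble[of _ 0] in auto)
  have z0: "\<zeta> x = 0 \<and> partial i \<zeta> x = 0" if "x \<notin> cube" for x
    using K that by blast
  have "(LINT x|lborel. partial i (\<lambda>x. w x * \<zeta> x) x) = 0"
    by (rule integral_partial_eq_0[OF C_on_mult[OF w z1] K(1)]) (use K in simp)
  then have "(LINT x|lborel. w x * partial i \<zeta> x) + (LINT x|lborel. partial i w x * \<zeta> x) = 0"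
    unfolding p using i by simp
  moreover have "(\<lambda>x. indicator cube x * (w x * partial i \<zeta> x)) = (\<lambda>x. w x * partial i \<zeta> x)"
      "(\<lambda>x. indicator cube x * (partial i w x * \<zeta> x)) = (\<lambda>x. partial i w x * \<zeta> x)"
    using z0 by (auto intro!: ext split: split_indicator)
  ultimately show ?thesis
    unfolding integral_lebesgue_on[OF cube_sets c1(1)[THEN continuous_borel]]
      integral_lebesgue_on[OF cube_sets c1(2)[THEN continuous_borel]] by simp
qed

section \<open>Slicing the cube\<close>

text \<open>The point of the line through \<open>x\<close> in direction \<open>i\<close> whose \<open>i\<close>-th coordinate is \<open>t\<close>.\<close>

definition upd :: "'n \<Rightarrow> real \<Rightarrow> real^'n::finite \<Rightarrow> real^'n" where
  "upd i t x = x + (t - x $ i) *\<^sub>R axis i 1"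

lemma upd_nth: "upd i t x $ j = (if j = i then t else x $ j)"
  by (simp add: upd_def axis_def)

text \<open>Fubini on the cube without splitting off a coordinate: the integral over the slice through \<open>x\<close> is constant along that slice,
so integrating it over the cube again counts \<open>F\<close> with the length 2 of the slice. The proof is Tonelli's theorem for \<open>(x, s)\<close> and
the shift \<open>x \<mapsto> x - s e\<close>.\<close>

lemma nn_integral_cube_slice:
  fixes F :: "real^'n::finite \<Rightarrow> ennreal"
  assumes [measurable]: "F \<in> borel_measurable borel"
  shows "2 * (\<integral>\<^sup>+x\<in>cube. F x \<partial>lborel) = (\<integral>\<^sup>+x\<in>cube. (\<integral>\<^sup>+t\<in>{-1<..<1}. F (upd i t x) \<partial>lborel) \<partial>lborel)"
proof -
  define e :: "real^'n" where "e = axis i 1"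
  define G where "G x = F x * indicator cube x" for x
  have [measurable]: "G \<in> borel_measurable borel" unfolding G_def[abs_def] by measurable
  have [measurable]: "(indicator cube :: real^'n \<Rightarrow> ennreal) \<in> borel_measurable borel" by measurable
  have e_nth: "e $ j = (if j = i then 1 else 0)" for j by (simp add: e_def axis_def)
  have slice: "(\<integral>\<^sup>+t\<in>{-1<..<1}. F (upd i t x) \<partial>lborel) = (\<integral>\<^sup>+s. G (x + s *\<^sub>R e) \<partial>lborel)" if "x \<in> cube" for x
  proof -
    have "(\<integral>\<^sup>+s. G (x + s *\<^sub>R e) \<partial>lborel) = (\<integral>\<^sup>+t. G (x + (t - x $ i) *\<^sub>R e) \<partial>lborel)"
      using lborel_nn_integral_shift[of "\<lambda>s. G (x + s *\<^sub>R e)" "- (x $ i)"] by simp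
    also have "\<dots> = (\<integral>\<^sup>+t\<in>{-1<..<1}. F (upd i t x) \<partial>lborel)"
    proof (rule nn_integral_cong)
      fix t :: real
      have "upd i t x \<in> cube \<longleftrightarrow> t \<in> {-1<..<1}"
        using that by (auto simp: cube_def upd_nth)
      then show "G (x + (t - x $ i) *\<^sub>R e) = F (upd i t x) * indicator {-1<..<1} t"
        unfolding G_def upd_def[symmetric] e_def by (auto simp: indicator_def)
    qed
    finally show ?thesis ..
  qed
  have len: "(\<integral>\<^sup>+s. indicator cube (x + - (s *\<^sub>R e)) \<partial>lborel) = (2 :: ennreal)" if "x \<in> cube" for x
  proof -
    have "(\<integral>\<^sup>+s. indicator cube (x + - (s *\<^sub>R e)) \<partial>lborel) = (\<integral>\<^sup>+s. indicator {x $ i - 1<..<x $ i + 1} s \<partial>lborel)"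
    proof (rule nn_integral_cong)
      fix s :: real
      have "x + - (s *\<^sub>R e) \<in> cube \<longleftrightarrow> s \<in> {x $ i - 1<..<x $ i + 1}"
        using that by (auto simp: cube_def e_nth)
      then show "(indicator cube (x + - (s *\<^sub>R e)) :: ennreal) = indicator {x $ i - 1<..<x $ i + 1} s"
        by (auto simp: indicator_def)
    qed
    also have "\<dots> = 2" by simp
    finally show ?thesis .
  qed
  have "(\<integral>\<^sup>+x\<in>cube. (\<integral>\<^sup>+t\<in>{-1<..<1}. F (upd i t x) \<partial>lborel) \<partial>lborel)
      = (\<integral>\<^sup>+x. (\<integral>\<^sup>+s. G (x + s *\<^sub>R e) * indicator cube x \<partial>lborel) \<partial>lborel)"
  proof (rule nn_integral_cong)
    fix x :: "real^'n"
    show "(\<integral>\<^sup>+t\<in>{-1<..<1}. F (upd i t x) \<partial>lborel) * indicator cube x = (\<integral>\<^sup>+s. G (x + s *\<^sub>R e) * indicator cube x \<partial>lborel)"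
      using slice[of x] by (cases "x \<in> cube") auto
  qed
  also have "\<dots> = (\<integral>\<^sup>+s. (\<integral>\<^sup>+x. G (x + s *\<^sub>R e) * indicator cube x \<partial>lborel) \<partial>lborel)"
    by (rule lborel_pair.Fubini'[of "\<lambda>x s. G (x + s *\<^sub>R e) * indicator cube x", symmetric]) measurable
  also have "\<dots> = (\<integral>\<^sup>+s. (\<integral>\<^sup>+x. G x * indicator cube (x + - (s *\<^sub>R e)) \<partial>lborel) \<partial>lborel)"
  proof (rule nn_integral_cong)
    fix s :: real
    show "(\<integral>\<^sup>+x. G (x + s *\<^sub>R e) * indicator cube x \<partial>lborel) = (\<integral>\<^sup>+x. G x * indicator cube (x + - (s *\<^sub>R e)) \<partial>lborel)"
      using lborel_nn_integral_shift[of "\<lambda>x. G x * indicator cube (x + - (s *\<^sub>R e))" "s *\<^sub>R e"] by simp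
  qed
  also have "\<dots> = (\<integral>\<^sup>+x. (\<integral>\<^sup>+s. G x * indicator cube (x + - (s *\<^sub>R e)) \<partial>lborel) \<partial>lborel)"
    by (rule lborel_pair.Fubini'[of "\<lambda>x s. G x * indicator cube (x + - (s *\<^sub>R e))"]) measurable
  also have "\<dots> = (\<integral>\<^sup>+x. 2 * G x \<partial>lborel)"
  proof (rule nn_integral_cong)
    fix x :: "real^'n"
    have "(\<integral>\<^sup>+s. G x * indicator cube (x + - (s *\<^sub>R e)) \<partial>lborel) = G x * (\<integral>\<^sup>+s. indicator cube (x + - (s *\<^sub>R e)) \<partial>lborel)"
      by (rule nn_integral_cmult) measurable
    also have "\<dots> = 2 * G x" using len[of x] by (cases "x \<in> cube") (auto simp: G_def mult.commute)
    finally show "(\<integral>\<^sup>+s. G x * indicator cube (x + - (s *\<^sub>R e)) \<partial>lborel) = 2 * G x" .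
  qed
  also have "\<dots> = 2 * (\<integral>\<^sup>+x\<in>cube. F x \<partial>lborel)"
    unfolding G_def by (rule nn_integral_cmult) measurable
  finally show ?thesis ..
qed

lemma nn_integral_cube_slice_le:
  fixes F :: "real^'n::finite \<Rightarrow> ennreal"
  assumes F: "F \<in> borel_measurable borel"
    and le: "\<And>x. x \<in> cube \<Longrightarrow> (\<integral>\<^sup>+t\<in>{-1<..<1}. F (upd i t x) \<partial>lborel) \<le> G x"
  shows "(\<integral>\<^sup>+x\<in>cube. F x \<partial>lborel) \<le> (\<integral>\<^sup>+x\<in>cube. G x \<partial>lborel)"
proof -
  have "(\<integral>\<^sup>+x\<in>cube. F x \<partial>lborel) \<le> 2 * (\<integral>\<^sup>+x\<in>cube. F x \<partial>lborel)"
    using mult_right_mono[of "1::ennreal" 2 "\<integral>\<^sup>+x\<in>cube. F x \<partial>lborel"] by simp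
  also have "\<dots> \<le> (\<integral>\<^sup>+x\<in>cube. G x \<partial>lborel)"
    unfolding nn_integral_cube_slice[OF F, of i]
    by (intro nn_integral_mono) (use le in \<open>auto simp: indicator_def\<close>)
  finally show ?thesis .
qed

section \<open>Weak gradients\<close>

lemma integrable_on_cube_bounded:
  fixes f :: "real^'n::finite \<Rightarrow> 'b::euclidean_space"
  assumes "f \<in> borel_measurable (lebesgue_on cube)" "\<And>x. x \<in> cube \<Longrightarrow> norm (f x) \<le> B"
  shows "integrable (lebesgue_on cube) f"
proof (rule finite_measure.integrable_const_bound)
  show "finite_measure (lebesgue_on (cube :: (real^'n) set))"
    using emeasure_cube_finite[where 'n='n]
    by (intro finite_measureI) (simp add: emeasure_restrict_space)
  show "AE x in lebesgue_on cube. norm (f x) \<le> B"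
    using assms(2) by (auto simp: AE_restrict_space_iff)
qed (rule assms(1))

lemma borel_lebesgue_on:
  fixes f :: "real^'n::finite \<Rightarrow> 'b::euclidean_space"
  shows "f \<in> borel_measurable borel \<Longrightarrow> f \<in> borel_measurable (lebesgue_on \<Omega>)"
  by (rule measurable_restrict_space1) (simp add: measurable_completion)

lemma continuous_bounded_cube:
  fixes f :: "real^'n::finite \<Rightarrow> 'b::real_normed_vector"
  assumes "continuous_on UNIV f"
  obtains B where "\<And>x. x \<in> cube \<Longrightarrow> norm (f x) \<le> B"
proof -
  have "compact (f ` closure cube)"
    using bounded_cube assms by (intro compact_continuous_image) (auto simp: compact_closure intro: continuous_on_subset)
  then obtain b where "\<forall>x\<in>f ` closure cube. norm x \<le> b"
    using compact_imp_bounded bounded_iff by metis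
  then show ?thesis using closure_subset[of cube] by (intro that[of b]) auto
qed

lemma integrable_on_cube_continuous:
  fixes f :: "real^'n::finite \<Rightarrow> real"
  assumes "continuous_on UNIV f"
  shows "integrable (lebesgue_on cube) f"
  using continuous_bounded_cube[OF assms] integrable_on_cube_bounded[OF borel_lebesgue_on[OF continuous_borel[OF assms]]]
  by metis

lemma integrable_imp_locally_integrable:
  fixes f :: "real^'n::finite \<Rightarrow> 'b::euclidean_space"
  assumes "integrable (lebesgue_on \<Omega>) f" "\<Omega> \<in> sets borel"
  shows "locally_integrable \<Omega> f"
  unfolding locally_integrable_def
proof (intro allI impI)
  fix K assume K: "compact K \<and> K \<subseteq> \<Omega>"
  then have "K \<in> sets lebesgue" by (simp add: compact_imp_closed borel_closed)
  moreover have "\<Omega> \<in> sets lebesgue" using assms(2) by simp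
  moreover have "set_integrable lebesgue \<Omega> f"
    using assms by (simp add: set_integrable_def integrable_restrict_space)
  ultimately have "set_integrable lebesgue K f" using K by (intro set_integrable_subset[of lebesgue \<Omega> f K]) auto
  then show "integrable (lebesgue_on K) f"
    using \<open>K \<in> sets lebesgue\<close> by (simp add: set_integrable_def integrable_restrict_space)
qed

lemma measurable_vec_components:
  fixes V :: "'a \<Rightarrow> real^'n::finite"
  assumes "\<And>i. (\<lambda>x. V x $ i) \<in> borel_measurable M"
  shows "V \<in> borel_measurable M"
  unfolding borel_measurable_euclidean_space[of V]
  using assms by (auto simp: Basis_vec_def inner_axis)

lemma grad_nth: "grad f x $ i = partial i f x" by (simp add: grad_def)

lemma continuous_grad: "f \<in> C_on 1 UNIV \<Longrightarrow> continuous_on UNIV (grad f)"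
  unfolding grad_def using C_on_partial[of f 0] by (intro continuous_on_vec_lambda) (auto simp: C_on_0)

lemma weak_gradient_C1:
  fixes w :: "real^'n::finite \<Rightarrow> real"
  assumes w: "w \<in> C_on 1 UNIV"
  shows "is_weak_gradient cube w (grad w)"
proof -
  have 1: "integrable (lebesgue_on cube) w" by (rule integrable_on_cube_continuous[OF C_on_continuous[OF w]])
  have gc: "continuous_on UNIV (grad w)" by (rule continuous_grad[OF w])
  obtain B where "\<And>x. x \<in> cube \<Longrightarrow> norm (grad w x) \<le> B" using continuous_bounded_cube[OF gc] by blast
  then have 2: "integrable (lebesgue_on cube) (grad w)"
    by (rule integrable_on_cube_bounded[OF borel_lebesgue_on[OF borel_measurable_continuous_onI[OF gc]]])
  show ?thesis
    unfolding is_weak_gradient_def grad_nth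
    using integrable_imp_locally_integrable[OF 1 cube_sets] integrable_imp_locally_integrable[OF 2 cube_sets]
      integration_by_parts[OF w] by blast
qed

lemma locally_integrable_test:
  fixes f :: "real^'n::finite \<Rightarrow> real"
  assumes f: "locally_integrable cube f" and K: "compact K" "K \<subseteq> cube" and z: "continuous_on UNIV \<zeta>"
     "\<And>x. x \<notin> K \<Longrightarrow> \<zeta> x = 0"
  shows "integrable (lebesgue_on cube) (\<lambda>x. f x * \<zeta> x)"
proof -
  have Ks: "K \<in> sets lebesgue" using K by (simp add: compact_imp_closed borel_closed)
  have "integrable (lebesgue_on K) f" using f K by (auto simp: locally_integrable_def)
  then have i: "integrable lebesgue (\<lambda>x. indicator K x * f x)"
    using Ks by (simp add: integrable_restrict_space)
  have zb: "\<zeta> \<in> borel_measurable lebesgue" using continuous_borel[OF z(1)] by (simp add: measurable_completion)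
  obtain B where B: "\<And>x. x \<in> cube \<Longrightarrow> norm (\<zeta> x) \<le> B" using continuous_bounded_cube[OF z(1)] by blast
  have B': "\<bar>\<zeta> x\<bar> \<le> \<bar>B\<bar>" for x
    using B[of x] z(2)[of x] K by (cases "x \<in> K") auto
  have "integrable lebesgue (\<lambda>x. (indicator K x * f x) * \<zeta> x)"
  proof (rule Bochner_Integration.integrable_bound[OF integrable_mult_right[OF i, of B]])
    show "(\<lambda>x. indicator K x * f x * \<zeta> x) \<in> borel_measurable lebesgue"
      using borel_measurable_integrable[OF i] zb by measurable
    show "AE x in lebesgue. norm (indicat_real K x * f x * \<zeta> x) \<le> norm (B * (indicat_real K x * f x))"
    proof (intro always_eventually allI)
      fix x
      have "\<bar>indicat_real K x * f x\<bar> * \<bar>\<zeta> x\<bar> \<le> \<bar>indicat_real K x * f x\<bar> * \<bar>B\<bar>"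
        by (rule mult_left_mono[OF B']) simp
      then show "norm (indicat_real K x * f x * \<zeta> x) \<le> norm (B * (indicat_real K x * f x))"
        by (simp add: abs_mult mult_ac)
    qed
  qed
  moreover have "(\<lambda>x. (indicator K x * f x) * \<zeta> x) = (\<lambda>x. indicator cube x *\<^sub>R (f x * \<zeta> x))"
    using K z(2) by (intro ext) (auto split: split_indicator)
  ultimately have "integrable lebesgue (\<lambda>x. indicator cube x *\<^sub>R (f x * \<zeta> x))" by simp
  then show ?thesis by (simp add: integrable_restrict_space)
qed

lemma integrable_test:
  fixes f :: "real^'n::finite \<Rightarrow> real"
  assumes f: "locally_integrable cube f" and z: "\<zeta> \<in> test_functions cube"
  shows "integrable (lebesgue_on cube) (\<lambda>x. f x * \<zeta> x)" "integrable (lebesgue_on cube) (\<lambda>x. f x * partial i \<zeta> x)"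
proof -
  obtain K where K: "compact K" "K \<subseteq> cube" "\<And>x. x \<notin> K \<Longrightarrow> \<zeta> x = 0" "\<And>x i. x \<notin> K \<Longrightarrow> partial i \<zeta> x = 0"
    using test_support[OF z] by metis
  show "integrable (lebesgue_on cube) (\<lambda>x. f x * \<zeta> x)"
    by (rule locally_integrable_test[OF f K(1,2) C_on_continuous[OF test_C[OF z, of 0]] K(3)])
  show "integrable (lebesgue_on cube) (\<lambda>x. f x * partial i \<zeta> x)"
    by (rule locally_integrable_test[OF f K(1,2) C_on_continuous[OF C_on_partial[OF test_C[OF z, of "Suc 0"]]] K(4)])
qed

lemma locally_integrable_nth:
  fixes V :: "real^'n::finite \<Rightarrow> real^'n"
  assumes "locally_integrable \<Omega> V" shows "locally_integrable \<Omega> (\<lambda>x. V x $ i)"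
  using assms unfolding locally_integrable_def
  by (auto intro!: integrable_bounded_linear[OF bounded_linear_vec_nth])

lemma locally_integrable_lin:
  fixes u v :: "real^'n::finite \<Rightarrow> 'b::euclidean_space"
  assumes "locally_integrable \<Omega> u" "locally_integrable \<Omega> v"
  shows "locally_integrable \<Omega> (\<lambda>x. a *\<^sub>R u x + b *\<^sub>R v x)"
  using assms unfolding locally_integrable_def by auto

lemma weak_gradient_lin:
  fixes u v :: "real^'n::finite \<Rightarrow> real"
  assumes u: "is_weak_gradient cube u U" and v: "is_weak_gradient cube v V"
  shows "is_weak_gradient cube (\<lambda>x. a * u x + b * v x) (\<lambda>x. a *\<^sub>R U x + b *\<^sub>R V x)"
proof -
  have l: "locally_integrable cube u" "locally_integrable cube U" "locally_integrable cube v" "locally_integrable cube V"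
    and eq: "\<And>\<phi> i. \<phi> \<in> test_functions cube \<Longrightarrow> (LINT x|lebesgue_on cube. u x * partial i \<phi> x) = - (LINT x|lebesgue_on cube. U x $ i * \<phi> x)"
      "\<And>\<phi> i. \<phi> \<in> test_functions cube \<Longrightarrow> (LINT x|lebesgue_on cube. v x * partial i \<phi> x) = - (LINT x|lebesgue_on cube. V x $ i * \<phi> x)"
    using u v by (auto simp: is_weak_gradient_def)
  have "(LINT x|lebesgue_on cube. (a * u x + b * v x) * partial i \<phi> x)
     = - (LINT x|lebesgue_on cube. (a *\<^sub>R U x + b *\<^sub>R V x) $ i * \<phi> x)" if \<phi>: "\<phi> \<in> test_functions cube" for \<phi> i
  proof -
    note i = integrable_test[OF _ \<phi>]
    have "(LINT x|lebesgue_on cube. (a * u x + b * v x) * partial i \<phi> x)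
      = (LINT x|lebesgue_on cube. a * (u x * partial i \<phi> x) + b * (v x * partial i \<phi> x))"
      by (simp add: algebra_simps)
    also have "\<dots> = a * (LINT x|lebesgue_on cube. u x * partial i \<phi> x) + b * (LINT x|lebesgue_on cube. v x * partial i \<phi> x)"
      using i(2)[OF l(1), of i] i(2)[OF l(3), of i] by simp
    also have "\<dots> = - (a * (LINT x|lebesgue_on cube. U x $ i * \<phi> x) + b * (LINT x|lebesgue_on cube. V x $ i * \<phi> x))"
      by (simp add: eq[OF \<phi>])
    also have "\<dots> = - (LINT x|lebesgue_on cube. a * (U x $ i * \<phi> x) + b * (V x $ i * \<phi> x))"
      using i(1)[OF locally_integrable_nth[OF l(2)], of i] i(1)[OF locally_integrable_nth[OF l(4)], of i] by simp
    also have "\<dots> = - (LINT x|lebesgue_on cube. (a *\<^sub>R U x + b *\<^sub>R V x) $ i * \<phi> x)"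
      by (simp add: algebra_simps)
    finally show ?thesis .
  qed
  with locally_integrable_lin[OF l(1,3), of a b] locally_integrable_lin[OF l(2,4), of a b]
  show ?thesis by (simp add: is_weak_gradient_def)
qed

lemma LINT_test_limit:
  fixes u :: "real^'n::finite \<Rightarrow> real"
  assumes um: "\<And>m. integrable (lebesgue_on cube) (um m)" and u: "integrable (lebesgue_on cube) u"
    and lim: "(\<lambda>m. LINT x|lebesgue_on cube. \<bar>um m x - u x\<bar>) \<longlonglongrightarrow> 0"
    and z: "continuous_on UNIV \<zeta>"
  shows "(\<lambda>m. LINT x|lebesgue_on cube. um m x * \<zeta> x) \<longlonglongrightarrow> (LINT x|lebesgue_on cube. u x * \<zeta> x)"
proof -
  obtain B where B: "\<And>x. x \<in> cube \<Longrightarrow> norm (\<zeta> x) \<le> B" using continuous_bounded_cube[OF z] by blast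
  have zb: "\<zeta> \<in> borel_measurable (lebesgue_on cube)" by (rule borel_lebesgue_on[OF continuous_borel[OF z]])
  have int: "integrable (lebesgue_on cube) (\<lambda>x. f x * \<zeta> x)" if f: "integrable (lebesgue_on cube) f" for f :: "real^'n \<Rightarrow> real"
  proof (rule Bochner_Integration.integrable_bound[OF integrable_mult_right[OF f, of B]])
    show "(\<lambda>x. f x * \<zeta> x) \<in> borel_measurable (lebesgue_on cube)"
      using borel_measurable_integrable[OF f] zb by measurable
    show "AE x in lebesgue_on cube. norm (f x * \<zeta> x) \<le> norm (B * f x)"
    proof (rule AE_I2)
      fix x :: "real^'n" assume "x \<in> space (lebesgue_on cube)"
      then have "\<bar>f x\<bar> * \<bar>\<zeta> x\<bar> \<le> \<bar>f x\<bar> * \<bar>B\<bar>" using B[of x] by (intro mult_left_mono) auto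
      then show "norm (f x * \<zeta> x) \<le> norm (B * f x)" by (simp add: abs_mult mult_ac)
    qed
  qed
  have "(\<lambda>m. (LINT x|lebesgue_on cube. um m x * \<zeta> x) - (LINT x|lebesgue_on cube. u x * \<zeta> x)) \<longlonglongrightarrow> 0"
  proof (rule Lim_null_comparison)
    show "\<forall>\<^sub>F m in sequentially. norm ((LINT x|lebesgue_on cube. um m x * \<zeta> x) - (LINT x|lebesgue_on cube. u x * \<zeta> x))
       \<le> \<bar>B\<bar> * (LINT x|lebesgue_on cube. \<bar>um m x - u x\<bar>)"
    proof (intro always_eventually allI)
      fix m
      have d: "integrable (lebesgue_on cube) (\<lambda>x. um m x - u x)" using um u by simp
      have "(LINT x|lebesgue_on cube. um m x * \<zeta> x) - (LINT x|lebesgue_on cube. u x * \<zeta> x)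
        = (LINT x|lebesgue_on cube. (um m x - u x) * \<zeta> x)"
        using int[OF um] int[OF u] by (simp add: left_diff_distrib)
      also have "norm \<dots> \<le> (LINT x|lebesgue_on cube. norm ((um m x - u x) * \<zeta> x))" by (rule integral_norm_bound)
      also have "\<dots> \<le> (LINT x|lebesgue_on cube. \<bar>B\<bar> * \<bar>um m x - u x\<bar>)"
      proof (rule integral_mono)
        show "integrable (lebesgue_on cube) (\<lambda>x. norm ((um m x - u x) * \<zeta> x))" using int[OF d] by (rule integrable_norm)
        show "integrable (lebesgue_on cube) (\<lambda>x. \<bar>B\<bar> * \<bar>um m x - u x\<bar>)" using d by (intro integrable_mult_right integrable_abs)
        fix x :: "real^'n" assume "x \<in> space (lebesgue_on cube)"
        then have "\<bar>um m x - u x\<bar> * \<bar>\<zeta> x\<bar> \<le> \<bar>um m x - u x\<bar> * \<bar>B\<bar>" using B[of x] by (intro mult_left_mono) auto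
        then show "norm ((um m x - u x) * \<zeta> x) \<le> \<bar>B\<bar> * \<bar>um m x - u x\<bar>" by (simp add: abs_mult mult_ac)
      qed
      finally show "norm ((LINT x|lebesgue_on cube. um m x * \<zeta> x) - (LINT x|lebesgue_on cube. u x * \<zeta> x))
       \<le> \<bar>B\<bar> * (LINT x|lebesgue_on cube. \<bar>um m x - u x\<bar>)" by simp
    qed
    show "(\<lambda>m. \<bar>B\<bar> * (LINT x|lebesgue_on cube. \<bar>um m x - u x\<bar>)) \<longlonglongrightarrow> 0"
      using tendsto_mult_right_zero[OF lim] .
  qed
  then show ?thesis by (rule LIM_zero_cancel)
qed

text \<open>Smooth functions satisfy the defining identity by integration by parts, and both of its sides are continuous with respect to
\<open>L\<^sup>1\<close> convergence.\<close>

lemma weak_gradient_limit: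
  fixes u :: "real^'n::finite \<Rightarrow> real"
  assumes um: "\<And>m. um m \<in> C_on 1 UNIV" and u: "integrable (lebesgue_on cube) u" and V: "integrable (lebesgue_on cube) V"
    and lim: "(\<lambda>m. LINT x|lebesgue_on cube. \<bar>um m x - u x\<bar>) \<longlonglongrightarrow> 0"
      "(\<lambda>m. LINT x|lebesgue_on cube. norm (grad (um m) x - V x)) \<longlonglongrightarrow> 0"
  shows "is_weak_gradient cube u V"
  unfolding is_weak_gradient_def
proof (intro conjI ballI allI)
  show "locally_integrable cube u" "locally_integrable cube V"
    using integrable_imp_locally_integrable[OF u cube_sets] integrable_imp_locally_integrable[OF V cube_sets] by auto
  fix \<phi> :: "real^'n \<Rightarrow> real" and i :: 'n assume \<phi>: "\<phi> \<in> test_functions cube"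
  have c: "continuous_on UNIV \<phi>" "continuous_on UNIV (partial i \<phi>)"
    using C_on_continuous[OF test_C[OF \<phi>, of 0]] C_on_continuous[OF C_on_partial[OF test_C[OF \<phi>, of "Suc 0"]]] by auto
  have pi: "integrable (lebesgue_on cube) (partial i (um m))" for m
    using um[of m] C_on_partial[of "um m" 0 i] by (intro integrable_on_cube_continuous) (simp add: C_on_0)
  have gi: "integrable (lebesgue_on cube) (grad (um m))" for m
  proof -
    have gc: "continuous_on UNIV (grad (um m))" by (rule continuous_grad[OF um])
    obtain B where "\<And>x. x \<in> cube \<Longrightarrow> norm (grad (um m) x) \<le> B" using continuous_bounded_cube[OF gc] by blast
    then show ?thesis
      by (rule integrable_on_cube_bounded[OF borel_lebesgue_on[OF borel_measurable_continuous_onI[OF gc]]])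
  qed
  have Vi: "integrable (lebesgue_on cube) (\<lambda>x. V x $ i)"
    using V by (rule integrable_bounded_linear[OF bounded_linear_vec_nth])
  have "(\<lambda>m. LINT x|lebesgue_on cube. \<bar>partial i (um m) x - V x $ i\<bar>) \<longlonglongrightarrow> 0"
  proof (rule tendsto_sandwich[OF _ _ tendsto_const lim(2)])
    show "\<forall>\<^sub>F m in sequentially. 0 \<le> (LINT x|lebesgue_on cube. \<bar>partial i (um m) x - V x $ i\<bar>)" by simp
    show "\<forall>\<^sub>F m in sequentially. (LINT x|lebesgue_on cube. \<bar>partial i (um m) x - V x $ i\<bar>)
        \<le> (LINT x|lebesgue_on cube. norm (grad (um m) x - V x))"
    proof (intro always_eventually allI integral_mono)
      fix m and x :: "real^'n"
      show "integrable (lebesgue_on cube) (\<lambda>x. \<bar>partial i (um m) x - V x $ i\<bar>)" using pi Vi by simp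
      show "integrable (lebesgue_on cube) (\<lambda>x. norm (grad (um m) x - V x))"
        using gi V by (intro integrable_norm Bochner_Integration.integrable_diff)
      show "\<bar>partial i (um m) x - V x $ i\<bar> \<le> norm (grad (um m) x - V x)"
        using component_le_norm_cart[of "grad (um m) x - V x" i] by (simp add: grad_nth)
    qed
  qed
  from LINT_test_limit[OF pi Vi this c(1)]
  have 1: "(\<lambda>m. LINT x|lebesgue_on cube. partial i (um m) x * \<phi> x) \<longlonglongrightarrow> (LINT x|lebesgue_on cube. V x $ i * \<phi> x)" .
  have "(\<lambda>m. LINT x|lebesgue_on cube. um m x * partial i \<phi> x) \<longlonglongrightarrow> (LINT x|lebesgue_on cube. u x * partial i \<phi> x)"
    by (rule LINT_test_limit[OF integrable_on_cube_continuous[OF C_on_continuous[OF um]] u lim(1) c(2)])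
  then have "(\<lambda>m. - (LINT x|lebesgue_on cube. partial i (um m) x * \<phi> x)) \<longlonglongrightarrow> (LINT x|lebesgue_on cube. u x * partial i \<phi> x)"
    unfolding integration_by_parts[OF um \<phi>] .
  from LIMSEQ_unique[OF this tendsto_minus[OF 1]]
  show "(LINT x|lebesgue_on cube. u x * partial i \<phi> x) = - (LINT x|lebesgue_on cube. V x $ i * \<phi> x)" .
qed

section \<open>Uniqueness of weak gradients\<close>

text \<open>Since \<open>ramp (m y) = ramp y powr (1 / m)\<close>, these test functions increase to the indicator of the open box.\<close>

definition box_bump :: "real^'n::finite \<Rightarrow> real^'n \<Rightarrow> nat \<Rightarrow> real^'n \<Rightarrow> real" where
  "box_bump l u m x = (\<Prod>i\<in>UNIV. ramp (real (Suc m) * ((x $ i - l $ i) * (u $ i - x $ i))))"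

lemma box_bump_outside:
  assumes lu: "\<And>i. l $ i < u $ i" and "x \<notin> cbox l u"
  shows "box_bump l u m x = 0"
proof -
  obtain i where "\<not> (l $ i \<le> x $ i \<and> x $ i \<le> u $ i)" using assms(2) by (auto simp: mem_box_cart)
  then have "(x $ i - l $ i) * (u $ i - x $ i) \<le> 0"
    using lu[of i] unfolding mult_le_0_iff by linarith
  then have "ramp (real (Suc m) * ((x $ i - l $ i) * (u $ i - x $ i))) = 0"
    by (auto intro!: ramp_zero mult_nonneg_nonpos[of "real (Suc m)"] simp del: of_nat_Suc)
  then show ?thesis unfolding box_bump_def by (intro prod_zero) auto
qed

lemma box_bump_test:
  assumes lu: "\<And>i. l $ i < u $ i" and sub: "cbox l u \<subseteq> cube"
  shows "box_bump l u m \<in> test_functions cube"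
proof -
  have "box_bump l u m \<in> C_on k UNIV" for k
    unfolding box_bump_def[abs_def]
    by (intro C_on_prod C_on_compose[OF Ck_ramp] C_on_cmult C_on_mult C_on_diff C_on_coord C_on_const) auto
  then show ?thesis using sub box_bump_outside[OF lu] unfolding test_functions_def
    by (auto intro!: exI[of _ "cbox l u"])
qed

lemma box_bump_le: "\<bar>box_bump l u m x\<bar> \<le> 1"
  unfolding box_bump_def abs_prod by (intro prod_le_1) (auto simp: ramp_nonneg ramp_le_1)

lemma box_bump_tendsto:
  assumes lu: "\<And>i. l $ i < u $ i"
  shows "(\<lambda>m. box_bump l u m x) \<longlonglongrightarrow> indicator (box l u) x"
proof -
  have "(\<lambda>m. ramp (real (Suc m) * ((x $ i - l $ i) * (u $ i - x $ i)))) \<longlonglongrightarrow> of_bool (l $ i < x $ i \<and> x $ i < u $ i)" for i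
  proof (cases "l $ i < x $ i \<and> x $ i < u $ i")
    case True
    define y where "y = (x $ i - l $ i) * (u $ i - x $ i)"
    have y: "y > 0" using True by (simp add: y_def)
    have "(\<lambda>m. (- 1 / y) * inverse (real (Suc m))) \<longlonglongrightarrow> (- 1 / y) * 0"
      by (intro tendsto_mult tendsto_const LIMSEQ_inverse_real_of_nat)
    then have "(\<lambda>m. exp ((- 1 / y) * inverse (real (Suc m)))) \<longlonglongrightarrow> exp 0" by (intro tendsto_exp) simp
    moreover have "ramp (real (Suc m) * y) = exp ((- 1 / y) * inverse (real (Suc m)))" for m
    proof -
      have "real (Suc m) * y > 0" using y by (intro mult_pos_pos) auto
      then show ?thesis by (simp add: ramp_eq inverse_eq_divide mult.commute)
    qed
    ultimately show ?thesis using True by (simp add: y_def)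
  next
    case False
    then have "(x $ i - l $ i) * (u $ i - x $ i) \<le> 0"
      using lu[of i] unfolding mult_le_0_iff by linarith
    then have "ramp (real (Suc m) * ((x $ i - l $ i) * (u $ i - x $ i))) = 0" for m
      by (auto intro!: ramp_zero mult_nonneg_nonpos[of "real (Suc m)"] simp del: of_nat_Suc)
    then show ?thesis using False by auto
  qed
  then have "(\<lambda>m. box_bump l u m x) \<longlonglongrightarrow> (\<Prod>i\<in>UNIV. of_bool (l $ i < x $ i \<and> x $ i < u $ i))"
    unfolding box_bump_def by (intro tendsto_prod)
  also have "(\<Prod>i\<in>UNIV. of_bool (l $ i < x $ i \<and> x $ i < u $ i)) = (indicator (box l u) x :: real)"
    by (cases "x \<in> box l u") (auto simp: mem_box_cart intro!: prod_zero prod.neutral)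
  finally show ?thesis .
qed

text \<open>Boxes are stable under intersection and generate the Borel sets, so the integral of \<open>f\<close> vanishes over every Borel set.\<close>

lemma box_integrals_zero_imp_AE_zero:
  fixes f :: "'a::euclidean_space \<Rightarrow> real"
  assumes f: "integrable lborel f" and z: "\<And>l u. (LINT x|lborel. indicator (box l u) x * f x) = 0"
  shows "AE x in lborel. f x = 0"
proof (rule sigma_finite_measure.density_zero[OF sigma_finite_lborel f])
  have [measurable]: "f \<in> borel_measurable borel" using borel_measurable_integrable[OF f] by simp
  fix A :: "'a set" assume "A \<in> sets lborel"
  then have A: "A \<in> sigma_sets UNIV (range (\<lambda>(a, b). box a b))"
    by (simp add: borel_eq_box)
  have bs: "B \<in> sets borel" if "B \<in> sigma_sets UNIV (range (\<lambda>(a, b). box a b))" for B :: "'a set"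
    using that by (simp add: borel_eq_box)
  have int: "integrable lborel (\<lambda>x. indicator B x * f x)" if "B \<in> sets borel" for B
    using integrable_mult_indicator[of B lborel f] f that by simp
  have iUN: "(LINT x|lborel. f x) = 0"
  proof -
    have "(\<lambda>m. LINT x|lborel. indicator (box (- real m *\<^sub>R One) (real m *\<^sub>R One)) x * f x) \<longlonglongrightarrow> (LINT x|lborel. f x)"
    proof (rule integral_dominated_convergence[where w = "\<lambda>x. \<bar>f x\<bar>"])
      show "AE x in lborel. (\<lambda>m. indicat_real (box (- real m *\<^sub>R One) (real m *\<^sub>R One)) x * f x) \<longlonglongrightarrow> f x"
      proof (intro always_eventually allI)
        fix x :: 'a
        obtain M :: nat where M: "norm x < real M" using reals_Archimedean2 by blast
        have "\<forall>\<^sub>F m in sequentially. indicat_real (box (- real m *\<^sub>R One) (real m *\<^sub>R One)) x * f x = f x"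
          using eventually_ge_at_top[of M]
        proof eventually_elim
          case (elim m)
          have "x \<in> box (- real m *\<^sub>R One) (real m *\<^sub>R One)"
            unfolding mem_box
          proof
            fix b :: 'a assume b: "b \<in> Basis"
            have "\<bar>x \<bullet> b\<bar> < real m" using Basis_le_norm[OF b, of x] M elim by linarith
            then show "(- real m *\<^sub>R One) \<bullet> b < x \<bullet> b \<and> x \<bullet> b < (real m *\<^sub>R One) \<bullet> b" using b by (auto simp: inner_sum_left_Basis)
          qed
          then show ?case by simp
        qed
        then show "(\<lambda>m. indicat_real (box (- real m *\<^sub>R One) (real m *\<^sub>R One)) x * f x) \<longlonglongrightarrow> f x"
          by (rule tendsto_eventually)
      qed
    qed (use f in \<open>auto split: split_indicator\<close>)
    then show ?thesis unfolding z by (simp add: LIMSEQ_const_iff)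
  qed
  have "(LINT x|lborel. indicator A x * f x) = 0"
  proof (rule sigma_sets_induct_disjoint[OF _ _ A])
    show "Int_stable (range (\<lambda>(a, b). box a b :: 'a set))"
    proof (rule Int_stableI)
      fix A B :: "'a set" assume "A \<in> range (\<lambda>(a, b). box a b)" "B \<in> range (\<lambda>(a, b). box a b)"
      then obtain a b c d where "A = box a b" "B = box c d" by auto
      moreover obtain p r where "box a b \<inter> box c d = box p r" using box_Int_box[of a b c d] by blast
      ultimately show "A \<inter> B \<in> range (\<lambda>(a, b). box a b)"
        by (intro image_eqI[of _ _ "(p, r)"]) auto
    qed
    fix B :: "'a set" assume "B \<in> range (\<lambda>(a, b). box a b)"
    then show "(LINT x|lborel. indicator B x * f x) = 0" using z by auto
  next
    fix B assume B: "B \<in> sigma_sets UNIV (range (\<lambda>(a, b). box a b :: 'a set))" and "(LINT x|lborel. indicator B x * f x) = 0"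
    moreover have "(LINT x|lborel. indicator (UNIV - B) x * f x) = (LINT x|lborel. f x - indicator B x * f x)"
      by (rule Bochner_Integration.integral_cong) (auto split: split_indicator)
    ultimately show "(LINT x|lborel. indicator (UNIV - B) x * f x) = 0" using f int[OF bs[OF B]] iUN by simp
  next
    fix B :: "nat \<Rightarrow> 'a set" assume d: "disjoint_family B" and r: "range B \<subseteq> sigma_sets UNIV (range (\<lambda>(a, b). box a b))"
      and 0: "\<And>i. (LINT x|lborel. indicator (B i) x * f x) = 0"
    have Bs: "B i \<in> sets lborel" for i using r bs by auto
    have "set_integrable lborel (\<Union>i. B i) f" unfolding set_integrable_def using int[of "\<Union>i. B i"] Bs by simp
    from lebesgue_integral_countable_add[OF Bs _ this]
    have "set_lebesgue_integral lborel (\<Union>i. B i) f = (\<Sum>i. set_lebesgue_integral lborel (B i) f)"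
      using d by (auto simp: disjoint_family_on_def)
    then show "(LINT x|lborel. indicator (\<Union> (range B)) x * f x) = 0"
      by (simp add: set_lebesgue_integral_def 0)
  qed auto
  then show "set_lebesgue_integral lborel A f = 0" by (simp add: set_lebesgue_integral_def)
qed

text \<open>Fundamental lemma of the calculus of variations. On each smaller cube \<open>B m\<close> the function is integrable, and testing with
\<open>box_bump\<close> gives vanishing integrals over all boxes inside.\<close>

lemma test_integrals_zero_imp_AE_zero:
  fixes f :: "real^'n::finite \<Rightarrow> real"
  assumes f: "locally_integrable cube f"
    and z: "\<And>\<phi>. \<phi> \<in> test_functions cube \<Longrightarrow> (LINT x|lebesgue_on cube. f x * \<phi> x) = 0"
  shows "AE x in lebesgue_on cube. f x = 0"
proof -
  define B :: "nat \<Rightarrow> (real^'n) set" where "B m = box (\<chi> i. - (1 - 1 / real (Suc m))) (\<chi> i. 1 - 1 / real (Suc m))" for m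
  have sub: "cbox (\<chi> i. - (1 - 1 / real (Suc m))) (\<chi> i. 1 - 1 / real (Suc m)) \<subseteq> (cube :: (real^'n) set)" for m
  proof
    fix x :: "real^'n" assume x: "x \<in> cbox (\<chi> i. - (1 - 1 / real (Suc m))) (\<chi> i. 1 - 1 / real (Suc m))"
    have p: "0 < 1 / real (Suc m)" by simp
    have "-1 < x $ i \<and> x $ i < 1" for i
    proof -
      have "- (1 - 1 / real (Suc m)) \<le> x $ i \<and> x $ i \<le> 1 - 1 / real (Suc m)"
        using x by (simp add: mem_box_cart)
      with p show ?thesis by linarith
    qed
    then show "x \<in> cube" by (simp add: cube_def)
  qed
  have "AE x in lborel. x \<in> B m \<longrightarrow> f x = 0" for m
  proof -
    define C :: "(real^'n) set" where "C = cbox (\<chi> i. - (1 - 1 / real (Suc m))) (\<chi> i. 1 - 1 / real (Suc m))"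
    have C: "compact C" "C \<subseteq> cube" "B m \<subseteq> C" "C \<in> sets lebesgue" "B m \<in> sets lebesgue"
      using sub[of m] box_subset_cbox by (auto simp: C_def B_def)
    have fC: "integrable lebesgue (\<lambda>x. indicator C x * f x)"
      using f C by (auto simp: locally_integrable_def integrable_restrict_space)
    have fB: "integrable lebesgue (\<lambda>x. indicator (B m) x * f x)"
    proof -
      have "integrable lebesgue (\<lambda>x. indicator (B m) x *\<^sub>R (indicator C x * f x))"
        by (rule integrable_mult_indicator[OF C(5) fC])
      moreover have "(\<lambda>x. indicator (B m) x *\<^sub>R (indicator C x * f x)) = (\<lambda>x. indicator (B m) x * f x)"
        using C(3) by (intro ext) (auto split: split_indicator)
      ultimately show ?thesis by simp
    qed
    obtain h where h: "h \<in> borel_measurable lborel" "AE x in lborel. indicator (B m) x * f x = h x"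
      using completion_ex_borel_measurable_real[of "\<lambda>x. indicator (B m) x * f x" lborel] borel_measurable_integrable[OF fB]
      by auto
    have hb [measurable]: "h \<in> borel_measurable borel" using h(1) by simp
    have ae: "AE x in lebesgue. indicator (B m) x * f x = h x" using h(2) by (rule AE_completion)
    have "integrable lebesgue h"
      by (rule integrable_cong_AE_imp[OF fB _ ae]) (simp add: measurable_completion)
    then have hi: "integrable lborel h" by (simp add: integrable_completion)
    have "(LINT x|lborel. indicator (box l u) x * h x) = 0" for l u
    proof -
      have *: "(LINT x|lborel. indicator (box l u) x * h x) = (LINT x|lebesgue. indicator (box l u \<inter> B m) x * f x)"
      proof -
        have "(LINT x|lborel. indicator (box l u) x * h x) = (LINT x|lebesgue. indicator (box l u) x * h x)"
          by (rule integral_completion[symmetric]) measurable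
        also have "\<dots> = (LINT x|lebesgue. indicator (box l u) x * (indicator (B m) x * f x))"
        proof (rule integral_cong_AE)
          show "(\<lambda>x. indicator (box l u) x * h x) \<in> borel_measurable lebesgue"
            by (rule measurable_completion) measurable
          show "AE x in lebesgue. indicat_real (box l u) x * h x = indicat_real (box l u) x * (indicat_real (B m) x * f x)"
            using ae by eventually_elim simp
          show "(\<lambda>x. indicat_real (box l u) x * (indicat_real (B m) x * f x)) \<in> borel_measurable lebesgue"
            by (rule borel_measurable_times[OF _ borel_measurable_integrable[OF fB]])
               (rule measurable_completion, measurable)
        qed
        also have "(\<lambda>x. indicator (box l u) x * (indicator (B m) x * f x)) = (\<lambda>x. indicator (box l u \<inter> B m) x * f x)"
          by (auto split: split_indicator)
        finally show ?thesis .
      qed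
      obtain a b where ab: "box l u \<inter> B m = box a b" unfolding B_def using box_Int_box by blast
      show ?thesis
      proof (cases "box a b = {}")
        case True then show ?thesis unfolding * ab by simp
      next
        case False
        then obtain y where "y \<in> box a b" by blast
        then have lt: "a $ i < b $ i" for i unfolding mem_box_cart by (meson less_trans)
        have "cbox a b = closure (box a b)" by (rule closure_box[OF False, symmetric])
        also have "\<dots> \<subseteq> C"
          using ab C(3) compact_imp_closed[OF C(1)] by (intro closure_minimal) auto
        finally have abC: "cbox a b \<subseteq> C" .
        have t: "box_bump a b k \<in> test_functions cube" for k
          by (rule box_bump_test[OF lt]) (use abC C(2) in auto)
        have supp: "box_bump a b k x = 0" if "x \<notin> C" for k x
          using box_bump_outside[OF lt, of x k] that abC by blast
        have "(\<lambda>k. LINT x|lebesgue. indicator C x * f x * box_bump a b k x) \<longlonglongrightarrow> (LINT x|lebesgue. indicator C x * f x * indicator (box a b) x)"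
        proof (rule integral_dominated_convergence[where w = "\<lambda>x. \<bar>indicator C x * f x\<bar>"])
          show "AE x in lebesgue. (\<lambda>k. indicat_real C x * f x * box_bump a b k x) \<longlonglongrightarrow> indicat_real C x * f x * indicat_real (box a b) x"
            by (intro always_eventually allI tendsto_mult tendsto_const box_bump_tendsto lt)
          show "AE x in lebesgue. norm (indicat_real C x * f x * box_bump a b k x) \<le> \<bar>indicat_real C x * f x\<bar>" for k
          proof (intro always_eventually allI)
            fix x
            have "\<bar>indicat_real C x * f x\<bar> * \<bar>box_bump a b k x\<bar> \<le> \<bar>indicat_real C x * f x\<bar> * 1"
              by (intro mult_left_mono box_bump_le) auto
            then show "norm (indicat_real C x * f x * box_bump a b k x) \<le> \<bar>indicat_real C x * f x\<bar>" by (simp add: abs_mult)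
          qed
          have "box_bump a b k \<in> borel_measurable lebesgue" for k
            using continuous_borel[OF C_on_continuous[OF test_C[OF t[of k], of 0]]] by (simp add: measurable_completion)
          then show "(\<lambda>x. indicat_real C x * f x * box_bump a b k x) \<in> borel_measurable lebesgue" for k
            using borel_measurable_integrable[OF fC] by measurable
          show "(\<lambda>x. indicat_real C x * f x * indicat_real (box a b) x) \<in> borel_measurable lebesgue"
            by (rule borel_measurable_times[OF borel_measurable_integrable[OF fC]])
               (rule measurable_completion, measurable)
          show "integrable lebesgue (\<lambda>x. \<bar>indicator C x * f x\<bar>)" using fC by simp
        qed
        moreover have "(LINT x|lebesgue. indicator C x * f x * box_bump a b k x) = 0" for k
        proof -
          have "(LINT x|lebesgue_on cube. f x * box_bump a b k x) = (LINT x|lebesgue. indicator cube x *\<^sub>R (f x * box_bump a b k x))"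
            by (rule integral_restrict_space) simp
          also have "(\<lambda>x. indicator cube x *\<^sub>R (f x * box_bump a b k x)) = (\<lambda>x. indicator C x * f x * box_bump a b k x)"
            using supp C(2) by (intro ext) (auto split: split_indicator)
          finally show ?thesis using z[OF t] by simp
        qed
        ultimately have "(LINT x|lebesgue. indicator C x * f x * indicator (box a b) x) = 0"
          by (simp only: LIMSEQ_const_iff)
        moreover have "(\<lambda>x. indicator C x * f x * indicator (box a b) x) = (\<lambda>x. indicator (box a b) x * f x)"
          using ab C(3) by (intro ext) (auto split: split_indicator)
        ultimately show ?thesis unfolding * ab by simp
      qed
    qed
    from box_integrals_zero_imp_AE_zero[OF hi this] have "AE x in lborel. h x = 0" .
    with h(2) show ?thesis by eventually_elim (auto split: split_indicator_asm)
  qed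
  then have "AE x in lborel. \<forall>m. x \<in> B m \<longrightarrow> f x = 0" unfolding AE_all_countable by (rule allI)
  moreover have "\<exists>m. x \<in> B m" if "x \<in> cube" for x
  proof -
    define r where "r = Max (range (\<lambda>i. \<bar>x $ i\<bar>))"
    have "r < 1" unfolding r_def using that by (subst Max_less_iff) (auto simp: cube_def abs_less_iff minus_less_iff)
    then obtain m where m: "1 / real (Suc m) < 1 - r" using reals_Archimedean[of "1 - r"] by (auto simp: inverse_eq_divide)
    have "\<bar>x $ i\<bar> < 1 - 1 / real (Suc m)" for i
    proof -
      have "\<bar>x $ i\<bar> \<le> r" unfolding r_def by (intro Max_ge) auto
      with m show ?thesis by linarith
    qed
    then have "- (1 - 1 / real (Suc m)) < x $ i \<and> x $ i < 1 - 1 / real (Suc m)" for i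
      unfolding abs_less_iff by (smt (verit))
    then have "x \<in> B m" unfolding B_def mem_box_cart by simp
    then show ?thesis ..
  qed
  ultimately show ?thesis by (auto simp: AE_lebesgue_on_iff)
qed

lemma weak_gradient_unique:
  fixes u :: "real^'n::finite \<Rightarrow> real"
  assumes U: "is_weak_gradient cube u U" and V: "is_weak_gradient cube u V"
  shows "AE x in lebesgue_on cube. U x = V x"
proof -
  have lU: "locally_integrable cube U" and lV: "locally_integrable cube V" using U V by (auto simp: is_weak_gradient_def)
  have "AE x in lebesgue_on cube. U x $ i - V x $ i = 0" for i
  proof (rule test_integrals_zero_imp_AE_zero)
    show "locally_integrable cube (\<lambda>x. U x $ i - V x $ i)"
      using locally_integrable_nth[OF lU, of i] locally_integrable_nth[OF lV, of i] by (auto simp: locally_integrable_def)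
    fix \<phi> :: "real^'n \<Rightarrow> real" assume \<phi>: "\<phi> \<in> test_functions cube"
    have "(LINT x|lebesgue_on cube. U x $ i * \<phi> x) = (LINT x|lebesgue_on cube. V x $ i * \<phi> x)"
    proof -
      have "(LINT x|lebesgue_on cube. u x * partial i \<phi> x) = - (LINT x|lebesgue_on cube. U x $ i * \<phi> x)"
        using U \<phi> unfolding is_weak_gradient_def by blast
      moreover have "(LINT x|lebesgue_on cube. u x * partial i \<phi> x) = - (LINT x|lebesgue_on cube. V x $ i * \<phi> x)"
        using V \<phi> unfolding is_weak_gradient_def by blast
      ultimately show ?thesis by simp
    qed
    then show "(LINT x|lebesgue_on cube. (U x $ i - V x $ i) * \<phi> x) = 0"
      using integrable_test(1)[OF locally_integrable_nth[OF lU, of i] \<phi>] integrable_test(1)[OF locally_integrable_nth[OF lV, of i] \<phi>]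
      by (simp add: left_diff_distrib)
  qed
  then have "AE x in lebesgue_on cube. \<forall>i. U x $ i - V x $ i = 0" unfolding AE_all_countable by (rule allI)
  then show ?thesis by eventually_elim (simp add: vec_eq_iff)
qed

text \<open>The representative chosen by \<open>weak_grad\<close> may be replaced by any known weak gradient.\<close>

lemma weak_grad_AE:
  fixes u :: "real^'n::finite \<Rightarrow> real"
  assumes "is_weak_gradient cube u U"
  shows "AE x in lebesgue_on cube. weak_grad cube u x = U x"
  by (rule weak_gradient_unique[OF _ assms]) (unfold weak_grad_def, rule someI[of _ U], rule assms)

section \<open>A lacunary series that vanishes on a Cantor set\<close>

definition periodic_smooth :: "(real \<Rightarrow> real) \<Rightarrow> bool" where
  "periodic_smooth f \<longleftrightarrow> (\<forall>k. Ck k f) \<and> (\<forall>x. f (x + 1) = f x)"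

lemma periodic_add_nat: "(\<And>x::real. f (x + 1) = f x) \<Longrightarrow> f (x + of_nat m) = f x"
proof (induction m)
  case (Suc m)
  have "f (x + of_nat (Suc m)) = f ((x + of_nat m) + 1)" by (simp add: add_ac)
  then show ?case using Suc by simp
qed simp

lemma periodic_add_int: assumes "\<And>x::real. f (x + 1) = f x" shows "f (x + of_int m) = f x"
proof (cases "m \<ge> 0")
  case True
  then show ?thesis using periodic_add_nat[of f x "nat m", OF assms] by simp
next
  case False
  then show ?thesis using periodic_add_nat[of f "x + of_int m" "nat (- m)", OF assms] by simp
qed

lemma periodic_frac: assumes "\<And>x::real. f (x + 1) = f x" shows "f x = f (frac x)"
  using periodic_add_int[of f "frac x" "\<lfloor>x\<rfloor>", OF assms] by (simp add: frac_def)

lemma periodic_smooth_deriv: "periodic_smooth f \<Longrightarrow> periodic_smooth (deriv f)"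
proof -
  assume f: "periodic_smooth f"
  have "deriv f (x + 1) = deriv f x" for x
  proof -
    have "(f has_real_derivative deriv f (x + 1)) (at (x + 1))"
      using f Ck_has_deriv[of 0 f] by (auto simp: periodic_smooth_def)
    then have "((\<lambda>x. f (x + 1)) has_real_derivative deriv f (x + 1)) (at x)" by (simp add: DERIV_shift)
    moreover have "(\<lambda>x. f (x + 1)) = f" using f by (auto simp: periodic_smooth_def)
    ultimately show ?thesis using DERIV_imp_deriv by fastforce
  qed
  then show ?thesis using f Ck_deriv by (auto simp: periodic_smooth_def)
qed

lemma periodic_smooth_bounded: "periodic_smooth f \<Longrightarrow> \<exists>B\<ge>0. \<forall>x. \<bar>f x\<bar> \<le> B"
proof -
  assume f: "periodic_smooth f"
  have "continuous_on UNIV f" using f Ck_continuous by (auto simp: periodic_smooth_def)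
  then have "compact (f ` {0..1})" by (intro compact_continuous_image) (auto intro: continuous_on_subset)
  then obtain b where b: "\<forall>x\<in>f ` {0..1}. norm x \<le> b" using compact_imp_bounded bounded_iff by metis
  have "\<bar>f x\<bar> \<le> b" for x
  proof -
    have "frac x \<in> {0..1}" using frac_lt_1[of x] frac_ge_0[of x] by auto
    with b have "\<bar>f (frac x)\<bar> \<le> b" by auto
    then show ?thesis using periodic_frac[of f x] f by (simp add: periodic_smooth_def)
  qed
  moreover have "b \<ge> 0" using calculation[of 0] by linarith
  ultimately show ?thesis by blast
qed

lemma periodic_smooth_has_deriv: "periodic_smooth f \<Longrightarrow> (f has_real_derivative deriv f x) (at x)"
  using Ck_has_deriv[of 0 f] by (auto simp: periodic_smooth_def)

text \<open>Base \<open>N\<close> for digit expansions, and decay exponent \<open>M\<close> of the series. The Cantor set consists of the expansions that avoid the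
digits \<open>0, 1, N - 2, N - 1\<close>; as \<open>N\<close> grows its dimension \<open>ln (N - 4) / ln N\<close> tends to one.\<close>

locale digits =
  fixes N M :: nat
  assumes N: "8 \<le> N" and M: "2 \<le> M"
begin

lemma ratio: "0 < 1 / real N ^ p" "1 \<le> p \<Longrightarrow> 1 / real N ^ p \<le> 1 / 8"
proof -
  show "0 < 1 / real N ^ p" using N by simp
  assume "1 \<le> p"
  then have "real N ^ 1 \<le> real N ^ p" using N by (intro power_increasing) auto
  moreover have "8 \<le> real N ^ 1" using N by simp
  ultimately have "8 \<le> real N ^ p" by linarith
  then show "1 / real N ^ p \<le> 1 / 8" using N by (intro divide_left_mono) auto
qed

definition lacunary :: "nat \<Rightarrow> (real \<Rightarrow> real) \<Rightarrow> real \<Rightarrow> real" where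
  "lacunary p f x = (\<Sum>k. (1 / real N ^ p) ^ k * f (real N ^ k * x))"

lemma lacunary_terms:
  assumes "\<And>x. \<bar>f x\<bar> \<le> B" shows "norm ((1 / real N ^ p) ^ k * f (real N ^ k * x)) \<le> B * (1 / real N ^ p) ^ k"
  using assms mult_right_mono[OF assms, of "(1 / real N ^ p) ^ k" "real N ^ k * x"] by (simp add: abs_mult mult.commute)

lemma geo: "1 \<le> p \<Longrightarrow> summable (\<lambda>k. B * (1 / real N ^ p) ^ k)"
  using ratio[of p] by (intro summable_mult summable_geometric) auto

lemma lacunary_summable:
  assumes "\<And>x. \<bar>f x\<bar> \<le> B" "1 \<le> p" shows "summable (\<lambda>k. (1 / real N ^ p) ^ k * f (real N ^ k * x))"
  by (rule summable_comparison_test'[OF geo[OF assms(2)] lacunary_terms[OF assms(1)]])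

lemma lacunary_uniform:
  assumes "\<And>x. \<bar>f x\<bar> \<le> B" "1 \<le> p"
  shows "uniform_limit UNIV (\<lambda>n x. \<Sum>k<n. (1 / real N ^ p) ^ k * f (real N ^ k * x)) (lacunary p f) sequentially"
  unfolding lacunary_def[abs_def]
  by (rule Weierstrass_m_test[OF lacunary_terms[OF assms(1)] geo[OF assms(2)]])

lemma lacunary_continuous:
  assumes f: "periodic_smooth f" and p: "1 \<le> p" shows "continuous_on UNIV (lacunary p f)"
proof -
  obtain B where B: "\<And>x. \<bar>f x\<bar> \<le> B" using periodic_smooth_bounded[OF f] by blast
  have c: "continuous_on UNIV f" using f Ck_continuous by (auto simp: periodic_smooth_def)
  have "continuous_on UNIV (\<lambda>x. \<Sum>k<n. (1 / real N ^ p) ^ k * f (real N ^ k * x))" for n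
    by (intro continuous_on_sum continuous_on_mult_left continuous_on_compose2[OF c] continuous_on_mult_left continuous_on_id) auto
  then show ?thesis
    by (intro uniform_limit_theorem[OF _ lacunary_uniform[OF B p]]) auto
qed

text \<open>Differentiating a term multiplies it by \<open>N\<^sup>k\<close>, which costs one power in the decay rate.\<close>

lemma lacunary_has_deriv:
  assumes f: "periodic_smooth f" and p: "1 \<le> p"
  shows "(lacunary (Suc p) f has_real_derivative lacunary p (deriv f) x) (at x)"
proof -
  obtain B where B: "\<And>x. \<bar>f x\<bar> \<le> B" using periodic_smooth_bounded[OF f] by blast
  obtain B' where B': "\<And>x. \<bar>deriv f x\<bar> \<le> B'" using periodic_smooth_bounded[OF periodic_smooth_deriv[OF f]] by blast
  have d: "((\<lambda>x. (1 / real N ^ Suc p) ^ k * f (real N ^ k * x)) has_real_derivative (1 / real N ^ p) ^ k * deriv f (real N ^ k * x)) (at x)" for k x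
  proof -
    have "((\<lambda>x. f (real N ^ k * x)) has_real_derivative deriv f (real N ^ k * x) * real N ^ k) (at x)"
      by (rule DERIV_chain2[OF periodic_smooth_has_deriv[OF f]]) (auto intro!: derivative_eq_intros)
    then have "((\<lambda>x. (1 / real N ^ Suc p) ^ k * f (real N ^ k * x)) has_real_derivative (1 / real N ^ Suc p) ^ k * (deriv f (real N ^ k * x) * real N ^ k)) (at x)"
      by (rule DERIV_cmult)
    moreover have "(1 / real N ^ Suc p) ^ k * (deriv f (real N ^ k * x) * real N ^ k) = (1 / real N ^ p) ^ k * deriv f (real N ^ k * x)"
      using N by (simp add: power_divide power_mult_distrib field_simps)
    ultimately show ?thesis by (simp only:)
  qed
  show ?thesis
    unfolding lacunary_def[abs_def]
  proof (rule has_field_derivative_series'(2)[of "UNIV :: real set" "\<lambda>k x. (1 / real N ^ Suc p) ^ k * f (real N ^ k * x)"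
        "\<lambda>k x. (1 / real N ^ p) ^ k * deriv f (real N ^ k * x)" "0 :: real" x])
    show "uniformly_convergent_on UNIV (\<lambda>n x. \<Sum>k<n. (1 / real N ^ p) ^ k * deriv f (real N ^ k * x))"
      unfolding uniformly_convergent_on_def using lacunary_uniform[of "deriv f", OF B' p] by blast
    show "summable (\<lambda>k. (1 / real N ^ Suc p) ^ k * f (real N ^ k * 0))"
      by (rule lacunary_summable[OF B]) simp
  qed (use d in auto)
qed

lemma Ck_lacunary: "periodic_smooth f \<Longrightarrow> Ck m (lacunary (Suc m) f)"
proof (induction m arbitrary: f)
  case 0 then show ?case using lacunary_continuous[of f 1] by (simp add: Ck_0)
next
  case (Suc m)
  show ?case by (rule Ck_SucI[OF lacunary_has_deriv[OF Suc.prems] Suc.IH[OF periodic_smooth_deriv[OF Suc.prems]]]) simp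
qed

text \<open>A periodic bump that vanishes exactly at distance at least \<open>2 / N\<close> from the integers.\<close>

definition gap :: "real \<Rightarrow> real" where
  "gap x = ramp (cos (2 * pi * x) - cos (4 * pi / N)) * (1 / 4)"

lemma gap_periodic_smooth: "periodic_smooth gap"
proof -
  have "Ck k gap" for k
    unfolding gap_def[abs_def]
    by (rule Ck_mult[OF Ck_compose[OF Ck_ramp Ck_diff[OF Ck_compose[OF Ck_cos Ck_cmult[OF Ck_id]] Ck_const]] Ck_const])
  moreover have "gap (x + 1) = gap x" for x
    unfolding gap_def by (simp add: distrib_left)
  ultimately show ?thesis by (simp add: periodic_smooth_def)
qed

lemma gap_periodic: "gap (x + 1) = gap x" using gap_periodic_smooth by (simp add: periodic_smooth_def)

lemma gap_nonneg: "0 \<le> gap x" by (simp add: gap_def ramp_nonneg)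
lemma gap_le: "gap x \<le> 1 / 4" using ramp_le_1 by (simp add: gap_def)
lemma gap_abs: "\<bar>gap x\<bar> \<le> 1 / 4" using gap_le[of x] gap_nonneg[of x] by linarith

lemma gap_zero:
  assumes "2 / real N \<le> y" "y \<le> 1 - 2 / real N" shows "gap y = 0"
proof -
  have *: "cos (2 * pi * y) \<le> cos (4 * pi / N)" if y: "2 / real N \<le> y" "y \<le> 1 / 2" for y
  proof -
    have "2 * pi * (2 / real N) \<le> 2 * pi * y" using y by (intro mult_left_mono) auto
    moreover have "2 * pi * y \<le> 2 * pi * (1/2)" using y by (intro mult_left_mono) auto
    ultimately show ?thesis by (intro cos_monotone_0_pi_le) auto
  qed
  have "cos (2 * pi * y) \<le> cos (4 * pi / N)"
  proof (cases "y \<le> 1 / 2")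
    case False
    have "cos (2 * pi * y) = cos (2 * pi - 2 * pi * y)" by (simp add: cos_diff)
    also have "\<dots> = cos (2 * pi * (1 - y))" by (simp add: algebra_simps)
    also have "\<dots> \<le> cos (4 * pi / N)" by (rule *) (use False assms in auto)
    finally show ?thesis .
  qed (use * assms in auto)
  then show ?thesis by (simp add: gap_def ramp_zero)
qed

definition gap0 :: real where "gap0 = ramp (cos (2 * pi / N) - cos (4 * pi / N)) * (1 / 4)"

lemma gap0_pos: "0 < gap0"
proof -
  have "4 * pi / N \<le> pi" using N by (simp add: field_simps)
  then have "cos (4 * pi / N) < cos (2 * pi / N)"
    using N by (intro cos_monotone_0_pi) (auto simp: field_simps)
  then show ?thesis by (simp add: gap0_def ramp_pos)
qed

text \<open>Only the half of the gap closest to the integers is used here: there the bump is bounded below, whereas it degenerates to infinite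
order at the ends of the gap.\<close>

lemma gap_ge:
  assumes "(0 \<le> y \<and> y \<le> 1 / real N) \<or> (1 - 1 / real N \<le> y \<and> y \<le> 1)" shows "gap0 \<le> gap y"
proof -
  have pN: "2 * pi / N \<le> pi" using N by (simp add: field_simps)
  have *: "cos (2 * pi / N) \<le> cos (2 * pi * y)" if y: "0 \<le> y" "y \<le> 1 / real N" for y
  proof -
    have "2 * pi * y \<le> 2 * pi * (1 / real N)" using y by (intro mult_left_mono) auto
    then show ?thesis using y pN by (intro cos_monotone_0_pi_le) auto
  qed
  have "cos (2 * pi / N) \<le> cos (2 * pi * y)"
  proof (cases "0 \<le> y \<and> y \<le> 1 / real N")
    case False
    have "cos (2 * pi * y) = cos (2 * pi - 2 * pi * y)" by (simp add: cos_diff)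
    also have "\<dots> = cos (2 * pi * (1 - y))" by (simp add: algebra_simps)
    finally have "cos (2 * pi * y) = cos (2 * pi * (1 - y))" .
    moreover have "0 \<le> 1 - y" "1 - y \<le> 1 / real N" using False assms by auto
    ultimately show ?thesis using *[of "1 - y"] by (simp only:)
  qed (use * in auto)
  then have "ramp (cos (2 * pi / N) - cos (4 * pi / N)) \<le> ramp (cos (2 * pi * y) - cos (4 * pi / N))"
    by (intro ramp_mono) simp
  then show ?thesis by (simp add: gap0_def gap_def)
qed

abbreviation r where "r \<equiv> 1 / real N ^ M"

lemma r: "0 < r" "r \<le> 1 / 8" "r < 1" using ratio[of M] M by auto

definition h :: "real \<Rightarrow> real" where "h = lacunary M gap"

lemma h_def': "h x = (\<Sum>k. r ^ k * gap (real N ^ k * x))" by (simp add: h_def lacunary_def)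

lemma h_summable: "summable (\<lambda>k. r ^ k * gap (real N ^ k * x))"
  using M by (intro lacunary_summable[OF gap_abs]) auto

lemma Ck_h: "Ck (M - 1) h" using Ck_lacunary[OF gap_periodic_smooth, of "M - 1"] M by (simp add: h_def)

lemma h_continuous: "continuous_on UNIV h" by (rule Ck_continuous[OF Ck_h])

lemma h_borel [measurable]: "h \<in> borel_measurable borel"
  by (rule borel_measurable_continuous_onI[OF h_continuous])

lemma h_nonneg: "0 \<le> h x" unfolding h_def'
  using h_summable r by (intro suminf_nonneg) (auto intro!: mult_nonneg_nonneg gap_nonneg)

text \<open>The self-similarity from which all properties of the zero set are derived.\<close>

lemma h_self: "h x = gap x + r * h (real N * x)"
proof -
  have "h x = gap x + (\<Sum>k. r ^ Suc k * gap (real N ^ Suc k * x))"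
    unfolding h_def' using suminf_split_head[OF h_summable[of x]] by simp
  also have "(\<Sum>k. r ^ Suc k * gap (real N ^ Suc k * x)) = (\<Sum>k. r * (r ^ k * gap (real N ^ k * (real N * x))))"
    by (simp add: mult_ac)
  also have "\<dots> = r * h (real N * x)" unfolding h_def' by (rule suminf_mult[OF h_summable])
  finally show ?thesis .
qed

lemma h_periodic: "h (x + 1) = h x"
proof -
  have "gap (real N ^ k * (x + 1)) = gap (real N ^ k * x)" for k
    using periodic_add_nat[of gap "real N ^ k * x" "N ^ k", OF gap_periodic] by (simp add: distrib_left)
  then show ?thesis unfolding h_def' by simp
qed

text \<open>The truncated series, lifted by a constant that exceeds the tail. It is smooth, positive and lies above \<open>h\<close>.\<close>

definition h_approx :: "nat \<Rightarrow> real \<Rightarrow> real" where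
  "h_approx m x = (\<Sum>k<Suc m. r ^ k * gap (real N ^ k * x)) + r ^ Suc m"

lemma Ck_h_approx: "Ck p (h_approx m)"
proof -
  have g: "Ck p gap" using gap_periodic_smooth by (simp add: periodic_smooth_def)
  have "Ck p (\<lambda>x. r ^ k * gap (real N ^ k * x))" for k
    by (rule Ck_cmult[OF Ck_compose[OF g Ck_cmult[OF Ck_id]]])
  then show ?thesis unfolding h_approx_def[abs_def]
    by (intro Ck_add[OF Ck_sum Ck_const]) auto
qed

lemma h_approx_pos: "0 < h_approx m x"
proof -
  have "0 \<le> (\<Sum>k<Suc m. r ^ k * gap (real N ^ k * x))" using r by (intro sum_nonneg mult_nonneg_nonneg gap_nonneg) auto
  moreover have "0 < r ^ Suc m" using r by (intro zero_less_power) auto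
  ultimately show ?thesis unfolding h_approx_def by linarith
qed

lemma geo_sum: "(\<Sum>k. r ^ k) \<le> 8 / 7" "summable (\<lambda>k. r ^ k)"
proof -
  show "summable (\<lambda>k. r ^ k)" using r by (intro summable_geometric) auto
  have "(\<Sum>k. r ^ k) = 1 / (1 - r)" using r by (intro suminf_geometric) auto
  also have "\<dots> \<le> 8 / 7" using r by (simp add: divide_le_eq)
  finally show "(\<Sum>k. r ^ k) \<le> 8 / 7" .
qed

lemma h_le_h_approx: "h x \<le> h_approx m x"
proof -
  let ?f = "\<lambda>k. r ^ k * gap (real N ^ k * x)"
  have s1: "h x = (\<Sum>k. ?f (k + Suc m)) + (\<Sum>k<Suc m. ?f k)"
    unfolding h_def' by (rule suminf_split_initial_segment[OF h_summable])
  have s2: "(\<Sum>k. ?f (k + Suc m)) \<le> (\<Sum>k. (r ^ Suc m * (1 / 4)) * r ^ k)"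
  proof (rule suminf_le)
    show "?f (k + Suc m) \<le> (r ^ Suc m * (1 / 4)) * r ^ k" for k
      using mult_left_mono[OF gap_le[of "real N ^ (k + Suc m) * x"], of "r ^ (k + Suc m)"] r
      by (simp only: power_add mult_ac) simp
    show "summable (\<lambda>k. ?f (k + Suc m))" using summable_ignore_initial_segment[OF h_summable] .
    show "summable (\<lambda>k. (r ^ Suc m * (1 / 4)) * r ^ k)" by (rule summable_mult[OF geo_sum(2)])
  qed
  have s3: "(\<Sum>k. (r ^ Suc m * (1 / 4)) * r ^ k) = (r ^ Suc m * (1 / 4)) * (\<Sum>k. r ^ k)"
    by (rule suminf_mult[OF geo_sum(2)])
  have s4: "(r ^ Suc m * (1 / 4)) * (\<Sum>k. r ^ k) \<le> r ^ Suc m"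
  proof -
    have "(r ^ Suc m * (1 / 4)) * (\<Sum>k. r ^ k) \<le> (r ^ Suc m * (1 / 4)) * (8 / 7)"
      using r by (intro mult_left_mono geo_sum) (auto intro!: mult_nonneg_nonneg)
    also have "\<dots> \<le> r ^ Suc m"
    proof -
      have aux: "a * (1 / 4) * (8 / 7) \<le> a" if "0 \<le> a" for a :: real using that by simp
      show ?thesis by (rule aux, rule zero_le_power) (use r in linarith)
    qed
    finally show ?thesis .
  qed
  have s5: "(\<Sum>k. ?f (k + Suc m)) \<le> r ^ Suc m" by (rule order_trans[OF s2 ord_eq_le_trans[OF s3 s4]])
  have "h x \<le> r ^ Suc m + (\<Sum>k<Suc m. ?f k)" unfolding s1 by (rule add_right_mono[OF s5])
  then show ?thesis unfolding h_approx_def by (simp only: add.commute)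
qed

lemma h_approx_le_1: "h_approx m x \<le> 1"
proof -
  have "(\<Sum>k<Suc m. r ^ k * gap (real N ^ k * x)) \<le> (\<Sum>k<Suc m. r ^ k * (1 / 4))"
    using r by (intro sum_mono mult_left_mono gap_le) auto
  also have "\<dots> = (\<Sum>k<Suc m. r ^ k) * (1 / 4)" by (rule sum_distrib_right[symmetric])
  also have "\<dots> \<le> 8 / 7 * (1 / 4)"
    using sum_le_suminf[OF geo_sum(2), of "{..<Suc m}"] geo_sum(1) r by (intro mult_right_mono) auto
  finally have "(\<Sum>k<Suc m. r ^ k * gap (real N ^ k * x)) \<le> 2 / 7" by simp
  moreover have "r ^ Suc m \<le> r" using r mult_left_mono[of "r ^ m" 1 r] power_le_one[of r m] by simp
  ultimately show ?thesis using r unfolding h_approx_def by linarith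
qed

lemma h_le_1: "h x \<le> 1" using h_le_h_approx[of x 0] h_approx_le_1[of 0 x] by linarith

lemma h_approx_tendsto: "(\<lambda>m. h_approx m x) \<longlonglongrightarrow> h x"
proof -
  have "(\<lambda>m. \<Sum>k<m. r ^ k * gap (real N ^ k * x)) \<longlonglongrightarrow> h x"
    unfolding h_def' using summable_LIMSEQ[OF h_summable] .
  then have 1: "(\<lambda>m. \<Sum>k<Suc m. r ^ k * gap (real N ^ k * x)) \<longlonglongrightarrow> h x" by (rule LIMSEQ_Suc)
  have "(\<lambda>m. r ^ m) \<longlonglongrightarrow> 0" using r by (intro LIMSEQ_power_zero) auto
  then have 2: "(\<lambda>m. r ^ Suc m) \<longlonglongrightarrow> 0" by (rule LIMSEQ_Suc)
  show ?thesis unfolding h_approx_def using tendsto_add[OF 1 2] by simp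
qed

abbreviation r1 where "r1 \<equiv> 1 / real N ^ (M - 1)"
lemma r1: "0 < r1" "r1 \<le> 1 / 8" using ratio[of "M - 1"] M by auto

definition dh_approx :: "nat \<Rightarrow> real \<Rightarrow> real" where
  "dh_approx m x = (\<Sum>k<Suc m. r1 ^ k * deriv gap (real N ^ k * x))"

definition dh :: "real \<Rightarrow> real" where "dh = lacunary (M - 1) (deriv gap)"

lemma h_has_deriv: "(h has_real_derivative dh x) (at x)"
  using lacunary_has_deriv[OF gap_periodic_smooth, of "M - 1" x] M by (simp add: h_def dh_def Suc_diff_le)

lemma h_approx_has_deriv: "(h_approx m has_real_derivative dh_approx m x) (at x)"
proof -
  have d: "((\<lambda>x. r ^ k * gap (real N ^ k * x)) has_real_derivative r1 ^ k * deriv gap (real N ^ k * x)) (at x)" for k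
  proof -
    have "((\<lambda>x. gap (real N ^ k * x)) has_real_derivative deriv gap (real N ^ k * x) * real N ^ k) (at x)"
      by (rule DERIV_chain2[OF periodic_smooth_has_deriv[OF gap_periodic_smooth]]) (auto intro!: derivative_eq_intros)
    then have "((\<lambda>x. r ^ k * gap (real N ^ k * x)) has_real_derivative r ^ k * (deriv gap (real N ^ k * x) * real N ^ k)) (at x)"
      by (rule DERIV_cmult)
    moreover have "r ^ k * real N ^ k = r1 ^ k"
    proof -
      have "r * real N = r1" using M N by (cases M) (auto simp: field_simps)
      then show ?thesis by (simp only: power_mult_distrib[symmetric])
    qed
    then have "r ^ k * (deriv gap (real N ^ k * x) * real N ^ k) = r1 ^ k * deriv gap (real N ^ k * x)"
    proof -
      assume e: "r ^ k * real N ^ k = r1 ^ k"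
      have "a * (b * c) = (a * c) * b" for a b c :: real by simp
      then show ?thesis using e by (simp only:)
    qed
    ultimately show ?thesis by (simp only:)
  qed
  have "((\<lambda>x. (\<Sum>k<Suc m. r ^ k * gap (real N ^ k * x)) + r ^ Suc m) has_real_derivative
     (\<Sum>k<Suc m. r1 ^ k * deriv gap (real N ^ k * x)) + 0) (at x)"
    by (intro DERIV_add DERIV_sum d DERIV_const)
  then show ?thesis unfolding h_approx_def[abs_def] dh_approx_def by simp
qed

lemma dgap_bound: obtains B where "B \<ge> 0" "\<And>x. \<bar>deriv gap x\<bar> \<le> B"
  using periodic_smooth_bounded[OF periodic_smooth_deriv[OF gap_periodic_smooth]] by blast

lemma dh_approx_tendsto: "(\<lambda>m. dh_approx m x) \<longlonglongrightarrow> dh x"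
proof -
  obtain B where B: "\<And>x. \<bar>deriv gap x\<bar> \<le> B" using dgap_bound by blast
  have "(\<lambda>m. \<Sum>k<m. r1 ^ k * deriv gap (real N ^ k * x)) \<longlonglongrightarrow> dh x"
    unfolding dh_def lacunary_def using M by (intro summable_LIMSEQ lacunary_summable[of "deriv gap", OF B]) auto
  then show ?thesis unfolding dh_approx_def by (rule LIMSEQ_Suc)
qed

lemma dh_approx_bound: "\<exists>K>0. \<forall>m x. \<bar>dh_approx m x\<bar> \<le> K \<and> \<bar>dh x\<bar> \<le> K"
proof -
  obtain B where B0: "B \<ge> 0" and B: "\<And>x. \<bar>deriv gap x\<bar> \<le> B" using dgap_bound by blast
  have s: "summable (\<lambda>k. r1 ^ k)" using r1 by (intro summable_geometric) auto
  define K where "K = (\<Sum>k. r1 ^ k) * B + 1"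
  have K: "\<bar>dh_approx m x\<bar> \<le> K" for m x
  proof -
    have "\<bar>dh_approx m x\<bar> \<le> (\<Sum>k<Suc m. \<bar>r1 ^ k * deriv gap (real N ^ k * x)\<bar>)" unfolding dh_approx_def by (rule sum_abs)
    also have "\<dots> \<le> (\<Sum>k<Suc m. r1 ^ k * B)"
      unfolding abs_mult using r1 B by (intro sum_mono mult_mono) auto
    also have "\<dots> = (\<Sum>k<Suc m. r1 ^ k) * B" by (rule sum_distrib_right[symmetric])
    also have "\<dots> \<le> (\<Sum>k. r1 ^ k) * B"
      using sum_le_suminf[OF s, of "{..<Suc m}"] r1 B0 by (intro mult_right_mono) auto
    finally show ?thesis by (simp add: K_def)
  qed
  have "\<bar>dh x\<bar> \<le> K" for x
    by (rule LIMSEQ_le_const2[OF tendsto_rabs[OF dh_approx_tendsto]]) (use K in auto)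
  moreover have "K > 0" using B0 suminf_nonneg[OF s] r1 by (auto simp: K_def intro!: add_nonneg_pos mult_nonneg_nonneg)
  ultimately show ?thesis using K by blast
qed

lemma h_Lipschitz: "\<exists>K>0. \<forall>x y. \<bar>h x - h y\<bar> \<le> K * \<bar>x - y\<bar>"
proof -
  obtain K where K: "K > 0" "\<And>x. \<bar>dh x\<bar> \<le> K" using dh_approx_bound by blast
  have "norm (h x - h y) \<le> K * norm (x - y)" for x y
    by (rule field_differentiable_bound[of UNIV h dh]) (use K h_has_deriv in auto)
  then show ?thesis using K by auto
qed

text \<open>The expansion with all digits equal to 2, which is a fixed point of the digit shift.\<close>

definition rho :: real where "rho = 2 / (real N - 1)"

lemma rho: "2 / real N \<le> rho" "rho \<le> 1 - 2 / real N" "h rho = 0"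
proof -
  have N': "real N \<ge> 8" using N by simp
  show 1: "2 / real N \<le> rho" unfolding rho_def using N' by (intro divide_left_mono) auto
  have "rho \<le> 2 / 7" unfolding rho_def using N' by (intro divide_left_mono) auto
  moreover have "2 / real N \<le> 2 / 8" using N' by (intro divide_left_mono) auto
  ultimately show 2: "rho \<le> 1 - 2 / real N" by linarith
  have "real N * rho = rho + of_nat 2" using N' by (simp add: rho_def field_simps)
  then have "h (real N * rho) = h rho" using periodic_add_nat[of h rho 2, OF h_periodic] by simp
  then have "h rho = r * h rho" using h_self[of rho] gap_zero[OF 1 2] by simp
  then have "(1 - r) * h rho = 0" by (simp add: algebra_simps)
  then show "h rho = 0" using r by simp
qed

text \<open>Integers with \<open>k\<close> digits in base \<open>N\<close>, all of them between \<open>2\<close> and \<open>N - 3\<close>.\<close>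

primrec digit_nums :: "nat \<Rightarrow> nat set" where
  "digit_nums 0 = {0}"
| "digit_nums (Suc k) = (\<lambda>(m, d). N * m + d) ` (digit_nums k \<times> {2..N - 3})"

lemma digit_nums_finite: "finite (digit_nums k)" by (induction k) auto

lemma digits_inj: "inj_on (\<lambda>(m, d). N * m + d) (A \<times> {2..N - 3})"
proof (rule inj_onI, clarsimp)
  fix a b c d assume "N * a + b = N * c + d" "2 \<le> b" "b \<le> N - 3" "2 \<le> d" "d \<le> N - 3"
  moreover from this N have "b < N" "d < N" by auto
  ultimately show "a = c \<and> b = d"
    by (metis add_left_cancel div_mult_self4 div_less add.right_neutral not_less_zero mult.commute N gr0I)
qed

lemma digit_nums_card: "card (digit_nums k) = (N - 4) ^ k"
proof (induction k)
  case (Suc k)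
  have "card (digit_nums (Suc k)) = card (digit_nums k \<times> {2..N - 3})" by (simp add: card_image[OF digits_inj])
  also have "\<dots> = (N - 4) ^ Suc k" using Suc N by (simp add: card_cartesian_product Suc_diff_le)
  finally show ?case .
qed simp

text \<open>Fixing the leading digits leaves a free choice of the last \<open>l\<close> digits.\<close>

lemma digit_nums_class_card: "l \<le> k \<Longrightarrow> card {m \<in> digit_nums k. m div N ^ l = v} \<le> (N - 4) ^ l"
proof (induction l arbitrary: k)
  case 0
  have "{m \<in> digit_nums k. m div N ^ 0 = v} \<subseteq> {v}" by auto
  then have "card {m \<in> digit_nums k. m div N ^ 0 = v} \<le> card {v}" by (intro card_mono) auto
  then show ?case by simp
next
  case (Suc l)
  then obtain k' where k: "k = Suc k'" "l \<le> k'" by (cases k) auto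
  have "{m \<in> digit_nums k. m div N ^ Suc l = v} \<subseteq> (\<lambda>(m, d). N * m + d) ` ({m \<in> digit_nums k'. m div N ^ l = v} \<times> {2..N - 3})"
  proof
    fix m assume "m \<in> {m \<in> digit_nums k. m div N ^ Suc l = v}"
    then obtain a d where a: "m = N * a + d" "a \<in> digit_nums k'" "d \<in> {2..N - 3}" "m div N ^ Suc l = v" by (auto simp: k)
    have "d < N" using a N by auto
    then have "m div N = a" using a(1) N by simp
    then have "a div N ^ l = v" using a(4) by (simp add: div_mult2_eq)
    with a show "m \<in> (\<lambda>(m, d). N * m + d) ` ({m \<in> digit_nums k'. m div N ^ l = v} \<times> {2..N - 3})" by auto
  qed
  then have "card {m \<in> digit_nums k. m div N ^ Suc l = v} \<le> card ({m \<in> digit_nums k'. m div N ^ l = v} \<times> {2..N - 3})"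
    using digit_nums_finite by (intro surj_card_le) auto
  also have "\<dots> = card {m \<in> digit_nums k'. m div N ^ l = v} * (N - 4)" using N by (simp add: card_cartesian_product Suc_diff_le)
  also have "\<dots> \<le> (N - 4) ^ l * (N - 4)" by (intro mult_right_mono Suc.IH k) auto
  finally show ?case by (simp add: mult.commute)
qed

text \<open>The zero of \<open>h\<close> whose first \<open>k\<close> digits are those of \<open>m\<close> and whose other digits are all 2.\<close>

definition contact :: "nat \<Rightarrow> nat \<Rightarrow> real" where "contact k m = (real m + rho) / real N ^ k"

text \<open>The last digit of \<open>m\<close> can be moved into the tail \<open>y\<close>: if \<open>h y = 0\<close>, then \<open>h ((d + y) / N) = 0\<close> by self-similarity.\<close>

lemma contact_props:
  assumes "m \<in> digit_nums k"
  shows "2 / real N \<le> contact k m" "contact k m \<le> 1 - 2 / real N" "h (contact k m) = 0"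
proof -
  have "2 / real N \<le> (real m + y) / real N ^ k \<and> (real m + y) / real N ^ k \<le> 1 - 2 / real N \<and> h ((real m + y) / real N ^ k) = 0"
    if "2 / real N \<le> y" "y \<le> 1 - 2 / real N" "h y = 0" for y
    using assms that
  proof (induction k arbitrary: m y)
    case 0 then show ?case by simp
  next
    case (Suc k)
    then obtain a d where a: "m = N * a + d" "a \<in> digit_nums k" "d \<in> {2..N - 3}" by auto
    have N': "real N \<ge> 8" using N by simp
    have N0: "0 < 2 / real N" using N' by simp
    have d: "2 \<le> real d" "real d \<le> real N - 3" using a N by auto
    have y01: "0 \<le> y" "y \<le> 1" using Suc.prems N0 by linarith+
    define z where "z = (real d + y) / real N"
    have z: "2 / real N \<le> z" "z \<le> 1 - 2 / real N"
    proof -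
      show "2 / real N \<le> z" unfolding z_def using d y01 by (intro divide_right_mono) auto
      have "z \<le> (real N - 2) / real N" unfolding z_def using d y01 by (intro divide_right_mono) auto
      then show "z \<le> 1 - 2 / real N" using N' by (simp add: diff_divide_distrib)
    qed
    have "real N * z = y + of_nat d" using N' by (simp add: z_def)
    then have "h (real N * z) = h y" using periodic_add_nat[of h y d, OF h_periodic] by simp
    then have "h z = 0" using h_self[of z] gap_zero[OF z] Suc.prems by simp
    from Suc.IH[OF a(2) z this] have IH: "2 / real N \<le> (real a + z) / real N ^ k \<and> (real a + z) / real N ^ k \<le> 1 - 2 / real N \<and> h ((real a + z) / real N ^ k) = 0" .
    have "real a + z = (real m + y) / real N" using N' by (simp add: a(1) z_def field_simps)
    then have "(real a + z) / real N ^ k = (real m + y) / real N ^ Suc k" by simp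
    with IH show ?case by simp
  qed
  from this[OF rho] show "2 / real N \<le> contact k m" "contact k m \<le> 1 - 2 / real N" "h (contact k m) = 0"
    by (auto simp: contact_def)
qed

text \<open>The Frostman bound for the normalised counting measure of the contact points: an interval of length \<open>2 t\<close> meets at most three
classes of integers with the same leading digits, where the number \<open>l\<close> of free digits is the least one with \<open>t \<le> N\<^sup>l\<^sup>-\<^sup>k\<close>.\<close>

lemma contact_count:
  assumes D: "real N powr D \<le> real N - 4" "0 < D" "D < 1" and t: "1 / real N ^ k \<le> t" "t \<le> 1"
  shows "real (card {m \<in> digit_nums k. \<bar>contact k m - x\<bar> \<le> t}) \<le> 3 * real N * (real N - 4) ^ k * t powr D"
proof -
  have N': "real N \<ge> 8" using N by simp
  have t0: "t > 0" using t(1) N' by (smt (verit) divide_pos_pos zero_less_power)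
  define l where "l = (LEAST l. t * real N ^ k \<le> real N ^ l)"
  have k: "t * real N ^ k \<le> real N ^ k" using t N' by (simp add: mult_left_le_one_le)
  have l1: "t * real N ^ k \<le> real N ^ l" unfolding l_def by (rule LeastI[of _ k]) (rule k)
  have lk: "l \<le> k" unfolding l_def by (rule Least_le) (rule k)
  have l2: "real N ^ l \<le> real N * (t * real N ^ k)"
  proof (cases l)
    case 0
    have "1 \<le> t * real N ^ k" using t(1) N' by (simp add: field_simps)
    then have "1 * 1 \<le> real N * (t * real N ^ k)" using N' by (intro mult_mono) auto
    then show ?thesis using 0 by simp
  next
    case (Suc l')
    then have "\<not> t * real N ^ k \<le> real N ^ l'" unfolding l_def using not_less_Least by (metis lessI l_def)
    then show ?thesis using Suc N' by simp
  qed
  define A where "A = {m \<in> digit_nums k. \<bar>contact k m - x\<bar> \<le> t}"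
  have Af: "finite A" unfolding A_def using digit_nums_finite by auto
  have card: "card A \<le> 3 * (N - 4) ^ l"
  proof (cases "A = {}")
    case False
    define m0 where "m0 = Min A"
    have m0: "m0 \<in> A" "\<And>m. m \<in> A \<Longrightarrow> m0 \<le> m" unfolding m0_def using Af False by auto
    define v where "v = m0 div N ^ l"
    have Nl: "0 < N ^ l" using N by simp
    have "A \<subseteq> {m \<in> digit_nums k. m div N ^ l = v} \<union> {m \<in> digit_nums k. m div N ^ l = v + 1} \<union> {m \<in> digit_nums k. m div N ^ l = v + 2}"
    proof
      fix m assume m: "m \<in> A"
      have "contact k m - contact k m0 \<le> 2 * t" using m m0(1) unfolding A_def by auto
      then have "(real m - real m0) / real N ^ k \<le> 2 * t"
        by (simp add: contact_def diff_divide_distrib add_divide_distrib)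
      then have "real m - real m0 \<le> 2 * t * real N ^ k" using N' by (simp add: pos_divide_le_eq)
      also have "\<dots> \<le> 2 * real N ^ l" using l1 by simp
      finally have "real m \<le> real (m0 + 2 * N ^ l)" by simp
      then have "m \<le> m0 + 2 * N ^ l" by (simp only: of_nat_le_iff)
      then have "m div N ^ l \<le> (m0 + 2 * N ^ l) div N ^ l" by (rule div_le_mono)
      also have "\<dots> = v + 2" using Nl by (simp add: v_def)
      finally have "m div N ^ l \<le> v + 2" .
      moreover have "v \<le> m div N ^ l" unfolding v_def using m0(2)[OF m] by (rule div_le_mono)
      ultimately have "m div N ^ l = v \<or> m div N ^ l = v + 1 \<or> m div N ^ l = v + 2" by linarith
      then show "m \<in> {m \<in> digit_nums k. m div N ^ l = v} \<union> {m \<in> digit_nums k. m div N ^ l = v + 1} \<union> {m \<in> digit_nums k. m div N ^ l = v + 2}"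
        using m by (auto simp: A_def)
    qed
    then have "card A \<le> card ({m \<in> digit_nums k. m div N ^ l = v} \<union> {m \<in> digit_nums k. m div N ^ l = v + 1} \<union> {m \<in> digit_nums k. m div N ^ l = v + 2})"
      using digit_nums_finite by (intro card_mono) auto
    also have "\<dots> \<le> card {m \<in> digit_nums k. m div N ^ l = v} + card {m \<in> digit_nums k. m div N ^ l = v + 1} + card {m \<in> digit_nums k. m div N ^ l = v + 2}"
      by (meson add_mono card_Un_le order_refl order_trans)
    also have "\<dots> \<le> (N - 4) ^ l + (N - 4) ^ l + (N - 4) ^ l"
      by (intro add_mono digit_nums_class_card lk)
    finally show ?thesis by simp
  qed simp
  define e where "e = k - l"
  have pe: "(real N - 4) ^ l * (real N powr D) ^ e \<le> (real N - 4) ^ k"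
  proof -
    have "(real N - 4) ^ l * (real N powr D) ^ e \<le> (real N - 4) ^ l * (real N - 4) ^ e"
      using D(1) N' by (intro mult_left_mono power_mono) auto
    also have "\<dots> = (real N - 4) ^ k" using lk by (simp add: e_def power_add[symmetric])
    finally show ?thesis .
  qed
  have Ne: "(real N powr D) ^ e = (real N ^ e) powr D"
    using N' by (simp add: powr_realpow[symmetric] powr_powr mult.commute)
  have te: "1 \<le> real N * t * real N ^ e"
  proof -
    have "real N ^ l * 1 \<le> real N ^ l * (real N * t * real N ^ e)"
      using l2 lk by (simp add: e_def power_add[symmetric] mult_ac)
    then show ?thesis using N' by (simp add: mult_le_cancel_left)
  qed
  have "1 \<le> (real N * t * real N ^ e) powr D" using te D by (intro ge_one_powr_ge_zero) auto
  also have "\<dots> = real N powr D * t powr D * (real N ^ e) powr D" using N' t0 by (simp add: powr_mult)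
  also have "\<dots> \<le> real N * t powr D * (real N ^ e) powr D"
    using D(1) by (intro mult_right_mono) auto
  finally have 1: "1 \<le> real N * t powr D * (real N powr D) ^ e" by (simp add: Ne)
  have "real (card A) \<le> 3 * (real N - 4) ^ l"
  proof -
    have "real (card A) \<le> real (3 * (N - 4) ^ l)" using card by (simp only: of_nat_le_iff)
    also have "\<dots> = 3 * (real N - 4) ^ l" using N by (simp add: of_nat_diff)
    finally show ?thesis .
  qed
  also have "\<dots> \<le> 3 * (real N - 4) ^ l * (real N * t powr D * (real N powr D) ^ e)"
  proof -
    have "0 \<le> 3 * (real N - 4) ^ l" using N' by simp
    from mult_left_mono[OF 1 this] show ?thesis by (simp only: mult_1_right)
  qed
  also have "\<dots> = 3 * real N * t powr D * ((real N - 4) ^ l * (real N powr D) ^ e)" by (simp add: mult_ac)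
  also have "\<dots> \<le> 3 * real N * t powr D * (real N - 4) ^ k"
    using pe by (intro mult_left_mono) auto
  finally show ?thesis by (simp add: A_def mult_ac)
qed

end

section \<open>Negative powers of the lacunary series\<close>

lemma nn_integral_periodic_shift:
  fixes f :: "real \<Rightarrow> ennreal"
  assumes [measurable]: "f \<in> borel_measurable borel" and per: "\<And>x. f (x + 1) = f x"
  shows "(\<integral>\<^sup>+x\<in>{real_of_int m..real_of_int m + 1}. f x \<partial>lborel) = (\<integral>\<^sup>+x\<in>{0..1}. f x \<partial>lborel)"
proof -
  have p: "f (x + real_of_int m) = f x" for x
  proof (cases "m \<ge> 0")
    case True
    have "f (x + real n) = f x" for n by (induction n) (use per in \<open>auto simp: add.assoc[symmetric] add.commute[of 1] add.left_commute[of _ 1]\<close>)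
    from this[of "nat m"] True show ?thesis by simp
  next
    case False
    have "f (x + real n) = f x" for n x by (induction n) (use per in \<open>auto simp: add.assoc[symmetric] add.commute[of 1] add.left_commute[of _ 1]\<close>)
    from this[of "x + real_of_int m" "nat (- m)"] False show ?thesis by simp
  qed
  have "(\<integral>\<^sup>+x\<in>{real_of_int m..real_of_int m + 1}. f x \<partial>lborel)
      = (\<integral>\<^sup>+x. f (x + real_of_int m) * indicator {real_of_int m..real_of_int m + 1} (x + real_of_int m) \<partial>lborel)"
    by (rule lborel_nn_integral_shift[symmetric]) measurable
  also have "\<dots> = (\<integral>\<^sup>+x\<in>{0..1}. f x \<partial>lborel)"
    unfolding p by (intro nn_integral_cong) (auto split: split_indicator)
  finally show ?thesis .
qed

lemma nn_integral_cover:
  fixes f :: "real \<Rightarrow> ennreal"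
  assumes [measurable]: "f \<in> borel_measurable borel" and per: "\<And>x. f (x + 1) = f x"
  shows "(\<integral>\<^sup>+x\<in>{real_of_int m..real_of_int m + real n}. f x \<partial>lborel) \<le> of_nat n * (\<integral>\<^sup>+x\<in>{0..1}. f x \<partial>lborel)"
proof (induction n)
  case 0
  have "(\<integral>\<^sup>+x\<in>{real_of_int m..real_of_int m + real 0}. f x \<partial>lborel) = (\<integral>\<^sup>+x\<in>{real_of_int m}. f x \<partial>lborel)" by simp
  also have "\<dots> = 0" by (rule nn_integral_null_set) (simp add: null_sets_def)
  finally show ?case by simp
next
  case (Suc n)
  have "(\<integral>\<^sup>+x\<in>{real_of_int m..real_of_int m + real (Suc n)}. f x \<partial>lborel)
    \<le> (\<integral>\<^sup>+x. f x * indicator {real_of_int m..real_of_int m + real n} x + f x * indicator {real_of_int (m + int n)..real_of_int (m + int n) + 1} x \<partial>lborel)"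
    by (intro nn_integral_mono) (auto split: split_indicator)
  also have "\<dots> = (\<integral>\<^sup>+x\<in>{real_of_int m..real_of_int m + real n}. f x \<partial>lborel)
      + (\<integral>\<^sup>+x\<in>{real_of_int (m + int n)..real_of_int (m + int n) + 1}. f x \<partial>lborel)"
    by (rule nn_integral_add) measurable
  also have "\<dots> \<le> of_nat n * (\<integral>\<^sup>+x\<in>{0..1}. f x \<partial>lborel) + (\<integral>\<^sup>+x\<in>{0..1}. f x \<partial>lborel)"
    unfolding nn_integral_periodic_shift[OF assms] by (intro add_mono Suc.IH order_refl)
  also have "\<dots> = of_nat (Suc n) * (\<integral>\<^sup>+x\<in>{0..1}. f x \<partial>lborel)"
    by (simp add: distrib_right add.commute)
  finally show ?case .
qed

context digits begin

text \<open>The value \<open>\<infinity>\<close> on the zero set lets one integral control both the power and the measure of the zero set.\<close>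

definition inv_pow :: "real \<Rightarrow> real \<Rightarrow> ennreal" where
  "inv_pow \<epsilon> x = (if h x > 0 then ennreal (h x powr - \<epsilon>) else \<infinity>)"

lemma inv_pow_borel [measurable]: "inv_pow \<epsilon> \<in> borel_measurable borel"
  unfolding inv_pow_def[abs_def] by measurable

lemma inv_pow_periodic: "inv_pow \<epsilon> (x + 1) = inv_pow \<epsilon> x"
  by (simp add: inv_pow_def h_periodic)

text \<open>The last condition says that the factor in the self-similar recursion for \<open>\<integral> h powr - \<epsilon>\<close> is less than one.\<close>

definition small_exponent :: "real \<Rightarrow> bool" where
  "small_exponent \<epsilon> \<longleftrightarrow> 0 < \<epsilon> \<and> \<epsilon> \<le> 1 / 2 \<and> real N powr (real M * \<epsilon>) * (real N - 2) < real N"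

lemma small_exponent_mono: "small_exponent \<epsilon> \<Longrightarrow> 0 < \<epsilon>' \<Longrightarrow> \<epsilon>' \<le> \<epsilon> \<Longrightarrow> small_exponent \<epsilon>'"
  unfolding small_exponent_def
proof (elim conjE, intro conjI)
  assume a: "0 < \<epsilon>'" "\<epsilon>' \<le> \<epsilon>" "real N powr (real M * \<epsilon>) * (real N - 2) < real N"
  have "real N powr (real M * \<epsilon>') * (real N - 2) \<le> real N powr (real M * \<epsilon>) * (real N - 2)"
    using a N by (intro mult_right_mono powr_mono mult_left_mono) auto
  with a show "real N powr (real M * \<epsilon>') * (real N - 2) < real N" by simp
qed auto

lemma ex_small_exponent: "\<exists>\<epsilon>. small_exponent \<epsilon>"
proof -
  have N': "real N \<ge> 8" using N by simp
  have M': "real M \<ge> 2" using M by simp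
  define \<delta> where "\<delta> = ln (real N / (real N - 2)) / (2 * real M * ln (real N))"
  have l: "ln (real N / (real N - 2)) > 0" using N' by (simp add: ln_gt_zero)
  have lN: "ln (real N) > 0" using N' by simp
  have d: "\<delta> > 0" unfolding \<delta>_def using l lN M' by (intro divide_pos_pos mult_pos_pos) auto
  define \<epsilon> where "\<epsilon> = min \<delta> (1 / 2)"
  have "real N powr (real M * \<epsilon>) = exp (real M * \<epsilon> * ln (real N))" using N' by (simp add: powr_def)
  also have "\<dots> \<le> exp (real M * \<delta> * ln (real N))" using M' lN by (simp add: \<epsilon>_def mult_right_mono mult_left_mono)
  also have "real M * \<delta> * ln (real N) = ln (real N / (real N - 2)) / 2" using M' lN by (simp add: \<delta>_def)
  also have "exp \<dots> < exp (ln (real N / (real N - 2)))" using l by simp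
  also have "\<dots> = real N / (real N - 2)" using N' by simp
  finally have "real N powr (real M * \<epsilon>) * (real N - 2) < real N" using N' by (simp add: field_simps)
  then show ?thesis using d by (intro exI[of _ \<epsilon>]) (auto simp: small_exponent_def \<epsilon>_def)
qed

text \<open>Let \<open>I = \<integral> (h + \<delta>) powr - \<epsilon>\<close> over one period. Near the integers \<open>h \<ge> gap0\<close>; on the rest \<open>h(x) + \<delta> \<ge> r (h(N x) + \<delta>)\<close>, and
\<open>x \<mapsto> N x\<close> maps it onto \<open>N - 2\<close> periods. Hence \<open>I \<le> C + \<rho> I\<close> with \<open>\<rho> < 1\<close> and \<open>C\<close> independent of \<open>\<delta>\<close>. Fatou's lemma removes \<open>\<delta>\<close>.\<close>

lemma inv_pow_integral_unit:
  assumes \<epsilon>: "small_exponent \<epsilon>"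
  shows "(\<integral>\<^sup>+x\<in>{0..1}. inv_pow \<epsilon> x \<partial>lborel) < \<infinity>"
proof -
  have N': "real N \<ge> 8" using N by simp
  have e: "0 < \<epsilon>" using \<epsilon> by (simp add: small_exponent_def)
  define \<rho> where "\<rho> = real N powr (real M * \<epsilon>) * (real N - 2) / real N"
  have \<rho>: "0 \<le> \<rho>" "\<rho> < 1" using \<epsilon> N' by (auto simp: small_exponent_def \<rho>_def divide_simps)
  \<comment> \<open>the fixed point of \<open>I = gap0 powr - \<epsilon> + \<rho> I\<close>\<close>
  define A where "A = gap0 powr - \<epsilon> / (1 - \<rho>)"
  have bound: "(\<integral>\<^sup>+x\<in>{0..1}. ennreal ((h x + \<delta>) powr - \<epsilon>) \<partial>lborel) \<le> ennreal A" if \<delta>: "0 < \<delta>" for \<delta>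
  proof -
    define f where "f x = ennreal ((h x + \<delta>) powr - \<epsilon>)" for x
    have fb [measurable]: "f \<in> borel_measurable borel" unfolding f_def[abs_def] by measurable
    have fper: "f (x + 1) = f x" for x by (simp add: f_def h_periodic)
    define I where "I = (\<integral>\<^sup>+x\<in>{0..1}. f x \<partial>lborel)"
    have "I \<le> (\<integral>\<^sup>+x\<in>{0..1::real}. ennreal (\<delta> powr - \<epsilon>) \<partial>lborel)"
      unfolding I_def f_def
    proof (intro nn_integral_mono mult_right_mono ennreal_leI)
      fix x show "(h x + \<delta>) powr - \<epsilon> \<le> \<delta> powr - \<epsilon>"
        using h_nonneg[of x] \<delta> e by (intro powr_mono2') auto
    qed auto
    \<comment> \<open>finiteness is needed before \<open>\<rho> I\<close> can be subtracted\<close>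
    also have "\<dots> = ennreal (\<delta> powr - \<epsilon>)" by (simp add: nn_integral_cmult_indicator)
    finally have "I < \<infinity>" by (simp add: le_less_trans)
    then obtain i where i: "I = ennreal i" "0 \<le> i" by (cases I) auto
    define mid where "mid = {1 / real N..1 - 1 / real N}"
    have "I \<le> (\<integral>\<^sup>+x. ennreal (gap0 powr - \<epsilon>) * indicator {0..1::real} x + ennreal (real N powr (real M * \<epsilon>)) * (f (real N * x) * indicator mid x) \<partial>lborel)"
      unfolding I_def
    proof (intro nn_integral_mono)
      fix x :: real
      show "f x * indicator {0..1} x \<le> ennreal (gap0 powr - \<epsilon>) * indicator {0..1::real} x + ennreal (real N powr (real M * \<epsilon>)) * (f (real N * x) * indicator mid x)"
      proof (cases "x \<in> {0..1}")
        case x: True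
        show ?thesis
        proof (cases "x \<in> mid")
          case True
          have "r * (h (real N * x) + \<delta>) \<le> h x + \<delta>"
          proof -
            have "r * \<delta> \<le> 1 * \<delta>" by (rule mult_right_mono) (use r \<delta> in linarith)+
            then show ?thesis using h_self[of x] gap_nonneg[of x] by (simp add: distrib_left)
          qed
          moreover have "0 < r * (h (real N * x) + \<delta>)" using r h_nonneg[of "real N * x"] \<delta> by (intro mult_pos_pos) auto
          ultimately have "(h x + \<delta>) powr - \<epsilon> \<le> (r * (h (real N * x) + \<delta>)) powr - \<epsilon>" using e by (intro powr_mono2') auto
          also have "\<dots> = r powr - \<epsilon> * (h (real N * x) + \<delta>) powr - \<epsilon>"
            by (rule powr_mult)
          also have "r powr - \<epsilon> = real N powr (real M * \<epsilon>)"
            using N' by (simp add: powr_minus powr_divide powr_realpow[symmetric] powr_powr)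
          finally have "f x \<le> ennreal (real N powr (real M * \<epsilon>)) * f (real N * x)"
            unfolding f_def by (simp add: ennreal_mult'[symmetric] ennreal_leI)
          then show ?thesis using True x by (simp add: add_increasing)
        next
          case False
          then have "gap0 \<le> gap x" using x by (intro gap_ge) (auto simp: mid_def)
          then have "gap0 \<le> h x + \<delta>" using h_self[of x] h_nonneg[of "real N * x"] r \<delta> by (smt (verit) mult_nonneg_nonneg)
          then have "(h x + \<delta>) powr - \<epsilon> \<le> gap0 powr - \<epsilon>" using gap0_pos e by (intro powr_mono2') auto
          then show ?thesis using x False by (simp add: f_def ennreal_leI)
        qed
      qed simp
    qed
    also have "\<dots> = ennreal (gap0 powr - \<epsilon>) + ennreal (real N powr (real M * \<epsilon>)) * (\<integral>\<^sup>+x\<in>mid. f (real N * x) \<partial>lborel)"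
      by (simp add: nn_integral_add nn_integral_cmult nn_integral_cmult_indicator mid_def)
    also have "(\<integral>\<^sup>+x\<in>mid. f (real N * x) \<partial>lborel) \<le> ennreal ((real N - 2) / real N) * I"
    proof -
      have "(\<integral>\<^sup>+y\<in>{1..real N - 1}. f y \<partial>lborel) = ennreal (real N) * (\<integral>\<^sup>+x. f (0 + real N * x) * indicator {1..real N - 1} (0 + real N * x) \<partial>lborel)"
        using N' nn_integral_real_affine[of "\<lambda>y. f y * indicator {1..real N - 1} y" "real N" 0] by simp
      also have "(\<lambda>x. f (0 + real N * x) * indicator {1..real N - 1} (0 + real N * x)) = (\<lambda>x. f (real N * x) * indicator mid x)"
      proof
        fix x :: real
        have "0 + real N * x \<in> {1..real N - 1} \<longleftrightarrow> x \<in> mid" using N' by (auto simp: mid_def field_simps)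
        then show "f (0 + real N * x) * indicator {1..real N - 1} (0 + real N * x) = f (real N * x) * indicator mid x"
          by (auto split: split_indicator)
      qed
      finally have 1: "(\<integral>\<^sup>+y\<in>{1..real N - 1}. f y \<partial>lborel) = ennreal (real N) * (\<integral>\<^sup>+x\<in>mid. f (real N * x) \<partial>lborel)" .
      have "(\<integral>\<^sup>+y\<in>{1..real N - 1}. f y \<partial>lborel) \<le> of_nat (N - 2) * I"
        using nn_integral_cover[OF fb fper, of 1 "N - 2"] N by (simp add: I_def of_nat_diff)
      also have "of_nat (N - 2) = ennreal (real N - 2)" using N by (simp add: ennreal_of_nat_eq_real_of_nat of_nat_diff)
      finally have 2: "ennreal (real N) * (\<integral>\<^sup>+x\<in>mid. f (real N * x) \<partial>lborel) \<le> ennreal (real N - 2) * I" unfolding 1 .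
      have "(\<integral>\<^sup>+x\<in>mid. f (real N * x) \<partial>lborel) = ennreal (1 / real N) * (ennreal (real N) * (\<integral>\<^sup>+x\<in>mid. f (real N * x) \<partial>lborel))"
        using N' by (simp add: mult.assoc[symmetric] ennreal_mult[symmetric])
      also have "\<dots> \<le> ennreal (1 / real N) * (ennreal (real N - 2) * I)" by (intro mult_left_mono 2) auto
      also have "\<dots> = ennreal ((real N - 2) / real N) * I"
        using N' by (simp add: mult.assoc[symmetric] ennreal_mult[symmetric])
      finally show ?thesis .
    qed
    finally have "I \<le> ennreal (gap0 powr - \<epsilon>) + ennreal (real N powr (real M * \<epsilon>)) * (ennreal ((real N - 2) / real N) * I)"
      by (simp add: mult_left_mono add_left_mono)
    then have "ennreal i \<le> ennreal (gap0 powr - \<epsilon> + \<rho> * i)"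
      using N' i by (simp add: i(1) ennreal_mult[symmetric] ennreal_plus[symmetric] \<rho>_def del: ennreal_plus)
    then have "i \<le> gap0 powr - \<epsilon> + \<rho> * i" using i \<rho> by (subst (asm) ennreal_le_iff) (auto intro!: add_nonneg_nonneg)
    then have "i \<le> A" using \<rho> by (simp add: A_def field_simps)
    then show ?thesis using i(1) by (simp add: I_def f_def ennreal_leI)
  qed
  define d where "d m = inverse (real (Suc m))" for m
  have d: "d m > 0" for m by (simp add: d_def)
  have d0: "d \<longlonglongrightarrow> 0" unfolding d_def[abs_def] by (rule LIMSEQ_inverse_real_of_nat)
  have lim: "(\<lambda>m. ennreal ((h x + d m) powr - \<epsilon>)) \<longlonglongrightarrow> inv_pow \<epsilon> x" for x
  proof (cases "h x > 0")
    case True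
    have "(\<lambda>m. h x + d m) \<longlonglongrightarrow> h x + 0" by (intro tendsto_add tendsto_const d0)
    then have "(\<lambda>m. (h x + d m) powr - \<epsilon>) \<longlonglongrightarrow> h x powr - \<epsilon>" using True by (intro tendsto_powr tendsto_const) auto
    then show ?thesis using True by (simp add: inv_pow_def)
  next
    case False
    then have h0: "h x = 0" using h_nonneg[of x] by simp
    have eq: "(h x + d m) powr - \<epsilon> = real (Suc m) powr \<epsilon>" for m
      by (simp add: h0 d_def powr_minus inverse_powr del: of_nat_Suc)
    have "(\<lambda>m. ennreal (real (Suc m) powr \<epsilon>)) \<longlonglongrightarrow> \<infinity>"
      unfolding infinity_ennreal_def ennreal_tendsto_top_eq_at_top
    proof -
      have "filterlim (\<lambda>m. real (Suc m)) at_top sequentially"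
        by (rule filterlim_compose[OF filterlim_real_sequentially filterlim_Suc])
      then have "filterlim (\<lambda>m. exp (\<epsilon> * ln (real (Suc m)))) at_top sequentially"
        using e by (intro filterlim_compose[OF exp_at_top] filterlim_tendsto_pos_mult_at_top[OF tendsto_const]
          filterlim_compose[OF ln_at_top])
      then show "filterlim (\<lambda>m. real (Suc m) powr \<epsilon>) at_top sequentially"
        by (simp add: powr_def del: of_nat_Suc)
    qed
    moreover have "inv_pow \<epsilon> x = \<infinity>" by (simp add: inv_pow_def h0)
    ultimately show ?thesis unfolding eq by (simp only:)
  qed
  have "(\<integral>\<^sup>+x\<in>{0..1}. inv_pow \<epsilon> x \<partial>lborel) = (\<integral>\<^sup>+x. liminf (\<lambda>m. ennreal ((h x + d m) powr - \<epsilon>) * indicator {0..1} x) \<partial>lborel)"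
  proof (intro nn_integral_cong)
    fix x :: real
    have t: "(\<lambda>m. ennreal ((h x + d m) powr - \<epsilon>) * indicator {0..1} x) \<longlonglongrightarrow> inv_pow \<epsilon> x * indicator {0..1} x"
      using lim[of x] by (cases "x \<in> {0..1}") auto
    show "inv_pow \<epsilon> x * indicator {0..1} x = liminf (\<lambda>m. ennreal ((h x + d m) powr - \<epsilon>) * indicator {0..1} x)"
      using lim_imp_Liminf[OF _ t] by simp
  qed
  also have "\<dots> \<le> liminf (\<lambda>m. \<integral>\<^sup>+x\<in>{0..1}. ennreal ((h x + d m) powr - \<epsilon>) \<partial>lborel)"
    by (rule nn_integral_liminf) measurable
  also have "\<dots> \<le> ennreal A"
    by (rule order_trans[OF Liminf_mono[of _ "\<lambda>_. ennreal A"]]) (use bound d in \<open>auto simp: Liminf_const\<close>)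
  finally show ?thesis by (simp add: le_less_trans)
qed

lemma inv_pow_integral:
  assumes \<epsilon>: "small_exponent \<epsilon>"
  shows "(\<integral>\<^sup>+x\<in>{-1<..<1}. inv_pow \<epsilon> (x + 1 / 2) \<partial>lborel) < \<infinity>"
proof -
  have "(\<integral>\<^sup>+x\<in>{-1<..<1}. inv_pow \<epsilon> (x + 1 / 2) \<partial>lborel) = (\<integral>\<^sup>+x. inv_pow \<epsilon> (x + 1 / 2) * indicator {- 1 / 2<..<3 / 2} (x + 1 / 2) \<partial>lborel)"
    by (intro nn_integral_cong) (auto split: split_indicator)
  also have "\<dots> = (\<integral>\<^sup>+x\<in>{- 1 / 2<..<3 / 2}. inv_pow \<epsilon> x \<partial>lborel)"
    by (rule lborel_nn_integral_shift) measurable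
  also have "\<dots> \<le> (\<integral>\<^sup>+x\<in>{real_of_int (-1)..real_of_int (-1) + real 3}. inv_pow \<epsilon> x \<partial>lborel)"
    by (intro nn_integral_mono) (auto split: split_indicator)
  also have "\<dots> \<le> of_nat 3 * (\<integral>\<^sup>+x\<in>{0..1}. inv_pow \<epsilon> x \<partial>lborel)"
    by (rule nn_integral_cover[OF inv_pow_borel inv_pow_periodic])
  also have "\<dots> < \<infinity>" using inv_pow_integral_unit[OF \<epsilon>] by (simp add: ennreal_mult_less_top)
  finally show ?thesis .
qed

end

section \<open>The coefficient and its competitor\<close>

definition plateau :: "real \<Rightarrow> real" where
  "plateau x = step (8 * (5 / 8 - x)) * step (8 * (5 / 8 + x))"

lemma Ck_plateau: "Ck k plateau"
  unfolding plateau_def[abs_def]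
  by (rule Ck_mult[OF Ck_compose[OF Ck_step Ck_cmult[OF Ck_diff[OF Ck_const Ck_id]]]
        Ck_compose[OF Ck_step Ck_cmult[OF Ck_add[OF Ck_const Ck_id]]]])

lemma plateau_one: "\<bar>x\<bar> \<le> 1 / 2 \<Longrightarrow> plateau x = 1"
  by (simp add: plateau_def step_high)
lemma plateau_zero: "3 / 4 \<le> \<bar>x\<bar> \<Longrightarrow> plateau x = 0"
  by (cases "x > 0") (auto simp: plateau_def step_low)
lemma plateau_bounds: "0 \<le> plateau x" "plateau x \<le> 1"
  unfolding plateau_def by (intro mult_nonneg_nonneg step_nonneg mult_le_one step_le_1)+

lemma grad_step_quotient:
  fixes K :: "real^'n::finite \<Rightarrow> real"
  assumes K: "K \<in> C_on 1 UNIV" "\<And>x. K x > 0"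
  shows "partial l (\<lambda>x. step (x $ j / K x)) x
    = dstep (x $ j / K x) * ((if l = j then 1 else 0) / K x - x $ j * partial l K x / (K x)\<^sup>2)"
proof -
  have dK: "K differentiable at x" for x using C_on_diffble[of K 0] K by simp
  have inv: "(\<lambda>x. inverse (K x)) differentiable at x"
    using has_derivative_compose_real[OF dK inverse_has_deriv[OF less_imp_neq[OF K(2), symmetric]]] unfolding differentiable_def by blast
  have c: "(\<lambda>x. x $ j) differentiable at x" by (rule bounded_linear_imp_differentiable[OF bounded_linear_vec_nth])
  have q: "(\<lambda>x. x $ j * inverse (K x)) differentiable at x" by (rule differentiable_mult[OF c inv])
  have "partial l (\<lambda>x. step (x $ j * inverse (K x))) x = dstep (x $ j * inverse (K x)) * partial l (\<lambda>x. x $ j * inverse (K x)) x"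
    by (rule partial_compose[OF q step_deriv])
  also have "partial l (\<lambda>x. x $ j * inverse (K x)) x = x $ j * partial l (\<lambda>x. inverse (K x)) x + partial l (\<lambda>x. x $ j) x * inverse (K x)"
    by (rule partial_mult[OF c inv])
  also have "partial l (\<lambda>x. inverse (K x)) x = - (inverse (K x) * inverse (K x)) * partial l K x"
    using K(2)[of x] by (intro partial_compose[OF dK inverse_has_deriv]) simp
  finally show ?thesis by (simp add: partial_coord divide_inverse power2_eq_square algebra_simps)
qed

text \<open>The gradient of \<open>step (x\<^sub>j / K)\<close>. The convention \<open>1 / 0 = 0\<close> makes it vanish where \<open>K = 0\<close>.\<close>

definition quotient_grad :: "'n \<Rightarrow> (real^'n::finite \<Rightarrow> real) \<Rightarrow> real^'n \<Rightarrow> real^'n" where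
  "quotient_grad j K x = (\<chi> l. dstep (x $ j / K x) * ((if l = j then 1 else 0) / K x - x $ j * partial l K x / (K x)\<^sup>2))"

lemma quotient_grad_zero: "K x = 0 \<Longrightarrow> quotient_grad j K x = 0"
  by (simp add: quotient_grad_def vec_eq_iff)

lemma quotient_grad_outside: "K x \<le> \<bar>x $ j\<bar> \<Longrightarrow> 0 \<le> K x \<Longrightarrow> quotient_grad j K x = 0"
proof (cases "K x = 0")
  case False
  assume "K x \<le> \<bar>x $ j\<bar>" "0 \<le> K x"
  then have "1 \<le> \<bar>x $ j / K x\<bar>" using False by (simp add: abs_divide)
  then show ?thesis by (simp add: quotient_grad_def vec_eq_iff dstep_zero)
qed (simp add: quotient_grad_zero)

text \<open>The gradient lives where \<open>\<bar>x\<^sub>j\<bar> < K\<close> and is at most of size \<open>1 / K\<close> there. Writing \<open>1 / K = K powr - e * K powr (e - 1)\<close> trades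
most of the singularity for one in \<open>x\<^sub>j\<close>, which gives a bound that is monotone in \<open>K\<close>.\<close>

lemma quotient_grad_bound:
  fixes K :: "real^'n::finite \<Rightarrow> real"
  assumes K: "0 < K x" and p: "\<And>l. \<bar>partial l K x\<bar> \<le> C" and B: "\<And>y. dstep y \<le> B" and e: "0 < e" "e < 1" and xj: "x $ j \<noteq> 0"
  shows "norm (quotient_grad j K x) \<le> real CARD('n) * (B * (1 + C)) * (K x powr - e * \<bar>x $ j\<bar> powr (e - 1))"
proof (cases "K x \<le> \<bar>x $ j\<bar>")
  case True
  have "C \<ge> 0" using p[of undefined] by linarith
  moreover have "B \<ge> 0" using B[of 0] dstep_nonneg[of 0] by linarith
  ultimately show ?thesis using quotient_grad_outside[of K x j, OF True] K by simp
next
  case False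
  have C0: "C \<ge> 0" using p[of undefined] by linarith
  have B0: "B \<ge> 0" using B[of 0] dstep_nonneg[of 0] by linarith
  have le: "\<bar>quotient_grad j K x $ l\<bar> \<le> B * (1 + C) * (1 / K x)" for l
  proof -
    have "\<bar>(if l = j then 1 else 0) / K x - x $ j * partial l K x / (K x)\<^sup>2\<bar> \<le> 1 / K x + C * (1 / K x)"
    proof -
      have "\<bar>x $ j * partial l K x / (K x)\<^sup>2\<bar> = (\<bar>x $ j\<bar> / K x) * (\<bar>partial l K x\<bar> * (1 / K x))"
        using K by (simp add: abs_mult abs_divide power2_eq_square)
      also have "\<dots> \<le> 1 * (C * (1 / K x))"
        using False K p[of l] by (intro mult_mono) (auto simp: divide_le_eq divide_right_mono)
      finally have "\<bar>x $ j * partial l K x / (K x)\<^sup>2\<bar> \<le> C * (1 / K x)" by simp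
      moreover have "\<bar>(if l = j then 1 else 0) / K x\<bar> \<le> 1 / K x" using K by simp
      ultimately show ?thesis by linarith
    qed
    then have "\<bar>quotient_grad j K x $ l\<bar> \<le> B * (1 / K x + C * (1 / K x))"
      unfolding quotient_grad_def vec_lambda_beta abs_mult using B[of "x $ j / K x"] dstep_nonneg[of "x $ j / K x"] B0
      by (intro mult_mono) auto
    then show ?thesis by (simp add: algebra_simps add_divide_distrib)
  qed
  have "norm (quotient_grad j K x) \<le> (\<Sum>l\<in>UNIV. \<bar>quotient_grad j K x $ l\<bar>)" by (rule norm_le_l1_cart)
  also have "\<dots> \<le> (\<Sum>l\<in>(UNIV::'n set). B * (1 + C) * (1 / K x))" by (rule sum_mono) (rule le)
  also have "\<dots> = real CARD('n) * (B * (1 + C)) * (1 / K x)" by simp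
  also have "\<dots> \<le> real CARD('n) * (B * (1 + C)) * (K x powr - e * \<bar>x $ j\<bar> powr (e - 1))"
  proof (rule mult_left_mono)
    have "K x powr - e * K x powr (e - 1) = K x powr - 1" unfolding powr_add[symmetric] by simp
    then have "1 / K x = K x powr - e * K x powr (e - 1)" using K by (simp only: powr_minus_divide powr_one)
    also have "\<dots> \<le> K x powr - e * \<bar>x $ j\<bar> powr (e - 1)"
      using False xj e by (intro mult_left_mono powr_mono2') auto
    finally show "1 / K x \<le> K x powr - e * \<bar>x $ j\<bar> powr (e - 1)" .
    show "0 \<le> real CARD('n) * (B * (1 + C))" using B0 C0 by simp
  qed
  finally show ?thesis .
qed

locale barrier = digits N M for N M :: nat +
  fixes i j :: "'n::finite"
  assumes ij: "i \<noteq> j"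
begin

definition X :: "real^'n \<Rightarrow> real" where "X x = (\<Prod>l\<in>UNIV - {j}. plateau (x $ l))"

text \<open>Half the thickness of the layer in which the competitor climbs. The shift by \<open>1 / 2\<close> moves the zeros of \<open>\<eta>\<close> in \<open>[0, 1]\<close> into
\<open>[- 1 / 2, 1 / 2]\<close>. Near the lateral boundary of the cube the cut-off \<open>X\<close> makes the width constant, so that the boundary values are
the smooth function \<open>v\<close>.\<close>

definition width :: "(real \<Rightarrow> real) \<Rightarrow> real^'n \<Rightarrow> real" where
  "width \<eta> x = (1 / 2) * (1 - (1 - \<eta> (x $ i + 1 / 2)) * X x)"

lemma X_bounds: "0 \<le> X x" "X x \<le> 1"
  unfolding X_def by (intro prod_nonneg ballI plateau_bounds) (intro prod_le_1 conjI plateau_bounds)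

lemma X_C: "X \<in> C_on k UNIV"
  unfolding X_def[abs_def] by (intro C_on_prod C_on_compose_coord Ck_plateau) auto

lemma X_zero: "l \<noteq> j \<Longrightarrow> 3 / 4 \<le> \<bar>x $ l\<bar> \<Longrightarrow> X x = 0"
  unfolding X_def using plateau_zero by (intro prod_zero) auto

lemma X_one: "(\<And>l. l \<noteq> j \<Longrightarrow> \<bar>x $ l\<bar> \<le> 1 / 2) \<Longrightarrow> X x = 1"
  unfolding X_def using plateau_one by (intro prod.neutral) auto

lemma width_le: assumes "\<eta> (x $ i + 1 / 2) \<le> 1" shows "width \<eta> x \<le> 1 / 2"
  unfolding width_def using X_bounds[of x] assms by (simp add: mult_nonneg_nonneg)

lemma width_ge:
  assumes "\<eta> (x $ i + 1 / 2) \<le> 1" shows "\<eta> (x $ i + 1 / 2) / 2 \<le> width \<eta> x"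
proof -
  have "(1 - \<eta> (x $ i + 1 / 2)) * X x \<le> (1 - \<eta> (x $ i + 1 / 2)) * 1"
    using X_bounds[of x] assms by (intro mult_left_mono) auto
  then have "\<eta> (x $ i + 1 / 2) \<le> 1 - (1 - \<eta> (x $ i + 1 / 2)) * X x" by simp
  then show ?thesis unfolding width_def by simp
qed

lemma width_mono: "\<eta> (x $ i + 1 / 2) \<le> \<eta>' (x $ i + 1 / 2) \<Longrightarrow> width \<eta> x \<le> width \<eta>' x"
  unfolding width_def using X_bounds[of x] by (simp add: mult_right_mono)

lemma width_outside: "l \<noteq> j \<Longrightarrow> 3 / 4 \<le> \<bar>x $ l\<bar> \<Longrightarrow> width \<eta> x = 1 / 2"
  unfolding width_def using X_zero by simp

lemma width_C: "Ck k \<eta> \<Longrightarrow> width \<eta> \<in> C_on k UNIV"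
  unfolding width_def[abs_def]
  by (rule C_on_cmult[OF C_on_diff[OF C_on_const C_on_mult[OF C_on_diff[OF C_on_const
        C_on_compose[OF _ C_on_add[OF C_on_coord C_on_const]]] X_C]]])

lemma width_partial:
  assumes \<eta>: "\<And>y. (\<eta> has_real_derivative d\<eta> y) (at y)"
  shows "partial l (width \<eta>) x = (1 / 2) * ((if l = i then d\<eta> (x $ i + 1 / 2) else 0) * X x - (1 - \<eta> (x $ i + 1 / 2)) * partial l X x)"
proof -
  have c: "(\<lambda>x::real^'n. x $ i) differentiable at x" by (rule bounded_linear_imp_differentiable[OF bounded_linear_vec_nth])
  have s: "(\<lambda>x::real^'n. x $ i + 1 / 2) differentiable at x" by (rule differentiable_add[OF c differentiable_const])
  have e: "(\<lambda>x::real^'n. \<eta> (x $ i + 1 / 2)) differentiable at x"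
    using has_derivative_compose_real[OF s \<eta>] unfolding differentiable_def by blast
  have e1: "(\<lambda>x::real^'n. 1 - \<eta> (x $ i + 1 / 2)) differentiable at x" by (rule differentiable_diff[OF differentiable_const e])
  have X: "X differentiable at x" using C_on_diffble[of X 0] X_C by simp
  have p: "(\<lambda>x::real^'n. (1 - \<eta> (x $ i + 1 / 2)) * X x) differentiable at x" by (rule differentiable_mult[OF e1 X])
  have p1: "(\<lambda>x::real^'n. 1 - (1 - \<eta> (x $ i + 1 / 2)) * X x) differentiable at x" by (rule differentiable_diff[OF differentiable_const p])
  have pe: "partial l (\<lambda>x::real^'n. \<eta> (x $ i + 1 / 2)) x = d\<eta> (x $ i + 1 / 2) * (if l = i then 1 else 0)"
    using partial_compose[OF s \<eta>, of l] partial_add[OF c differentiable_const, of l "1 / 2"] by (simp add: partial_coord)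
  show ?thesis
    unfolding width_def[abs_def] partial_mult[OF differentiable_const p1] partial_diff[OF differentiable_const p]
      partial_mult[OF e1 X] partial_diff[OF differentiable_const e] pe
    by simp
qed

definition H :: "real^'n \<Rightarrow> real" where "H = width h"
definition Hm :: "nat \<Rightarrow> real^'n \<Rightarrow> real" where "Hm m = width (h_approx m)"

text \<open>For \<open>H \<ge> 0\<close> at most one summand is positive, and the sum is \<open>(\<bar>x\<^sub>j\<bar> - H)\<^sub>+\<^sup>\<alpha>\<close>. In this form it is a sum of powers of smooth functions.\<close>

definition coef :: "real \<Rightarrow> real^'n \<Rightarrow> real" where
  "coef \<alpha> x = pos_powr \<alpha> (x $ j - H x) + pos_powr \<alpha> (- 1 * x $ j - H x)"

definition U :: "real^'n \<Rightarrow> real" where "U x = step (x $ j / H x)"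
definition G :: "real^'n \<Rightarrow> real^'n" where "G = quotient_grad j H"
definition Um :: "nat \<Rightarrow> real^'n \<Rightarrow> real" where "Um m x = step (x $ j / Hm m x)"
definition v :: "real^'n \<Rightarrow> real" where "v x = step (2 * x $ j)"

lemma Hm_pos: "0 < Hm m x"
  using width_ge[of "h_approx m" x, OF h_approx_le_1[of m "x $ i + 1 / 2"]] h_approx_pos[of m "x $ i + 1 / 2"] by (simp add: Hm_def)

lemma H_ge: "h (x $ i + 1 / 2) / 2 \<le> H x" unfolding H_def by (rule width_ge[OF h_le_1])
lemma H_nonneg: "0 \<le> H x" using H_ge[of x] h_nonneg[of "x $ i + 1 / 2"] by linarith
lemma Hm_le: "Hm m x \<le> 1 / 2" unfolding Hm_def by (rule width_le[OF h_approx_le_1])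
lemma H_le_Hm: "H x \<le> Hm m x" unfolding H_def Hm_def by (rule width_mono[OF h_le_h_approx])

lemma H_C: "H \<in> C_on (M - 1) UNIV" unfolding H_def by (rule width_C[OF Ck_h])
lemma H_C1: "H \<in> C_on 1 UNIV" by (rule C_on_mono[OF H_C]) (use M in auto)
lemma Hm_C: "Hm m \<in> C_on k UNIV" unfolding Hm_def by (rule width_C[OF Ck_h_approx])
lemma v_C: "v \<in> C_on k UNIV" unfolding v_def[abs_def] by (rule C_on_compose[OF Ck_step C_on_cmult[OF C_on_coord]])

lemma Um_C: "Um m \<in> C_on k UNIV"
proof -
  have "(\<lambda>x. step (x $ j * inverse (Hm m x))) \<in> C_on k UNIV"
    by (rule C_on_compose[OF Ck_step C_on_mult[OF C_on_coord C_on_inverse[OF Hm_C]]]) (metis Hm_pos less_irrefl)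
  then show ?thesis by (simp add: Um_def[abs_def] divide_inverse)
qed

lemma grad_Um: "grad (Um m) x = quotient_grad j (Hm m) x"
  unfolding grad_def quotient_grad_def Um_def[abs_def]
  using grad_step_quotient[OF Hm_C Hm_pos] by (simp add: vec_eq_iff)

text \<open>Outside the cube of radius \<open>3 / 4\<close> either the width equals \<open>1 / 2\<close>, and the two functions coincide, or \<open>\<bar>x\<^sub>j\<bar>\<close> exceeds both widths,
and they are equal constants.\<close>

lemma Um_minus_v_test: "(\<lambda>x. Um m x - v x) \<in> test_functions cube"
proof -
  let ?K = "cbox (\<chi> l. - (3 / 4)) (\<chi> l. 3 / 4) :: (real^'n) set"
  have "Um m x - v x = 0" if "x \<notin> ?K" for x
  proof -
    have "\<not> (\<forall>l. - (3 / 4) \<le> x $ l \<and> x $ l \<le> 3 / 4)" using that by (simp add: mem_box_cart)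
    then obtain l where "\<not> (- (3 / 4) \<le> x $ l \<and> x $ l \<le> 3 / 4)" by blast
    then have l: "3 / 4 \<le> \<bar>x $ l\<bar>" by linarith
    show ?thesis
    proof (cases "l = j")
      case False
      then have w: "width (h_approx m) x = 1 / 2" using l by (rule width_outside)
      show ?thesis unfolding Um_def v_def Hm_def w by (simp add: mult.commute)
    next
      case True
      show ?thesis
      proof (cases "x $ j > 0")
        case pos: True
        then have "1 \<le> x $ j / Hm m x" "1 \<le> 2 * x $ j" using l True Hm_le[of m x] Hm_pos[of m x] by (auto simp: le_divide_eq)
        then show ?thesis by (simp add: Um_def v_def step_high)
      next
        case False
        then have "x $ j / Hm m x \<le> - 1" "2 * x $ j \<le> - 1" using l True Hm_le[of m x] Hm_pos[of m x] by (auto simp: divide_le_eq)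
        then show ?thesis by (simp add: Um_def v_def step_low)
      qed
    qed
  qed
  moreover have "?K \<subseteq> cube"
  proof
    fix x assume "x \<in> ?K"
    then have le: "- (3 / 4) \<le> x $ l \<and> x $ l \<le> 3 / 4" for l by (simp add: mem_box_cart)
    have "- 1 < x $ l \<and> x $ l < 1" for l using le[of l] by linarith
    then show "x \<in> cube" by (simp add: cube_def)
  qed
  moreover have "(\<lambda>x. Um m x - v x) \<in> C_on k UNIV" for k by (rule C_on_diff[OF Um_C v_C])
  ultimately show ?thesis unfolding test_functions_def by (auto intro!: exI[of _ ?K])
qed

lemma coef_nonneg: "0 \<le> coef \<alpha> x" by (simp add: coef_def pos_powr_def)

text \<open>The competitor climbs only where the coefficient vanishes.\<close>

lemma coef_G: "0 < \<alpha> \<Longrightarrow> coef \<alpha> x = 0 \<or> G x = 0"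
proof (cases "H x \<le> \<bar>x $ j\<bar>")
  case True
  then show ?thesis unfolding G_def using quotient_grad_outside[of H x j, OF True H_nonneg] by simp
next
  case False
  then show ?thesis by (simp add: coef_def pos_powr_def)
qed

lemma coef_ge:
  assumes "0 < \<alpha>" "H x \<le> \<bar>x $ j\<bar> / 2"
  shows "(\<bar>x $ j\<bar> / 2) powr \<alpha> \<le> coef \<alpha> x"
proof (cases "x $ j \<ge> 0")
  case True
  then have "(\<bar>x $ j\<bar> / 2) powr \<alpha> \<le> pos_powr \<alpha> (x $ j - H x)"
    unfolding pos_powr_def using assms by (intro powr_mono2) auto
  then show ?thesis unfolding coef_def by (simp add: pos_powr_def add_increasing2)
next
  case False
  then have "(\<bar>x $ j\<bar> / 2) powr \<alpha> \<le> pos_powr \<alpha> (- 1 * x $ j - H x)"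
    unfolding pos_powr_def using assms by (intro powr_mono2) auto
  then show ?thesis unfolding coef_def by (simp add: pos_powr_def add_increasing)
qed

lemma coef_le: assumes "0 < \<alpha>" "x \<in> cube" shows "coef \<alpha> x \<le> 2"
proof -
  have "pos_powr \<alpha> y \<le> 1" if "y \<le> 1" for y
    unfolding pos_powr_def using that assms(1) powr_mono2[of \<alpha> "max 0 y" 1] by auto
  moreover have "x $ j - H x \<le> 1" "- 1 * x $ j - H x \<le> 1" using assms(2) H_nonneg[of x] by (auto simp: cube_def) (smt (verit))+
  ultimately show ?thesis unfolding coef_def by (smt (verit))
qed

lemma coef_continuous: "0 < \<alpha> \<Longrightarrow> continuous_on UNIV (coef \<alpha>)"
  unfolding coef_def[abs_def] pos_powr_def
  using C_on_continuous[OF H_C]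
  by (intro continuous_on_add continuous_on_powr' continuous_on_max continuous_on_const continuous_on_diff
        continuous_on_component continuous_on_id continuous_on_mult_left) auto

lemma coef_holder:
  assumes "M = k + 2" "0 < \<beta>" "\<beta> \<le> 1" "real k + \<beta> = \<alpha>"
  shows "coef \<alpha> \<in> holder_class \<alpha> cube"
proof -
  have H: "H \<in> C_on (Suc k) UNIV" using H_C assms(1) by simp
  note c = bounded_cube convex_cube assms(2,3)
  have "C_holder k \<beta> cube (\<lambda>x. pos_powr (real k + \<beta>) (x $ j - H x) + pos_powr (real k + \<beta>) (- 1 * x $ j - H x))"
    by (rule C_holder_add[OF c C_holder_pos_powr[OF c C_on_diff[OF C_on_coord H]] C_holder_pos_powr[OF c C_on_diff[OF C_on_cmult[OF C_on_coord] H]]])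
  then have "coef \<alpha> \<in> holder_closure k \<beta> cube"
    by (intro C_holder_holder_closure) (simp add: coef_def[abs_def] assms(4))
  then show ?thesis using assms unfolding holder_class_def by blast
qed

section \<open>Domination of the gradients\<close>

definition weight :: "real \<Rightarrow> real \<Rightarrow> real^'n \<Rightarrow> ennreal" where
  "weight \<epsilon> \<sigma> x = inv_pow \<epsilon> (x $ i + 1 / 2) * ennreal (\<bar>x $ j\<bar> powr - \<sigma>)"

lemma vec_nth_borel [measurable]: "(\<lambda>x::real^'n. x $ l) \<in> borel_measurable borel"
  by (intro borel_measurable_continuous_onI continuous_on_component continuous_on_id)

lemma weight_borel [measurable]: "weight \<epsilon> \<sigma> \<in> borel_measurable borel"
  unfolding weight_def[abs_def] by measurable

lemma abs_powr_integral:
  assumes "\<sigma> < 1" shows "(\<integral>\<^sup>+t\<in>{-1<..<1}. ennreal (\<bar>t\<bar> powr - \<sigma>) \<partial>lborel) < \<infinity>"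
proof -
  have "((\<lambda>x. x powr - \<sigma>) has_integral (1 powr (- \<sigma> + 1) / (- \<sigma> + 1))) {0..1::real}"
    using assms by (intro has_integral_powr_from_0) auto
  then have "(\<integral>\<^sup>+t\<in>{0..1}. ennreal (t powr - \<sigma>) \<partial>lborel) = ennreal (1 powr (- \<sigma> + 1) / (- \<sigma> + 1))"
    by (intro nn_integral_has_integral_lebesgue') auto
  then have 1: "(\<integral>\<^sup>+t\<in>{0..1}. ennreal (\<bar>t\<bar> powr - \<sigma>) \<partial>lborel) < \<infinity>"
    by (subst nn_integral_cong[where v = "\<lambda>t. ennreal (t powr - \<sigma>) * indicator {0..1} t"]) (auto split: split_indicator)
  have "(\<integral>\<^sup>+t\<in>{-1..0}. ennreal (\<bar>t\<bar> powr - \<sigma>) \<partial>lborel) = (\<integral>\<^sup>+t. ennreal (\<bar>0 + (-1) * t\<bar> powr - \<sigma>) * indicator {-1..0} (0 + (-1) * t) \<partial>lborel)"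
    using nn_integral_real_affine[of "\<lambda>t. ennreal (\<bar>t\<bar> powr - \<sigma>) * indicator {-1..0} t" "-1" 0] by simp
  also have "\<dots> = (\<integral>\<^sup>+t\<in>{0..1}. ennreal (\<bar>t\<bar> powr - \<sigma>) \<partial>lborel)"
    by (intro nn_integral_cong) (auto split: split_indicator)
  finally have 2: "(\<integral>\<^sup>+t\<in>{-1..0}. ennreal (\<bar>t\<bar> powr - \<sigma>) \<partial>lborel) < \<infinity>" using 1 by simp
  have "(\<integral>\<^sup>+t\<in>{-1<..<1}. ennreal (\<bar>t\<bar> powr - \<sigma>) \<partial>lborel)
     \<le> (\<integral>\<^sup>+t. ennreal (\<bar>t\<bar> powr - \<sigma>) * indicator {-1..0} t + ennreal (\<bar>t\<bar> powr - \<sigma>) * indicator {0..1} t \<partial>lborel)"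
    by (intro nn_integral_mono) (auto split: split_indicator)
  also have "\<dots> = (\<integral>\<^sup>+t\<in>{-1..0}. ennreal (\<bar>t\<bar> powr - \<sigma>) \<partial>lborel) + (\<integral>\<^sup>+t\<in>{0..1}. ennreal (\<bar>t\<bar> powr - \<sigma>) \<partial>lborel)"
    by (rule nn_integral_add) measurable
  also have "\<dots> < \<infinity>" using 1 2 by simp
  finally show ?thesis .
qed

text \<open>The two factors depend on different coordinates, so slicing in the directions \<open>j\<close> and \<open>i\<close> separates them.\<close>

lemma weight_integral:
  assumes "small_exponent \<epsilon>" "\<sigma> < 1"
  shows "(\<integral>\<^sup>+x\<in>cube. weight \<epsilon> \<sigma> x \<partial>lborel) < \<infinity>"
proof -
  define c where "c = (\<integral>\<^sup>+t\<in>{-1<..<1}. ennreal (\<bar>t\<bar> powr - \<sigma>) \<partial>lborel)"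
  have c: "c < \<infinity>" unfolding c_def by (rule abs_powr_integral[OF assms(2)])
  have "(\<integral>\<^sup>+x\<in>cube. weight \<epsilon> \<sigma> x \<partial>lborel) \<le> (\<integral>\<^sup>+x\<in>cube. c * inv_pow \<epsilon> (x $ i + 1 / 2) \<partial>lborel)"
  proof (rule nn_integral_cube_slice_le[of _ j])
    fix x :: "real^'n"
    have "(\<integral>\<^sup>+t\<in>{-1<..<1}. weight \<epsilon> \<sigma> (upd j t x) \<partial>lborel) = (\<integral>\<^sup>+t. inv_pow \<epsilon> (x $ i + 1 / 2) * (ennreal (\<bar>t\<bar> powr - \<sigma>) * indicator {-1<..<1} t) \<partial>lborel)"
      unfolding weight_def using ij by (simp add: upd_nth mult.assoc)
    also have "\<dots> = inv_pow \<epsilon> (x $ i + 1 / 2) * c" unfolding c_def by (rule nn_integral_cmult) measurable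
    finally show "(\<integral>\<^sup>+t\<in>{-1<..<1}. weight \<epsilon> \<sigma> (upd j t x) \<partial>lborel) \<le> c * inv_pow \<epsilon> (x $ i + 1 / 2)"
      by (simp add: mult.commute)
  qed measurable
  also have "\<dots> \<le> (\<integral>\<^sup>+x\<in>(cube :: (real^'n) set). c * (\<integral>\<^sup>+t\<in>{-1<..<1}. inv_pow \<epsilon> (t + 1 / 2) \<partial>lborel) \<partial>lborel)"
  proof (rule nn_integral_cube_slice_le[of _ i])
    fix x :: "real^'n"
    have "(\<integral>\<^sup>+t\<in>{-1<..<1}. c * inv_pow \<epsilon> (upd i t x $ i + 1 / 2) \<partial>lborel) = (\<integral>\<^sup>+t. c * (inv_pow \<epsilon> (t + 1 / 2) * indicator {-1<..<1} t) \<partial>lborel)"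
      by (simp add: upd_nth mult.assoc)
    also have "\<dots> = c * (\<integral>\<^sup>+t\<in>{-1<..<1}. inv_pow \<epsilon> (t + 1 / 2) \<partial>lborel)" by (rule nn_integral_cmult) measurable
    finally show "(\<integral>\<^sup>+t\<in>{-1<..<1}. c * inv_pow \<epsilon> (upd i t x $ i + 1 / 2) \<partial>lborel) \<le> c * (\<integral>\<^sup>+t\<in>{-1<..<1}. inv_pow \<epsilon> (t + 1 / 2) \<partial>lborel)"
      by simp
  qed measurable
  also have "\<dots> = c * (\<integral>\<^sup>+t\<in>{-1<..<1}. inv_pow \<epsilon> (t + 1 / 2) \<partial>lborel) * emeasure lborel (cube :: (real^'n) set)"
    by (rule nn_integral_cmult_indicator) simp
  also have "\<dots> < \<infinity>" using c inv_pow_integral[OF assms(1)] emeasure_cube_finite[where 'n='n] by (simp add: ennreal_mult_less_top)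
  finally show ?thesis .
qed

text \<open>Where \<open>weight \<epsilon> 0\<close> is finite, \<open>h\<close> is positive.\<close>

lemma AE_good: "AE x in lborel. x \<in> cube \<longrightarrow> 0 < h (x $ i + 1 / 2) \<and> x $ j \<noteq> 0"
proof -
  obtain \<epsilon> where \<epsilon>: "small_exponent \<epsilon>" using ex_small_exponent by blast
  have "(\<integral>\<^sup>+x\<in>(cube :: (real^'n) set). weight \<epsilon> 0 x \<partial>lborel) < \<infinity>" by (rule weight_integral[OF \<epsilon>]) simp
  then have "AE x in lborel. weight \<epsilon> 0 x * indicator cube x \<noteq> \<infinity>"
    by (intro nn_integral_PInf_AE) auto
  moreover have "AE x in lborel. x \<in> cube \<longrightarrow> x $ j \<noteq> (0::real)"
  proof -
    have "(\<integral>\<^sup>+x\<in>(cube :: (real^'n) set). indicator {0} (x $ j) \<partial>lborel) \<le> (\<integral>\<^sup>+x\<in>(cube :: (real^'n) set). 0 \<partial>lborel)"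
    proof (rule nn_integral_cube_slice_le[of _ j])
      fix x :: "real^'n"
      have "(\<integral>\<^sup>+t\<in>{-1<..<1}. indicator {0} (upd j t x $ j) \<partial>lborel) = (\<integral>\<^sup>+t. indicator {0::real} t \<partial>lborel)"
        by (intro nn_integral_cong) (auto simp: upd_nth split: split_indicator)
      then show "(\<integral>\<^sup>+t\<in>{-1<..<1}. indicator {0} (upd j t x $ j) \<partial>lborel) \<le> 0" by simp
    qed measurable
    then have "(\<integral>\<^sup>+x. indicator {0} (x $ j) * indicator (cube :: (real^'n) set) x \<partial>lborel) = 0" by simp
    then have "AE x in lborel. indicator {0} (x $ j) * indicator (cube :: (real^'n) set) x = (0 :: ennreal)"
      by (subst (asm) nn_integral_0_iff_AE) auto
    then show ?thesis by eventually_elim (auto split: split_indicator_asm)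
  qed
  ultimately show ?thesis
  proof eventually_elim
    case (elim x)
    show ?case
    proof
      assume x: "x \<in> cube"
      have "0 < h (x $ i + 1 / 2)"
      proof (rule ccontr)
        assume "\<not> ?thesis"
        then show False using elim x by (simp add: weight_def inv_pow_def)
      qed
      then show "0 < h (x $ i + 1 / 2) \<and> x $ j \<noteq> 0" using elim x by simp
    qed
  qed
qed

lemma partial_bounds: "\<exists>C. \<forall>m. \<forall>x\<in>cube. \<forall>l. \<bar>partial l (Hm m) x\<bar> \<le> C \<and> \<bar>partial l H x\<bar> \<le> C"
proof -
  obtain B where B: "\<And>x l. x \<in> cube \<Longrightarrow> \<bar>partial l X x\<bar> \<le> B"
    using C1_bounded_partials[OF X_C bounded_cube] by blast
  obtain K where K: "K > 0" "\<And>m x. \<bar>dh_approx m x\<bar> \<le> K" "\<And>x. \<bar>dh x\<bar> \<le> K" using dh_approx_bound by blast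
  have *: "\<bar>(1 / 2) * ((if l = i then d else 0) * X x - (1 - e) * partial l X x)\<bar> \<le> K + B"
    if "\<bar>d\<bar> \<le> K" "0 \<le> e" "e \<le> 1" "x \<in> cube" for l d e x
  proof -
    have "\<bar>(if l = i then d else 0) * X x\<bar> \<le> K * 1"
      unfolding abs_mult using that X_bounds[of x] K by (intro mult_mono) auto
    moreover have "\<bar>(1 - e) * partial l X x\<bar> \<le> 1 * B"
      unfolding abs_mult using that B[OF that(4), of l] by (intro mult_mono) auto
    moreover have "\<bar>(1 / 2) * (p - p')\<bar> \<le> s + t" if "\<bar>p\<bar> \<le> s * 1" "\<bar>p'\<bar> \<le> 1 * t" for p p' s t :: real
    proof -
      have "\<bar>p - p'\<bar> \<le> s + t" using that by linarith
      then show ?thesis by (simp add: abs_mult)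
    qed
    ultimately show ?thesis by blast
  qed
  show ?thesis
  proof (intro exI allI ballI conjI)
    fix m l and x :: "real^'n" assume x: "x \<in> cube"
    show "\<bar>partial l (Hm m) x\<bar> \<le> K + B"
      unfolding Hm_def width_partial[OF h_approx_has_deriv] by (rule *[OF K(2) less_imp_le[OF h_approx_pos] h_approx_le_1 x])
    show "\<bar>partial l H x\<bar> \<le> K + B"
      unfolding H_def width_partial[OF h_has_deriv] by (rule *[OF K(3) h_nonneg h_le_1 x])
  qed
qed

lemma gradient_domination:
  "\<exists>C\<ge>0. \<forall>(e::real) x. 0 < e \<longrightarrow> e < 1 \<longrightarrow> x \<in> cube \<longrightarrow> 0 < h (x $ i + 1 / 2) \<longrightarrow> x $ j \<noteq> 0 \<longrightarrow>
     norm (G x) \<le> C * (h (x $ i + 1 / 2) powr - e * \<bar>x $ j\<bar> powr (e - 1)) \<and>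
     (\<forall>m. norm (grad (Um m) x) \<le> C * (h (x $ i + 1 / 2) powr - e * \<bar>x $ j\<bar> powr (e - 1)))"
proof -
  obtain C where C: "\<And>m x l. x \<in> cube \<Longrightarrow> \<bar>partial l (Hm m) x\<bar> \<le> C" "\<And>x l. x \<in> cube \<Longrightarrow> \<bar>partial l H x\<bar> \<le> C"
    using partial_bounds by blast
  obtain B where B: "B > 0" "\<And>y. dstep y \<le> B" using dstep_bounded by blast
  have "(0::real^'n) \<in> cube" by (simp add: cube_def)
  from C(2)[OF this, of undefined] have C0: "C \<ge> 0" by linarith
  define D where "D = real CARD('n) * (B * (1 + C)) * 2"
  have D: "0 \<le> D" using B C0 by (simp add: D_def)
  have *: "norm (quotient_grad j K x) \<le> D * (h (x $ i + 1 / 2) powr - e * \<bar>x $ j\<bar> powr (e - 1))"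
    if K: "h (x $ i + 1 / 2) / 2 \<le> K x" "\<And>l. \<bar>partial l K x\<bar> \<le> C" and e: "0 < e" "e < 1" and x: "0 < h (x $ i + 1 / 2)" "x $ j \<noteq> 0" for K :: "real^'n \<Rightarrow> real" and e :: real and x
  proof -
    have "0 < K x" using K(1) x(1) by linarith
    from quotient_grad_bound[OF this K(2) B(2) e x(2)]
    have 1: "norm (quotient_grad j K x) \<le> real CARD('n) * (B * (1 + C)) * (K x powr - e * \<bar>x $ j\<bar> powr (e - 1))" .
    have "K x powr - e \<le> (h (x $ i + 1 / 2) / 2) powr - e" using K x e by (intro powr_mono2') auto
    also have "\<dots> = h (x $ i + 1 / 2) powr - e * 2 powr e" by (simp add: powr_divide powr_minus_divide)
    also have "\<dots> \<le> h (x $ i + 1 / 2) powr - e * 2" using e powr_mono[of e 1 2] by (intro mult_left_mono) auto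
    finally have "K x powr - e * \<bar>x $ j\<bar> powr (e - 1) \<le> (h (x $ i + 1 / 2) powr - e * 2) * \<bar>x $ j\<bar> powr (e - 1)"
      by (rule mult_right_mono) simp
    from mult_left_mono[OF this, of "real CARD('n) * (B * (1 + C))"] B C0
    have "real CARD('n) * (B * (1 + C)) * (K x powr - e * \<bar>x $ j\<bar> powr (e - 1))
      \<le> real CARD('n) * (B * (1 + C)) * ((h (x $ i + 1 / 2) powr - e * 2) * \<bar>x $ j\<bar> powr (e - 1))" by simp
    also have "\<dots> = D * (h (x $ i + 1 / 2) powr - e * \<bar>x $ j\<bar> powr (e - 1))" by (simp add: D_def)
    finally show ?thesis by (rule order_trans[OF 1])
  qed
  show ?thesis
  proof (intro exI[of _ D] conjI D allI impI)
    fix e :: real and x assume e: "0 < e" "e < 1" and x: "x \<in> cube" "0 < h (x $ i + 1 / 2)" "x $ j \<noteq> 0"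
    show "norm (G x) \<le> D * (h (x $ i + 1 / 2) powr - e * \<bar>x $ j\<bar> powr (e - 1))"
      unfolding G_def by (rule *[OF H_ge C(2)[OF x(1)] e x(2,3)])
    fix m
    show "norm (grad (Um m) x) \<le> D * (h (x $ i + 1 / 2) powr - e * \<bar>x $ j\<bar> powr (e - 1))"
      unfolding grad_Um by (rule *[OF order_trans[OF H_ge H_le_Hm] C(1)[OF x(1)] e x(2,3)])
  qed
qed

end

section \<open>Divergence-free flows through the contact points\<close>

lemma upd_same: "upd l (x $ l) x = x" by (simp add: upd_def)

lemma partial_slice_deriv:
  fixes f :: "real^'n::finite \<Rightarrow> real"
  assumes "f differentiable at x"
  shows "((\<lambda>s. f (upd l s x)) has_real_derivative partial l f x) (at (x $ l))"
proof -
  have f: "(f has_derivative frechet_derivative f (at x)) (at (upd l (x $ l) x))"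
    using assms by (simp add: upd_same frechet_derivative_works)
  have "((\<lambda>s. upd l s x) has_derivative (\<lambda>t. t *\<^sub>R axis l 1)) (at (x $ l))"
    unfolding upd_def by (auto intro!: derivative_eq_intros)
  from has_derivative_compose[OF this f]
  have "((\<lambda>s. f (upd l s x)) has_derivative (\<lambda>t. frechet_derivative f (at x) (t *\<^sub>R axis l 1))) (at (x $ l))" .
  moreover have "(\<lambda>t. frechet_derivative f (at x) (t *\<^sub>R axis l 1)) = (*) (partial l f x)"
    using linear_scale[OF has_derivative_linear[OF f]] by (intro ext) (simp add: partial_def)
  ultimately show ?thesis by (simp add: has_field_derivative_def)
qed

lemma partial_slice_eq:
  fixes f :: "real^'n::finite \<Rightarrow> real"
  assumes "f differentiable at x" "((\<lambda>s. f (upd l s x)) has_real_derivative d) (at (x $ l))"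
  shows "partial l f x = d"
  using DERIV_unique[OF partial_slice_deriv[OF assms(1)] assms(2)] .

text \<open>A smooth substitute for \<open>\<bar>t\<bar>\<close> that stays away from zero.\<close>

definition radius :: "real \<Rightarrow> real \<Rightarrow> real" where "radius \<delta> t = sqrt (t\<^sup>2 + \<delta>\<^sup>2)"

lemma radius_pos: "\<delta> > 0 \<Longrightarrow> radius \<delta> t > 0"
  unfolding radius_def by (simp add: add_nonneg_pos)

lemma radius_deriv: "\<delta> > 0 \<Longrightarrow> (radius \<delta> has_real_derivative (t * inverse (radius \<delta> t))) (at t)"
proof -
  assume d: "\<delta> > 0"
  have p: "t\<^sup>2 + \<delta>\<^sup>2 > 0" using d by (simp add: add_nonneg_pos)
  have "((\<lambda>t. sqrt (t\<^sup>2 + \<delta>\<^sup>2)) has_real_derivative inverse (sqrt (t\<^sup>2 + \<delta>\<^sup>2)) / 2 * (2 * t)) (at t)"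
    by (rule DERIV_chain2[where f = sqrt and g = "\<lambda>t. t\<^sup>2 + \<delta>\<^sup>2", OF DERIV_real_sqrt[OF p]]) (auto intro!: derivative_eq_intros)
  then show ?thesis unfolding radius_def[abs_def] by (simp add: mult.commute)
qed

lemma Ck_radius: "\<delta> > 0 \<Longrightarrow> Ck k (radius \<delta>)"
proof (induction k)
  case 0
  then show ?case unfolding Ck_0 by (simp add: continuous_at_imp_continuous_on DERIV_isCont[OF radius_deriv])
next
  case (Suc k)
  have "Ck k (\<lambda>t. t * inverse (radius \<delta> t))"
    by (rule Ck_mult[OF Ck_id Ck_inverse[OF Suc.IH[OF Suc.prems]]]) (metis radius_pos[OF Suc.prems] less_irrefl)
  then show ?case by (rule Ck_SucI[OF radius_deriv[OF Suc.prems]])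
qed

lemma radius_ge: "\<bar>t\<bar> \<le> radius \<delta> t"
  unfolding radius_def by (rule real_le_rsqrt) simp

lemma radius_le: "0 \<le> \<delta> \<Longrightarrow> \<delta> \<le> b \<Longrightarrow> \<bar>t\<bar> \<le> b \<Longrightarrow> radius \<delta> t \<le> 2 * b"
proof -
  assume a: "0 \<le> \<delta>" "\<delta> \<le> b" "\<bar>t\<bar> \<le> b"
  have "t\<^sup>2 \<le> b\<^sup>2" using a by (simp add: abs_le_square_iff[symmetric])
  moreover have "\<delta>\<^sup>2 \<le> b\<^sup>2" using a by (intro power_mono) auto
  ultimately have "t\<^sup>2 + \<delta>\<^sup>2 \<le> (2 * b)\<^sup>2" by (simp add: power_mult_distrib) (smt (verit) zero_le_power2)
  then show ?thesis unfolding radius_def using a by (intro real_le_lsqrt) auto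
qed

definition cap :: "real \<Rightarrow> real \<Rightarrow> real" where "cap \<kappa> z = ramp (\<kappa>\<^sup>2 - z\<^sup>2)"

lemma Ck_cap: "Ck k (cap \<kappa>)"
proof -
  have "Ck k (\<lambda>z. ramp (\<kappa>\<^sup>2 - z * z))" by (rule Ck_compose[OF Ck_ramp Ck_diff[OF Ck_const Ck_mult[OF Ck_id Ck_id]]])
  then show ?thesis by (simp add: cap_def[abs_def] power2_eq_square)
qed

lemma cap_bounds: "0 \<le> cap \<kappa> z" "cap \<kappa> z \<le> 1" by (simp_all add: cap_def ramp_nonneg ramp_le_1)

lemma cap_support: "0 \<le> \<kappa> \<Longrightarrow> cap \<kappa> z \<noteq> 0 \<Longrightarrow> \<bar>z\<bar> < \<kappa>"
proof (rule ccontr)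
  assume "0 \<le> \<kappa>" "cap \<kappa> z \<noteq> 0" "\<not> \<bar>z\<bar> < \<kappa>"
  then have "\<kappa>\<^sup>2 \<le> z\<^sup>2" by (simp add: abs_le_square_iff[symmetric])
  with \<open>cap \<kappa> z \<noteq> 0\<close> show False by (simp add: cap_def ramp_zero)
qed

lemma cap_borel [measurable]: "cap \<kappa> \<in> borel_measurable borel"
  by (rule borel_measurable_continuous_onI[OF Ck_continuous[OF Ck_cap[of 0]]])

definition mass :: "real \<Rightarrow> ennreal" where "mass \<kappa> = (\<integral>\<^sup>+z. ennreal (cap \<kappa> z) \<partial>lborel)"

lemma mass_finite: assumes "0 < \<kappa>" shows "mass \<kappa> < \<infinity>"
proof -
  have "mass \<kappa> \<le> (\<integral>\<^sup>+z. indicator {- \<kappa>..\<kappa>} z \<partial>lborel)"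
    unfolding mass_def
  proof (rule nn_integral_mono)
    fix z show "ennreal (cap \<kappa> z) \<le> indicator {- \<kappa>..\<kappa>} z"
      using cap_support[of \<kappa> z] assms cap_bounds[of \<kappa> z] by (cases "cap \<kappa> z = 0") (auto simp: abs_less_iff)
  qed
  also have "\<dots> < \<infinity>" using assms by simp
  finally show ?thesis .
qed

text \<open>The slices of the flow through a contact point all carry the same mass.\<close>

lemma mass_scaled: assumes "0 < R" shows "(\<integral>\<^sup>+t. ennreal (cap \<kappa> ((t + b) * inverse R) * inverse R) \<partial>lborel) = mass \<kappa>"
proof -
  have "mass \<kappa> = ennreal (inverse R) * (\<integral>\<^sup>+t. ennreal (cap \<kappa> (b * inverse R + inverse R * t)) \<partial>lborel)"
    unfolding mass_def using assms nn_integral_real_affine[of "\<lambda>z. ennreal (cap \<kappa> z)" "inverse R" "b * inverse R"] by simp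
  also have "\<dots> = (\<integral>\<^sup>+t. ennreal (inverse R) * ennreal (cap \<kappa> (b * inverse R + inverse R * t)) \<partial>lborel)"
    by (rule nn_integral_cmult[symmetric]) measurable
  also have "\<dots> = (\<integral>\<^sup>+t. ennreal (cap \<kappa> ((t + b) * inverse R) * inverse R) \<partial>lborel)"
    using assms cap_bounds by (intro nn_integral_cong) (simp add: ennreal_mult[symmetric] algebra_simps)
  finally show ?thesis ..
qed

text \<open>If \<open>g > y\<close> then \<open>g = g powr q * g powr (1 - q) \<le> g powr q * y powr (1 - q)\<close>.\<close>

lemma young_split:
  fixes g y q :: real
  assumes "0 \<le> g" "0 < y" "1 < q" shows "g \<le> y + g powr q * y powr (1 - q)"
proof (cases "g \<le> y")
  case False
  then have g: "0 < g" "y \<le> g" using assms by auto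
  have "g = g powr q * g powr (1 - q)" unfolding powr_add[symmetric] using g by simp
  also have "\<dots> \<le> g powr q * y powr (1 - q)" using g assms by (intro mult_left_mono powr_mono2') auto
  finally show ?thesis using assms by linarith
qed (use assms in \<open>simp add: add_increasing2\<close>)

context barrier begin

text \<open>A cut-off in the directions other than \<open>i\<close> and \<open>j\<close>. It is constant along the flow and so does not affect the divergence.\<close>

definition Y :: "real^'n \<Rightarrow> real" where "Y x = (\<Prod>l\<in>UNIV - {i, j}. cap (1 / 2) (x $ l))"

lemma Y_bounds: "0 \<le> Y x" "Y x \<le> 1"
  unfolding Y_def by (intro prod_nonneg ballI cap_bounds) (intro prod_le_1 conjI cap_bounds)

lemma Y_C: "Y \<in> C_on k UNIV"
  unfolding Y_def[abs_def] by (intro C_on_prod C_on_compose_coord Ck_cap) auto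

lemma Y_upd: "l = i \<or> l = j \<Longrightarrow> Y (upd l t x) = Y x"
  unfolding Y_def by (intro prod.cong) (auto simp: upd_nth)

lemma Y_support: "Y x \<noteq> 0 \<Longrightarrow> l \<noteq> i \<Longrightarrow> l \<noteq> j \<Longrightarrow> \<bar>x $ l\<bar> \<le> 1 / 2"
proof -
  assume a: "Y x \<noteq> 0" "l \<noteq> i" "l \<noteq> j"
  then have "cap (1 / 2) (x $ l) \<noteq> 0" unfolding Y_def by (auto simp: prod_zero_iff)
  then show ?thesis using cap_support[of "1 / 2" "x $ l"] by simp
qed

lemma Y_partial: "l = i \<or> l = j \<Longrightarrow> partial l Y x = 0"
  using C_on_diffble[of Y 0 x] Y_C by (intro partial_slice_eq) (simp_all add: Y_upd)

lemma Y_borel [measurable]: "Y \<in> borel_measurable borel"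
  by (rule continuous_borel[OF C_on_continuous[OF Y_C[of 0]]])

context
  fixes \<kappa> \<delta> c :: real
  assumes \<kappa>: "0 < \<kappa>" "\<kappa> \<le> 1" and \<delta>: "0 < \<delta>"
begin

definition ray :: "real^'n \<Rightarrow> real" where "ray x = (x $ i + (1 / 2 - c)) * inverse (radius \<delta> (x $ j))"
definition flow2 :: "real^'n \<Rightarrow> real" where "flow2 x = cap \<kappa> (ray x) * inverse (radius \<delta> (x $ j))"
definition flow1 :: "real^'n \<Rightarrow> real" where "flow1 x = (x $ j * inverse (radius \<delta> (x $ j))) * (ray x * flow2 x)"

lemma radius_C: "(\<lambda>x::real^'n. radius \<delta> (x $ j)) \<in> C_on k UNIV"
  by (rule C_on_compose_coord[OF Ck_radius[OF \<delta>]])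
lemma inv_radius_C: "(\<lambda>x::real^'n. inverse (radius \<delta> (x $ j))) \<in> C_on k UNIV"
  by (rule C_on_inverse[OF radius_C]) (metis radius_pos[OF \<delta>] less_irrefl)
lemma ray_C: "ray \<in> C_on k UNIV"
  unfolding ray_def[abs_def] by (rule C_on_mult[OF C_on_add[OF C_on_coord C_on_const] inv_radius_C])
lemma flow2_C: "flow2 \<in> C_on k UNIV"
  unfolding flow2_def[abs_def] by (rule C_on_mult[OF C_on_compose[OF Ck_cap ray_C] inv_radius_C])
lemma flow1_C: "flow1 \<in> C_on k UNIV"
  unfolding flow1_def[abs_def] by (rule C_on_mult[OF C_on_mult[OF C_on_coord inv_radius_C] C_on_mult[OF ray_C flow2_C]])

text \<open>The flow lines are \<open>x\<^sub>i = c - 1 / 2 + z radius(x\<^sub>j)\<close> with constant \<open>z\<close>. The second component is the density \<open>cap(z) / radius\<close> of these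
lines, and the first one is this density times the slope \<open>z radius'(x\<^sub>j)\<close>, so conservation of mass holds exactly, also near the vertex.\<close>

lemma flow_divergence_free: "partial i flow1 x + partial j flow2 x = 0"
proof -
  define R where "R = radius \<delta> (x $ j)"
  have R: "R > 0" unfolding R_def by (rule radius_pos[OF \<delta>])
  define z where "z = ray x"
  define d where "d = deriv (cap \<kappa>) z"
  have dcap: "(cap \<kappa> has_real_derivative d) (at z)" unfolding d_def by (rule Ck_has_deriv[OF Ck_cap])
  have xi: "x $ i + (1 / 2 - c) = z * R" using R by (simp add: z_def ray_def R_def)
  have ji: "j \<noteq> i" using ij by simp
  have p1: "partial i flow1 x = (x $ j * inverse R) * ((inverse R * cap \<kappa> z + z * (d * inverse R)) * inverse R)"
  proof (rule partial_slice_eq)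
    show "flow1 differentiable at x" using C_on_diffble[of flow1 0 x] flow1_C by simp
    have ray: "((\<lambda>s. (s + (1 / 2 - c)) * inverse R) has_real_derivative inverse R) (at (x $ i))"
      by (auto intro!: derivative_eq_intros)
    have z: "(x $ i + (1 / 2 - c)) * inverse R = z" by (simp add: z_def ray_def R_def)
    have capr: "((\<lambda>s. cap \<kappa> ((s + (1 / 2 - c)) * inverse R)) has_real_derivative d * inverse R) (at (x $ i))"
      by (rule DERIV_chain2[OF _ ray]) (simp only: z dcap)
    have "((\<lambda>s. (x $ j * inverse R) * (((s + (1 / 2 - c)) * inverse R) * (cap \<kappa> ((s + (1 / 2 - c)) * inverse R) * inverse R))) has_real_derivative
      (x $ j * inverse R) * (inverse R * (cap \<kappa> z * inverse R) + (d * inverse R) * inverse R * z)) (at (x $ i))"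
      using DERIV_cmult[OF DERIV_mult[OF ray DERIV_cmult_right[OF capr, of "inverse R"]], of "x $ j * inverse R"]
      unfolding z .
    then show "((\<lambda>s. flow1 (upd i s x)) has_real_derivative (x $ j * inverse R) * ((inverse R * cap \<kappa> z + z * (d * inverse R)) * inverse R)) (at (x $ i))"
      unfolding flow1_def flow2_def ray_def upd_nth using ji by (simp add: R_def algebra_simps)
  qed
  have p2: "partial j flow2 x = (d * (z * R * (- (x $ j * inverse R) * (inverse R * inverse R)))) * inverse R + cap \<kappa> z * (- (x $ j * inverse R) * (inverse R * inverse R))"
  proof (rule partial_slice_eq)
    show "flow2 differentiable at x" using C_on_diffble[of flow2 0 x] flow2_C by simp
    have inv: "((\<lambda>s. inverse (radius \<delta> s)) has_real_derivative - (x $ j * inverse R) * (inverse R * inverse R)) (at (x $ j))"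
      using DERIV_chain2[OF inverse_has_deriv radius_deriv[OF \<delta>], of "x $ j"] R unfolding R_def[symmetric] by (simp add: R_def[symmetric] mult_ac)
    have ray: "((\<lambda>s. (x $ i + (1 / 2 - c)) * inverse (radius \<delta> s)) has_real_derivative (z * R) * (- (x $ j * inverse R) * (inverse R * inverse R))) (at (x $ j))"
      unfolding xi by (rule DERIV_cmult[OF inv])
    have z: "(x $ i + (1 / 2 - c)) * inverse (radius \<delta> (x $ j)) = z" by (simp add: z_def ray_def)
    have capr: "((\<lambda>s. cap \<kappa> ((x $ i + (1 / 2 - c)) * inverse (radius \<delta> s))) has_real_derivative d * ((z * R) * (- (x $ j * inverse R) * (inverse R * inverse R)))) (at (x $ j))"
      by (rule DERIV_chain2[OF _ ray]) (simp only: z dcap)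
    have "((\<lambda>s. cap \<kappa> ((x $ i + (1 / 2 - c)) * inverse (radius \<delta> s)) * inverse (radius \<delta> s)) has_real_derivative
       (d * ((z * R) * (- (x $ j * inverse R) * (inverse R * inverse R)))) * inverse R + (- (x $ j * inverse R) * (inverse R * inverse R)) * cap \<kappa> z) (at (x $ j))"
      using DERIV_mult[OF capr inv] unfolding R_def[symmetric] z[unfolded R_def[symmetric]] .
    then show "((\<lambda>s. flow2 (upd j s x)) has_real_derivative (d * (z * R * (- (x $ j * inverse R) * (inverse R * inverse R)))) * inverse R + cap \<kappa> z * (- (x $ j * inverse R) * (inverse R * inverse R))) (at (x $ j))"
      unfolding flow2_def ray_def upd_nth using ij by (simp add: mult.commute)
  qed
  show ?thesis unfolding p1 p2 using R by (simp add: field_simps)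
qed

lemma flow2_nonneg: "0 \<le> flow2 x"
  unfolding flow2_def using cap_bounds radius_pos[OF \<delta>, of "x $ j"] by (intro mult_nonneg_nonneg) auto

lemma flow1_le: "\<bar>flow1 x\<bar> \<le> flow2 x"
proof (cases "cap \<kappa> (ray x) = 0")
  case True then show ?thesis by (simp add: flow1_def flow2_def)
next
  case False
  then have r: "\<bar>ray x\<bar> \<le> 1" using cap_support[of \<kappa> "ray x"] \<kappa> by simp
  have "\<bar>x $ j * inverse (radius \<delta> (x $ j))\<bar> \<le> 1"
    using radius_ge[of "x $ j" \<delta>] radius_pos[OF \<delta>, of "x $ j"] by (simp add: abs_mult field_simps)
  then have "\<bar>x $ j * inverse (radius \<delta> (x $ j))\<bar> * (\<bar>ray x\<bar> * flow2 x) \<le> 1 * (1 * flow2 x)"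
    using r flow2_nonneg[of x] by (intro mult_mono) auto
  then show ?thesis unfolding flow1_def abs_mult using flow2_nonneg[of x] by simp
qed

text \<open>Integration by parts in the directions \<open>i\<close> and \<open>j\<close>.\<close>

lemma flow_orthogonal:
  assumes \<phi>: "\<phi> \<in> test_functions cube"
  shows "(LINT x|lborel. partial i \<phi> x * (flow1 x * Y x) + partial j \<phi> x * (flow2 x * Y x)) = 0"
proof -
  obtain K where K: "compact K" "K \<subseteq> cube" "\<And>x. x \<notin> K \<Longrightarrow> \<phi> x = 0" "\<And>x i. x \<notin> K \<Longrightarrow> partial i \<phi> x = 0"
    using test_support[OF \<phi>] by metis
  have p1: "\<phi> \<in> C_on k UNIV" for k by (rule test_C[OF \<phi>])
  have F: "(\<lambda>x. flow1 x * Y x) \<in> C_on k UNIV" "(\<lambda>x. flow2 x * Y x) \<in> C_on k UNIV" for k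
    by (rule C_on_mult[OF flow1_C Y_C], rule C_on_mult[OF flow2_C Y_C])
  have d: "f differentiable at x" if "\<And>k. f \<in> C_on k UNIV" for f :: "real^'n \<Rightarrow> real" and x
    using C_on_diffble[of f 0 x] that by simp
  have e1: "partial i (\<lambda>x. \<phi> x * (flow1 x * Y x)) x = \<phi> x * (partial i flow1 x * Y x) + partial i \<phi> x * (flow1 x * Y x)" for x
    unfolding partial_mult[OF d[OF p1] d[OF F(1)]] partial_mult[OF d[OF flow1_C] d[OF Y_C]] Y_partial[OF disjI1[OF refl]] by simp
  have e2: "partial j (\<lambda>x. \<phi> x * (flow2 x * Y x)) x = \<phi> x * (partial j flow2 x * Y x) + partial j \<phi> x * (flow2 x * Y x)" for x
    unfolding partial_mult[OF d[OF p1] d[OF F(2)]] partial_mult[OF d[OF flow2_C] d[OF Y_C]] Y_partial[OF disjI2[OF refl]] by simp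
  have g: "(\<lambda>x. \<phi> x * (flow1 x * Y x)) \<in> C_on k UNIV" "(\<lambda>x. \<phi> x * (flow2 x * Y x)) \<in> C_on k UNIV" for k
    by (rule C_on_mult[OF p1 F(1)], rule C_on_mult[OF p1 F(2)])
  have z: "(LINT x|lborel. partial i (\<lambda>x. \<phi> x * (flow1 x * Y x)) x) = 0"
      "(LINT x|lborel. partial j (\<lambda>x. \<phi> x * (flow2 x * Y x)) x) = 0"
    by (rule integral_partial_eq_0[OF g(1) K(1)], use K in simp, rule integral_partial_eq_0[OF g(2) K(1)], use K in simp)
  have int: "integrable lborel (partial l f)" if "\<And>k. f \<in> C_on k UNIV" "\<And>x. x \<notin> K \<Longrightarrow> f x = 0" for f l
    by (rule integrable_continuous_compact[OF C_on_continuous[OF C_on_partial[OF that(1)[of "Suc 0"]]] K(1)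
          partial_zero_outside[OF compact_imp_closed[OF K(1)] that(2)]])
  have "(LINT x|lborel. partial i (\<lambda>x. \<phi> x * (flow1 x * Y x)) x + partial j (\<lambda>x. \<phi> x * (flow2 x * Y x)) x) = 0"
    using z int[OF g(1)] int[OF g(2)] K(3) by simp
  moreover have "partial i (\<lambda>x. \<phi> x * (flow1 x * Y x)) x + partial j (\<lambda>x. \<phi> x * (flow2 x * Y x)) x
     = partial i \<phi> x * (flow1 x * Y x) + partial j \<phi> x * (flow2 x * Y x)" for x
  proof -
    have "\<phi> x * (partial i flow1 x * Y x) + \<phi> x * (partial j flow2 x * Y x) = \<phi> x * Y x * (partial i flow1 x + partial j flow2 x)"
      by (simp add: algebra_simps)
    then show ?thesis unfolding e1 e2 flow_divergence_free by simp
  qed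
  ultimately show ?thesis by simp
qed

lemma flow2_borel [measurable]: "flow2 \<in> borel_measurable borel"
  by (rule continuous_borel[OF C_on_continuous[OF flow2_C[of 0]]])

lemma flow2_slice:
  "(\<integral>\<^sup>+t. ennreal (flow2 (upd i t x)) \<partial>lborel) = mass \<kappa>"
  unfolding flow2_def ray_def upd_nth using ij
  by (simp add: mass_scaled[OF radius_pos[OF \<delta>]])

lemma flow2_support: "flow2 x \<noteq> 0 \<Longrightarrow> \<bar>x $ i + 1 / 2 - c\<bar> < \<kappa> * radius \<delta> (x $ j)"
proof -
  assume "flow2 x \<noteq> 0"
  then have "\<bar>ray x\<bar> < \<kappa>" using cap_support[of \<kappa> "ray x"] \<kappa> by (auto simp: flow2_def)
  then show ?thesis using radius_pos[OF \<delta>, of "x $ j"] by (simp add: ray_def abs_mult divide_inverse[symmetric] pos_divide_less_eq add_diff_eq)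
qed

lemma flow2_le: "flow2 x \<le> inverse (radius \<delta> (x $ j))"
  unfolding flow2_def using cap_bounds(2)[of \<kappa> "ray x"] radius_pos[OF \<delta>, of "x $ j"] by (simp add: mult_left_le_one_le cap_bounds)

text \<open>The flux through each hyperplane \<open>x\<^sub>j = t\<close> is at most \<open>mass \<kappa>\<close>, which reduces the integral to one in \<open>t\<close>.\<close>

lemma flow2_weighted:
  fixes \<psi> :: "real \<Rightarrow> ennreal"
  assumes [measurable]: "\<psi> \<in> borel_measurable borel"
  shows "(\<integral>\<^sup>+x\<in>cube. \<psi> (x $ j) * ennreal (flow2 x * Y x) \<partial>lborel)
     \<le> mass \<kappa> * (\<integral>\<^sup>+t\<in>{-1<..<1}. \<psi> t \<partial>lborel) * emeasure lborel (cube :: (real^'n) set)"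
proof -
  have ji: "j \<noteq> i" using ij by simp
  have "(\<integral>\<^sup>+x\<in>cube. \<psi> (x $ j) * ennreal (flow2 x * Y x) \<partial>lborel) \<le> (\<integral>\<^sup>+x\<in>cube. mass \<kappa> * \<psi> ((x::real^'n) $ j) \<partial>lborel)"
  proof (rule nn_integral_cube_slice_le[of _ i])
    fix x :: "real^'n"
    have "(\<integral>\<^sup>+t\<in>{-1<..<1}. \<psi> (upd i t x $ j) * ennreal (flow2 (upd i t x) * Y (upd i t x)) \<partial>lborel)
       \<le> (\<integral>\<^sup>+t. \<psi> (x $ j) * ennreal (flow2 (upd i t x)) \<partial>lborel)"
    proof (rule nn_integral_mono)
      fix t
      have "flow2 (upd i t x) * Y (upd i t x) \<le> flow2 (upd i t x)" 
        using Y_bounds(2)[of "upd i t x"] Y_bounds(1)[of "upd i t x"] flow2_nonneg[of "upd i t x"] by (simp add: mult_left_le)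
      then have "ennreal (flow2 (upd i t x) * Y (upd i t x)) \<le> ennreal (flow2 (upd i t x))" by (rule ennreal_leI)
      then show "\<psi> (upd i t x $ j) * ennreal (flow2 (upd i t x) * Y (upd i t x)) * indicator {-1<..<1} t \<le> \<psi> (x $ j) * ennreal (flow2 (upd i t x))"
        using ji by (auto simp: upd_nth split: split_indicator intro!: mult_left_mono)
    qed
    also have "\<dots> = \<psi> (x $ j) * (\<integral>\<^sup>+t. ennreal (flow2 (upd i t x)) \<partial>lborel)"
    proof (rule nn_integral_cmult)
      have "(\<lambda>t. upd i t x) \<in> borel_measurable borel" unfolding upd_def by measurable
      then show "(\<lambda>t. ennreal (flow2 (upd i t x))) \<in> borel_measurable lborel" by measurable
    qed
    finally show "(\<integral>\<^sup>+t\<in>{-1<..<1}. \<psi> (upd i t x $ j) * ennreal (flow2 (upd i t x) * Y (upd i t x)) \<partial>lborel) \<le> mass \<kappa> * \<psi> (x $ j)"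
      unfolding flow2_slice by (simp add: mult.commute)
  qed measurable
  also have "\<dots> \<le> (\<integral>\<^sup>+x\<in>(cube :: (real^'n) set). mass \<kappa> * (\<integral>\<^sup>+t\<in>{-1<..<1}. \<psi> t \<partial>lborel) \<partial>lborel)"
  proof (rule nn_integral_cube_slice_le[of _ j])
    fix x :: "real^'n"
    have "(\<integral>\<^sup>+t\<in>{-1<..<1}. mass \<kappa> * \<psi> (upd j t x $ j) \<partial>lborel) = (\<integral>\<^sup>+t. mass \<kappa> * (\<psi> t * indicator {-1<..<1} t) \<partial>lborel)"
      by (simp add: upd_nth mult.assoc)
    also have "\<dots> = mass \<kappa> * (\<integral>\<^sup>+t\<in>{-1<..<1}. \<psi> t \<partial>lborel)" by (rule nn_integral_cmult) measurable
    finally show "(\<integral>\<^sup>+t\<in>{-1<..<1}. mass \<kappa> * \<psi> (upd j t x $ j) \<partial>lborel) \<le> mass \<kappa> * (\<integral>\<^sup>+t\<in>{-1<..<1}. \<psi> t \<partial>lborel)" by simp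
  qed measurable
  also have "\<dots> = mass \<kappa> * (\<integral>\<^sup>+t\<in>{-1<..<1}. \<psi> t \<partial>lborel) * emeasure lborel (cube :: (real^'n) set)"
    by (rule nn_integral_cmult_indicator) simp
  finally show ?thesis .
qed

end

end

section \<open>A lower bound for smooth functions\<close>

context barrier begin

text \<open>The flux of the boundary values, up to the factor \<open>mass \<kappa> / 2\<close>. It does not depend on the contact point or on \<open>\<delta>\<close>.\<close>

definition seed :: ennreal where
  "seed = (\<integral>\<^sup>+x\<in>cube. ennreal (partial j v x * Y x) \<partial>lborel)"

lemma v_partial: "partial l v x = (if l = j then 2 * dstep (2 * x $ j) else 0)"
proof -
  have d: "(\<lambda>x::real^'n. 2 * x $ j) differentiable at x"
    by (rule bounded_linear_imp_differentiable) (intro bounded_linear_mult_right bounded_linear_compose[OF bounded_linear_mult_right bounded_linear_vec_nth])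
  have c: "(\<lambda>x::real^'n. x $ j) differentiable at x" by (rule bounded_linear_imp_differentiable[OF bounded_linear_vec_nth])
  have "partial l (\<lambda>x::real^'n. 2 * x $ j) x = 2 * (if l = j then 1 else 0)"
    unfolding partial_mult[OF differentiable_const c] partial_coord by simp
  then show ?thesis unfolding v_def[abs_def] partial_compose[OF d step_deriv] by simp
qed

lemma seed_pos: "0 < seed"
proof (rule ccontr)
  let ?f = "\<lambda>x. partial j v x * Y x"
  assume "\<not> 0 < seed"
  then have "seed = 0" by simp
  have fc: "continuous_on UNIV ?f"
    by (rule continuous_on_mult[OF C_on_continuous[OF C_on_partial[OF v_C[of "Suc 0"]]] C_on_continuous[OF Y_C[of 0]]])
  have [measurable]: "?f \<in> borel_measurable borel" by (rule continuous_borel[OF fc])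
  have "AE x in lborel. ennreal (?f x) * indicator cube x = 0"
    using \<open>seed = 0\<close> unfolding seed_def by (subst (asm) nn_integral_0_iff_AE) auto
  then have "AE x in lborel. x \<in> cube \<longrightarrow> x \<in> {x. ?f x \<le> 0}"
    by eventually_elim (auto split: split_indicator_asm simp: ennreal_eq_0_iff)
  then have "AE x\<in>cube in lebesgue. x \<in> {x. ?f x \<le> 0}" by (rule AE_completion)
  moreover have "closed {x. ?f x \<le> 0}" by (intro closed_Collect_le fc continuous_on_const)
  moreover have "(0::real^'n) \<in> cube" by (simp add: cube_def)
  ultimately have "0 \<in> {x. ?f x \<le> 0}" using open_cube mem_closed_if_AE_lebesgue_open by blast
  moreover have "0 < ?f 0"
    by (simp add: v_partial Y_def cap_def ramp_pos prod_pos dstep_pos)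
  ultimately show False by simp
qed

text \<open>The derivative of \<open>v\<close> depends on \<open>x\<^sub>j\<close> only, so the slices in direction \<open>i\<close> see the full mass of the flow: for \<open>\<kappa> \<le> 1 / (2 N)\<close>
the double cone stays inside the cube.\<close>

lemma seed_le_flow:
  assumes \<kappa>: "0 < \<kappa>" "\<kappa> \<le> 1 / (2 * real N)" and \<delta>: "0 < \<delta>" "\<delta> \<le> 1" and c: "2 / real N \<le> c" "c \<le> 1 - 2 / real N"
  shows "mass \<kappa> * seed \<le> 2 * (\<integral>\<^sup>+x\<in>cube. ennreal (partial j v x * (flow2 \<kappa> \<delta> c x * Y x)) \<partial>lborel)"
proof -
  have N': "real N \<ge> 8" using N by simp
  have ji: "j \<noteq> i" using ij by simp
  have \<kappa>1: "\<kappa> \<le> 1" using \<kappa>(2) N' by (smt (verit) divide_le_eq_1)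
  have [measurable]: "partial j v \<in> borel_measurable borel"
    by (rule continuous_borel[OF C_on_continuous[OF C_on_partial[OF v_C[of "Suc 0"]]]])
  note [measurable] = flow2_borel[OF \<kappa>(1) \<kappa>1 \<delta>(1)]
  have pv: "0 \<le> partial j v x" for x by (simp add: v_partial dstep_nonneg)
  have "2 * (\<integral>\<^sup>+x\<in>cube. ennreal (partial j v x * (flow2 \<kappa> \<delta> c x * Y x)) \<partial>lborel)
     = (\<integral>\<^sup>+x\<in>cube. (\<integral>\<^sup>+t\<in>{-1<..<1}. ennreal (partial j v (upd i t x) * (flow2 \<kappa> \<delta> c (upd i t x) * Y (upd i t x))) \<partial>lborel) \<partial>lborel)"
    by (rule nn_integral_cube_slice) measurable
  also have "\<dots> = (\<integral>\<^sup>+x. mass \<kappa> * (ennreal (partial j v x * Y x) * indicator cube x) \<partial>lborel)"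
  proof (rule nn_integral_cong)
    fix x :: "real^'n"
    show "(\<integral>\<^sup>+t\<in>{-1<..<1}. ennreal (partial j v (upd i t x) * (flow2 \<kappa> \<delta> c (upd i t x) * Y (upd i t x))) \<partial>lborel) * indicator cube x
      = mass \<kappa> * (ennreal (partial j v x * Y x) * indicator cube x)"
    proof (cases "x \<in> cube")
      case True
      then have xj: "\<bar>x $ j\<bar> \<le> 1" by (auto simp: cube_def abs_le_iff less_imp_le minus_le_iff)
      have "(\<integral>\<^sup>+t\<in>{-1<..<1}. ennreal (partial j v (upd i t x) * (flow2 \<kappa> \<delta> c (upd i t x) * Y (upd i t x))) \<partial>lborel)
        = (\<integral>\<^sup>+t. ennreal (partial j v x * Y x) * ennreal (flow2 \<kappa> \<delta> c (upd i t x)) \<partial>lborel)"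
      proof (rule nn_integral_cong)
        fix t
        have "flow2 \<kappa> \<delta> c (upd i t x) = 0" if "t \<notin> {-1<..<1}"
        proof (rule ccontr)
          assume "flow2 \<kappa> \<delta> c (upd i t x) \<noteq> 0"
          from flow2_support[OF \<kappa>(1) \<kappa>1 \<delta>(1) this]
          have "\<bar>t + 1 / 2 - c\<bar> < \<kappa> * radius \<delta> (x $ j)" using ji by (simp add: upd_nth)
          also have "\<dots> \<le> \<kappa> * (2 * 1)" using radius_le[of \<delta> 1 "x $ j"] \<delta> xj \<kappa> by (intro mult_left_mono) auto
          also have "\<dots> \<le> 1 / (2 * real N) * 2" using \<kappa> by simp
          also have "\<dots> = 1 / real N" by simp
          finally have *: "\<bar>t + 1 / 2 - c\<bar> < 1 / real N" .
          have "1 / real N \<le> 1 / 8" using N' by simp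
          moreover have "0 < 2 / real N" using N' by simp
          ultimately have "\<bar>t\<bar> < 1" using c * by linarith
          then show False using that by auto
        qed
        moreover have "partial j v (upd i t x) = partial j v x" using ji by (simp add: v_partial upd_nth)
        ultimately show "ennreal (partial j v (upd i t x) * (flow2 \<kappa> \<delta> c (upd i t x) * Y (upd i t x))) * indicator {-1<..<1} t
          = ennreal (partial j v x * Y x) * ennreal (flow2 \<kappa> \<delta> c (upd i t x))"
          using pv[of x] Y_bounds[of x] flow2_nonneg[OF \<kappa>(1) \<kappa>1 \<delta>(1), of c "upd i t x"]
          by (cases "t \<in> {-1<..<1}") (auto simp: Y_upd ennreal_mult[symmetric] mult_ac)
      qed
      also have "\<dots> = ennreal (partial j v x * Y x) * (\<integral>\<^sup>+t. ennreal (flow2 \<kappa> \<delta> c (upd i t x)) \<partial>lborel)"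
      proof (rule nn_integral_cmult)
        have "(\<lambda>t. upd i t x) \<in> borel_measurable borel" unfolding upd_def by measurable
        then show "(\<lambda>t. ennreal (flow2 \<kappa> \<delta> c (upd i t x))) \<in> borel_measurable lborel" by measurable
      qed
      finally show ?thesis using True unfolding flow2_slice[OF \<kappa>(1) \<kappa>1 \<delta>(1)] by (simp add: mult.commute)
    qed simp
  qed
  also have "\<dots> = mass \<kappa> * seed" unfolding seed_def by (rule nn_integral_cmult) measurable
  finally show ?thesis by simp
qed

text \<open>The flow is orthogonal to \<open>D\<phi>\<close>, and \<open>v\<close> has no derivative in direction \<open>i\<close>; so the flux of \<open>Dv\<close> equals that of \<open>D(v + \<phi>)\<close>.\<close>

lemma flow_testing:
  assumes \<kappa>: "0 < \<kappa>" "\<kappa> \<le> 1" and \<delta>: "0 < \<delta>" and \<phi>: "\<phi> \<in> test_functions cube"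
  shows "(\<integral>\<^sup>+x\<in>cube. ennreal (partial j v x * (flow2 \<kappa> \<delta> c x * Y x)) \<partial>lborel)
     \<le> (\<integral>\<^sup>+x\<in>cube. ennreal (2 * norm (grad (\<lambda>x. v x + \<phi> x) x) * (flow2 \<kappa> \<delta> c x * Y x)) \<partial>lborel)"
proof -
  let ?w = "\<lambda>x. v x + \<phi> x"
  define f1 where "f1 = flow1 \<kappa> \<delta> c"
  define f2 where "f2 = flow2 \<kappa> \<delta> c"
  note F = flow1_C[OF \<kappa> \<delta>, of c, folded f1_def] flow2_C[OF \<kappa> \<delta>, of c, folded f2_def]
  have p1: "\<phi> \<in> C_on k UNIV" for k by (rule test_C[OF \<phi>])
  obtain K where K: "compact K" "K \<subseteq> cube" "\<And>x. x \<notin> K \<Longrightarrow> \<phi> x = 0" "\<And>x i. x \<notin> K \<Longrightarrow> partial i \<phi> x = 0"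
    using test_support[OF \<phi>] by metis
  have cont: "continuous_on UNIV (partial l f)" if "\<And>k. f \<in> C_on k UNIV" for f :: "real^'n \<Rightarrow> real" and l
    by (rule C_on_continuous[OF C_on_partial[OF that[of "Suc 0"]]])
  have c1: "continuous_on UNIV (\<lambda>x. partial i \<phi> x * (f1 x * Y x) + partial j \<phi> x * (f2 x * Y x))"
    by (intro continuous_on_add continuous_on_mult cont p1 C_on_continuous[OF F(1)[of 0]] C_on_continuous[OF F(2)[of 0]] C_on_continuous[OF Y_C[of 0]])
  have c2: "continuous_on UNIV (\<lambda>x. partial j v x * (f2 x * Y x))"
    by (intro continuous_on_mult cont v_C C_on_continuous[OF F(2)[of 0]] C_on_continuous[OF Y_C[of 0]])
  have pd: "partial l ?w x = partial l v x + partial l \<phi> x" for l x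
    using C_on_diffble[of v 0 x] C_on_diffble[of \<phi> 0 x] v_C p1 by (intro partial_add) auto
  have wC: "?w \<in> C_on k UNIV" for k by (rule C_on_add[OF v_C p1])
  have c3: "continuous_on UNIV (\<lambda>x. 2 * norm (grad ?w x) * (f2 x * Y x))"
    by (intro continuous_on_mult continuous_on_norm continuous_on_const continuous_grad wC C_on_continuous[OF F(2)[of 0]] C_on_continuous[OF Y_C[of 0]])
  have nn2: "0 \<le> f2 x * Y x" for x using flow2_nonneg[OF \<kappa> \<delta>] Y_bounds by (simp add: f2_def)
  have pv: "0 \<le> partial j v x" for x by (simp add: v_partial dstep_nonneg)
  have zero: "(LINT x|lebesgue_on cube. partial i \<phi> x * (f1 x * Y x) + partial j \<phi> x * (f2 x * Y x)) = 0"
  proof -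
    have "(LINT x|lebesgue_on cube. partial i \<phi> x * (f1 x * Y x) + partial j \<phi> x * (f2 x * Y x))
       = (LINT x|lborel. indicator cube x * (partial i \<phi> x * (f1 x * Y x) + partial j \<phi> x * (f2 x * Y x)))"
      by (rule integral_lebesgue_on[OF cube_sets continuous_borel[OF c1]])
    also have "(\<lambda>x. indicator cube x * (partial i \<phi> x * (f1 x * Y x) + partial j \<phi> x * (f2 x * Y x)))
       = (\<lambda>x. partial i \<phi> x * (f1 x * Y x) + partial j \<phi> x * (f2 x * Y x))"
    proof
      fix x
      have "partial l \<phi> x = 0" if "x \<notin> cube" for l using K(2,4) that by blast
      then show "indicator cube x * (partial i \<phi> x * (f1 x * Y x) + partial j \<phi> x * (f2 x * Y x))
         = partial i \<phi> x * (f1 x * Y x) + partial j \<phi> x * (f2 x * Y x)"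
        by (cases "x \<in> cube") auto
    qed
    finally show ?thesis using flow_orthogonal[OF \<kappa> \<delta> \<phi>, of c] by (simp add: f1_def f2_def)
  qed
  have i1: "integrable (lebesgue_on cube) (\<lambda>x. partial i \<phi> x * (f1 x * Y x) + partial j \<phi> x * (f2 x * Y x))"
    by (rule integrable_on_cube_continuous[OF c1])
  have i2: "integrable (lebesgue_on cube) (\<lambda>x. partial j v x * (f2 x * Y x))" by (rule integrable_on_cube_continuous[OF c2])
  have i3: "integrable (lebesgue_on cube) (\<lambda>x. 2 * norm (grad ?w x) * (f2 x * Y x))" by (rule integrable_on_cube_continuous[OF c3])
  have "(LINT x|lebesgue_on cube. partial j v x * (f2 x * Y x))
     = (LINT x|lebesgue_on cube. partial j v x * (f2 x * Y x) + (partial i \<phi> x * (f1 x * Y x) + partial j \<phi> x * (f2 x * Y x)))"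
    using i1 i2 zero by simp
  also have "\<dots> \<le> (LINT x|lebesgue_on cube. 2 * norm (grad ?w x) * (f2 x * Y x))"
  proof (rule integral_mono)
    show "integrable (lebesgue_on cube) (\<lambda>x. partial j v x * (f2 x * Y x) + (partial i \<phi> x * (f1 x * Y x) + partial j \<phi> x * (f2 x * Y x)))"
      using i1 i2 by simp
    show "integrable (lebesgue_on cube) (\<lambda>x. 2 * norm (grad ?w x) * (f2 x * Y x))" by (rule i3)
    fix x
    have "partial i v x = 0" using ij by (simp add: v_partial)
    then have "partial j v x * (f2 x * Y x) + (partial i \<phi> x * (f1 x * Y x) + partial j \<phi> x * (f2 x * Y x))
        = partial i ?w x * (f1 x * Y x) + partial j ?w x * (f2 x * Y x)" unfolding pd by (simp add: algebra_simps)
    also have "\<dots> \<le> \<bar>partial i ?w x\<bar> * (f2 x * Y x) + \<bar>partial j ?w x\<bar> * (f2 x * Y x)"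
    proof (rule add_mono)
      have "\<bar>f1 x * Y x\<bar> \<le> f2 x * Y x"
        unfolding abs_mult using flow1_le[OF \<kappa> \<delta>, of c x] Y_bounds[of x] by (simp add: f1_def f2_def mult_right_mono)
      then have "\<bar>partial i ?w x * (f1 x * Y x)\<bar> \<le> \<bar>partial i ?w x\<bar> * (f2 x * Y x)"
        unfolding abs_mult[of "partial i ?w x"] by (rule mult_left_mono) simp
      then show "partial i ?w x * (f1 x * Y x) \<le> \<bar>partial i ?w x\<bar> * (f2 x * Y x)" by linarith
      show "partial j ?w x * (f2 x * Y x) \<le> \<bar>partial j ?w x\<bar> * (f2 x * Y x)"
        by (rule mult_right_mono[OF abs_ge_self nn2])
    qed
    also have "\<dots> \<le> norm (grad ?w x) * (f2 x * Y x) + norm (grad ?w x) * (f2 x * Y x)"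
      using component_le_norm_cart[of "grad ?w x"] by (intro add_mono mult_right_mono nn2) (auto simp: grad_nth[symmetric])
    also have "\<dots> = 2 * norm (grad ?w x) * (f2 x * Y x)" by simp
    finally show "partial j v x * (f2 x * Y x) + (partial i \<phi> x * (f1 x * Y x) + partial j \<phi> x * (f2 x * Y x))
      \<le> 2 * norm (grad ?w x) * (f2 x * Y x)" .
  qed
  finally have le: "(LINT x|lebesgue_on cube. partial j v x * (f2 x * Y x)) \<le> (LINT x|lebesgue_on cube. 2 * norm (grad ?w x) * (f2 x * Y x))" .
  have "(\<integral>\<^sup>+x\<in>cube. ennreal (partial j v x * (f2 x * Y x)) \<partial>lborel) = (\<integral>\<^sup>+x. ennreal (partial j v x * (f2 x * Y x)) \<partial>lebesgue_on cube)"
    using continuous_borel[OF c2] by (intro nn_integral_lebesgue_on[symmetric]) auto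
  also have "\<dots> = ennreal (LINT x|lebesgue_on cube. partial j v x * (f2 x * Y x))"
    using nn2 pv by (intro nn_integral_eq_integral[OF i2]) simp
  also have "\<dots> \<le> ennreal (LINT x|lebesgue_on cube. 2 * norm (grad ?w x) * (f2 x * Y x))" by (rule ennreal_leI[OF le])
  also have "\<dots> = (\<integral>\<^sup>+x. ennreal (2 * norm (grad ?w x) * (f2 x * Y x)) \<partial>lebesgue_on cube)"
    using nn2 by (intro nn_integral_eq_integral[OF i3, symmetric]) simp
  also have "\<dots> = (\<integral>\<^sup>+x\<in>cube. ennreal (2 * norm (grad ?w x) * (f2 x * Y x)) \<partial>lborel)"
    using continuous_borel[OF c3] by (intro nn_integral_lebesgue_on) auto
  finally show ?thesis by (simp only: f2_def)
qed

definition mesh :: "nat \<Rightarrow> real" where "mesh k = 1 / real N ^ k"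

lemma mesh: "0 < mesh k" "mesh k \<le> 1"
  using N by (auto simp: mesh_def divide_le_eq)

definition avg_flow :: "real \<Rightarrow> nat \<Rightarrow> real^'n \<Rightarrow> real" where
  "avg_flow \<kappa> k x = (\<Sum>m\<in>digit_nums k. flow2 \<kappa> (mesh k) (contact k m) x) / (real N - 4) ^ k * Y x"

lemma avg_nn_integral:
  fixes F :: "real^'n \<Rightarrow> ennreal"
  assumes \<kappa>: "0 < \<kappa>" "\<kappa> \<le> 1" and [measurable]: "F \<in> borel_measurable borel"
  shows "(\<integral>\<^sup>+x\<in>cube. F x * ennreal (avg_flow \<kappa> k x) \<partial>lborel)
    = (\<Sum>m\<in>digit_nums k. (\<integral>\<^sup>+x\<in>cube. F x * ennreal (flow2 \<kappa> (mesh k) (contact k m) x * Y x) \<partial>lborel)) * ennreal (1 / (real N - 4) ^ k)"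
proof -
  note [measurable] = flow2_borel[OF \<kappa> mesh(1)]
  have P: "(real N - 4) ^ k > 0" using N by (intro zero_less_power) auto
  have eq: "F x * ennreal (avg_flow \<kappa> k x) * indicator cube x
     = (\<Sum>m\<in>digit_nums k. F x * ennreal (flow2 \<kappa> (mesh k) (contact k m) x * Y x) * indicator cube x) * ennreal (1 / (real N - 4) ^ k)" for x
  proof -
    have "avg_flow \<kappa> k x = (\<Sum>m\<in>digit_nums k. flow2 \<kappa> (mesh k) (contact k m) x * Y x) * (1 / (real N - 4) ^ k)"
      unfolding avg_flow_def by (simp add: sum_distrib_right[symmetric])
    moreover have nn: "0 \<le> flow2 \<kappa> (mesh k) (contact k m) x * Y x" for m
      using flow2_nonneg[OF \<kappa> mesh(1)] Y_bounds[of x] by simp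
    ultimately have "ennreal (avg_flow \<kappa> k x) = ennreal (\<Sum>m\<in>digit_nums k. flow2 \<kappa> (mesh k) (contact k m) x * Y x) * ennreal (1 / (real N - 4) ^ k)"
      using P by (simp only:) (intro ennreal_mult sum_nonneg, auto)
    also have "ennreal (\<Sum>m\<in>digit_nums k. flow2 \<kappa> (mesh k) (contact k m) x * Y x) = (\<Sum>m\<in>digit_nums k. ennreal (flow2 \<kappa> (mesh k) (contact k m) x * Y x))"
      by (rule sum_ennreal[symmetric]) (rule nn)
    finally have "ennreal (avg_flow \<kappa> k x) = (\<Sum>m\<in>digit_nums k. ennreal (flow2 \<kappa> (mesh k) (contact k m) x * Y x)) * ennreal (1 / (real N - 4) ^ k)" .
    then show ?thesis by (simp add: sum_distrib_left sum_distrib_right mult_ac)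
  qed
  have "(\<integral>\<^sup>+x\<in>cube. F x * ennreal (avg_flow \<kappa> k x) \<partial>lborel)
     = (\<integral>\<^sup>+x. (\<Sum>m\<in>digit_nums k. F x * ennreal (flow2 \<kappa> (mesh k) (contact k m) x * Y x) * indicator cube x) \<partial>lborel) * ennreal (1 / (real N - 4) ^ k)"
    unfolding eq by (rule nn_integral_multc) measurable
  also have "(\<integral>\<^sup>+x. (\<Sum>m\<in>digit_nums k. F x * ennreal (flow2 \<kappa> (mesh k) (contact k m) x * Y x) * indicator cube x) \<partial>lborel)
     = (\<Sum>m\<in>digit_nums k. (\<integral>\<^sup>+x\<in>cube. F x * ennreal (flow2 \<kappa> (mesh k) (contact k m) x * Y x) \<partial>lborel))"
    by (rule nn_integral_sum) measurable
  finally show ?thesis .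
qed

lemma seed_le_avg:
  assumes \<kappa>: "0 < \<kappa>" "\<kappa> \<le> 1 / (2 * real N)" and \<phi>: "\<phi> \<in> test_functions cube"
  shows "mass \<kappa> * seed \<le> 2 * (\<integral>\<^sup>+x\<in>cube. ennreal (2 * norm (grad (\<lambda>x. v x + \<phi> x) x)) * ennreal (avg_flow \<kappa> k x) \<partial>lborel)"
proof -
  have N': "real N \<ge> 8" using N by simp
  have \<kappa>1: "\<kappa> \<le> 1" using \<kappa>(2) N' by (smt (verit) divide_le_eq_1)
  have P: "(real N - 4) ^ k > 0" using N by (intro zero_less_power) auto
  let ?g = "\<lambda>x. ennreal (2 * norm (grad (\<lambda>x. v x + \<phi> x) x))"
  have wC: "(\<lambda>x. v x + \<phi> x) \<in> C_on k UNIV" for k by (rule C_on_add[OF v_C test_C[OF \<phi>]])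
  have gb: "grad (\<lambda>x. v x + \<phi> x) \<in> borel_measurable borel"
    by (rule borel_measurable_continuous_onI[OF continuous_grad[OF wC]])
  then have gm: "?g \<in> borel_measurable borel" by measurable
  have each: "mass \<kappa> * seed \<le> 2 * (\<integral>\<^sup>+x\<in>cube. ?g x * ennreal (flow2 \<kappa> (mesh k) (contact k m) x * Y x) \<partial>lborel)" if m: "m \<in> digit_nums k" for m
  proof -
    have "mass \<kappa> * seed \<le> 2 * (\<integral>\<^sup>+x\<in>cube. ennreal (partial j v x * (flow2 \<kappa> (mesh k) (contact k m) x * Y x)) \<partial>lborel)"
      by (rule seed_le_flow[OF \<kappa> mesh contact_props(1,2)[OF m]])
    also have "\<dots> \<le> 2 * (\<integral>\<^sup>+x\<in>cube. ennreal (2 * norm (grad (\<lambda>x. v x + \<phi> x) x) * (flow2 \<kappa> (mesh k) (contact k m) x * Y x)) \<partial>lborel)"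
      by (intro mult_left_mono flow_testing[OF \<kappa>(1) \<kappa>1 mesh(1) \<phi>]) simp
    finally show ?thesis by (simp add: ennreal_mult')
  qed
  have card: "ennreal (real (card (digit_nums k))) * ennreal (1 / (real N - 4) ^ k) = 1"
    using P N by (simp add: digit_nums_card of_nat_diff ennreal_mult[symmetric])
  have "mass \<kappa> * seed = (\<Sum>m\<in>digit_nums k. mass \<kappa> * seed) * ennreal (1 / (real N - 4) ^ k)"
    using card by (simp add: ennreal_of_nat_eq_real_of_nat mult.assoc mult.commute mult.left_commute)
  also have "\<dots> \<le> (\<Sum>m\<in>digit_nums k. 2 * (\<integral>\<^sup>+x\<in>cube. ?g x * ennreal (flow2 \<kappa> (mesh k) (contact k m) x * Y x) \<partial>lborel)) * ennreal (1 / (real N - 4) ^ k)"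
    by (intro mult_right_mono sum_mono each) auto
  also have "\<dots> = 2 * (\<integral>\<^sup>+x\<in>cube. ?g x * ennreal (avg_flow \<kappa> k x) \<partial>lborel)"
    unfolding avg_nn_integral[OF \<kappa>(1) \<kappa>1 gm] by (simp add: sum_distrib_left[symmetric] mult.assoc)
  finally show ?thesis .
qed

lemma avg_weighted:
  fixes \<psi> :: "real \<Rightarrow> ennreal"
  assumes \<kappa>: "0 < \<kappa>" "\<kappa> \<le> 1" and [measurable]: "\<psi> \<in> borel_measurable borel"
  shows "(\<integral>\<^sup>+x\<in>cube. \<psi> (x $ j) * ennreal (avg_flow \<kappa> k x) \<partial>lborel)
     \<le> mass \<kappa> * (\<integral>\<^sup>+t\<in>{-1<..<1}. \<psi> t \<partial>lborel) * emeasure lborel (cube :: (real^'n) set)"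
proof -
  have P: "(real N - 4) ^ k > 0" using N by (intro zero_less_power) auto
  let ?C = "mass \<kappa> * (\<integral>\<^sup>+t\<in>{-1<..<1}. \<psi> t \<partial>lborel) * emeasure lborel (cube :: (real^'n) set)"
  have card: "ennreal (real (card (digit_nums k))) * ennreal (1 / (real N - 4) ^ k) = 1"
    using P N by (simp add: digit_nums_card of_nat_diff ennreal_mult[symmetric])
  have m: "(\<lambda>x::real^'n. \<psi> (x $ j)) \<in> borel_measurable borel" by measurable
  have "(\<integral>\<^sup>+x\<in>cube. \<psi> (x $ j) * ennreal (avg_flow \<kappa> k x) \<partial>lborel)
    \<le> (\<Sum>m\<in>digit_nums k. ?C) * ennreal (1 / (real N - 4) ^ k)"
    unfolding avg_nn_integral[OF \<kappa> m] by (intro mult_right_mono sum_mono flow2_weighted[OF \<kappa> mesh(1)]) auto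
  also have "\<dots> = ?C * (ennreal (real (card (digit_nums k))) * ennreal (1 / (real N - 4) ^ k))"
    by (simp add: ennreal_of_nat_eq_real_of_nat mult_ac)
  finally show ?thesis unfolding card by simp
qed

lemma avg_flow_nonneg: "0 < \<kappa> \<Longrightarrow> \<kappa> \<le> 1 \<Longrightarrow> 0 \<le> avg_flow \<kappa> k x"
  unfolding avg_flow_def using N Y_bounds flow2_nonneg[OF _ _ mesh(1)]
  by (intro mult_nonneg_nonneg divide_nonneg_nonneg sum_nonneg) auto

text \<open>At height \<open>\<bar>x\<^sub>j\<bar>\<close> each flow has density at most \<open>1 / \<bar>x\<^sub>j\<bar>\<close>, and only contact points at distance at most \<open>\<bar>x\<^sub>j\<bar>\<close> contribute; these are
counted by \<open>contact_count\<close>.\<close>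

lemma avg_flow_bound:
  assumes \<kappa>: "0 < \<kappa>" "\<kappa> \<le> 1 / 2" and D: "real N powr D \<le> real N - 4" "0 < D" "D < 1"
    and x: "mesh k \<le> \<bar>x $ j\<bar>" "\<bar>x $ j\<bar> \<le> 1"
  shows "avg_flow \<kappa> k x \<le> 3 * real N * \<bar>x $ j\<bar> powr (D - 1)"
proof -
  have \<kappa>1: "\<kappa> \<le> 1" using \<kappa> by simp
  define t where "t = \<bar>x $ j\<bar>"
  have t: "t > 0" using x mesh(1)[of k] by (simp add: t_def)
  have P: "(real N - 4) ^ k > 0" using N by (intro zero_less_power) auto
  define A where "A = {m \<in> digit_nums k. \<bar>contact k m - (x $ i + 1 / 2)\<bar> \<le> t}"
  have fin: "finite A" using digit_nums_finite by (simp add: A_def)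
  have "(\<Sum>m\<in>digit_nums k. flow2 \<kappa> (mesh k) (contact k m) x) = (\<Sum>m\<in>A. flow2 \<kappa> (mesh k) (contact k m) x)"
  proof (rule sum.mono_neutral_right[OF digit_nums_finite])
    show "A \<subseteq> digit_nums k" by (auto simp: A_def)
    show "\<forall>m\<in>digit_nums k - A. flow2 \<kappa> (mesh k) (contact k m) x = 0"
    proof (rule ballI, rule ccontr)
      fix m assume m: "m \<in> digit_nums k - A" and "flow2 \<kappa> (mesh k) (contact k m) x \<noteq> 0"
      from flow2_support[OF \<kappa>(1) \<kappa>1 mesh(1) this(2)]
      have "\<bar>x $ i + 1 / 2 - contact k m\<bar> < \<kappa> * radius (mesh k) (x $ j)" .
      also have "\<dots> \<le> 1 / 2 * (2 * t)"
        using \<kappa> radius_le[of "mesh k" t "x $ j"] x mesh[of k] radius_pos[OF mesh(1), of k "x $ j"] by (intro mult_mono) (auto simp: t_def)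
      finally have "m \<in> A" using m by (auto simp: A_def)
      then show False using m by simp
    qed
  qed
  also have "\<dots> \<le> (\<Sum>m\<in>A. inverse t)"
  proof (rule sum_mono)
    fix m
    have "flow2 \<kappa> (mesh k) (contact k m) x \<le> inverse (radius (mesh k) (x $ j))" by (rule flow2_le[OF \<kappa>(1) \<kappa>1 mesh(1)])
    also have "\<dots> \<le> inverse t" using radius_ge[of "x $ j" "mesh k"] t by (intro le_imp_inverse_le) (auto simp: t_def)
    finally show "flow2 \<kappa> (mesh k) (contact k m) x \<le> inverse t" .
  qed
  also have "\<dots> = real (card A) * inverse t" by simp
  also have "\<dots> \<le> (3 * real N * (real N - 4) ^ k * t powr D) * inverse t"
    unfolding A_def using x t by (intro mult_right_mono contact_count[OF D]) (auto simp: t_def mesh_def)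
  finally have "(\<Sum>m\<in>digit_nums k. flow2 \<kappa> (mesh k) (contact k m) x) / (real N - 4) ^ k \<le> (3 * real N * (real N - 4) ^ k * t powr D) * inverse t / (real N - 4) ^ k"
    using P by (intro divide_right_mono) auto
  also have "\<dots> = 3 * real N * (t powr D * inverse t)" using N by simp
  also have "t powr D * inverse t = t powr (D - 1)" using t by (simp add: powr_diff divide_inverse)
  finally have *: "(\<Sum>m\<in>digit_nums k. flow2 \<kappa> (mesh k) (contact k m) x) / (real N - 4) ^ k \<le> 3 * real N * t powr (D - 1)" .
  have "avg_flow \<kappa> k x \<le> (\<Sum>m\<in>digit_nums k. flow2 \<kappa> (mesh k) (contact k m) x) / (real N - 4) ^ k * 1"
    unfolding avg_flow_def using P flow2_nonneg[OF \<kappa>(1) \<kappa>1 mesh(1)] Y_bounds[of x]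
    by (intro mult_left_mono divide_nonneg_nonneg sum_nonneg) auto
  with * show ?thesis by (simp add: t_def)
qed

text \<open>A point that carries flow is close, relative to \<open>\<bar>x\<^sub>j\<bar>\<close>, to a zero of the Lipschitz function \<open>h\<close>. For a narrow cone this forces
\<open>H \<le> \<bar>x\<^sub>j\<bar> / 2\<close>.\<close>

lemma avg_flow_coef:
  assumes \<kappa>: "0 < \<kappa>" "\<kappa> \<le> 1 / (2 * real N)" and K: "2 * \<kappa> * K \<le> 1" "\<And>x y. \<bar>h x - h y\<bar> \<le> K * \<bar>x - y\<bar>" "0 < K"
    and \<alpha>: "0 < \<alpha>" and x: "mesh k \<le> \<bar>x $ j\<bar>" "\<bar>x $ j\<bar> \<le> 1" and nz: "avg_flow \<kappa> k x \<noteq> 0"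
  shows "(\<bar>x $ j\<bar> / 2) powr \<alpha> \<le> coef \<alpha> x"
proof (rule coef_ge[OF \<alpha>])
  have N': "real N \<ge> 8" using N by simp
  have \<kappa>1: "\<kappa> \<le> 1" using \<kappa>(2) N' by (smt (verit) divide_le_eq_1)
  from nz have "(\<Sum>m\<in>digit_nums k. flow2 \<kappa> (mesh k) (contact k m) x) \<noteq> 0" and Y: "Y x \<noteq> 0" by (auto simp: avg_flow_def)
  then obtain m where m: "m \<in> digit_nums k" "flow2 \<kappa> (mesh k) (contact k m) x \<noteq> 0" by (meson sum.not_neutral_contains_not_neutral)
  have "\<bar>x $ i + 1 / 2 - contact k m\<bar> < \<kappa> * radius (mesh k) (x $ j)" by (rule flow2_support[OF \<kappa>(1) \<kappa>1 mesh(1) m(2)])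
  also have "\<dots> \<le> \<kappa> * (2 * \<bar>x $ j\<bar>)"
    using \<kappa> radius_le[of "mesh k" "\<bar>x $ j\<bar>" "x $ j"] x mesh[of k] by (intro mult_left_mono) auto
  finally have d: "\<bar>x $ i + 1 / 2 - contact k m\<bar> \<le> 2 * \<kappa> * \<bar>x $ j\<bar>" by simp
  have "h (x $ i + 1 / 2) \<le> K * \<bar>x $ i + 1 / 2 - contact k m\<bar>"
    using K(2)[of "x $ i + 1 / 2" "contact k m"] contact_props(3)[OF m(1)] by simp
  also have "\<dots> \<le> K * (2 * \<kappa> * \<bar>x $ j\<bar>)" using d K(3) by (intro mult_left_mono) auto
  also have "\<dots> = (2 * \<kappa> * K) * \<bar>x $ j\<bar>" by simp
  also have "\<dots> \<le> 1 * \<bar>x $ j\<bar>" using K(1) by (intro mult_right_mono) auto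
  finally have hle: "h (x $ i + 1 / 2) \<le> \<bar>x $ j\<bar>" by simp
  have "2 * \<kappa> * \<bar>x $ j\<bar> \<le> 2 * (1 / (2 * real N)) * 1" using \<kappa> x by (intro mult_mono) auto
  then have "2 * \<kappa> * \<bar>x $ j\<bar> \<le> 1 / real N" by simp
  moreover have "0 < 1 / real N" using N' by simp
  moreover have "2 / real N = 1 / real N + 1 / real N" by simp
  ultimately have xi: "\<bar>x $ i\<bar> \<le> 1 / 2" using d contact_props(1,2)[OF m(1)] by linarith
  have "X x = 1"
  proof (rule X_one)
    fix l assume "l \<noteq> j"
    then show "\<bar>x $ l\<bar> \<le> 1 / 2" using xi Y_support[OF Y, of l] by (cases "l = i") auto
  qed
  then have "H x = h (x $ i + 1 / 2) / 2" by (simp add: H_def width_def)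
  then show "H x \<le> \<bar>x $ j\<bar> / 2" using hle by simp
qed

text \<open>Below height \<open>mesh k\<close> the flux is bounded by the supremum of the gradient times \<open>mesh k\<close> and disappears as \<open>k \<rightarrow> \<infinity>\<close>. Above it
\<open>young_split\<close> with \<open>y = l \<bar>x\<^sub>j\<bar> powr - \<gamma>\<close> bounds the flux by \<open>l\<close> times a fixed integral plus a multiple of \<open>\<integral> a \<bar>Dw\<bar>\<^sup>q\<close>; the
number \<open>l\<close> is chosen to absorb the first part.\<close>

theorem smooth_energy_lower_bound:
  assumes D: "real N powr D \<le> real N - 4" "0 < D" "D < 1" and \<alpha>: "0 < \<alpha>" and q: "1 < q" "\<alpha> + 1 - D < q - 1"
  shows "\<exists>c>0. \<forall>\<phi>\<in>test_functions cube. ennreal c \<le> (\<integral>\<^sup>+x\<in>cube. ennreal (coef \<alpha> x * norm (grad (\<lambda>x. v x + \<phi> x) x) powr q) \<partial>lborel)"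
proof -
  have N': "real N \<ge> 8" using N by simp
  obtain K where K: "K > 0" "\<And>x y. \<bar>h x - h y\<bar> \<le> K * \<bar>x - y\<bar>" using h_Lipschitz by blast
  \<comment> \<open>narrow enough for the cones to stay in the cube and outside the layer\<close>
  define \<kappa> where "\<kappa> = min (1 / (2 * real N)) (1 / (2 * K))"
  have \<kappa>: "0 < \<kappa>" "\<kappa> \<le> 1 / (2 * real N)" using K N' by (auto simp: \<kappa>_def)
  have \<kappa>K: "2 * \<kappa> * K \<le> 1"
  proof -
    have "2 * \<kappa> * K \<le> 2 * (1 / (2 * K)) * K" using K by (intro mult_right_mono mult_left_mono) (auto simp: \<kappa>_def)
    then show ?thesis using K by simp
  qed
  have "1 / (2 * real N) \<le> 1 / 2" using N' by simp
  then have \<kappa>2: "\<kappa> \<le> 1 / 2" "\<kappa> \<le> 1" using \<kappa> by linarith+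
  \<comment> \<open>the exponent for which \<open>y powr (1 - q) * \<bar>x\<^sub>j\<bar> powr (D - 1)\<close> is comparable with the coefficient\<close>
  define \<gamma> where "\<gamma> = (\<alpha> + 1 - D) / (q - 1)"
  have \<gamma>: "\<gamma> < 1" "\<gamma> * (q - 1) + (D - 1) = \<alpha>" using q by (auto simp: \<gamma>_def divide_less_eq)
  define vol where "vol = emeasure lborel (cube :: (real^'n) set)"
  have vol: "vol < \<infinity>" unfolding vol_def by (rule emeasure_cube_finite)
  define W where "W = mass \<kappa> * (\<integral>\<^sup>+t\<in>{-1<..<1}. ennreal (\<bar>t\<bar> powr - \<gamma>) \<partial>lborel) * vol"
  have W: "W < \<infinity>" unfolding W_def using mass_finite[OF \<kappa>(1)] abs_powr_integral[OF \<gamma>(1)] vol by (simp add: ennreal_mult_less_top)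
  define J where "J = mass \<kappa> * seed"
  have J0: "0 < J"
  proof -
    have "mass \<kappa> \<noteq> 0" 
    proof
      assume "mass \<kappa> = 0"
      have "AE z in lborel. z \<in> (UNIV :: real set) \<longrightarrow> z \<in> {z. cap \<kappa> z \<le> 0}"
        using \<open>mass \<kappa> = 0\<close> unfolding mass_def by (subst (asm) nn_integral_0_iff_AE) (auto simp: ennreal_eq_0_iff)
      then have "AE z\<in>UNIV in lebesgue. z \<in> {z. cap \<kappa> z \<le> 0}" by (rule AE_completion)
      moreover have "closed {z. cap \<kappa> z \<le> 0}" by (intro closed_Collect_le Ck_continuous[OF Ck_cap[of 0]] continuous_on_const)
      ultimately have "(0::real) \<in> {z. cap \<kappa> z \<le> 0}" using mem_closed_if_AE_lebesgue_open[OF open_UNIV] by blast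
      then show False using \<kappa> ramp_pos[of "\<kappa>\<^sup>2"] by (simp add: cap_def)
    qed
    then show ?thesis using seed_pos by (simp add: J_def ennreal_zero_less_mult_iff zero_less_iff_neq_zero)
  qed
  \<comment> \<open>truncated so that it is a real number\<close>
  define J' where "J' = min J 1"
  have J': "0 < J'" "J' < \<infinity>" "J' \<le> J" using J0 by (auto simp: J'_def min_less_iff_disj)
  obtain jr where jr: "J' = ennreal jr" "0 < jr" using J' by (cases J') auto
  obtain wr where wr: "W = ennreal wr" "0 \<le> wr" using W by (cases W) auto
  \<comment> \<open>then \<open>4 l W\<close> is at most half of the flux\<close>
  define l where "l = jr / (8 * (wr + 1))"
  have l: "0 < l" using jr wr by (simp add: l_def)
  define C3 where "C3 = 2 * (l powr (1 - q) * (3 * real N) * 2 powr \<alpha>)"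
  have C3: "0 < C3" using l N' by (simp add: C3_def)
  have pointwise: "2 * g * avg_flow \<kappa> k x \<le> 2 * Mw * (indicator {- mesh k..mesh k} (x $ j) * avg_flow \<kappa> k x)
      + 2 * l * (\<bar>x $ j\<bar> powr - \<gamma> * avg_flow \<kappa> k x) + C3 * (coef \<alpha> x * g powr q)"
    if x: "x \<in> cube" and g: "0 \<le> g" "g \<le> Mw" for x k g Mw
  proof -
    define b where "b = avg_flow \<kappa> k x"
    have b: "0 \<le> b" unfolding b_def by (rule avg_flow_nonneg[OF \<kappa>(1) \<kappa>2(2)])
    have xj: "\<bar>x $ j\<bar> \<le> 1" using x by (auto simp: cube_def abs_le_iff less_imp_le minus_le_iff)
    have nn: "0 \<le> 2 * l * (\<bar>x $ j\<bar> powr - \<gamma> * b)" "0 \<le> C3 * (coef \<alpha> x * g powr q)" "0 \<le> 2 * Mw * (indicator {- mesh k..mesh k} (x $ j) * b)"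
      using l b C3 coef_nonneg[of \<alpha> x] g by (auto intro!: mult_nonneg_nonneg)
    show ?thesis
    proof (cases "\<bar>x $ j\<bar> \<le> mesh k")
      case True
      then have ind: "indicator {- mesh k..mesh k} (x $ j) = (1::real)" by (auto simp: abs_le_iff minus_le_iff)
      have "2 * g * b \<le> 2 * Mw * b" using g b by (intro mult_right_mono) auto
      then show ?thesis using nn(1,2) unfolding b_def[symmetric] ind mult_1_left by linarith
    next
      case False
      then have xk: "mesh k \<le> \<bar>x $ j\<bar>" "0 < \<bar>x $ j\<bar>" using mesh(1)[of k] by auto
      show ?thesis
      proof (cases "b = 0")
        case True then show ?thesis using nn unfolding b_def[symmetric] by simp
      next
        case b0: False
        define t where "t = \<bar>x $ j\<bar>"
        have t: "0 < t" using xk by (simp add: t_def)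
        have coef: "(t / 2) powr \<alpha> \<le> coef \<alpha> x"
          using avg_flow_coef[OF \<kappa> \<kappa>K K(2,1) \<alpha> xk(1) xj] b0 by (simp add: b_def t_def)
        have bb: "b \<le> 3 * real N * t powr (D - 1)"
          unfolding b_def t_def by (rule avg_flow_bound[OF \<kappa>(1) \<kappa>2(1) D xk(1) xj])
        have "g \<le> l * t powr - \<gamma> + g powr q * (l * t powr - \<gamma>) powr (1 - q)"
          using g l t q by (intro young_split) auto
        from mult_right_mono[OF this b]
        have "g * b \<le> l * t powr - \<gamma> * b + g powr q * (l * t powr - \<gamma>) powr (1 - q) * b" by (simp add: distrib_right)
        also have "g powr q * (l * t powr - \<gamma>) powr (1 - q) * b \<le> g powr q * (l * t powr - \<gamma>) powr (1 - q) * (3 * real N * t powr (D - 1))"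
          by (intro mult_left_mono bb) auto
        also have "(l * t powr - \<gamma>) powr (1 - q) = l powr (1 - q) * t powr (\<gamma> * (q - 1))"
          by (simp add: powr_mult powr_powr algebra_simps)
        also have "g powr q * (l powr (1 - q) * t powr (\<gamma> * (q - 1))) * (3 * real N * t powr (D - 1))
            = l powr (1 - q) * (3 * real N) * (t powr (\<gamma> * (q - 1)) * t powr (D - 1)) * g powr q" by (simp add: mult_ac)
        also have "t powr (\<gamma> * (q - 1)) * t powr (D - 1) = t powr \<alpha>" unfolding powr_add[symmetric] \<gamma>(2) ..
        also have "t powr \<alpha> = 2 powr \<alpha> * (t / 2) powr \<alpha>" using t by (simp add: powr_divide)
        also have "l powr (1 - q) * (3 * real N) * (2 powr \<alpha> * (t / 2) powr \<alpha>) * g powr q \<le> l powr (1 - q) * (3 * real N) * (2 powr \<alpha> * coef \<alpha> x) * g powr q"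
          using coef by (intro mult_right_mono mult_left_mono) auto
        finally have "g * b \<le> l * t powr - \<gamma> * b + l powr (1 - q) * (3 * real N) * (2 powr \<alpha> * coef \<alpha> x) * g powr q" by simp
        then have "2 * (g * b) \<le> 2 * (l * t powr - \<gamma> * b + l powr (1 - q) * (3 * real N) * (2 powr \<alpha> * coef \<alpha> x) * g powr q)" by simp
        also have "\<dots> = 2 * l * (t powr - \<gamma> * b) + C3 * (coef \<alpha> x * g powr q)" by (simp add: C3_def algebra_simps)
        finally have "2 * g * b \<le> 2 * l * (t powr - \<gamma> * b) + C3 * (coef \<alpha> x * g powr q)" by (simp only: mult.assoc)
        then show ?thesis using nn(3) unfolding b_def[symmetric] t_def by linarith
      qed
    qed
  qed
  show ?thesis
  proof (intro exI conjI ballI)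
    show "0 < jr / (4 * C3)" using jr C3 by simp
    fix \<phi> assume \<phi>: "\<phi> \<in> test_functions (cube :: (real^'n) set)"
    let ?g = "\<lambda>x. norm (grad (\<lambda>x. v x + \<phi> x) x)"
    have wC: "(\<lambda>x. v x + \<phi> x) \<in> C_on k UNIV" for k by (rule C_on_add[OF v_C test_C[OF \<phi>]])
    have gc: "continuous_on UNIV (grad (\<lambda>x. v x + \<phi> x))" by (rule continuous_grad[OF wC])
    have gb [measurable]: "grad (\<lambda>x. v x + \<phi> x) \<in> borel_measurable borel" by (rule borel_measurable_continuous_onI[OF gc])
    obtain Mw where Mw: "\<And>x. x \<in> cube \<Longrightarrow> ?g x \<le> Mw" using continuous_bounded_cube[OF gc] by blast
    have Mw0: "0 \<le> Mw" using Mw[of 0] by (auto simp: cube_def intro: order_trans[OF norm_ge_zero])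
    define E where "E = (\<integral>\<^sup>+x\<in>cube. ennreal (coef \<alpha> x * ?g x powr q) \<partial>lborel)"
    have [measurable]: "coef \<alpha> \<in> borel_measurable borel" by (rule continuous_borel[OF coef_continuous[OF \<alpha>]])
    have [measurable]: "avg_flow \<kappa> k \<in> borel_measurable borel" for k
    proof -
      note [measurable] = flow2_borel[OF \<kappa>(1) \<kappa>2(2) mesh(1)]
      show ?thesis unfolding avg_flow_def[abs_def] by measurable
    qed
    have aux: "ennreal (a * (i * b) + c * (p * b) + d * e)
        = ennreal a * (ennreal i * ennreal b) + ennreal c * (ennreal p * ennreal b) + ennreal d * ennreal e"
      if "0 \<le> a" "0 \<le> i" "0 \<le> b" "0 \<le> c" "0 \<le> p" "0 \<le> d" "0 \<le> e" for a i b c p d e :: real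
      using that by (simp add: ennreal_mult ennreal_plus)
    define V where "V k = 4 * Mw * (2 * mesh k)" for k
    have step: "J \<le> ennreal (V k) * (mass \<kappa> * vol) + ennreal (4 * l) * W + ennreal (2 * C3) * E" for k
    proof -
      have "J \<le> 2 * (\<integral>\<^sup>+x\<in>cube. ennreal (2 * ?g x) * ennreal (avg_flow \<kappa> k x) \<partial>lborel)"
        unfolding J_def by (rule seed_le_avg[OF \<kappa> \<phi>])
      also have "\<dots> \<le> 2 * (\<integral>\<^sup>+x. ennreal (2 * Mw) * (indicator {- mesh k..mesh k} (x $ j) * ennreal (avg_flow \<kappa> k x) * indicator cube x)
          + ennreal (2 * l) * (ennreal (\<bar>x $ j\<bar> powr - \<gamma>) * ennreal (avg_flow \<kappa> k x) * indicator cube x)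
          + ennreal C3 * (ennreal (coef \<alpha> x * ?g x powr q) * indicator cube x) \<partial>lborel)"
      proof (intro mult_left_mono nn_integral_mono)
        fix x :: "real^'n"
        show "ennreal (2 * ?g x) * ennreal (avg_flow \<kappa> k x) * indicator cube x
          \<le> ennreal (2 * Mw) * (indicator {- mesh k..mesh k} (x $ j) * ennreal (avg_flow \<kappa> k x) * indicator cube x)
          + ennreal (2 * l) * (ennreal (\<bar>x $ j\<bar> powr - \<gamma>) * ennreal (avg_flow \<kappa> k x) * indicator cube x)
          + ennreal C3 * (ennreal (coef \<alpha> x * ?g x powr q) * indicator cube x)"
        proof (cases "x \<in> cube")
          case True
          have b: "0 \<le> avg_flow \<kappa> k x" by (rule avg_flow_nonneg[OF \<kappa>(1) \<kappa>2(2)])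
          have "ennreal (2 * ?g x * avg_flow \<kappa> k x) \<le> ennreal (2 * Mw * (indicator {- mesh k..mesh k} (x $ j) * avg_flow \<kappa> k x)
            + 2 * l * (\<bar>x $ j\<bar> powr - \<gamma> * avg_flow \<kappa> k x) + C3 * (coef \<alpha> x * ?g x powr q))"
            by (rule ennreal_leI[OF pointwise[OF True norm_ge_zero Mw[OF True]]])
          also have "\<dots> = ennreal (2 * Mw) * (indicator {- mesh k..mesh k} (x $ j) * ennreal (avg_flow \<kappa> k x))
            + ennreal (2 * l) * (ennreal (\<bar>x $ j\<bar> powr - \<gamma>) * ennreal (avg_flow \<kappa> k x)) + ennreal C3 * ennreal (coef \<alpha> x * ?g x powr q)"
          proof -
            have cn: "0 \<le> 2 * Mw" "0 \<le> 2 * l" "0 \<le> C3" "0 \<le> coef \<alpha> x * ?g x powr q"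
              using l C3 Mw0 coef_nonneg[of \<alpha> x] by simp_all
            show ?thesis unfolding aux[OF cn(1) indicator_pos_le b cn(2) powr_ge_zero cn(3,4)] ennreal_indicator ..
          qed
          finally show ?thesis using True b by (simp add: ennreal_mult)
        qed simp
      qed simp
      also have "\<dots> = 2 * (ennreal (2 * Mw) * (\<integral>\<^sup>+x\<in>cube. indicator {- mesh k..mesh k} (x $ j) * ennreal (avg_flow \<kappa> k x) \<partial>lborel)
          + ennreal (2 * l) * (\<integral>\<^sup>+x\<in>cube. ennreal (\<bar>x $ j\<bar> powr - \<gamma>) * ennreal (avg_flow \<kappa> k x) \<partial>lborel)
          + ennreal C3 * E)"
        unfolding E_def by (subst nn_integral_add, measurable, subst nn_integral_add, measurable) (simp add: nn_integral_cmult)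
      also have "\<dots> \<le> 2 * (ennreal (2 * Mw) * (mass \<kappa> * (\<integral>\<^sup>+t\<in>{-1<..<1}. indicator {- mesh k..mesh k} t \<partial>lborel) * vol)
          + ennreal (2 * l) * W + ennreal C3 * E)"
        unfolding W_def vol_def
        by (intro mult_left_mono add_mono order_refl avg_weighted[OF \<kappa>(1) \<kappa>2(2), of "indicator {- mesh k..mesh k}"]
             avg_weighted[OF \<kappa>(1) \<kappa>2(2), of "\<lambda>t. ennreal (\<bar>t\<bar> powr - \<gamma>)"]) auto
      also have "\<dots> \<le> 2 * (ennreal (2 * Mw) * (mass \<kappa> * ennreal (2 * mesh k) * vol) + ennreal (2 * l) * W + ennreal C3 * E)"
      proof -
        have "(\<integral>\<^sup>+t\<in>{-1<..<1}. indicator {- mesh k..mesh k} t \<partial>lborel) \<le> (\<integral>\<^sup>+t. indicator {- mesh k..mesh k} t \<partial>lborel)"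
          by (intro nn_integral_mono) (auto split: split_indicator)
        also have "\<dots> = ennreal (2 * mesh k)" using mesh[of k] by simp
        finally show ?thesis by (intro mult_left_mono add_mono mult_right_mono order_refl) auto
      qed
      also have "\<dots> = ennreal (V k) * (mass \<kappa> * vol) + ennreal (4 * l) * W + ennreal (2 * C3) * E"
      proof -
        have two: "(2::ennreal) = ennreal 2" by simp
        have "2 * (ennreal (2 * Mw) * (mass \<kappa> * ennreal (2 * mesh k) * vol)) = ennreal (V k) * (mass \<kappa> * vol)"
        proof -
          have "ennreal (V k) = ennreal 2 * (ennreal (2 * Mw) * ennreal (2 * mesh k))"
            unfolding V_def using Mw0 mesh(1)[of k] by (subst ennreal_mult[symmetric], simp, simp)+ (simp add: mult_ac)
          then show ?thesis unfolding two by (simp only: mult_ac)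
        qed
        moreover have "2 * (ennreal (2 * l) * W) = ennreal (4 * l) * W" 
        proof -
          have "ennreal 2 * ennreal (2 * l) = ennreal (4 * l)" using l by (subst ennreal_mult[symmetric]) auto
          then show ?thesis unfolding two mult.assoc[symmetric] by (simp only:)
        qed
        moreover have "2 * (ennreal C3 * E) = ennreal (2 * C3) * E" 
        proof -
          have "ennreal 2 * ennreal C3 = ennreal (2 * C3)" using C3 by (subst ennreal_mult[symmetric]) auto
          then show ?thesis unfolding two mult.assoc[symmetric] by (simp only:)
        qed
        ultimately show ?thesis by (simp only: distrib_left)
      qed
      finally show ?thesis .
    qed
    have "J' \<le> 0 * (mass \<kappa> * vol) + ennreal (4 * l) * W + ennreal (2 * C3) * E"
    proof (rule LIMSEQ_le_const)
      have "mesh \<longlonglongrightarrow> 0" unfolding mesh_def[abs_def] power_one_over[symmetric]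
        using N' by (intro LIMSEQ_power_zero) auto
      then have "V \<longlonglongrightarrow> 4 * Mw * (2 * 0)" unfolding V_def[abs_def] by (intro tendsto_mult tendsto_const)
      then have V0: "(\<lambda>k. ennreal (V k)) \<longlonglongrightarrow> 0" using tendsto_ennrealI[of V 0] by simp
      have fin: "mass \<kappa> * vol < \<infinity>" using mass_finite[OF \<kappa>(1)] vol by (simp add: ennreal_mult_less_top)
      show "(\<lambda>k. ennreal (V k) * (mass \<kappa> * vol) + ennreal (4 * l) * W + ennreal (2 * C3) * E)
         \<longlonglongrightarrow> 0 * (mass \<kappa> * vol) + ennreal (4 * l) * W + ennreal (2 * C3) * E"
      proof (intro tendsto_add tendsto_const)
        have "(\<lambda>k. (mass \<kappa> * vol) * ennreal (V k)) \<longlonglongrightarrow> (mass \<kappa> * vol) * 0"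
          using fin by (intro ennreal_tendsto_cmult V0) auto
        then show "(\<lambda>k. ennreal (V k) * (mass \<kappa> * vol)) \<longlonglongrightarrow> 0 * (mass \<kappa> * vol)" by (simp only: mult.commute)
      qed
      show "\<exists>N. \<forall>n\<ge>N. J' \<le> ennreal (V n) * (mass \<kappa> * vol) + ennreal (4 * l) * W + ennreal (2 * C3) * E"
        using step J'(3) by (auto intro: order_trans)
    qed
    then have fin: "ennreal jr \<le> ennreal (4 * l * wr) + ennreal (2 * C3) * E" using jr wr l by (simp add: ennreal_mult)
    have lw: "4 * l * wr \<le> jr / 2"
      using wr jr by (simp add: l_def field_simps)
    show "ennreal (jr / (4 * C3)) \<le> (\<integral>\<^sup>+x\<in>cube. ennreal (coef \<alpha> x * ?g x powr q) \<partial>lborel)"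
      unfolding E_def[symmetric]
    proof (cases E)
      case (real e)
      have e: "0 \<le> e" "E = ennreal e" using real by auto
      have "ennreal (2 * C3 * e) = ennreal (2 * C3) * ennreal e" by (rule ennreal_mult) (use e C3 in auto)
      moreover have "ennreal (4 * l * wr + 2 * C3 * e) = ennreal (4 * l * wr) + ennreal (2 * C3 * e)"
        by (rule ennreal_plus) (use e l wr C3 in auto)
      ultimately have "ennreal jr \<le> ennreal (4 * l * wr + 2 * C3 * e)" using fin unfolding e(2) by (simp only:)
      then have "jr \<le> 4 * l * wr + 2 * C3 * e" using real l wr C3 by (subst (asm) ennreal_le_iff) auto
      then have "jr / 2 \<le> 2 * C3 * e" using lw by linarith
      then have "jr / (4 * C3) \<le> e" using C3 by (simp add: field_simps)
      then show "ennreal (jr / (4 * C3)) \<le> E" using real by (simp add: ennreal_leI)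
    qed simp
  qed
qed

end

section \<open>The competitor as a Sobolev function\<close>

lemma test_cmult:
  assumes "\<phi> \<in> test_functions \<Omega>" shows "(\<lambda>x. c * \<phi> x) \<in> test_functions \<Omega>"
proof -
  obtain K where K: "compact K" "K \<subseteq> \<Omega>" "\<And>x. x \<notin> K \<Longrightarrow> \<phi> x = 0"
    using assms by (auto simp: test_functions_def)
  have "(\<lambda>x. c * \<phi> x) \<in> C_on k UNIV" for k by (rule C_on_cmult[OF test_C[OF assms]])
  then show ?thesis unfolding test_functions_def using K by (auto intro!: exI[of _ K])
qed

lemma lebesgue_on_AE_measurable:
  fixes f g :: "real^'n::finite \<Rightarrow> 'b::euclidean_space"
  assumes f: "f \<in> borel_measurable (lebesgue_on cube)" and ae: "AE x in lebesgue_on cube. g x = f x"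
  shows "g \<in> borel_measurable (lebesgue_on cube)"
proof (rule measurableI)
  fix B :: "'b set" assume B: "B \<in> sets borel"
  have A: "f -` B \<inter> cube \<in> sets lebesgue"
    using measurable_sets[OF f B] by (simp add: sets_restrict_space_iff)
  have "AE x in lebesgue. x \<in> cube \<longrightarrow> g x = f x" using ae by (simp add: AE_restrict_space_iff)
  then have "AE x in lebesgue. x \<in> f -` B \<inter> cube \<longleftrightarrow> x \<in> g -` B \<inter> cube" by eventually_elim auto
  from completion.in_sets_AE[OF this A] have "g -` B \<inter> cube \<in> sets lebesgue" by simp
  then show "g -` B \<inter> space (lebesgue_on cube) \<in> sets (lebesgue_on cube)"
    by (simp add: sets_restrict_space_iff)
qed simp

text \<open>Membership in \<open>W11_0\<close> is stated with the representative \<open>weak_grad\<close>; here it is replaced by an explicit weak gradient. Completeness of the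
Lebesgue measure provides the measurability of the representative.\<close>

lemma W11_0I:
  fixes u :: "real^'n::finite \<Rightarrow> real"
  assumes V: "is_weak_gradient cube u V" and i: "integrable (lebesgue_on cube) u" "integrable (lebesgue_on cube) V"
    and \<phi>: "\<And>m. \<phi> m \<in> test_functions cube"
    and lim: "(\<lambda>m. LINT x|lebesgue_on cube. \<bar>\<phi> m x - u x\<bar>) \<longlonglongrightarrow> 0"
      "(\<lambda>m. LINT x|lebesgue_on cube. norm (grad (\<phi> m) x - V x)) \<longlonglongrightarrow> 0"
  shows "u \<in> W11_0 cube"
proof -
  have ae: "AE x in lebesgue_on cube. weak_grad cube u x = V x" by (rule weak_grad_AE[OF V])
  have Vm: "V \<in> borel_measurable (lebesgue_on cube)" using i(2) by simp
  have w: "is_weak_gradient cube u (weak_grad cube u)" unfolding weak_grad_def by (rule someI[of _ V], rule V)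
  have wm: "weak_grad cube u \<in> borel_measurable (lebesgue_on cube)"
    by (rule lebesgue_on_AE_measurable[OF Vm ae])
  have eq: "(LINT x|lebesgue_on cube. norm (grad (\<phi> m) x - weak_grad cube u x)) = (LINT x|lebesgue_on cube. norm (grad (\<phi> m) x - V x))" for m
  proof (rule integral_cong_AE)
    have gm: "grad (\<phi> m) \<in> borel_measurable (lebesgue_on cube)"
      using continuous_grad[OF test_C[OF \<phi>[of m]]] by (intro borel_lebesgue_on borel_measurable_continuous_onI)
    show "(\<lambda>x. norm (grad (\<phi> m) x - weak_grad cube u x)) \<in> borel_measurable (lebesgue_on cube)" using gm wm by measurable
    show "(\<lambda>x. norm (grad (\<phi> m) x - V x)) \<in> borel_measurable (lebesgue_on cube)" using gm Vm by measurable
  qed (use ae in \<open>eventually_elim, simp\<close>)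
  have "u \<in> W11 cube" unfolding W11_def using i V by blast
  moreover have "(\<lambda>m. LINT x|lebesgue_on cube. norm (grad (\<phi> m) x - weak_grad cube u x)) \<longlonglongrightarrow> 0"
    unfolding eq by (rule lim(2))
  ultimately show ?thesis unfolding W11_0_def using \<phi> lim(1) by blast
qed

context barrier begin

lemma AE_good_cube: "AE x in lebesgue_on (cube :: (real^'n) set). 0 < h (x $ i + 1 / 2) \<and> x $ j \<noteq> 0"
  unfolding AE_lebesgue_on_iff[OF cube_sets] by (rule AE_good)

lemma step_borel [measurable]: "step \<in> borel_measurable borel" and dstep_borel [measurable]: "dstep \<in> borel_measurable borel"
  by (rule borel_measurable_continuous_onI[OF Ck_continuous[OF Ck_step[of 0]]],
      rule borel_measurable_continuous_onI[OF Ck_continuous[OF Ck_dstep[of 0]]])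

lemma H_borel [measurable]: "H \<in> borel_measurable borel" by (rule continuous_borel[OF C_on_continuous[OF H_C1]])

lemma U_borel [measurable]: "U \<in> borel_measurable borel" unfolding U_def[abs_def] by measurable

lemma G_borel [measurable]: "G \<in> borel_measurable borel"
proof (rule measurable_vec_components)
  fix l
  have [measurable]: "partial l H \<in> borel_measurable borel"
    using C_on_partial[of H 0 l] H_C1 by (intro continuous_borel C_on_continuous[of _ 0]) simp
  show "(\<lambda>x. G x $ l) \<in> borel_measurable borel" unfolding G_def quotient_grad_def vec_lambda_beta by measurable
qed

lemma U_bounds: "0 \<le> U x" "U x \<le> 1" by (simp_all add: U_def step_nonneg step_le_1)

lemma Hm_tendsto: "(\<lambda>m. Hm m x) \<longlonglongrightarrow> H x"
  unfolding H_def Hm_def width_def by (intro tendsto_intros h_approx_tendsto)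

lemma partial_Hm_tendsto: "(\<lambda>m. partial l (Hm m) x) \<longlonglongrightarrow> partial l H x"
  unfolding H_def Hm_def width_partial[OF h_approx_has_deriv] width_partial[OF h_has_deriv]
  by (cases "l = i") (auto intro!: tendsto_intros h_approx_tendsto dh_approx_tendsto)

lemma H_pos: "0 < h (x $ i + 1 / 2) \<Longrightarrow> 0 < H x" using H_ge[of x] by linarith

lemma Um_tendsto: "0 < h (x $ i + 1 / 2) \<Longrightarrow> (\<lambda>m. Um m x) \<longlonglongrightarrow> U x"
  unfolding U_def Um_def using H_pos[of x]
  by (intro isCont_tendsto_compose[OF DERIV_isCont[OF step_deriv]] tendsto_divide tendsto_const Hm_tendsto) auto

lemma grad_Um_tendsto: "0 < h (x $ i + 1 / 2) \<Longrightarrow> (\<lambda>m. grad (Um m) x) \<longlonglongrightarrow> G x"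
proof (rule vec_tendstoI)
  fix l
  assume "0 < h (x $ i + 1 / 2)"
  then have Hp: "H x \<noteq> 0" using H_pos[of x] by simp
  have d: "isCont dstep y" for y
    using Ck_continuous[OF Ck_dstep[of 0]] by (simp add: continuous_on_eq_continuous_at)
  show "(\<lambda>m. grad (Um m) x $ l) \<longlonglongrightarrow> G x $ l"
    unfolding grad_Um G_def quotient_grad_def vec_lambda_beta
    using Hp by (intro tendsto_mult isCont_tendsto_compose[OF d] tendsto_diff tendsto_divide tendsto_const Hm_tendsto partial_Hm_tendsto tendsto_power) auto
qed

text \<open>The common bound for the gradients of the approximations and of the competitor.\<close>

definition envelope :: "real \<Rightarrow> real^'n \<Rightarrow> real" where
  "envelope e x = h (x $ i + 1 / 2) powr - e * \<bar>x $ j\<bar> powr (e - 1)"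

lemma envelope_borel [measurable]: "envelope e \<in> borel_measurable borel"
  unfolding envelope_def[abs_def] by measurable

text \<open>A power of the envelope is again a product of a negative power of \<open>h\<close> and one of \<open>\<bar>x\<^sub>j\<bar>\<close>.\<close>

lemma envelope_power_finite:
  assumes e: "0 < e" and p: "0 < p" "(1 - e) * p < 1" and s: "small_exponent (e * p)"
  shows "(\<integral>\<^sup>+x\<in>cube. ennreal (envelope e x powr p) \<partial>lborel) < \<infinity>"
proof -
  have "(\<integral>\<^sup>+x\<in>cube. ennreal (envelope e x powr p) \<partial>lborel) \<le> (\<integral>\<^sup>+x\<in>(cube :: (real^'n) set). weight (e * p) ((1 - e) * p) x \<partial>lborel)"
  proof (intro nn_integral_mono mult_right_mono)
    fix x :: "real^'n"
    have "envelope e x powr p = h (x $ i + 1 / 2) powr - (e * p) * \<bar>x $ j\<bar> powr - ((1 - e) * p)"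
      by (simp add: envelope_def powr_mult powr_powr algebra_simps)
    then show "ennreal (envelope e x powr p) \<le> weight (e * p) ((1 - e) * p) x"
      using h_nonneg[of "x $ i + 1 / 2"]
      by (cases "h (x $ i + 1 / 2) > 0") (auto simp: weight_def inv_pow_def ennreal_mult)
  qed simp
  also have "\<dots> < \<infinity>" by (rule weight_integral[OF s p(2)])
  finally show ?thesis .
qed

lemma G_dominated:
  assumes e: "0 < e" "e < 1"
  shows "\<exists>C\<ge>0. (AE x in lebesgue_on cube. norm (G x) \<le> C * envelope e x)
    \<and> (\<forall>m. AE x in lebesgue_on cube. norm (grad (Um m) x) \<le> C * envelope e x)"
proof -
  obtain C where C: "0 \<le> C" "\<forall>(e::real) x. 0 < e \<longrightarrow> e < 1 \<longrightarrow> x \<in> cube \<longrightarrow> 0 < h (x $ i + 1 / 2) \<longrightarrow> x $ j \<noteq> 0 \<longrightarrow>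
     norm (G x) \<le> C * (h (x $ i + 1 / 2) powr - e * \<bar>x $ j\<bar> powr (e - 1)) \<and>
     (\<forall>m. norm (grad (Um m) x) \<le> C * (h (x $ i + 1 / 2) powr - e * \<bar>x $ j\<bar> powr (e - 1)))"
    using gradient_domination by blast
  have "AE x in lebesgue_on cube. norm (G x) \<le> C * envelope e x \<and> (\<forall>m. norm (grad (Um m) x) \<le> C * envelope e x)"
    using AE_good_cube AE_space
  proof eventually_elim
    case (elim x)
    then have "x \<in> cube" by simp
    then show ?case using elim(1) C(2) e unfolding envelope_def by blast
  qed
  then have "AE x in lebesgue_on cube. norm (G x) \<le> C * envelope e x"
    "AE x in lebesgue_on cube. norm (grad (Um m) x) \<le> C * envelope e x" for m by auto
  with C(1) show ?thesis by blast
qed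

lemma envelope_integrable:
  assumes "small_exponent e" shows "integrable (lebesgue_on cube) (envelope e)"
proof (rule integrableI_bounded)
  show "envelope e \<in> borel_measurable (lebesgue_on cube)" by (rule borel_lebesgue_on) measurable
  have e: "0 < e" "e \<le> 1 / 2" using assms by (auto simp: small_exponent_def)
  have nn: "0 \<le> envelope e x" for x by (simp add: envelope_def)
  have "(\<integral>\<^sup>+x. ennreal (norm (envelope e x)) \<partial>lebesgue_on cube) = (\<integral>\<^sup>+x\<in>cube. ennreal (envelope e x powr 1) \<partial>lborel)"
    using nn by (subst nn_integral_lebesgue_on) auto
  also have "\<dots> < \<infinity>" using e assms by (intro envelope_power_finite) auto
  finally show "(\<integral>\<^sup>+x. ennreal (norm (envelope e x)) \<partial>lebesgue_on cube) < \<infinity>" .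
qed

lemma U_integrable: "integrable (lebesgue_on cube) U"
proof (rule integrable_on_cube_bounded)
  show "norm (U x) \<le> 1" for x using U_bounds[of x] unfolding real_norm_def by linarith
qed (rule borel_lebesgue_on[OF U_borel])

lemma G_integrable: "integrable (lebesgue_on cube) G"
proof -
  obtain e where e: "small_exponent e" using ex_small_exponent by blast
  then have e1: "0 < e" "e < 1" by (auto simp: small_exponent_def)
  obtain C where C: "0 \<le> C" "AE x in lebesgue_on cube. norm (G x) \<le> C * envelope e x"
    using G_dominated[OF e1] by blast
  show ?thesis
  proof (rule Bochner_Integration.integrable_bound[OF integrable_mult_right[OF envelope_integrable[OF e], of C]])
    show "G \<in> borel_measurable (lebesgue_on cube)" by (rule borel_lebesgue_on) measurable
    show "AE x in lebesgue_on cube. norm (G x) \<le> norm (C * envelope e x)" using C(2) by eventually_elim simp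
  qed
qed

lemma Um_L1: "(\<lambda>m. LINT x|lebesgue_on cube. \<bar>Um m x - U x\<bar>) \<longlonglongrightarrow> 0"
proof -
  have "(\<lambda>m. LINT x|lebesgue_on (cube :: (real^'n) set). \<bar>Um m x - U x\<bar>) \<longlonglongrightarrow> (LINT x|lebesgue_on (cube :: (real^'n) set). 0)"
  proof (rule integral_dominated_convergence[where w = "\<lambda>x. 1"])
    show "integrable (lebesgue_on cube) (\<lambda>x::real^'n. 1 :: real)"
      by (rule integrable_on_cube_continuous[OF continuous_on_const])
    have [measurable]: "Um m \<in> borel_measurable borel" for m by (rule continuous_borel[OF C_on_continuous[OF Um_C[of _ 0]]])
    show "(\<lambda>x. \<bar>Um m x - U x\<bar>) \<in> borel_measurable (lebesgue_on cube)" for m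
      by (rule borel_lebesgue_on) measurable
    show "AE x in lebesgue_on cube. (\<lambda>m. \<bar>Um m x - U x\<bar>) \<longlonglongrightarrow> 0"
      using AE_good_cube
    proof eventually_elim
      case (elim x)
      from tendsto_rabs[OF LIM_zero[OF Um_tendsto]] elim show ?case by simp
    qed
    have "\<bar>Um m x - U x\<bar> \<le> 1" for m x
      using U_bounds[of x] step_nonneg[of "x $ j / Hm m x"] step_le_1[of "x $ j / Hm m x"] unfolding Um_def by linarith
    then show "AE x in lebesgue_on cube. norm \<bar>Um m x - U x\<bar> \<le> 1" for m by simp
  qed simp
  then show ?thesis by simp
qed

lemma grad_Um_L1: "(\<lambda>m. LINT x|lebesgue_on cube. norm (grad (Um m) x - G x)) \<longlonglongrightarrow> 0"
proof -
  obtain e where e: "small_exponent e" using ex_small_exponent by blast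
  then have e1: "0 < e" "e < 1" by (auto simp: small_exponent_def)
  obtain C where C: "0 \<le> C" "AE x in lebesgue_on cube. norm (G x) \<le> C * envelope e x"
    "\<forall>m. AE x in lebesgue_on cube. norm (grad (Um m) x) \<le> C * envelope e x" using G_dominated[OF e1] by blast
  have "(\<lambda>m. LINT x|lebesgue_on (cube :: (real^'n) set). norm (grad (Um m) x - G x)) \<longlonglongrightarrow> (LINT x|lebesgue_on (cube :: (real^'n) set). 0)"
  proof (rule integral_dominated_convergence[where w = "\<lambda>x. 2 * C * envelope e x"])
    show "integrable (lebesgue_on cube) (\<lambda>x. 2 * C * envelope e x)" by (rule integrable_mult_right[OF envelope_integrable[OF e]])
    have [measurable]: "grad (Um m) \<in> borel_measurable borel" for m
      by (rule borel_measurable_continuous_onI[OF continuous_grad[OF Um_C]])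
    show "(\<lambda>x. norm (grad (Um m) x - G x)) \<in> borel_measurable (lebesgue_on cube)" for m
      by (rule borel_lebesgue_on) measurable
    show "AE x in lebesgue_on cube. (\<lambda>m. norm (grad (Um m) x - G x)) \<longlonglongrightarrow> 0"
      using AE_good_cube
    proof eventually_elim
      case (elim x)
      from tendsto_norm_zero[OF LIM_zero[OF grad_Um_tendsto]] elim show ?case by simp
    qed
    show "AE x in lebesgue_on cube. norm (norm (grad (Um m) x - G x)) \<le> 2 * C * envelope e x" for m
      using C(2) C(3)[rule_format, of m]
    proof eventually_elim
      case (elim x)
      then show ?case using norm_triangle_ineq4[of "grad (Um m) x" "G x"] by simp
    qed
  qed simp
  then show ?thesis by simp
qed

lemma U_weak_gradient: "is_weak_gradient cube U G"
  by (rule weak_gradient_limit[OF Um_C U_integrable G_integrable Um_L1 grad_Um_L1])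

lemma v_weak_gradient: "is_weak_gradient cube v (grad v)" by (rule weak_gradient_C1[OF v_C])

lemma grad_lin:
  assumes "f \<in> C_on 1 UNIV" "g \<in> C_on 1 UNIV"
  shows "grad (\<lambda>x. a * f x + b * g x) x = a *\<^sub>R grad f x + b *\<^sub>R grad g x"
proof -
  have d: "f differentiable at x" "g differentiable at x" using assms C_on_diffble[of _ 0] by auto
  have e: "(\<lambda>x. a * f x) differentiable at x" "(\<lambda>x. b * g x) differentiable at x"
    using d by (auto intro: differentiable_mult differentiable_const)
  show ?thesis unfolding grad_def
    by (simp add: vec_eq_iff partial_add[OF e] partial_mult[OF differentiable_const d(1)] partial_mult[OF differentiable_const d(2)])
qed

lemma competitor_W11_0: "(\<lambda>x. T * (U x - v x)) \<in> W11_0 cube"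
proof (rule W11_0I[where V = "\<lambda>x. T *\<^sub>R (G x - grad v x)" and \<phi> = "\<lambda>m x. T * (Um m x - v x)"])
  have vi: "integrable (lebesgue_on cube) v" by (rule integrable_on_cube_continuous[OF C_on_continuous[OF v_C[of 0]]])
  have gi: "integrable (lebesgue_on cube) (grad v)"
  proof -
    have gc: "continuous_on UNIV (grad v)" by (rule continuous_grad[OF v_C])
    obtain B where "\<And>x. x \<in> cube \<Longrightarrow> norm (grad v x) \<le> B" using continuous_bounded_cube[OF gc] by blast
    then show ?thesis
      by (rule integrable_on_cube_bounded[OF borel_lebesgue_on[OF borel_measurable_continuous_onI[OF gc]]])
  qed
  show "is_weak_gradient cube (\<lambda>x. T * (U x - v x)) (\<lambda>x. T *\<^sub>R (G x - grad v x))"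
    using weak_gradient_lin[OF U_weak_gradient v_weak_gradient, of T "- T"] by (simp add: algebra_simps)
  show "integrable (lebesgue_on cube) (\<lambda>x. T * (U x - v x))" using U_integrable vi by simp
  show "integrable (lebesgue_on cube) (\<lambda>x. T *\<^sub>R (G x - grad v x))" using G_integrable gi by simp
  show "(\<lambda>x. T * (Um m x - v x)) \<in> test_functions cube" for m
    by (rule test_cmult[OF Um_minus_v_test])
  have "(LINT x|lebesgue_on cube. \<bar>T * (Um m x - v x) - T * (U x - v x)\<bar>) = \<bar>T\<bar> * (LINT x|lebesgue_on cube. \<bar>Um m x - U x\<bar>)" for m
  proof -
    have "\<bar>T * (Um m x - v x) - T * (U x - v x)\<bar> = \<bar>T\<bar> * \<bar>Um m x - U x\<bar>" for x
      unfolding abs_mult[symmetric] by (simp add: algebra_simps)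
    then show ?thesis by simp
  qed
  then show "(\<lambda>m. LINT x|lebesgue_on cube. \<bar>T * (Um m x - v x) - T * (U x - v x)\<bar>) \<longlonglongrightarrow> 0"
    using tendsto_mult_right_zero[OF Um_L1, of "\<bar>T\<bar>"] by simp
  have "(LINT x|lebesgue_on cube. norm (grad (\<lambda>x. T * (Um m x - v x)) x - T *\<^sub>R (G x - grad v x))) = \<bar>T\<bar> * (LINT x|lebesgue_on cube. norm (grad (Um m) x - G x))" for m
  proof -
    have "grad (\<lambda>x. T * (Um m x - v x)) x = T *\<^sub>R grad (Um m) x + (- T) *\<^sub>R grad v x" for x
      using grad_lin[OF Um_C v_C, of T m "- T" x] by (simp add: algebra_simps)
    then have "grad (\<lambda>x. T * (Um m x - v x)) x - T *\<^sub>R (G x - grad v x) = T *\<^sub>R (grad (Um m) x - G x)" for x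
      by (simp add: algebra_simps)
    then show ?thesis by simp
  qed
  then show "(\<lambda>m. LINT x|lebesgue_on cube. norm (grad (\<lambda>x. T * (Um m x - v x)) x - T *\<^sub>R (G x - grad v x))) \<longlonglongrightarrow> 0"
    using tendsto_mult_right_zero[OF grad_Um_L1, of "\<bar>T\<bar>"] by simp
qed

lemma competitor_L_infinity: "(\<lambda>x. U x - v x) \<in> L_infinity (closure cube)"
proof -
  have [measurable]: "v \<in> borel_measurable borel" by (rule continuous_borel[OF C_on_continuous[OF v_C[of 0]]])
  have "\<bar>U x - v x\<bar> \<le> 1" for x
    using U_bounds[of x] step_nonneg[of "2 * x $ j"] step_le_1[of "2 * x $ j"] unfolding v_def by linarith
  moreover have "(\<lambda>x. U x - v x) \<in> borel_measurable (lebesgue_on (closure cube))"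
    by (rule borel_lebesgue_on) measurable
  ultimately show ?thesis unfolding L_infinity_def by (intro CollectI conjI exI[of _ 1]) simp_all
qed

lemma v_smooth_closure: "(\<lambda>x. T * v x) \<in> smooth_closure cube"
  unfolding smooth_closure_def by (auto intro: C_on_C_closure C_on_cmult v_C)

text \<open>Slightly more than integrability: with \<open>p = 1 + e\<close> one has \<open>(1 - e) p < 1\<close> and \<open>e p \<le> 2 e\<close>.\<close>

lemma G_power_finite:
  assumes e: "0 < e" "small_exponent (2 * e)"
  shows "(\<integral>\<^sup>+x. ennreal (norm (G x) powr (1 + e)) \<partial>lebesgue_on cube) < \<infinity>"
proof -
  have e1: "e \<le> 1 / 4" using e by (simp add: small_exponent_def)
  have "e < 1" using e1 by simp
  then obtain C where C: "0 \<le> C" "AE x in lebesgue_on cube. norm (G x) \<le> C * envelope e x"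
    using G_dominated[OF e(1)] by blast
  have nn: "0 \<le> envelope e x" for x by (simp add: envelope_def)
  have "(\<integral>\<^sup>+x. ennreal (norm (G x) powr (1 + e)) \<partial>lebesgue_on cube) \<le> (\<integral>\<^sup>+x. ennreal (C powr (1 + e)) * ennreal (envelope e x powr (1 + e)) \<partial>lebesgue_on cube)"
  proof (rule nn_integral_mono_AE)
    show "AE x in lebesgue_on cube. ennreal (norm (G x) powr (1 + e)) \<le> ennreal (C powr (1 + e)) * ennreal (envelope e x powr (1 + e))"
      using C(2)
    proof eventually_elim
      case (elim x)
      then have "norm (G x) powr (1 + e) \<le> (C * envelope e x) powr (1 + e)" using e by (intro powr_mono2) auto
      also have "\<dots> = C powr (1 + e) * envelope e x powr (1 + e)" by (rule powr_mult)
      finally show ?case by (simp add: ennreal_mult[symmetric] ennreal_leI)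
    qed
  qed
  also have "\<dots> = (\<integral>\<^sup>+x\<in>cube. ennreal (C powr (1 + e)) * ennreal (envelope e x powr (1 + e)) \<partial>lborel)"
    by (rule nn_integral_lebesgue_on) measurable
  also have "\<dots> = ennreal (C powr (1 + e)) * (\<integral>\<^sup>+x\<in>cube. ennreal (envelope e x powr (1 + e)) \<partial>lborel)"
    unfolding mult.assoc by (rule nn_integral_cmult) measurable
  also have "\<dots> < \<infinity>"
  proof -
    have "(1 - e) * (1 + e) < 1" using e by (simp add: algebra_simps)
    moreover have "small_exponent (e * (1 + e))"
      using e e1 by (intro small_exponent_mono[OF e(2)]) (auto simp: mult_le_cancel_left mult.commute[of 2])
    ultimately have "(\<integral>\<^sup>+x\<in>cube. ennreal (envelope e x powr (1 + e)) \<partial>lborel) < \<infinity>"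
      using e by (intro envelope_power_finite) auto
    then show ?thesis by (simp add: ennreal_mult_less_top)
  qed
  finally show ?thesis .
qed

end

lemma growth_bound:
  assumes g: "growth_function g" and e: "0 < e"
  obtains c where "0 \<le> c" "\<And>t. 0 \<le> t \<Longrightarrow> t * g t \<le> c * (1 + t powr (1 + e))"
proof -
  obtain c where c: "\<forall>t\<ge>0. g t \<le> c * (1 + t powr e)" using g e unfolding growth_function_def by blast
  show ?thesis
  proof (rule that[of "2 * \<bar>c\<bar>"])
    fix t :: real assume t: "0 \<le> t"
    have 1: "t powr (1 + e) = t * t powr e" using t by (cases "t = 0") (auto simp: powr_add)
    have 2: "t \<le> 1 + t powr (1 + e)"
    proof (cases "t \<le> 1")
      case False
      then have "t powr 1 \<le> t powr (1 + e)" using e by (intro powr_mono) auto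
      then show ?thesis using False by simp
    qed (simp add: add_increasing2)
    have "g t \<le> \<bar>c\<bar> * (1 + t powr e)"
      using c[rule_format, OF t] mult_right_mono[of c "\<bar>c\<bar>" "1 + t powr e"] by (simp add: add_nonneg_nonneg) linarith
    then have "t * g t \<le> t * (\<bar>c\<bar> * (1 + t powr e))" using t by (rule mult_left_mono)
    also have "\<dots> = \<bar>c\<bar> * (t + t powr (1 + e))" unfolding 1 by (simp add: algebra_simps)
    also have "\<dots> \<le> \<bar>c\<bar> * (2 * (1 + t powr (1 + e)))" using 2 by (intro mult_left_mono) auto
    also have "\<dots> = 2 * \<bar>c\<bar> * (1 + t powr (1 + e))" by simp
    finally show "t * g t \<le> 2 * \<bar>c\<bar> * (1 + t powr (1 + e))" .
  qed simp
qed

lemma powr_add_le: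
  fixes a b p :: real
  assumes "0 \<le> a" "0 \<le> b" "0 < p" shows "(a + b) powr p \<le> 2 powr p * (a powr p + b powr p)"
proof -
  have "(a + b) powr p \<le> (2 * max a b) powr p" using assms by (intro powr_mono2) auto
  also have "\<dots> = 2 powr p * max a b powr p" by (rule powr_mult)
  also have "\<dots> \<le> 2 powr p * (a powr p + b powr p)" by (intro mult_left_mono) (auto simp: max_def)
  finally show ?thesis .
qed

section \<open>Energies and the Lavrentiev gap\<close>

lemma ext_integral_cong_AE:
  assumes "AE x in M. f x = g x" shows "ext_integral M f = ext_integral M g"
proof -
  have "(\<integral>\<^sup>+x. ennreal (f x) \<partial>M) = (\<integral>\<^sup>+x. ennreal (g x) \<partial>M)"
    by (rule nn_integral_cong_AE) (use assms in \<open>eventually_elim, simp\<close>)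
  moreover have "(\<integral>\<^sup>+x. ennreal (- f x) \<partial>M) = (\<integral>\<^sup>+x. ennreal (- g x) \<partial>M)"
    by (rule nn_integral_cong_AE) (use assms in \<open>eventually_elim, simp\<close>)
  ultimately show ?thesis by (simp add: ext_integral_def)
qed

lemma ext_integral_le:
  assumes "(\<integral>\<^sup>+x. ennreal (f x) \<partial>M) \<le> ennreal b" "0 \<le> b" shows "ext_integral M f \<le> ereal b"
proof -
  have "ext_integral M f \<le> enn2ereal (\<integral>\<^sup>+x. ennreal (f x) \<partial>M)"
    unfolding ext_integral_def by (rule ereal_diff_le_self) simp
  also have "\<dots> \<le> enn2ereal (ennreal b)" using assms(1) by (simp add: less_eq_ennreal.rep_eq)
  also have "\<dots> = ereal b" using assms(2) by (simp add: enn2ereal_ennreal)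
  finally show ?thesis .
qed

text \<open>The bound \<open>f \<ge> k - B\<close> loses \<open>B V\<close> in the positive part and at most \<open>B V\<close> in the negative one.\<close>

lemma ext_integral_ge:
  assumes [measurable]: "f \<in> borel_measurable M" and V: "emeasure M (space M) = ennreal V" "0 \<le> V"
    and B: "0 \<le> B" "\<And>x. k x - B \<le> f x" "\<And>x. 0 \<le> k x" and c: "0 \<le> c" "ennreal c \<le> (\<integral>\<^sup>+x. ennreal (k x) \<partial>M)"
  shows "ereal (c - 2 * B * V) \<le> ext_integral M f"
proof -
  define P where "P = (\<integral>\<^sup>+x. ennreal (f x) \<partial>M)"
  define Q where "Q = (\<integral>\<^sup>+x. ennreal (- f x) \<partial>M)"
  have const: "(\<integral>\<^sup>+x. ennreal B \<partial>M) = ennreal (B * V)" using V B by (simp add: ennreal_mult)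
  have "ennreal (- f x) \<le> ennreal B" for x using B(2)[of x] B(3)[of x] by (intro ennreal_leI) linarith
  then have Q: "Q \<le> ennreal (B * V)" unfolding Q_def const[symmetric] by (intro nn_integral_mono)
  have kf: "ennreal (k x) \<le> ennreal (f x) + ennreal B" for x
  proof (cases "0 \<le> f x")
    case True
    then show ?thesis using B(1) B(2)[of x] by (simp add: ennreal_plus[symmetric] ennreal_leI del: ennreal_plus)
  next
    case False
    then have "ennreal (k x) \<le> ennreal B" using B(2)[of x] by (intro ennreal_leI) linarith
    then show ?thesis by (simp add: add_increasing)
  qed
  have "ennreal c \<le> (\<integral>\<^sup>+x. ennreal (k x) \<partial>M)" by (rule c(2))
  also have "\<dots> \<le> (\<integral>\<^sup>+x. ennreal (f x) + ennreal B \<partial>M)" by (intro nn_integral_mono kf)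
  also have "\<dots> = P + ennreal (B * V)" unfolding P_def const[symmetric] by (rule nn_integral_add) measurable
  finally have cP: "ennreal c \<le> P + ennreal (B * V)" .
  have BV: "0 \<le> B * V" using B V by simp
  obtain qq where q: "Q = ennreal qq" "0 \<le> qq" using Q by (cases Q) (auto simp: top_unique)
  have qB: "qq \<le> B * V" using Q BV unfolding q(1) by (simp add: ennreal_le_iff)
  show ?thesis
  proof (cases P)
    case (real p)
    have "ennreal c \<le> ennreal (p + B * V)" using cP real BV by (simp add: ennreal_plus)
    then have "c \<le> p + B * V" using real BV by (subst (asm) ennreal_le_iff) auto
    then have "c - 2 * B * V \<le> p - qq" using qB by linarith
    then show ?thesis unfolding ext_integral_def P_def[symmetric] Q_def[symmetric] using real q by (simp add: enn2ereal_ennreal)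
  next
    case top
    then show ?thesis unfolding ext_integral_def P_def[symmetric] Q_def[symmetric] using q by (simp add: enn2ereal_ennreal)
  qed
qed

lemma power2_powr_half: "0 \<le> (y::real) \<Longrightarrow> (y\<^sup>2) powr (q / 2) = y powr q"
proof (cases "y = 0")
  case False
  assume "0 \<le> y"
  then have "y\<^sup>2 = y powr 2" using False by simp
  then show ?thesis by (simp only: powr_powr) simp
qed simp

text \<open>The growth conditions are imposed away from the origin, so \<open>L 0\<close> enters the constant.\<close>

lemma nearly_linear_growth_bounds:
  fixes L :: "real^'n::finite \<Rightarrow> real"
  assumes "nearly_linear_growth g \<Lambda> \<mu> L"
  shows "\<exists>B\<ge>0. \<forall>z. - B \<le> L z \<and> L z \<le> \<Lambda> * (norm z * g (norm z)) + B"
proof (intro exI[of _ "\<Lambda> + \<bar>L 0\<bar>"] conjI allI)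
  have \<Lambda>: "\<Lambda> \<ge> 1" and gr: "growth_function g" using assms by (auto simp: nearly_linear_growth_def)
  have g: "0 \<le> norm z * g (norm z)" for z :: "real^'n" using gr by (auto simp: growth_function_def)
  show "0 \<le> \<Lambda> + \<bar>L 0\<bar>" using \<Lambda> by simp
  fix z :: "real^'n"
  have ge: "1 / \<Lambda> * norm z * g (norm z) - \<Lambda> \<le> L z" and le: "L z \<le> \<Lambda> * norm z * g (norm z) + \<Lambda>" if "z \<noteq> 0"
    using assms that unfolding nearly_linear_growth_def by blast+
  have "0 \<le> 1 / \<Lambda> * (norm z * g (norm z))" using \<Lambda> by (intro mult_nonneg_nonneg[OF _ g]) auto
  then show "- (\<Lambda> + \<bar>L 0\<bar>) \<le> L z" using ge \<Lambda> by (cases "z = 0") (auto simp: mult.assoc)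
  have "0 \<le> \<Lambda> * (norm z * g (norm z))" using \<Lambda> by (intro mult_nonneg_nonneg[OF _ g]) auto
  then show "L z \<le> \<Lambda> * (norm z * g (norm z)) + (\<Lambda> + \<bar>L 0\<bar>)" using le \<Lambda> by (cases "z = 0") (auto simp: mult.assoc)
qed

lemma cube_measure: obtains V where "0 \<le> V" "emeasure (lebesgue_on (cube :: (real^'n::finite) set)) (space (lebesgue_on cube)) = ennreal V"
proof -
  have "emeasure (lebesgue_on (cube :: (real^'n) set)) (space (lebesgue_on cube)) < \<infinity>"
    using emeasure_cube_finite[where 'n='n] by (simp add: emeasure_restrict_space)
  then show ?thesis using that by (cases "emeasure (lebesgue_on (cube :: (real^'n) set)) (space (lebesgue_on cube))") auto
qed

context barrier begin

lemma weak_grad_smooth: "w \<in> C_on 1 UNIV \<Longrightarrow> AE x in lebesgue_on cube. weak_grad cube w x = grad w x"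
  by (rule weak_grad_AE[OF weak_gradient_C1])

lemma weak_grad_U: "AE x in lebesgue_on cube. weak_grad cube (\<lambda>x. T * U x) x = T *\<^sub>R G x"
  using weak_grad_AE[OF weak_gradient_lin[OF U_weak_gradient U_weak_gradient, of T 0]] by simp

lemma weak_grad_difference:
  assumes "f \<in> C_on 1 UNIV"
  shows "AE x in lebesgue_on cube. weak_grad cube (\<lambda>x. f x - U x) x = grad f x - G x"
  using weak_grad_AE[OF weak_gradient_lin[OF weak_gradient_C1[OF assms] U_weak_gradient, of 1 "- 1"]] by simp

lemma coef_borel: "0 < \<alpha> \<Longrightarrow> coef \<alpha> \<in> borel_measurable borel"
  by (rule continuous_borel[OF coef_continuous])

lemma modular_finite:
  assumes g: "growth_function g" and \<alpha>: "0 < \<alpha>" and q: "1 < q"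
  shows "modular g (coef \<alpha>) q (\<lambda>x. U x - v x) cube < \<infinity>"
proof -
  obtain \<epsilon> where \<epsilon>: "small_exponent \<epsilon>" using ex_small_exponent by blast
  define e where "e = \<epsilon> / 2"
  have e: "0 < e" "small_exponent (2 * e)" using \<epsilon> by (auto simp: e_def small_exponent_def)
  obtain c where c: "0 \<le> c" "\<And>t. 0 \<le> t \<Longrightarrow> t * g t \<le> c * (1 + t powr (1 + e))" using growth_bound[OF g e(1)] by blast
  have gv: "continuous_on UNIV (grad v)" by (rule continuous_grad[OF v_C])
  obtain B where B: "\<And>x. x \<in> cube \<Longrightarrow> norm (grad v x) \<le> B" using continuous_bounded_cube[OF gv] by blast
  obtain V where V: "0 \<le> V" "emeasure (lebesgue_on (cube :: (real^'n) set)) (space (lebesgue_on cube)) = ennreal V" by (rule cube_measure)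
  define K1 where "K1 = c * (1 + 2 powr (1 + e) * \<bar>B\<bar> powr (1 + e)) + 2 * \<bar>B\<bar> powr q"
  define K2 where "K2 = c * 2 powr (1 + e)"
  have K: "0 \<le> K1" "0 \<le> K2" using c by (auto simp: K1_def K2_def)
  have ae: "AE x in lebesgue_on cube. weak_grad cube (\<lambda>x. U x - v x) x = G x - grad v x"
    using weak_grad_AE[OF weak_gradient_lin[OF U_weak_gradient v_weak_gradient, of 1 "- 1"]] by simp
  have "modular g (coef \<alpha>) q (\<lambda>x. U x - v x) cube \<le> (\<integral>\<^sup>+x. ennreal K1 + ennreal K2 * ennreal (norm (G x) powr (1 + e)) \<partial>lebesgue_on cube)"
    unfolding modular_def
  proof (rule nn_integral_mono_AE)
    show "AE x in lebesgue_on cube. ennreal (norm (weak_grad cube (\<lambda>x. U x - v x) x) * g (norm (weak_grad cube (\<lambda>x. U x - v x) x))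
        + coef \<alpha> x * norm (weak_grad cube (\<lambda>x. U x - v x) x) powr q)
      \<le> ennreal K1 + ennreal K2 * ennreal (norm (G x) powr (1 + e))"
      using ae AE_space
    proof eventually_elim
      case (elim x)
      then have x: "x \<in> cube" by simp
      define z where "z = G x - grad v x"
      have "norm z powr (1 + e) \<le> (norm (G x) + \<bar>B\<bar>) powr (1 + e)"
        using B[OF x] e norm_triangle_ineq4[of "G x" "grad v x"] by (intro powr_mono2) (auto simp: z_def)
      also have "\<dots> \<le> 2 powr (1 + e) * (norm (G x) powr (1 + e) + \<bar>B\<bar> powr (1 + e))" using e by (intro powr_add_le) auto
      finally have "c * (1 + norm z powr (1 + e)) \<le> c * (1 + 2 powr (1 + e) * (norm (G x) powr (1 + e) + \<bar>B\<bar> powr (1 + e)))"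
        using c by (intro mult_left_mono add_left_mono) auto
      with c(2)[of "norm z"] have 1: "norm z * g (norm z) \<le> c * (1 + 2 powr (1 + e) * (norm (G x) powr (1 + e) + \<bar>B\<bar> powr (1 + e)))" by simp
      have "coef \<alpha> x * norm z powr q = coef \<alpha> x * norm (grad v x) powr q"
        using coef_G[OF \<alpha>, of x] by (auto simp: z_def)
      also have "\<dots> \<le> 2 * \<bar>B\<bar> powr q"
        using coef_le[OF \<alpha> x] coef_nonneg[of \<alpha> x] B[OF x] q by (intro mult_mono powr_mono2) auto
      finally have "norm z * g (norm z) + coef \<alpha> x * norm z powr q \<le> K1 + K2 * norm (G x) powr (1 + e)"
        using 1 unfolding K1_def K2_def by (simp add: algebra_simps)
      then have "ennreal (norm z * g (norm z) + coef \<alpha> x * norm z powr q) \<le> ennreal (K1 + K2 * norm (G x) powr (1 + e))" by (rule ennreal_leI)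
      then show ?case using K unfolding elim(1) z_def[symmetric] by (simp add: ennreal_mult)
    qed
  qed
  also have "\<dots> = ennreal K1 * ennreal V + ennreal K2 * (\<integral>\<^sup>+x. ennreal (norm (G x) powr (1 + e)) \<partial>lebesgue_on cube)"
  proof -
    have [measurable]: "G \<in> borel_measurable (lebesgue_on cube)" by (rule borel_lebesgue_on[OF G_borel])
    have "emeasure (lebesgue_on cube) (cube :: (real^'n) set) = ennreal V" using V(2) by simp
    then show ?thesis by (subst nn_integral_add) (simp_all add: nn_integral_cmult)
  qed
  also have "\<dots> < \<infinity>" using G_power_finite[OF e] by (simp add: ennreal_mult_less_top ennreal_mult[symmetric])
  finally show ?thesis .
qed

text \<open>Wherever the coefficient is positive, \<open>G\<close> vanishes and \<open>D(\<phi> - (U - v)) = D(v + \<phi>)\<close>.\<close>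

lemma modular_lower:
  assumes g: "growth_function g" and \<alpha>: "0 < \<alpha>" and \<phi>: "\<phi> \<in> test_functions cube"
  shows "(\<integral>\<^sup>+x\<in>cube. ennreal (coef \<alpha> x * norm (grad (\<lambda>x. v x + \<phi> x) x) powr q) \<partial>lborel)
     \<le> modular g (coef \<alpha>) q (\<lambda>x. \<phi> x - (U x - v x)) cube"
proof -
  have wC: "(\<lambda>x. v x + \<phi> x) \<in> C_on k UNIV" for k by (rule C_on_add[OF v_C test_C[OF \<phi>]])
  have [measurable]: "grad (\<lambda>x. v x + \<phi> x) \<in> borel_measurable borel"
    by (rule borel_measurable_continuous_onI[OF continuous_grad[OF wC]])
  note [measurable] = coef_borel[OF \<alpha>]
  have eq: "(\<lambda>x. \<phi> x - (U x - v x)) = (\<lambda>x. (v x + \<phi> x) - U x)" by (auto simp: algebra_simps)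
  have "(\<integral>\<^sup>+x\<in>cube. ennreal (coef \<alpha> x * norm (grad (\<lambda>x. v x + \<phi> x) x) powr q) \<partial>lborel)
     = (\<integral>\<^sup>+x. ennreal (coef \<alpha> x * norm (grad (\<lambda>x. v x + \<phi> x) x) powr q) \<partial>lebesgue_on cube)"
    by (rule nn_integral_lebesgue_on[symmetric]) measurable
  also have "\<dots> \<le> modular g (coef \<alpha>) q (\<lambda>x. \<phi> x - (U x - v x)) cube"
    unfolding modular_def eq
  proof (rule nn_integral_mono_AE)
    show "AE x in lebesgue_on cube. ennreal (coef \<alpha> x * norm (grad (\<lambda>x. v x + \<phi> x) x) powr q)
      \<le> ennreal (norm (weak_grad cube (\<lambda>x. v x + \<phi> x - U x) x) * g (norm (weak_grad cube (\<lambda>x. v x + \<phi> x - U x) x))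
        + coef \<alpha> x * norm (weak_grad cube (\<lambda>x. v x + \<phi> x - U x) x) powr q)"
      using weak_grad_difference[OF wC]
    proof eventually_elim
      case (elim x)
      have "coef \<alpha> x * norm (grad (\<lambda>x. v x + \<phi> x) x - G x) powr q = coef \<alpha> x * norm (grad (\<lambda>x. v x + \<phi> x) x) powr q"
        using coef_G[OF \<alpha>, of x] by auto
      moreover have "0 \<le> norm (grad (\<lambda>x. v x + \<phi> x) x - G x) * g (norm (grad (\<lambda>x. v x + \<phi> x) x - G x))"
        using g by (auto simp: growth_function_def)
      ultimately show ?case unfolding elim by (intro ennreal_leI) linarith
    qed
  qed
  finally show ?thesis .
qed

text \<open>By homogeneity \<open>T v + \<phi> = T (v + \<phi> / T)\<close> scales the lower bound with \<open>T powr q\<close>.\<close>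

lemma energy_lower:
  fixes L :: "real^'n \<Rightarrow> real"
  assumes L: "continuous_on UNIV L" "0 \<le> B" "\<And>z. - B \<le> L z" and \<alpha>: "0 < \<alpha>" and q: "1 < q" and T: "0 < T"
    and V: "0 \<le> V" "emeasure (lebesgue_on (cube :: (real^'n) set)) (space (lebesgue_on cube)) = ennreal V"
    and c: "0 < c" "\<And>\<phi>. \<phi> \<in> test_functions cube \<Longrightarrow> ennreal c \<le> (\<integral>\<^sup>+x\<in>cube. ennreal (coef \<alpha> x * norm (grad (\<lambda>x. v x + \<phi> x) x) powr q) \<partial>lborel)"
    and \<phi>: "\<phi> \<in> test_functions cube"
  shows "ereal (T powr q * c - 2 * B * V) \<le> energy L (coef \<alpha>) s q (\<lambda>x. T * v x + \<phi> x) cube"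
proof -
  let ?w = "\<lambda>x. T * v x + \<phi> x"
  let ?u = "\<lambda>x. v x + (1 / T) * \<phi> x"
  have wC: "?w \<in> C_on k UNIV" for k by (rule C_on_add[OF C_on_cmult[OF v_C] test_C[OF \<phi>]])
  have uC: "?u \<in> C_on k UNIV" for k by (rule C_on_add[OF v_C C_on_cmult[OF test_C[OF \<phi>]]])
  have gm [measurable]: "grad ?w \<in> borel_measurable borel" "grad ?u \<in> borel_measurable borel"
    by (rule borel_measurable_continuous_onI[OF continuous_grad[OF wC]], rule borel_measurable_continuous_onI[OF continuous_grad[OF uC]])
  have [measurable]: "L \<in> borel_measurable borel" by (rule borel_measurable_continuous_onI[OF L(1)])
  note [measurable] = coef_borel[OF \<alpha>]
  have gu: "grad ?w x = T *\<^sub>R grad ?u x" for x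
  proof -
    have "?w = (\<lambda>x. T * ?u x + 0 * ?u x)" using T by (auto simp: algebra_simps)
    then show ?thesis using grad_lin[OF uC uC, of T 0 x] by simp
  qed
  define F where "F x = L (grad ?w x) + coef \<alpha> x * (s\<^sup>2 + (norm (grad ?w x))\<^sup>2) powr (q / 2)" for x
  define k where "k x = coef \<alpha> x * norm (grad ?w x) powr q" for x
  have "energy L (coef \<alpha>) s q ?w cube = ext_integral (lebesgue_on cube) F"
    unfolding energy_def
  proof (rule ext_integral_cong_AE)
    show "AE x in lebesgue_on cube. L (weak_grad cube ?w x) + coef \<alpha> x * (s\<^sup>2 + (norm (weak_grad cube ?w x))\<^sup>2) powr (q / 2) = F x"
      using weak_grad_smooth[OF wC] by eventually_elim (simp add: F_def)
  qed
  moreover have "ereal (T powr q * c - 2 * B * V) \<le> ext_integral (lebesgue_on cube) F"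
  proof (rule ext_integral_ge[where k = k])
    have "F \<in> borel_measurable borel" unfolding F_def[abs_def] by measurable
    then show "F \<in> borel_measurable (lebesgue_on cube)" by (rule borel_lebesgue_on)
    show "k x - B \<le> F x" for x
    proof -
      have "norm (grad ?w x) powr q = ((norm (grad ?w x))\<^sup>2) powr (q / 2)" by (simp add: power2_powr_half)
      also have "\<dots> \<le> (s\<^sup>2 + (norm (grad ?w x))\<^sup>2) powr (q / 2)" using q by (intro powr_mono2) auto
      finally have "k x \<le> coef \<alpha> x * (s\<^sup>2 + (norm (grad ?w x))\<^sup>2) powr (q / 2)"
        unfolding k_def by (rule mult_left_mono[OF _ coef_nonneg])
      then show ?thesis unfolding F_def using L(3)[of "grad ?w x"] by linarith
    qed
    show "0 \<le> k x" for x unfolding k_def using coef_nonneg by simp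
    have "ennreal (T powr q * c) = ennreal (T powr q) * ennreal c" using c by (simp add: ennreal_mult)
    also have "\<dots> \<le> ennreal (T powr q) * (\<integral>\<^sup>+x\<in>cube. ennreal (coef \<alpha> x * norm (grad ?u x) powr q) \<partial>lborel)"
      by (intro mult_left_mono c(2) test_cmult \<phi>) simp
    also have "\<dots> = (\<integral>\<^sup>+x. ennreal (T powr q) * (ennreal (coef \<alpha> x * norm (grad ?u x) powr q) * indicator cube x) \<partial>lborel)"
      by (rule nn_integral_cmult[symmetric]) measurable
    also have "\<dots> = (\<integral>\<^sup>+x\<in>cube. ennreal (k x) \<partial>lborel)"
    proof (rule nn_integral_cong)
      fix x
      have "k x = T powr q * (coef \<alpha> x * norm (grad ?u x) powr q)"
        unfolding k_def gu using T by (simp add: powr_mult mult_ac)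
      then show "ennreal (T powr q) * (ennreal (coef \<alpha> x * norm (grad ?u x) powr q) * indicator cube x) = ennreal (k x) * indicator cube x"
        using coef_nonneg[of \<alpha> x] by (simp add: ennreal_mult mult.assoc)
    qed
    also have "\<dots> = (\<integral>\<^sup>+x. ennreal (k x) \<partial>lebesgue_on cube)"
      unfolding k_def by (rule nn_integral_lebesgue_on[symmetric]) measurable
    finally show "ennreal (T powr q * c) \<le> (\<integral>\<^sup>+x. ennreal (k x) \<partial>lebesgue_on cube)" .
    show "0 \<le> T powr q * c" using c by simp
  qed (use V L in auto)
  ultimately show ?thesis by simp
qed

text \<open>The competitor with boundary values \<open>T v\<close> is \<open>T U\<close>. The coefficient meets its gradient only where one of them vanishes, so the \<open>q\<close>-term is at most
\<open>a s\<^sup>q\<close>, and only the nearly linear part grows with \<open>T\<close>.\<close>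

lemma energy_upper:
  fixes L :: "real^'n \<Rightarrow> real"
  assumes g: "growth_function g" and L: "0 \<le> B" "0 \<le> \<Lambda>" "\<And>z. L z \<le> \<Lambda> * (norm z * g (norm z)) + B"
    and \<alpha>: "0 < \<alpha>" and q: "1 < q" and s: "0 \<le> s" "s \<le> 1" and e: "0 < e" "small_exponent (2 * e)"
  shows "\<exists>A\<ge>0. \<forall>T\<ge>1. energy L (coef \<alpha>) s q (\<lambda>x. T * v x + T * (U x - v x)) cube \<le> ereal (A * T powr (1 + e))"
proof -
  obtain c where c: "0 \<le> c" "\<And>t. 0 \<le> t \<Longrightarrow> t * g t \<le> c * (1 + t powr (1 + e))" using growth_bound[OF g e(1)] by blast
  obtain V where V: "0 \<le> V" "emeasure (lebesgue_on (cube :: (real^'n) set)) (space (lebesgue_on cube)) = ennreal V" by (rule cube_measure)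
  obtain I where I: "0 \<le> I" "(\<integral>\<^sup>+x. ennreal (norm (G x) powr (1 + e)) \<partial>lebesgue_on cube) = ennreal I"
    using G_power_finite[OF e] by (cases "\<integral>\<^sup>+x. ennreal (norm (G x) powr (1 + e)) \<partial>lebesgue_on cube") auto
  define K1 where "K1 = \<Lambda> * c + B + 2"
  define K2 where "K2 = \<Lambda> * c"
  have K: "0 \<le> K1" "0 \<le> K2" using c L by (auto simp: K1_def K2_def)
  have [measurable]: "G \<in> borel_measurable (lebesgue_on cube)" by (rule borel_lebesgue_on[OF G_borel])
  show ?thesis
  proof (intro exI[of _ "K1 * V + K2 * I"] conjI allI impI)
    show A0: "0 \<le> K1 * V + K2 * I" using K V I by simp
    fix T :: real assume T: "1 \<le> T"
    define t where "t = T powr (1 + e)"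
    have t: "1 \<le> t" unfolding t_def using T e by (intro ge_one_powr_ge_zero) auto
    define F where "F x = L (T *\<^sub>R G x) + coef \<alpha> x * (s\<^sup>2 + (norm (T *\<^sub>R G x))\<^sup>2) powr (q / 2)" for x
    have eq: "(\<lambda>x. T * v x + T * (U x - v x)) = (\<lambda>x. T * U x)" by (auto simp: algebra_simps)
    have en: "energy L (coef \<alpha>) s q (\<lambda>x. T * U x) cube = ext_integral (lebesgue_on cube) F"
      unfolding energy_def
    proof (rule ext_integral_cong_AE)
      show "AE x in lebesgue_on cube. L (weak_grad cube (\<lambda>x. T * U x) x) + coef \<alpha> x * (s\<^sup>2 + (norm (weak_grad cube (\<lambda>x. T * U x) x))\<^sup>2) powr (q / 2) = F x"
        using weak_grad_U[of T] by eventually_elim (simp add: F_def)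
    qed
    have Fle: "F x \<le> t * (K1 + K2 * norm (G x) powr (1 + e))" if x: "x \<in> cube" for x
    proof -
      have "coef \<alpha> x * (s\<^sup>2 + (norm (T *\<^sub>R G x))\<^sup>2) powr (q / 2) = coef \<alpha> x * (s\<^sup>2) powr (q / 2)"
        using coef_G[OF \<alpha>, of x] by auto
      also have "\<dots> \<le> 2 * 1"
      proof (intro mult_mono)
        have "(s\<^sup>2) powr (q / 2) = s powr q" using s by (simp add: power2_powr_half)
        also have "\<dots> \<le> 1 powr q" using s q by (intro powr_mono2) auto
        finally show "(s\<^sup>2) powr (q / 2) \<le> 1" by simp
      qed (use coef_le[OF \<alpha> x] in auto)
      finally have 1: "coef \<alpha> x * (s\<^sup>2 + (norm (T *\<^sub>R G x))\<^sup>2) powr (q / 2) \<le> 2" by simp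
      have Tn: "norm (T *\<^sub>R G x) powr (1 + e) = t * norm (G x) powr (1 + e)" using T by (simp add: t_def powr_mult)
      have "norm (T *\<^sub>R G x) * g (norm (T *\<^sub>R G x)) \<le> c * (1 + norm (T *\<^sub>R G x) powr (1 + e))" by (rule c(2)) simp
      then have "\<Lambda> * (norm (T *\<^sub>R G x) * g (norm (T *\<^sub>R G x))) \<le> \<Lambda> * (c * (1 + t * norm (G x) powr (1 + e)))"
        unfolding Tn using L(2) by (rule mult_left_mono)
      then have "L (T *\<^sub>R G x) \<le> \<Lambda> * (c * (1 + t * norm (G x) powr (1 + e))) + B" using L(3)[of "T *\<^sub>R G x"] by linarith
      then have "F x \<le> K1 + t * (K2 * norm (G x) powr (1 + e))" unfolding F_def K1_def K2_def using 1 by (simp add: algebra_simps)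
      also have "\<dots> \<le> t * K1 + t * (K2 * norm (G x) powr (1 + e))" using mult_right_mono[OF t K(1)] by simp
      finally show ?thesis by (simp add: distrib_left)
    qed
    have "(\<integral>\<^sup>+x. ennreal (F x) \<partial>lebesgue_on cube) \<le> (\<integral>\<^sup>+x. ennreal (t * K1) + ennreal (t * K2) * ennreal (norm (G x) powr (1 + e)) \<partial>lebesgue_on cube)"
    proof (rule nn_integral_mono)
      fix x :: "real^'n" assume "x \<in> space (lebesgue_on cube)"
      then have "ennreal (F x) \<le> ennreal (t * K1 + t * K2 * norm (G x) powr (1 + e))"
        using Fle[of x] by (intro ennreal_leI) (simp add: distrib_left mult.assoc)
      also have "\<dots> = ennreal (t * K1) + ennreal (t * K2) * ennreal (norm (G x) powr (1 + e))"
        using t K by (subst ennreal_plus) (auto simp: ennreal_mult)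
      finally show "ennreal (F x) \<le> ennreal (t * K1) + ennreal (t * K2) * ennreal (norm (G x) powr (1 + e))" .
    qed
    also have "\<dots> = ennreal (t * K1) * ennreal V + ennreal (t * K2) * ennreal I"
    proof -
      have "emeasure (lebesgue_on cube) (cube :: (real^'n) set) = ennreal V" using V(2) by simp
      then show ?thesis by (subst nn_integral_add) (simp_all add: nn_integral_cmult I)
    qed
    also have "\<dots> = ennreal (t * K1 * V + t * K2 * I)"
      using t K V I by (subst ennreal_plus) (auto simp: ennreal_mult)
    also have "t * K1 * V + t * K2 * I = (K1 * V + K2 * I) * T powr (1 + e)" by (simp add: t_def algebra_simps)
    finally show "energy L (coef \<alpha>) s q (\<lambda>x. T * v x + T * (U x - v x)) cube \<le> ereal ((K1 * V + K2 * I) * T powr (1 + e))"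
      unfolding eq en by (rule ext_integral_le) (use A0 in simp)
  qed
qed

end

text \<open>For \<open>2 \<le> N powr (1 - D)\<close> one has \<open>N powr D \<le> N / 2 \<le> N - 4\<close>.\<close>

lemma exists_base:
  fixes D :: real assumes "D < 1" shows "\<exists>N::nat. 8 \<le> N \<and> real N powr D \<le> real N - 4"
proof -
  define N where "N = max 8 (nat \<lceil>2 powr (1 / (1 - D))\<rceil>)"
  have N8: "8 \<le> N" by (simp add: N_def)
  have "2 powr (1 / (1 - D)) \<le> real N" unfolding N_def by linarith
  then have "(2 powr (1 / (1 - D))) powr (1 - D) \<le> real N powr (1 - D)" using assms by (intro powr_mono2) auto
  then have "2 \<le> real N powr (1 - D)" using assms by (simp add: powr_powr)
  then have "2 * real N powr D \<le> real N powr (1 - D) * real N powr D" by (intro mult_right_mono) auto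
  also have "\<dots> = real N" using N8 by (simp add: powr_add[symmetric])
  finally have "2 * real N powr D \<le> real N" .
  then show ?thesis using N8 by (intro exI[of _ N]) auto
qed

lemma holder_decomposition:
  fixes \<alpha> :: real assumes "0 < \<alpha>" obtains k :: nat and \<beta> where "0 < \<beta>" "\<beta> \<le> 1" "real k + \<beta> = \<alpha>"
proof -
  define k where "k = nat (\<lceil>\<alpha>\<rceil> - 1)"
  have "0 < \<lceil>\<alpha>\<rceil>" using assms by simp
  then have "real k = real_of_int \<lceil>\<alpha>\<rceil> - 1" by (simp add: k_def)
  then have "0 < \<alpha> - real k" "\<alpha> - real k \<le> 1" by linarith+
  then show ?thesis by (intro that[of "\<alpha> - real k" k]) auto
qed

theorem theorem3:
  fixes \<alpha> q s \<Lambda> \<mu> :: real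
    and g :: "real \<Rightarrow> real"
    and L :: "real^'n::finite \<Rightarrow> real"
  assumes "CARD('n) \<ge> 2"
    and "0 < \<alpha>" and "1 < q" and "q > 1 + \<alpha>"
    and "s \<in> {0..1}"
    and "nearly_linear_growth g \<Lambda> \<mu> L"
  shows "\<exists>(a :: real^'n \<Rightarrow> real) u0 v0.
      a \<in> holder_class \<alpha> cube \<and> (\<forall>x\<in>closure cube. 0 \<le> a x)
      \<and> u0 \<in> W11_0 cube \<inter> L_infinity (closure cube) \<and> modular g a q u0 cube < \<infinity>
      \<and> v0 \<in> smooth_closure cube
      \<and> (INF w\<in>{(\<lambda>x. v0 x + \<phi> x) |\<phi>. \<phi> \<in> test_functions cube}. energy L a s q w cube)
          > (INF w\<in>{(\<lambda>x. v0 x + \<phi> x) |\<phi>. \<phi> \<in> W11_0 cube}. energy L a s q w cube)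
      \<and> \<not> (\<exists>u. (\<forall>i::nat. u i \<in> test_functions cube)
              \<and> (\<lambda>i. modular g a q (\<lambda>x. u i x - u0 x) cube) \<longlonglongrightarrow> 0)"
proof -
  note \<alpha> = assms(2) and q = assms(3)
  have gr: "growth_function g" and \<Lambda>: "1 \<le> \<Lambda>" and LC: "L \<in> C_on 1 UNIV"
    using assms(6) by (auto simp: nearly_linear_growth_def)
  have "\<exists>i j :: 'n. i \<noteq> j"
  proof (rule ccontr)
    assume "\<not> ?thesis"
    then have "card (UNIV :: 'n set) \<le> Suc 0" by (subst card_le_Suc0_iff_eq) auto
    then show False using assms(1) by simp
  qed
  then obtain i j :: 'n where ij: "i \<noteq> j" by blast
  obtain k :: nat and \<beta> where k: "0 < \<beta>" "\<beta> \<le> 1" "real k + \<beta> = \<alpha>" using holder_decomposition[OF \<alpha>] by blast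
  \<comment> \<open>the midpoint of \<open>\<alpha> + 2 - q\<close> and \<open>1\<close>, kept positive\<close>
  define D where "D = max (1 / 2) ((\<alpha> + 3 - q) / 2)"
  have D_ge: "(\<alpha> + 3 - q) / 2 \<le> D" "1 / 2 \<le> D" unfolding D_def by (rule max.cobounded2, rule max.cobounded1)
  have "\<alpha> + 3 - q \<le> 2 * D" using D_ge(1) by simp
  then have D3: "\<alpha> + 1 - D < q - 1" using assms(4) by argo
  have D2: "0 < D" "D < 1" using D_ge(2) assms(4) by (simp_all add: D_def)
  note D = D2 D3
  obtain N :: nat where base: "8 \<le> N" "real N powr D \<le> real N - 4" using exists_base[OF D(2)] by blast
  \<comment> \<open>then \<open>H\<close> is of class \<open>C\<^sup>k\<^sup>+\<^sup>1\<close>\<close>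
  define M where "M = k + 2"
  interpret barrier N M i j by unfold_locales (use base ij in \<open>auto simp: M_def\<close>)
  obtain c where c: "0 < c" "\<And>\<phi>. \<phi> \<in> test_functions cube \<Longrightarrow>
      ennreal c \<le> (\<integral>\<^sup>+x\<in>cube. ennreal (coef \<alpha> x * norm (grad (\<lambda>x. v x + \<phi> x) x) powr q) \<partial>lborel)"
    using smooth_energy_lower_bound[OF base(2) D(1,2) \<alpha> q D(3)] by blast
  obtain B where B: "0 \<le> B" "\<And>z. - B \<le> L z" "\<And>z. L z \<le> \<Lambda> * (norm z * g (norm z)) + B"
    using nearly_linear_growth_bounds[OF assms(6)] by blast
  obtain V where V: "0 \<le> V" "emeasure (lebesgue_on (cube :: (real^'n) set)) (space (lebesgue_on cube)) = ennreal V" by (rule cube_measure)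
  obtain \<epsilon> where \<epsilon>: "small_exponent \<epsilon>" using ex_small_exponent by blast
  define e where "e = min (\<epsilon> / 2) ((q - 1) / 2)"
  have "0 < \<epsilon>" using \<epsilon> by (simp add: small_exponent_def)
  then have e0: "0 < e" using q by (simp add: e_def)
  have "e \<le> (q - 1) / 2" unfolding e_def by (rule min.cobounded2)
  then have "2 * e \<le> q - 1" by simp
  then have e1: "1 + e < q" using e0 by argo
  note e = e0 e1
  have e2: "small_exponent (2 * e)" by (rule small_exponent_mono[OF \<epsilon>]) (use e in \<open>auto simp: e_def\<close>)
  obtain A where A: "0 \<le> A" "\<And>T. 1 \<le> T \<Longrightarrow> energy L (coef \<alpha>) s q (\<lambda>x. T * v x + T * (U x - v x)) cube \<le> ereal (A * T powr (1 + e))"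
    using energy_upper[OF gr B(1) _ B(3) \<alpha> q _ _ e(1) e2, of s] \<Lambda> assms(5) by auto
  define y where "y = (A + 2 * B * V + 1) / c"
  \<comment> \<open>large enough for \<open>c T powr q\<close> to beat \<open>(A + 2 B V + 1) T powr (1 + e)\<close>\<close>
  define T where "T = max 1 (y powr (1 / (q - 1 - e)))"
  have T: "1 \<le> T" by (simp add: T_def)
  have BV: "0 \<le> 2 * B * V" using B V by simp
  have y: "0 < y" using c A BV by (simp add: y_def)
  have gap: "A * T powr (1 + e) < T powr q * c - 2 * B * V"
  proof -
    have "y = (y powr (1 / (q - 1 - e))) powr (q - 1 - e)" using y e by (simp add: powr_powr)
    also have "\<dots> \<le> T powr (q - 1 - e)" using e by (intro powr_mono2) (auto simp: T_def)
    finally have "A + 2 * B * V + 1 \<le> T powr (q - 1 - e) * c" using c by (simp add: y_def divide_le_eq)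
    then have "(A + 2 * B * V + 1) * T powr (1 + e) \<le> T powr (q - 1 - e) * c * T powr (1 + e)" by (rule mult_right_mono) simp
    also have "\<dots> = (T powr (q - 1 - e) * T powr (1 + e)) * c" by simp
    also have "T powr (q - 1 - e) * T powr (1 + e) = T powr q" unfolding powr_add[symmetric] by simp
    finally have "A * T powr (1 + e) + (2 * B * V + 1) * T powr (1 + e) \<le> T powr q * c" by (simp add: algebra_simps)
    moreover have "(2 * B * V + 1) * 1 \<le> (2 * B * V + 1) * T powr (1 + e)"
      using BV T e by (intro mult_left_mono ge_one_powr_ge_zero) auto
    ultimately show ?thesis by simp
  qed
  have Lc: "continuous_on UNIV L" by (rule C_on_continuous[OF LC])
  have low: "ereal (T powr q * c - 2 * B * V) \<le> (INF w\<in>{(\<lambda>x. T * v x + \<phi> x) |\<phi>. \<phi> \<in> test_functions cube}. energy L (coef \<alpha>) s q w cube)"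
  proof (rule INF_greatest)
    fix w assume "w \<in> {(\<lambda>x. T * v x + \<phi> x) |\<phi>. \<phi> \<in> test_functions cube}"
    then obtain \<phi> where w: "w = (\<lambda>x. T * v x + \<phi> x)" and \<phi>: "\<phi> \<in> test_functions cube" by blast
    show "ereal (T powr q * c - 2 * B * V) \<le> energy L (coef \<alpha>) s q w cube"
      unfolding w using T by (intro energy_lower[OF Lc B(1,2) \<alpha> q _ V c \<phi>]) auto
  qed
  have "(INF w\<in>{(\<lambda>x. T * v x + \<phi> x) |\<phi>. \<phi> \<in> W11_0 cube}. energy L (coef \<alpha>) s q w cube)
     \<le> energy L (coef \<alpha>) s q (\<lambda>x. T * v x + T * (U x - v x)) cube"
    by (rule INF_lower) (intro CollectI exI[of _ "\<lambda>x. T * (U x - v x)"] conjI refl competitor_W11_0)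
  also have "\<dots> \<le> ereal (A * T powr (1 + e))" by (rule A(2)[OF T])
  also have "\<dots> < ereal (T powr q * c - 2 * B * V)" using gap by simp
  also note low
  finally have lavrentiev: "(INF w\<in>{(\<lambda>x. T * v x + \<phi> x) |\<phi>. \<phi> \<in> W11_0 cube}. energy L (coef \<alpha>) s q w cube)
     < (INF w\<in>{(\<lambda>x. T * v x + \<phi> x) |\<phi>. \<phi> \<in> test_functions cube}. energy L (coef \<alpha>) s q w cube)" .
  have density: "\<not> (\<exists>u. (\<forall>i::nat. u i \<in> test_functions cube)
              \<and> (\<lambda>i. modular g (coef \<alpha>) q (\<lambda>x. u i x - (U x - v x)) cube) \<longlonglongrightarrow> 0)"
  proof
    assume "\<exists>u. (\<forall>i::nat. u i \<in> test_functions cube) \<and> (\<lambda>i. modular g (coef \<alpha>) q (\<lambda>x. u i x - (U x - v x)) cube) \<longlonglongrightarrow> 0"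
    then obtain u where u: "\<And>i::nat. u i \<in> test_functions cube"
      and lim: "(\<lambda>i. modular g (coef \<alpha>) q (\<lambda>x. u i x - (U x - v x)) cube) \<longlonglongrightarrow> 0" by blast
    have "ennreal c \<le> modular g (coef \<alpha>) q (\<lambda>x. u i x - (U x - v x)) cube" for i
      by (rule order_trans[OF c(2)[OF u] modular_lower[OF gr \<alpha> u]])
    then have "ennreal c \<le> 0" by (intro LIMSEQ_le_const[OF lim]) auto
    then show False using c(1) by simp
  qed
  have W: "(\<lambda>x. U x - v x) \<in> W11_0 cube" using competitor_W11_0[of 1] by simp
  show ?thesis
  proof (intro exI conjI)
    show "coef \<alpha> \<in> holder_class \<alpha> cube" by (rule coef_holder[OF M_def k])
    show "\<forall>x\<in>closure cube. 0 \<le> coef \<alpha> x" by (simp add: coef_nonneg)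
    show "(\<lambda>x. U x - v x) \<in> W11_0 cube \<inter> L_infinity (closure cube)" using W competitor_L_infinity by simp
    show "modular g (coef \<alpha>) q (\<lambda>x. U x - v x) cube < \<infinity>" by (rule modular_finite[OF gr \<alpha> q])
    show "(\<lambda>x. T * v x) \<in> smooth_closure cube" by (rule v_smooth_closure)
  qed (rule lavrentiev, rule density)
qed

end
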